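(* Let $M>0$, $\beta\in\mathbb{R}$ be a constant, $p(\rho)=\rho^\gamma$, and let $\mathfrak{R}\ge R_M$. Suppose that $\gamma>2$. Then the following three statements hold. (1) $\displaystyle\inf_{\rho\in W_M^{\ast}}F(\rho)<0$, and there are positive constants $C_1,C_2$ independent of $\rho$ such that $$F(\rho)\ge C_1\int_{\mathbb{R}^3}\rho(x)^{\gamma}\,dx-C_2\qquad\text{for all }\rho\in W_M^{\ast}.$$ (2) If $\{\rho^i\}\subset W_M^{\ast}$ is a minimizing sequence for the functional $F$ (on $W_M^{\ast}$), then there exist a sequence of vertical shifts $a_i\mathbf{e}_3$ ($a_i\in\mathbb{R}$, $\mathbf{e}_3=(0,0,1)$), a subsequence of $\{\rho^i\}$ (still labeled $\{\rho^i\}$), and a function $\tilde\rho\in W_M^{\ast}$ such that for any $\epsilon>0$ there exists $R>0$ with $$\int_{a_i\mathbf{e}_3+B_R(0)}\rho^i(x)\,dx\ge M-\epsilon,\qquad i\in\mathbb{N},$$ and $$T\rho^i(x):=\rho^i(x+a_i\mathbf{e}_3)\rightharpoonup\tilde\rho\quad\text{weakly in }L^{\gamma}(\mathbb{R}^3)\text{ as }i\to\infty.$$ (3) The function $\tilde\rho$ in (2) is a minimizer of $F$ in $W_M^{\ast}$.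
   Context: Write $x=(x_1,x_2,x_3)\in\mathbb{R}^3$, $r=\sqrt{x_1^2+x_2^2}$, $z=x_3$. A function is axisymmetric if it depends only on $(r,z)$. $B_R(0)$ is the ball of radius $R$ centered at $0$ in $\mathbb{R}^3$. Pressure and potentials: $p(\rho)=\rho^{\gamma}$ and $A(\rho)=\frac{p(\rho)}{\gamma-1}$. Set $\mathfrak{G}(\rho)(x)=\int_{\mathbb{R}^3}\frac{\rho(y)}{|x-y|}\,dy$. The magnetic potential $\psi=\mathfrak{P}(\rho)$ of an axisymmetric density $\rho$ is the solution of $\operatorname{div}\left(\frac{1}{r^2}\nabla\psi\right)=-4\pi\beta\rho$ given by $\mathfrak{P}(\rho)(x)=-4\pi\beta\int_{\mathbb{R}^3}G(x,y)\rho(y)\,dy$, where $G$ is the Green's function, $\operatorname{div}\left(\frac1{r^2}\nabla G(x,y)\right)=\delta(x-y)$. Explicitly, $\mathfrak{P}(\rho)(x)=r^2\chi_e(x_1,x_2,x_3,0,0)$, where, writing $\rho(x)=f(r,x_3)$ and, for $x\in\mathbb{R}^5$, $\rho_e(x)=f\left(\sqrt{x_1^2+x_2^2+x_4^2+x_5^2},\,x_3\right)$, $$\chi_e(x)=\int_{\mathbb{R}^5}G_5(x-y)\,(-4\pi\beta)\,\rho_e(y)\,dy,\qquad G_5(x)=-\frac{1}{15\,\omega_5}|x|^{-3},$$ with $\omega_5$ the volume of the unit ball of $\mathbb{R}^5$ (so $\Delta_5\chi_e=-4\pi\beta\rho_e$). Energy functional: $\displaystyle F(\rho)=\int_{\mathbb{R}^3}\left(A(\rho)-\tfrac12\rho\,\mathfrak{G}(\rho)-\tfrac12\beta\rho\,\mathfrak{P}(\rho)\right)dx.$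 Radius $R_M$: let $X_M$ be the set of $\rho:\mathbb{R}^3\to\mathbb{R}$ with $\rho\ge0$ a.e., $\int\rho\,dx=M$ and $\int_{\mathbb{R}^3}[A(\rho)+\frac12\rho\,\mathfrak{G}(\rho)]\,dx<\infty$, and let $\tilde F(\rho)=\int_{\mathbb{R}^3}[A(\rho)-\frac12\rho\,\mathfrak{G}(\rho)]\,dx$. For $\gamma>4/3$ it is known that $\tilde F$ has a minimizer $\hat\rho$ in $X_M$ (the non-rotating non-magnetic star solution), which is radial (about the origin), unique, and compactly supported: there is a unique $R_M>0$ with $\hat\rho(x)>0$ for $|x|<R_M$ and $\hat\rho(x)=0$ for $|x|\ge R_M$. Function classes: $W_M$ is the set of axisymmetric $\rho:\mathbb{R}^3\to\mathbb{R}$ with $\rho\ge 0$ a.e., $\rho\in L^1(\mathbb{R}^3)\cap L^{\gamma}(\mathbb{R}^3)$, $\int_{\mathbb{R}^3}\rho\,dx=M$. For a fixed constant $\mathfrak{R}\ge R_M$, $W_M^{\ast}=\{\rho\in W_M:\ \rho(r,z)=0\text{ for }r\ge\mathfrak{R}\}$. *)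

theory Defs
  imports "HOL-Analysis.Analysis"
begin

text \<open>Elements of $L^p$ are represented by Lebesgue measurable functions on the whole space.
  Pointwise conditions (axial symmetry, vanishing for $r \ge \mathfrak{R}$) are imposed on the
  representative; integrals are Bochner integrals with respect to Lebesgue measure.\<close>

definition Lp_space :: "real \<Rightarrow> ('a::euclidean_space \<Rightarrow> real) set" where
  "Lp_space p = {f. f \<in> borel_measurable lebesgue \<and>
                    integrable lebesgue (\<lambda>x. \<bar>f x\<bar> powr p)}"

text \<open>Weak convergence in $L^p$ for $1 < p < \infty$, where the dual space is $L^{p/(p-1)}$.\<close>

definition weak_conv_Lp ::
    "real \<Rightarrow> (nat \<Rightarrow> 'a::euclidean_space \<Rightarrow> real) \<Rightarrow> ('a \<Rightarrow> real) \<Rightarrow> bool" where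
  "weak_conv_Lp p f g \<longleftrightarrow>
     (\<forall>i. f i \<in> Lp_space p) \<and> g \<in> Lp_space p \<and>
     (\<forall>h\<in>Lp_space (p / (p - 1)).
        (\<lambda>i. LINT x|lebesgue. f i x * h x) \<longlonglongrightarrow> (LINT x|lebesgue. g x * h x))"

definition minimizing_seq :: "('b \<Rightarrow> real) \<Rightarrow> 'b set \<Rightarrow> (nat \<Rightarrow> 'b) \<Rightarrow> bool" where
  "minimizing_seq F W s \<longleftrightarrow>
     (\<forall>i. s i \<in> W) \<and> (\<lambda>i. ereal (F (s i))) \<longlonglongrightarrow> (INF w\<in>W. ereal (F w))"

definition cyl_r :: "real^3 \<Rightarrow> real" where
  "cyl_r x = sqrt ((x $ 1)\<^sup>2 + (x $ 2)\<^sup>2)"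

definition axisymmetric :: "(real^3 \<Rightarrow> real) \<Rightarrow> bool" where
  "axisymmetric \<rho> \<longleftrightarrow> (\<exists>f. \<forall>x. \<rho> x = f (cyl_r x) (x $ 3))"

definition pressure :: "real \<Rightarrow> real \<Rightarrow> real" where
  "pressure \<gamma> s = s powr \<gamma>"

definition A_fun :: "real \<Rightarrow> real \<Rightarrow> real" where
  "A_fun \<gamma> s = pressure \<gamma> s / (\<gamma> - 1)"

definition grav_pot :: "(real^3 \<Rightarrow> real) \<Rightarrow> real^3 \<Rightarrow> real" where
  "grav_pot \<rho> x = (LINT y|lebesgue. \<rho> y / norm (x - y))"

text \<open>For axisymmetric $\rho(x) = f(r, x_3)$ the profile $f$ is recovered as
  $f(r,z) = \rho(r,0,z)$ for $r \ge 0$.\<close>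

definition profile :: "(real^3 \<Rightarrow> real) \<Rightarrow> real \<Rightarrow> real \<Rightarrow> real" where
  "profile \<rho> r z = \<rho> (vector [r, 0, z])"

definition lift5 :: "(real^3 \<Rightarrow> real) \<Rightarrow> real^5 \<Rightarrow> real" where
  "lift5 \<rho> x = profile \<rho> (sqrt ((x $ 1)\<^sup>2 + (x $ 2)\<^sup>2 + (x $ 4)\<^sup>2 + (x $ 5)\<^sup>2)) (x $ 3)"

definition G5 :: "real^5 \<Rightarrow> real" where
  "G5 x = - 1 / (15 * measure lebesgue (ball (0 :: real^5) 1)) * (1 / norm x ^ 3)"

definition chi_e :: "real \<Rightarrow> (real^3 \<Rightarrow> real) \<Rightarrow> real^5 \<Rightarrow> real" where
  "chi_e \<beta> \<rho> x = (LINT y|lebesgue. G5 (x - y) * (- 4 * pi * \<beta>) * lift5 \<rho> y)"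

text \<open>The potential $\psi$ solving $\mathrm{div}(r^{-2} \nabla\psi) = -4\pi\beta\rho$, in its explicit
  form: $\psi = r^2 \chi_e$ reduces the equation to $\Delta_5 \chi_e = -4\pi\beta\rho_e$.
  Meaningful for axisymmetric densities only.\<close>

definition mag_pot :: "real \<Rightarrow> (real^3 \<Rightarrow> real) \<Rightarrow> real^3 \<Rightarrow> real" where
  "mag_pot \<beta> \<rho> x = (cyl_r x)\<^sup>2 * chi_e \<beta> \<rho> (vector [x $ 1, x $ 2, x $ 3, 0, 0])"

definition energy :: "real \<Rightarrow> real \<Rightarrow> (real^3 \<Rightarrow> real) \<Rightarrow> real" where
  "energy \<gamma> \<beta> \<rho> =
     (LINT x|lebesgue. A_fun \<gamma> (\<rho> x) - 1/2 * \<rho> x * grav_pot \<rho> x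
                                       - 1/2 * \<beta> * \<rho> x * mag_pot \<beta> \<rho> x)"

text \<open>In the next set, finiteness of $\int [A(\rho) + \frac12 \rho\,\mathfrak{G}(\rho)]$ is
  integrability, since the integrand is nonnegative almost everywhere.\<close>

definition X_class :: "real \<Rightarrow> real \<Rightarrow> (real^3 \<Rightarrow> real) set" where
  "X_class \<gamma> M =
     {\<rho>. (AE x in lebesgue. 0 \<le> \<rho> x) \<and>
          integrable lebesgue \<rho> \<and> (LINT x|lebesgue. \<rho> x) = M \<and>
          integrable lebesgue (\<lambda>x. A_fun \<gamma> (\<rho> x) + 1/2 * \<rho> x * grav_pot \<rho> x)}"

definition star_energy :: "real \<Rightarrow> (real^3 \<Rightarrow> real) \<Rightarrow> real" where
  "star_energy \<gamma> \<rho> = (LINT x|lebesgue. A_fun \<gamma> (\<rho> x) - 1/2 * \<rho> x * grav_pot \<rho> x)"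

text \<open>\<open>star_radius \<gamma> M R\<close> says that \<open>R\<close> is the radius $R_M$ of the non-rotating non-magnetic
  star solution of mass $M$.  A relation is used rather than a definite description, so that no
  existence or uniqueness theorem is needed to give the radius its meaning.\<close>

definition star_radius :: "real \<Rightarrow> real \<Rightarrow> real \<Rightarrow> bool" where
  "star_radius \<gamma> M R \<longleftrightarrow>
     0 < R \<and>
     (\<exists>\<rho>. is_arg_min (star_energy \<gamma>) (\<lambda>\<sigma>. \<sigma> \<in> X_class \<gamma> M) \<rho> \<and>
          (\<exists>g. \<forall>x. \<rho> x = g (norm x)) \<and>
          (\<forall>x. norm x < R \<longrightarrow> 0 < \<rho> x) \<and>
          (\<forall>x. R \<le> norm x \<longrightarrow> \<rho> x = 0))"

definition W_class :: "real \<Rightarrow> real \<Rightarrow> (real^3 \<Rightarrow> real) set" where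
  "W_class \<gamma> M =
     {\<rho>. axisymmetric \<rho> \<and> (AE x in lebesgue. 0 \<le> \<rho> x) \<and>
          integrable lebesgue \<rho> \<and> \<rho> \<in> Lp_space \<gamma> \<and> (LINT x|lebesgue. \<rho> x) = M}"

definition W_star :: "real \<Rightarrow> real \<Rightarrow> real \<Rightarrow> (real^3 \<Rightarrow> real) set" where
  "W_star \<gamma> M Rc = {\<rho> \<in> W_class \<gamma> M. \<forall>x. Rc \<le> cyl_r x \<longrightarrow> \<rho> x = 0}"

abbreviation e3 :: "real^3" where
  "e3 \<equiv> axis 3 1"

text \<open>The sequence \<open>\<sigma>\<close>, translated vertically by the \<open>a i\<close>, keeps its mass in bounded balls
  uniformly in \<open>i\<close> and converges weakly in $L^\gamma$ to \<open>\<tau>\<close>.\<close>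

definition shifted_limit ::
    "real \<Rightarrow> real \<Rightarrow> (nat \<Rightarrow> real^3 \<Rightarrow> real) \<Rightarrow> (nat \<Rightarrow> real) \<Rightarrow> (real^3 \<Rightarrow> real) \<Rightarrow> bool" where
  "shifted_limit \<gamma> M \<sigma> a \<tau> \<longleftrightarrow>
     (\<forall>\<epsilon>>0. \<exists>R>0. \<forall>i. M - \<epsilon> \<le> (LINT x : ball (a i *\<^sub>R e3) R | lebesgue. \<sigma> i x)) \<and>
     weak_conv_Lp \<gamma> (\<lambda>i x. \<sigma> i (x + a i *\<^sub>R e3)) \<tau>"

end

theory Submission
  imports Defs "HOL-Complex_Analysis.Great_Picard"
begin

text \<open>An axisymmetric density on \<open>\<real>\<^sup>3\<close> is a function of \<open>(r, z)\<close>, and its lift to \<open>\<real>\<^sup>5\<close> is the same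
  function integrated against \<open>r\<^sup>2\<close> times the measure.  In these coordinates the energy is the
  pressure term minus a symmetric bilinear form: half the Newtonian energy in \<open>\<real>\<^sup>3\<close> plus a
  nonnegative multiple (proportional to \<open>\<beta>\<^sup>2\<close>) of the energy of the lift for the kernel
  \<open>\<bar>x\<bar>\<^sup>-\<^sup>3\<close> of \<open>\<real>\<^sup>5\<close>.  Since \<open>\<gamma> > 2\<close>, Young's inequality bounds this form by the \<open>L\<^sup>2\<close> norm and
  the mass, hence by a small multiple of the pressure term; this is coercivity.  All densities live
  in a cylinder, so mass can only be lost along the axis.  Spreading mass along the axis makes the
  pressure term negligible, which gives negative energy; a minimizing sequence therefore does not
  vanish.  If it split into two distant parts, moving them to a bounded distance would gain a fixed
  amount of interaction energy, so it is tight up to vertical shifts.  Tightness gives a weak limit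
  of full mass along which the bilinear form passes to the limit, while the pressure term is weakly
  lower semicontinuous.\<close>

section \<open>Bilinear integrals with Riesz kernels\<close>

text \<open>The usual proof of strict subadditivity rescales mass, but the cylinder fixes a length.
  Two separate facts take its place. Plain subadditivity holds because densities can be strung out
  along the axis, where their interaction only lowers the energy. Strictness comes from bringing two
  bumps together, a gain of order 1/R that must beat the interaction destroyed by cutting the bumps
  out; a single cut gives no such bound, hence the average over R cuts. The cuts are cheap only if
  both bumps have nearly empty surroundings, and this is what a second concentration function, with
  two centres, guarantees. Kernel integrals take values in \<open>ennreal\<close> and are estimated
  in an arbitrary Euclidean space, so that \<open>real^3\<close> and \<open>real^5\<close> share all
  bounds and no integrability has to be checked on the way. A further obstacle is measurability:
  densities are only Lebesgue measurable, while \<open>lift5\<close> reads them on a half-plane, a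
  null set of \<open>real^3\<close>. A Borel function of (r,z) has to be recovered before anything
  can be transferred between the two spaces.\<close>

definition kint :: "('a::euclidean_space \<Rightarrow> ennreal) \<Rightarrow> ('a \<Rightarrow> ennreal) \<Rightarrow> ('a \<Rightarrow> ennreal) \<Rightarrow> ennreal" where
  "kint k f g = (\<integral>\<^sup>+x. \<integral>\<^sup>+y. f x * g y * k (x - y) \<partial>lborel \<partial>lborel)"

text \<open>For \<open>l > 0\<close> the value at the origin is 0, by the convention for division by
  zero. Upper bounds on the kernel therefore hold everywhere, lower bounds only off the
  diagonal.\<close>

definition riesz :: "nat \<Rightarrow> 'a::euclidean_space \<Rightarrow> ennreal" where
  "riesz l x = ennreal (1 / norm x ^ l)"

definition riesz_near :: "nat \<Rightarrow> real \<Rightarrow> 'a::euclidean_space \<Rightarrow> ennreal" where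
  "riesz_near l \<epsilon> x = riesz l x * indicator {x. norm x < \<epsilon>} x"

lemma riesz_measurable [measurable]: "riesz l \<in> borel_measurable borel"
  unfolding riesz_def [abs_def] by measurable

lemma riesz_near_measurable [measurable]: "riesz_near l \<epsilon> \<in> borel_measurable borel"
  unfolding riesz_near_def [abs_def] by measurable

lemma riesz_minus: "riesz l (- x) = riesz l x"
  by (simp add: riesz_def)

lemma kint_commute:
  assumes [measurable]: "k \<in> borel_measurable borel" "f \<in> borel_measurable borel"
    "g \<in> borel_measurable borel"
    and k: "\<And>x. k (- x) = k x"
  shows "kint k f g = kint k g f"
proof -
  have "kint k f g = (\<integral>\<^sup>+y. \<integral>\<^sup>+x. f x * g y * k (x - y) \<partial>lborel \<partial>lborel)"
    unfolding kint_def by (rule lborel_pair.Fubini'[symmetric]) measurable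
  also have "\<dots> = kint k g f"
    unfolding kint_def
    by (intro nn_integral_cong) (metis k minus_diff_eq mult.commute)
  finally show ?thesis .
qed

lemma kint_add_left:
  assumes [measurable]: "k \<in> borel_measurable borel" "f \<in> borel_measurable borel"
    "f' \<in> borel_measurable borel" "g \<in> borel_measurable borel"
  shows "kint k (\<lambda>x. f x + f' x) g = kint k f g + kint k f' g"
  unfolding kint_def by (simp add: distrib_right nn_integral_add)

lemma kint_add_kernel:
  assumes [measurable]: "k \<in> borel_measurable borel" "f \<in> borel_measurable borel"
    "k' \<in> borel_measurable borel" "g \<in> borel_measurable borel"
  shows "kint (\<lambda>x. k x + k' x) f g = kint k f g + kint k' f g"
  unfolding kint_def by (simp add: distrib_right distrib_left nn_integral_add)

lemma kint_cmult_kernel: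
  assumes [measurable]: "k \<in> borel_measurable borel" "f \<in> borel_measurable borel"
    "g \<in> borel_measurable borel"
  shows "kint (\<lambda>x. c * k x) f g = c * kint k f g"
proof -
  have *: "f x * g y * (c * k (x - y)) = c * (f x * g y * k (x - y))" for x y
    by (simp add: ac_simps)
  show ?thesis
    unfolding kint_def * by (simp add: nn_integral_cmult)
qed

lemma kint_mono:
  assumes "\<And>x y. f x * g y * k (x - y) \<le> f' x * g' y * k' (x - y)"
  shows "kint k f g \<le> kint k' f' g'"
  unfolding kint_def by (intro nn_integral_mono assms)

lemma kint_const:
  assumes [measurable]: "f \<in> borel_measurable borel" "g \<in> borel_measurable borel"
  shows "kint (\<lambda>_. c) f g = c * ((\<integral>\<^sup>+x. f x \<partial>lborel) * (\<integral>\<^sup>+x. g x \<partial>lborel))"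
proof -
  have *: "f x * g y * c = (c * f x) * g y" for x y
    by (simp add: ac_simps)
  show ?thesis
    unfolding kint_def *
    by (simp add: nn_integral_cmult nn_integral_multc mult.assoc)
qed

section \<open>Translation invariance and Young's inequality\<close>

lemma nn_integral_lborel_shift:
  fixes f :: "'a::euclidean_space \<Rightarrow> ennreal"
  assumes [measurable]: "f \<in> borel_measurable borel"
  shows "(\<integral>\<^sup>+x. f (x + v) \<partial>lborel) = (\<integral>\<^sup>+x. f x \<partial>lborel)"
proof -
  have "(\<integral>\<^sup>+x. f x \<partial>lborel) = (\<integral>\<^sup>+x. f x \<partial>(distr lborel borel ((+) v)))"
    by (simp add: lborel_distr_plus)
  also have "\<dots> = (\<integral>\<^sup>+x. f (x + v) \<partial>lborel)"
    by (subst nn_integral_distr) (auto simp: add.commute)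
  finally show ?thesis ..
qed

lemma nn_integral_lborel_reflect:
  fixes f :: "'a::euclidean_space \<Rightarrow> ennreal"
  assumes [measurable]: "f \<in> borel_measurable borel"
  shows "(\<integral>\<^sup>+x. f (v - x) \<partial>lborel) = (\<integral>\<^sup>+x. f x \<partial>lborel)"
proof -
  have "lborel = density (distr lborel borel (\<lambda>x. v - x)) (\<lambda>_. 1)"
    using lborel_affine[of "-1" v] by simp
  then have "(\<integral>\<^sup>+x. f x \<partial>lborel) = (\<integral>\<^sup>+x. f x \<partial>(density (distr lborel borel (\<lambda>x. v - x)) (\<lambda>_. 1)))"
    by simp
  also have "\<dots> = (\<integral>\<^sup>+x. f (v - x) \<partial>lborel)"
    by (simp add: density_1 nn_integral_distr)
  finally show ?thesis ..
qed

lemma kint_shift: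
  assumes [measurable]: "k \<in> borel_measurable borel" "f \<in> borel_measurable borel"
    "g \<in> borel_measurable borel"
  shows "kint k (\<lambda>x. f (x + v)) (\<lambda>x. g (x + v)) = kint k f g"
proof -
  have "kint k (\<lambda>x. f (x + v)) (\<lambda>x. g (x + v))
      = (\<integral>\<^sup>+x. (\<integral>\<^sup>+y. f (x + v) * g (y + v) * k ((x + v) - (y + v)) \<partial>lborel) \<partial>lborel)"
    by (simp add: kint_def)
  also have "\<dots> = (\<integral>\<^sup>+x. (\<integral>\<^sup>+y. f (x + v) * g y * k ((x + v) - y) \<partial>lborel) \<partial>lborel)"
    by (intro nn_integral_cong nn_integral_lborel_shift) measurable
  also have "\<dots> = kint k f g"
    unfolding kint_def by (rule nn_integral_lborel_shift) measurable
  finally show ?thesis .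
qed

lemma ennreal_AM_GM:
  fixes a b :: ennreal
  assumes "t > 0"
  shows "a * b \<le> ennreal t * a^2 + ennreal (1/t) * b^2"
proof (cases a)
  case (real r)
  note r = real
  show ?thesis
  proof (cases b)
    case (real s)
    have "0 \<le> (t * r - s)^2" by simp
    then have "2 * t * (r * s) \<le> t * t * (r * r) + s * s"
      by (simp add: power2_eq_square algebra_simps)
    moreover have "0 \<le> t * (r * s)" using assms r real by simp
    ultimately have "t * (r * s) \<le> t * t * (r * r) + s * s" by linarith
    then have "r * s \<le> (t * t * (r * r) + s * s) / t"
      using assms by (simp add: pos_le_divide_eq mult.commute)
    also have "\<dots> = t * r^2 + 1/t * s^2"
      using assms by (simp add: power2_eq_square add_divide_distrib)
    finally have "r * s \<le> t * r^2 + 1/t * s^2" .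
    then show ?thesis
      using r real assms
      by (simp add: ennreal_mult[symmetric] ennreal_power ennreal_plus[symmetric] ennreal_leI del: ennreal_plus)
  next
    case top
    then show ?thesis using assms by (simp add: ennreal_mult_top power2_eq_square)
  qed
next
  case top
  then show ?thesis using assms by (simp add: ennreal_mult_top power2_eq_square)
qed

text \<open>After the weighted arithmetic-geometric mean inequality each summand contains only one
  of the two densities, so the other variable integrates the kernel alone. The weight
  \<open>t\<close> stays free: a density with small square integral can then be paired with one that
  is merely bounded.\<close>

lemma kint_young:
  fixes k :: "'a::euclidean_space \<Rightarrow> ennreal"
  assumes [measurable]: "k \<in> borel_measurable borel" "f \<in> borel_measurable borel"
    "g \<in> borel_measurable borel" and t: "t > 0"
  shows "kint k f g \<le> (\<integral>\<^sup>+x. k x \<partial>lborel) *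
    (ennreal t * (\<integral>\<^sup>+x. (f x)^2 \<partial>lborel) + ennreal (1/t) * (\<integral>\<^sup>+x. (g x)^2 \<partial>lborel))"
proof -
  have "kint k f g \<le> (\<integral>\<^sup>+x. \<integral>\<^sup>+y. (ennreal t * (f x)^2) * k (x - y) + (ennreal (1/t) * (g y)^2) * k (x - y) \<partial>lborel \<partial>lborel)"
    unfolding kint_def using ennreal_AM_GM[OF t]
    by (intro nn_integral_mono) (auto simp flip: distrib_right intro!: mult_right_mono)
  also have "\<dots> = (\<integral>\<^sup>+x. \<integral>\<^sup>+y. (ennreal t * (f x)^2) * k (x - y) \<partial>lborel \<partial>lborel)
     + (\<integral>\<^sup>+x. \<integral>\<^sup>+y. (ennreal (1/t) * (g y)^2) * k (x - y) \<partial>lborel \<partial>lborel)"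
    by (simp add: nn_integral_add)
  also have "(\<integral>\<^sup>+x. \<integral>\<^sup>+y. (ennreal t * (f x)^2) * k (x - y) \<partial>lborel \<partial>lborel)
     = (\<integral>\<^sup>+x. k x \<partial>lborel) * (ennreal t * (\<integral>\<^sup>+x. (f x)^2 \<partial>lborel))"
    by (simp add: nn_integral_cmult nn_integral_multc nn_integral_lborel_reflect mult.commute)
  also have "(\<integral>\<^sup>+x. \<integral>\<^sup>+y. (ennreal (1/t) * (g y)^2) * k (x - y) \<partial>lborel \<partial>lborel)
     = (\<integral>\<^sup>+y. \<integral>\<^sup>+x. (ennreal (1/t) * (g y)^2) * k (x - y) \<partial>lborel \<partial>lborel)"
    by (rule lborel_pair.Fubini'[symmetric]) measurable
  also have "\<dots> = (\<integral>\<^sup>+y. (ennreal (1/t) * (g y)^2) * (\<integral>\<^sup>+x. k x \<partial>lborel) \<partial>lborel)"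
    using nn_integral_lborel_shift[of k "- _"]
    by (simp add: nn_integral_cmult)
  also have "\<dots> = (\<integral>\<^sup>+x. k x \<partial>lborel) * (ennreal (1/t) * (\<integral>\<^sup>+x. (g x)^2 \<partial>lborel))"
    by (simp add: nn_integral_cmult nn_integral_multc mult.commute)
  finally show ?thesis by (simp add: distrib_left)
qed

lemma ennreal_le_suminf: "a j \<le> (\<Sum>i. a i)" for a :: "nat \<Rightarrow> ennreal"
  using sum_le_suminf[of a "{j}"] by simp

text \<open>On the dyadic shell of index \<open>j\<close> the kernel is at most
  \<open>2 ^ ((j+1)*l)\<close>, while the ball of radius \<open>(1/2)^j\<close> in dimension n has
  volume of order \<open>(1/2)^(j*n)\<close>. The condition on \<open>l\<close> leaves at least one
  factor \<open>(1/2)^j\<close>, so a geometric series dominates.\<close>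

lemma riesz_near_integrable:
  assumes "l < DIM('a)"
  shows "(\<integral>\<^sup>+x. riesz_near l 1 (x::'a::euclidean_space) \<partial>lborel) < \<infinity>"
proof -
  let ?n = "DIM('a)"
  let ?\<omega> = "unit_ball_vol (real DIM('a))"
  let ?h = "\<lambda>j x::'a. ennreal (2 ^ ((j+1)*l)) * indicator {x. norm x < (1/2)^j} x"
  have le: "riesz_near l 1 x \<le> (\<Sum>j. ?h j x)" if "x \<noteq> 0" for x :: 'a
  proof (cases "norm x < 1")
    case True
    define P where "P j \<longleftrightarrow> (1/2::real)^(Suc j) \<le> norm x" for j
    have "\<exists>m. (1/2::real)^m < norm x"
      using that by (intro real_arch_pow_inv) auto
    then obtain m where "(1/2::real)^m < norm x" ..
    then have "P m" unfolding P_def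
      using norm_ge_zero[of x] by (simp, linarith)
    \<comment> \<open>Index of the shell that contains x: minimality yields
      \<open>norm x < (1/2)^j\<close>, with \<open>norm x < 1\<close> covering
      \<open>j = 0\<close>.\<close>
    define j where "j = (LEAST j. P j)"
    have Pj: "P j" unfolding j_def by (rule LeastI[of P, OF \<open>P m\<close>])
    have "norm x < (1/2)^j"
    proof (cases j)
      case 0 then show ?thesis using True by simp
    next
      case (Suc i)
      then have "\<not> P i" unfolding j_def by (metis lessI not_less_Least)
      then show ?thesis using Suc unfolding P_def by (simp add: not_le)
    qed
    have "(1/2::real)^((j+1)*l) \<le> norm x ^ l"
      using Pj power_mono[of "(1/2::real)^(Suc j)" "norm x" l] unfolding P_def
      by (metis Suc_eq_plus1 divide_nonneg_nonneg power_mult zero_le_numeral zero_le_one zero_le_power)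
    moreover have "0 < norm x ^ l" using that by simp
    ultimately have "1 / norm x ^ l \<le> 2 ^ ((j+1)*l)"
      by (simp add: field_simps power_one_over)
    then have "riesz_near l 1 x \<le> ?h j x"
      using \<open>norm x < (1/2)^j\<close> True by (simp add: riesz_near_def riesz_def ennreal_leI)
    also have "\<dots> \<le> (\<Sum>j. ?h j x)"
      by (rule ennreal_le_suminf)
    finally show ?thesis .
  next
    case False
    then show ?thesis by (simp add: riesz_near_def)
  qed
  have "(\<integral>\<^sup>+x. riesz_near l 1 (x::'a) \<partial>lborel) \<le> (\<integral>\<^sup>+x. (\<Sum>j. ?h j x) \<partial>lborel)"
    by (intro nn_integral_mono_AE) (use AE_lborel_singleton[of "0::'a"] le in \<open>auto elim!: eventually_mono\<close>)
  also have "\<dots> = (\<Sum>j. \<integral>\<^sup>+x. ?h j x \<partial>lborel)"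
    by (rule nn_integral_suminf) measurable
  also have "\<dots> \<le> (\<Sum>j. ennreal (2^l * ?\<omega> * (1/2)^j))"
  proof (intro suminf_le)
    fix j
    have "{x::'a. norm x < (1/2)^j} = ball 0 ((1/2)^j)" by auto
    then have "(\<integral>\<^sup>+x. ?h j x \<partial>lborel) = ennreal (2 ^ ((j+1)*l)) * emeasure lborel (ball (0::'a) ((1/2)^j))"
      by (simp add: nn_integral_cmult)
    also have "\<dots> = ennreal (2 ^ ((j+1)*l)) * (ennreal (((1/2)^j)^?n) * ennreal ?\<omega>)"
      by (simp add: emeasure_ball content_ball mult.commute flip: ennreal_mult)
    also have "\<dots> = ennreal (2^((j+1)*l) * (((1/2)^j)^?n * ?\<omega>))"
      by (simp add: ennreal_mult)
    also have "\<dots> \<le> ennreal (2^l * ?\<omega> * (1/2)^j)"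
    proof (rule ennreal_leI)
      have "(2::real)^((j+1)*l) * ((1/2)^j)^?n = 2^l * ((1/2)^j)^(?n - l)"
      proof -
        have "((1/2::real)^j)^?n = ((1/2)^j)^l * ((1/2)^j)^(?n - l)"
          using assms by (simp flip: power_add)
        moreover have "(2::real)^((j+1)*l) * ((1/2)^j)^l = 2^l"
          by (simp add: power_add power_mult_distrib power_divide flip: power_mult)
        ultimately show ?thesis by (simp add: mult.assoc[symmetric])
      qed
      also have "\<dots> \<le> 2^l * (1/2)^j"
        using power_decreasing[of 1 "?n - l" "(1/2::real)^j"] assms by (simp add: power_le_one)
      finally have "(2::real)^((j+1)*l) * ((1/2)^j)^?n \<le> 2^l * (1/2)^j" .
      from mult_right_mono[OF this, of ?\<omega>]
      show "2^((j+1)*l) * (((1/2)^j)^?n * ?\<omega>) \<le> 2^l * ?\<omega> * (1/2)^j"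
        by (simp add: mult_ac)
    qed
    finally show "(\<integral>\<^sup>+x. ?h j x \<partial>lborel) \<le> ennreal (2^l * ?\<omega> * (1/2)^j)" .
  qed auto
  also have "\<dots> = ennreal (\<Sum>j. 2^l * ?\<omega> * (1/2)^j)"
    by (intro suminf_ennreal2) (auto intro!: summable_mult)
  also have "\<dots> < \<infinity>" by simp
  finally show ?thesis .
qed

lemma riesz_near_mono: "\<epsilon> \<le> \<epsilon>' \<Longrightarrow> riesz_near l \<epsilon> x \<le> riesz_near l \<epsilon>' x"
  by (auto simp: riesz_near_def split: split_indicator)

text \<open>Dominated convergence along the radii 1/(n+1), with the kernel on the unit ball as
  majorant. The value 0 at the origin makes the pointwise limit 0 everywhere.\<close>

lemma riesz_near_small:
  assumes "0 < l" "l < DIM('a)" "\<theta> > 0"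
  obtains \<epsilon> where "0 < \<epsilon>" "\<epsilon> \<le> 1" "(\<integral>\<^sup>+x. riesz_near l \<epsilon> (x::'a::euclidean_space) \<partial>lborel) \<le> ennreal \<theta>"
proof -
  have "(\<lambda>n. \<integral>\<^sup>+x. riesz_near l (1 / Suc n) (x::'a) \<partial>lborel) \<longlonglongrightarrow> (\<integral>\<^sup>+x. 0 \<partial>(lborel :: 'a measure))"
  proof (rule nn_integral_dominated_convergence[where w="riesz_near l 1"])
    show "AE x in lborel. riesz_near l (1 / real (Suc j)) x \<le> riesz_near l 1 (x::'a)" for j
      by (intro AE_I2 riesz_near_mono) simp
    show "(\<integral>\<^sup>+x. riesz_near l 1 (x::'a) \<partial>lborel) < \<infinity>"
      by (rule riesz_near_integrable[OF assms(2)])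
    show "AE x in lborel. (\<lambda>i. riesz_near l (1 / real (Suc i)) (x::'a)) \<longlonglongrightarrow> 0"
    proof (rule AE_I2)
      fix x :: 'a
      show "(\<lambda>i. riesz_near l (1 / real (Suc i)) x) \<longlonglongrightarrow> 0"
      proof (cases "x = 0")
        case True
        then show ?thesis using assms(1) by (simp add: riesz_near_def riesz_def zero_power)
      next
        case False
        then have "eventually (\<lambda>n. 1 / real (Suc n) < norm x) sequentially"
          using LIMSEQ_inverse_real_of_nat by (intro order_tendstoD) (auto simp: inverse_eq_divide)
        then have "eventually (\<lambda>n. riesz_near l (1 / real (Suc n)) x = 0) sequentially"
          by eventually_elim (auto simp: riesz_near_def)
        then show ?thesis by (rule tendsto_eventually)
      qed
    qed
  qed measurable
  then have "eventually (\<lambda>n. (\<integral>\<^sup>+x. riesz_near l (1 / Suc n) (x::'a) \<partial>lborel) < ennreal \<theta>) sequentially"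
    using assms(3) by (intro order_tendstoD) auto
  then obtain n where "(\<integral>\<^sup>+x. riesz_near l (1 / Suc n) (x::'a) \<partial>lborel) < ennreal \<theta>"
    by (auto simp: eventually_sequentially)
  then show ?thesis by (intro that[of "1 / real (Suc n)"]) auto
qed

text \<open>Three regions are separated: the singularity, the rest of the slab of half-width
  \<open>D\<close> orthogonal to \<open>e\<close>, and points at axial distance at least
  \<open>D\<close>. Distance along the axis is the relevant one since mass can escape only in that
  direction. \<open>1 \<le> D\<close> lets the power \<open>l\<close> be lowered to 1 in the last
  region, so both kernels get the same tail \<open>1 / D\<close>.\<close>

lemma kint_riesz_split:
  fixes e :: "'a::euclidean_space"
  assumes [measurable]: "f \<in> borel_measurable borel" "g \<in> borel_measurable borel"
    and "norm e = 1" "0 < \<epsilon>" "\<epsilon> \<le> 1" "1 \<le> D" "0 < l"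
  shows "kint (riesz l) f g \<le> kint (riesz_near l \<epsilon>) f g
    + ennreal (1 / \<epsilon>^l) * kint (\<lambda>x. indicator {x. \<bar>x \<bullet> e\<bar> < D} x) f g
    + ennreal (1 / D) * ((\<integral>\<^sup>+x. f x \<partial>lborel) * (\<integral>\<^sup>+x. g x \<partial>lborel))"
proof -
  have *: "riesz l x \<le> riesz_near l \<epsilon> x + ennreal (1 / \<epsilon>^l) * indicator {x. \<bar>x \<bullet> e\<bar> < D} x + ennreal (1 / D)"
    for x :: 'a
  proof (cases "norm x < \<epsilon>")
    case True
    then show ?thesis by (simp add: riesz_near_def add.assoc)
  next
    case False
    then have "0 < norm x" using assms by linarith
    show ?thesis
    proof (cases "\<bar>x \<bullet> e\<bar> < D")
      case True
      have "1 / norm x ^ l \<le> 1 / \<epsilon> ^ l"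
        using False assms \<open>0 < norm x\<close> by (intro divide_left_mono power_mono) auto
      then have "riesz l x \<le> ennreal (1 / \<epsilon>^l)"
        by (simp add: riesz_def ennreal_leI)
      then show ?thesis using True False
        by (simp add: riesz_near_def add_increasing2)
    next
      case F2: False
      have "D \<le> norm x"
        using F2 Cauchy_Schwarz_ineq2[of x e] assms by auto
      moreover have "norm x \<le> norm x ^ l"
        using \<open>D \<le> norm x\<close> assms power_increasing[of 1 l "norm x"] by simp
      ultimately have "1 / norm x ^ l \<le> 1 / D"
        using assms by (intro divide_left_mono) auto
      then have "riesz l x \<le> ennreal (1 / D)"
        by (simp add: riesz_def ennreal_leI)
      then show ?thesis using F2 by (simp add: add_increasing)
    qed
  qed
  have "kint (riesz l) f g \<le> kint (\<lambda>x. riesz_near l \<epsilon> x + ennreal (1 / \<epsilon>^l) * indicator {x. \<bar>x \<bullet> e\<bar> < D} x + ennreal (1 / D)) f g"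
    by (intro kint_mono mult_left_mono *) auto
  also have "\<dots> = kint (riesz_near l \<epsilon>) f g
    + ennreal (1 / \<epsilon>^l) * kint (\<lambda>x. indicator {x. \<bar>x \<bullet> e\<bar> < D} x) f g
    + ennreal (1 / D) * ((\<integral>\<^sup>+x. f x \<partial>lborel) * (\<integral>\<^sup>+x. g x \<partial>lborel))"
    by (simp add: kint_add_kernel kint_cmult_kernel kint_const)
  finally show ?thesis .
qed

text \<open>For fixed x the inner integral is the mass of \<open>g\<close> in a slab centred at the
  height of x, so only the largest slab mass of \<open>g\<close> matters.\<close>

lemma kint_slab_le:
  fixes e :: "'a::euclidean_space"
  assumes [measurable]: "f \<in> borel_measurable borel" "g \<in> borel_measurable borel"
    and slab: "\<And>a. (\<integral>\<^sup>+x. g x * indicator {x. \<bar>x \<bullet> e - a\<bar> < D} x \<partial>lborel) \<le> \<delta>"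
  shows "kint (\<lambda>x. indicator {x. \<bar>x \<bullet> e\<bar> < D} x) f g \<le> \<delta> * (\<integral>\<^sup>+x. f x \<partial>lborel)"
proof -
  have "kint (\<lambda>x. indicator {x. \<bar>x \<bullet> e\<bar> < D} x) f g
      = (\<integral>\<^sup>+x. f x * (\<integral>\<^sup>+y. g y * indicator {y. \<bar>y \<bullet> e - x \<bullet> e\<bar> < D} y \<partial>lborel) \<partial>lborel)"
    unfolding kint_def
    by (subst nn_integral_cmult[symmetric])
       (auto intro!: nn_integral_cong simp: inner_diff_left abs_minus_commute mult.assoc split: split_indicator)
  also have "\<dots> \<le> (\<integral>\<^sup>+x. f x * \<delta> \<partial>lborel)"
    by (intro nn_integral_mono mult_left_mono slab) auto
  also have "\<dots> = \<delta> * (\<integral>\<^sup>+x. f x \<partial>lborel)"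
    by (simp add: nn_integral_cmult mult.commute)
  finally show ?thesis .
qed

lemma kint_riesz_far:
  fixes e :: "'a::euclidean_space"
  assumes [measurable]: "f \<in> borel_measurable borel" "g \<in> borel_measurable borel"
    and "norm e = 1" "1 \<le> D" "0 < l"
    and far: "\<And>x y. f x \<noteq> 0 \<Longrightarrow> g y \<noteq> 0 \<Longrightarrow> D \<le> \<bar>x \<bullet> e - y \<bullet> e\<bar>"
  shows "kint (riesz l) f g \<le> ennreal (1 / D) * ((\<integral>\<^sup>+x. f x \<partial>lborel) * (\<integral>\<^sup>+x. g x \<partial>lborel))"
proof -
  have "kint (riesz l) f g \<le> kint (\<lambda>_. ennreal (1 / D)) f g"
  proof (rule kint_mono)
    fix x y
    show "f x * g y * riesz l (x - y) \<le> f x * g y * ennreal (1 / D)"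
    proof (cases "f x = 0 \<or> g y = 0")
      case False
      then have "D \<le> \<bar>(x - y) \<bullet> e\<bar>" using far by (auto simp: inner_diff_left)
      then have D: "D \<le> norm (x - y)"
        using Cauchy_Schwarz_ineq2[of "x - y" e] assms by auto
      moreover have "norm (x - y) \<le> norm (x - y) ^ l"
        using D assms power_increasing[of 1 l "norm (x - y)"] by simp
      ultimately have "1 / norm (x - y) ^ l \<le> 1 / D"
        using assms by (intro divide_left_mono) auto
      then show ?thesis
        by (intro mult_left_mono) (auto simp: riesz_def ennreal_leI)
    qed auto
  qed
  then show ?thesis by (simp add: kint_const)
qed

lemma kint_riesz_lower:
  fixes f g :: "'a::euclidean_space \<Rightarrow> ennreal"
  assumes [measurable]: "f \<in> borel_measurable borel" "g \<in> borel_measurable borel"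
    and "0 < D"
    and close: "\<And>x y. f x \<noteq> 0 \<Longrightarrow> g y \<noteq> 0 \<Longrightarrow> norm (x - y) \<le> D"
  shows "ennreal (1 / D) * ((\<integral>\<^sup>+x. f x \<partial>lborel) * (\<integral>\<^sup>+x. g x \<partial>lborel)) \<le> kint (riesz 1) f g"
proof -
  have "kint (\<lambda>_. ennreal (1 / D)) f g \<le> kint (riesz 1) f g"
    unfolding kint_def
  \<comment> \<open>Almost everywhere in the inner variable: on the diagonal the kernel has the
    value 0 and the inequality may fail.\<close>
  proof (rule nn_integral_mono, rule nn_integral_mono_AE)
    fix x :: 'a
    show "AE y in lborel. f x * g y * ennreal (1 / D) \<le> f x * g y * riesz 1 (x - y)"
      using AE_lborel_singleton[of x]
    proof eventually_elim
      case (elim y)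
      show ?case
      proof (cases "f x = 0 \<or> g y = 0")
        case False
        then have "1 / D \<le> 1 / norm (x - y)"
          using close elim assms(3) by (intro divide_left_mono) auto
        then show ?thesis
          by (intro mult_left_mono) (auto simp: riesz_def ennreal_leI)
      qed auto
    qed
  qed
  then show ?thesis by (simp add: kint_const)
qed

text \<open>Exchange the sum over the cuts with the integral. A pair of points is counted once for
  every integer height \<open>L\<close> that separates it, hence at most axial distance plus one
  times, and one power of the kernel absorbs this growth. The resulting bound does not contain the
  number \<open>R\<close> of cuts, so a typical cut costs only a fraction 1/R of it. The point on
  the outer side of a cut always lies in the annulus that defines \<open>g\<close>.\<close>

lemma kint_riesz_cuts:
  fixes e :: "'a::euclidean_space" and R :: nat and a R' :: real
  assumes [measurable]: "f \<in> borel_measurable borel"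
    and e: "norm e = 1" and l: "0 < l" and t: "t > 0"
  defines "g \<equiv> \<lambda>x. f x * indicator {x. R < \<bar>x \<bullet> e - a\<bar> \<and> \<bar>x \<bullet> e - a\<bar> \<le> R'} x"
  shows "(\<Sum>L\<in>{R..<2*R}. kint (riesz l) (\<lambda>x. f x * indicator {x. \<bar>x \<bullet> e - a\<bar> \<le> L} x)
             (\<lambda>x. f x * indicator {x. L < \<bar>x \<bullet> e - a\<bar> \<and> \<bar>x \<bullet> e - a\<bar> \<le> R'} x))
     \<le> 2 * ((\<integral>\<^sup>+x. riesz_near l 1 (x::'a) \<partial>lborel) *
          (ennreal t * (\<integral>\<^sup>+x. (f x)^2 \<partial>lborel) + ennreal (1/t) * (\<integral>\<^sup>+x. (g x)^2 \<partial>lborel)))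
       + 2 * ((\<integral>\<^sup>+x. f x \<partial>lborel) * (\<integral>\<^sup>+x. g x \<partial>lborel))"
proof -
  have [measurable]: "g \<in> borel_measurable borel" unfolding g_def by measurable
  let ?z = "\<lambda>x. \<bar>x \<bullet> e - a\<bar>"
  let ?A = "\<lambda>L x. f x * indicator {x. ?z x \<le> real L} x"
  let ?B = "\<lambda>L x. f x * indicator {x. real L < ?z x \<and> ?z x \<le> R'} x"
  have count: "(\<Sum>L\<in>{R..<2*R}. indicator {x. ?z x \<le> real L} x * indicator {x. real L < ?z x \<and> ?z x \<le> R'} y)
      \<le> ennreal (\<bar>(x - y) \<bullet> e\<bar> + 1) * indicator {x. R < ?z x \<and> ?z x \<le> R'} y" for x y :: 'a
  proof (cases "R < ?z y \<and> ?z y \<le> R'")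
    case True
    let ?S = "{L\<in>{R..<2*R}. ?z x \<le> real L \<and> real L < ?z y}"
    have "(\<Sum>L\<in>{R..<2*R}. indicator {x. ?z x \<le> real L} x * indicator {x. real L < ?z x \<and> ?z x \<le> R'} y)
       = (\<Sum>L\<in>{R..<2*R}. if L \<in> ?S then 1 else (0::ennreal))"
      using True by (intro sum.cong) (auto split: split_indicator)
    also have "\<dots> = (\<Sum>L\<in>{R..<2*R} \<inter> ?S. 1)"
      by (simp only: sum.inter_restrict finite_atLeastLessThan)
    also have "{R..<2*R} \<inter> ?S = ?S" by auto
    also have "(\<Sum>L\<in>?S. 1) = (of_nat (card ?S) :: ennreal)" by simp
    also have "\<dots> \<le> ennreal (\<bar>(x - y) \<bullet> e\<bar> + 1)"
    proof -
      \<comment> \<open>The separating integers lie between the two ceilings; rounding produces the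
        additional 1.\<close>
      have sub: "?S \<subseteq> {nat \<lceil>?z x\<rceil>..<nat \<lceil>?z y\<rceil>}"
        by (auto simp: le_nat_iff nat_le_iff ceiling_le_iff less_ceiling_iff zless_nat_eq_int_zless)
      have "card ?S \<le> nat \<lceil>?z y\<rceil> - nat \<lceil>?z x\<rceil>"
        using card_mono[OF _ sub] by simp
      moreover have "real (nat \<lceil>?z y\<rceil> - nat \<lceil>?z x\<rceil>) \<le> \<bar>?z x - ?z y\<bar> + 1"
        by linarith
      moreover have "\<bar>?z x - ?z y\<bar> \<le> \<bar>(x - y) \<bullet> e\<bar>" by (simp add: inner_diff_left)
      ultimately have "real (card ?S) \<le> \<bar>(x - y) \<bullet> e\<bar> + 1" by linarith
      then show ?thesis by (metis ennreal_leI ennreal_of_nat_eq_real_of_nat)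
    qed
    finally show ?thesis using True by simp
  next
    case False
    then have "(indicator {x. real L < ?z x \<and> ?z x \<le> R'} y :: ennreal) = 0" if "L \<in> {R..<2*R}" for L
      using that by (auto split: split_indicator)
    then show ?thesis by simp
  qed
  have le2: "ennreal r \<le> 2" if "r \<le> 2" for r
    using ennreal_leI[OF that] by simp
  \<comment> \<open>Inside the unit ball the factor is at most 2; from distance 1 on it is at most
    \<open>2 * norm x ^ l\<close>, which cancels the denominator.\<close>
  have kb: "ennreal (\<bar>x \<bullet> e\<bar> + 1) * riesz l x \<le> 2 * riesz_near l 1 x + 2" for x :: 'a
  proof (cases "norm x < 1")
    case True
    have "\<bar>x \<bullet> e\<bar> + 1 \<le> 2" using Cauchy_Schwarz_ineq2[of x e] e True by auto
    then have "ennreal (\<bar>x \<bullet> e\<bar> + 1) \<le> 2" by (rule le2)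
    then have "ennreal (\<bar>x \<bullet> e\<bar> + 1) * riesz l x \<le> 2 * riesz l x"
      by (rule mult_right_mono) auto
    then show ?thesis using True by (simp add: riesz_near_def add_increasing2)
  next
    case False
    have "\<bar>x \<bullet> e\<bar> + 1 \<le> 2 * norm x" using Cauchy_Schwarz_ineq2[of x e] e False by auto
    also have "\<dots> \<le> 2 * norm x ^ l" using False l power_increasing[of 1 l "norm x"] by simp
    finally have "(\<bar>x \<bullet> e\<bar> + 1) * (1 / norm x ^ l) \<le> 2" using False
      by (simp add: divide_le_eq)
    then have "ennreal (\<bar>x \<bullet> e\<bar> + 1) * riesz l x \<le> 2"
      unfolding riesz_def by (subst ennreal_mult[symmetric]) (auto intro: le2)
    then show ?thesis by (simp add: add_increasing)
  qed
  have "(\<Sum>L\<in>{R..<2*R}. kint (riesz l) (?A L) (?B L))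
      = (\<integral>\<^sup>+x. \<integral>\<^sup>+y. (\<Sum>L\<in>{R..<2*R}. ?A L x * ?B L y * riesz l (x - y)) \<partial>lborel \<partial>lborel)"
    unfolding kint_def by (simp add: nn_integral_sum)
  also have "\<dots> \<le> kint (\<lambda>x. 2 * riesz_near l 1 x + 2) f g"
    unfolding kint_def
  proof (intro nn_integral_mono)
    fix x y
    have "(\<Sum>L\<in>{R..<2*R}. ?A L x * ?B L y * riesz l (x - y)) = f x * f y * riesz l (x - y) *
      (\<Sum>L\<in>{R..<2*R}. indicator {x. ?z x \<le> real L} x * indicator {x. real L < ?z x \<and> ?z x \<le> R'} y)"
      by (simp only: sum_distrib_left mult_ac)
    also have "\<dots> \<le> f x * f y * riesz l (x - y) * (ennreal (\<bar>(x - y) \<bullet> e\<bar> + 1) * indicator {x. R < ?z x \<and> ?z x \<le> R'} y)"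
      by (intro mult_left_mono count) auto
    also have "\<dots> = f x * g y * (ennreal (\<bar>(x - y) \<bullet> e\<bar> + 1) * riesz l (x - y))"
      by (simp add: g_def mult_ac)
    also have "\<dots> \<le> f x * g y * (2 * riesz_near l 1 (x - y) + 2)"
      by (intro mult_left_mono kb) auto
    finally show "(\<Sum>L\<in>{R..<2*R}. ?A L x * ?B L y * riesz l (x - y)) \<le> f x * g y * (2 * riesz_near l 1 (x - y) + 2)" .
  qed
  also have "\<dots> = 2 * kint (riesz_near l 1) f g + 2 * ((\<integral>\<^sup>+x. f x \<partial>lborel) * (\<integral>\<^sup>+x. g x \<partial>lborel))"
    by (simp add: kint_add_kernel kint_cmult_kernel kint_const)
  also have "\<dots> \<le> 2 * ((\<integral>\<^sup>+x. riesz_near l 1 (x::'a) \<partial>lborel) *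
          (ennreal t * (\<integral>\<^sup>+x. (f x)^2 \<partial>lborel) + ennreal (1/t) * (\<integral>\<^sup>+x. (g x)^2 \<partial>lborel)))
       + 2 * ((\<integral>\<^sup>+x. f x \<partial>lborel) * (\<integral>\<^sup>+x. g x \<partial>lborel))"
    by (intro add_right_mono mult_left_mono kint_young t) auto
  finally show ?thesis .
qed

section \<open>Cylindrical coordinates in arbitrary dimension\<close>

text \<open>For \<open>norm e = 1\<close> these are the distance from the axis through
  \<open>e\<close> and the height along it. Dimension and axis stay variable because the same
  half-plane coordinates serve for \<open>real^3\<close> and for the lift to
  \<open>real^5\<close>.\<close>

definition cyl :: "'a::euclidean_space \<Rightarrow> 'a \<Rightarrow> real \<times> real" where
  "cyl e x = (norm (x - (x \<bullet> e) *\<^sub>R e), x \<bullet> e)"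

text \<open>In \<open>real^3\<close> this is the measure 2 pi r dr dz on the half-plane of
  nonnegative r. It is handled through shifts, scalings and the comparison of two dimensions instead
  of an explicit density.\<close>

definition cylm :: "'a::euclidean_space \<Rightarrow> (real \<times> real) measure" where
  "cylm e = distr lborel borel (cyl e)"

lemma measurable_fst_borel [measurable]: "fst \<in> borel_measurable (borel :: (real \<times> real) measure)"
  and measurable_snd_borel [measurable]: "snd \<in> borel_measurable (borel :: (real \<times> real) measure)"
  by (intro borel_measurable_continuous_onI continuous_intros)+

lemma sets_borel_rect [measurable]:
  fixes A B :: "real set"
  assumes "A \<in> sets borel" "B \<in> sets borel"
  shows "A \<times> B \<in> sets borel"
  using assms by (simp add: borel_Times)

lemma cyl_measurable [measurable]: "cyl e \<in> borel_measurable borel"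
  unfolding cyl_def [abs_def]
  by (intro borel_measurable_continuous_onI continuous_intros)

lemma snd_cyl [simp]: "snd (cyl e x) = x \<bullet> e"
  by (simp add: cyl_def)

lemma fst_cyl_nonneg [simp]: "0 \<le> fst (cyl e x)"
  by (simp add: cyl_def)

lemma sets_cylm [simp, measurable_cong]: "sets (cylm e) = sets borel"
  by (simp add: cylm_def)

lemma space_cylm [simp]: "space (cylm e) = UNIV"
  by (simp add: cylm_def)

lemma nn_integral_cylm:
  assumes "s \<in> borel_measurable borel"
  shows "(\<integral>\<^sup>+p. s p \<partial>cylm e) = (\<integral>\<^sup>+x. s (cyl e x) \<partial>lborel)"
  using assms unfolding cylm_def by (subst nn_integral_distr) auto

lemma AE_cylm_iff:
  assumes "Measurable.pred borel P"
  shows "(AE p in cylm e. P p) \<longleftrightarrow> (AE x in lborel. P (cyl e x))"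
  using assms unfolding cylm_def by (subst AE_distr_iff) auto

lemma emeasure_cylm:
  "S \<in> sets borel \<Longrightarrow> emeasure (cylm e) S = emeasure lborel (cyl e -` S)"
  unfolding cylm_def by (subst emeasure_distr) auto

lemma norm_cyl:
  assumes "norm e = 1"
  shows "(norm x)\<^sup>2 = (fst (cyl e x))\<^sup>2 + (snd (cyl e x))\<^sup>2"
proof -
  have "e \<bullet> e = 1" using assms by (simp add: dot_square_norm)
  then have "(norm (x - (x \<bullet> e) *\<^sub>R e))\<^sup>2 = x \<bullet> x - (x \<bullet> e)\<^sup>2"
    by (simp add: power2_norm_eq_inner inner_diff_left inner_diff_right inner_commute)
      (simp add: power2_eq_square)
  then show ?thesis
    by (simp add: cyl_def power2_norm_eq_inner)
qed

lemma norm_le_cyl: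
  assumes "norm e = 1"
  shows "norm x \<le> fst (cyl e x) + \<bar>snd (cyl e x)\<bar>"
    and "fst (cyl e x) \<le> norm x"
proof -
  have "(norm x)\<^sup>2 \<le> (fst (cyl e x) + \<bar>snd (cyl e x)\<bar>)\<^sup>2"
    using norm_cyl[OF assms, of x] by (simp add: power2_sum)
  then show "norm x \<le> fst (cyl e x) + \<bar>snd (cyl e x)\<bar>"
    by (rule power2_le_imp_le) (simp add: cyl_def)
  have "(fst (cyl e x))\<^sup>2 \<le> (norm x)\<^sup>2"
    using norm_cyl[OF assms, of x] by simp
  then show "fst (cyl e x) \<le> norm x"
    by (rule power2_le_imp_le) simp
qed

lemma cyl_shift: "norm e = 1 \<Longrightarrow> cyl e (x + a *\<^sub>R e) = (fst (cyl e x), snd (cyl e x) + a)"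
  by (simp add: cyl_def inner_add_left dot_square_norm algebra_simps)

lemma nn_integral_cylm_shift:
  assumes [measurable]: "s \<in> borel_measurable borel" and "norm e = 1"
  shows "(\<integral>\<^sup>+p. s (fst p, snd p + a) \<partial>cylm e) = (\<integral>\<^sup>+p. s p \<partial>cylm e)"
proof -
  have [measurable]: "(\<lambda>p. s (fst p, snd p + a)) \<in> borel_measurable borel"
    by (rule measurable_compose[OF _ assms(1)])
      (intro borel_measurable_continuous_onI continuous_intros)
  have "(\<integral>\<^sup>+p. s (fst p, snd p + a) \<partial>cylm e) = (\<integral>\<^sup>+x. s (cyl e (x + a *\<^sub>R e)) \<partial>lborel)"
    by (subst nn_integral_cylm) (auto simp: cyl_shift assms)
  also have "\<dots> = (\<integral>\<^sup>+x. s (cyl e x) \<partial>lborel)"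
    by (rule nn_integral_lborel_shift) measurable
  finally show ?thesis by (simp add: nn_integral_cylm)
qed

text \<open>The map that multiplies the axis direction by \<open>d\<close> and all others by
  \<open>t\<close>, and then moves by \<open>a\<close> along the axis, acts on cylindrical
  coordinates exactly as in the right-hand integrand; the prefactor is its determinant. Taking
  \<open>e\<close> from \<open>Basis\<close> makes its linear part diagonal.\<close>

lemma nn_integral_cylm_scale:
  fixes e :: "'a::euclidean_space"
  assumes [measurable]: "s \<in> borel_measurable borel" and e: "e \<in> Basis" and t: "t > 0" and d: "d > 0"
  shows "(\<integral>\<^sup>+p. s p \<partial>cylm e) =
    ennreal (t ^ (DIM('a) - 1) * d) * (\<integral>\<^sup>+p. s (t * fst p, a + d * snd p) \<partial>cylm e)"
proof -
  define c where "c j = (if j = e then d else t)" for j :: 'a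
  define T where "T x = a *\<^sub>R e + (\<Sum>j\<in>Basis. (c j * (x \<bullet> j)) *\<^sub>R j)" for x :: 'a
  have [measurable]: "T \<in> borel_measurable borel"
    unfolding T_def [abs_def] by measurable
  have Tj: "T x \<bullet> j = a * (e \<bullet> j) + c j * (x \<bullet> j)" if "j \<in> Basis" for x j
    using that by (simp add: T_def inner_add_left inner_sum_left inner_Basis if_distrib cong: if_cong)
  have cylT: "cyl e (T x) = (t * fst (cyl e x), a + d * snd (cyl e x))" for x
  proof -
    have Te: "T x \<bullet> e = a + d * (x \<bullet> e)" using Tj[OF e] e by (simp add: c_def)
    have "T x - (T x \<bullet> e) *\<^sub>R e = t *\<^sub>R (x - (x \<bullet> e) *\<^sub>R e)"
    proof (rule euclidean_eqI)
      fix j :: 'a assume j: "j \<in> Basis"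
      show "(T x - (T x \<bullet> e) *\<^sub>R e) \<bullet> j = t *\<^sub>R (x - (x \<bullet> e) *\<^sub>R e) \<bullet> j"
        using e j by (cases "j = e") (auto simp: inner_diff_left Tj[OF j] Te c_def inner_Basis)
    qed
    then show ?thesis using t by (simp add: cyl_def Te)
  qed
  have "(\<Prod>j\<in>Basis. \<bar>c j\<bar>) = (\<Prod>j\<in>{e}. \<bar>c j\<bar>) * (\<Prod>j\<in>Basis - {e}. \<bar>c j\<bar>)"
    using e by (subst prod.union_disjoint[symmetric]) (auto intro!: arg_cong2[where f=prod])
  also have "\<dots> = d * t ^ (DIM('a) - 1)"
  proof -
    have "(\<Prod>j\<in>Basis - {e}. \<bar>c j\<bar>) = (\<Prod>j\<in>(Basis::'a set) - {e}. t)"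
      using t by (intro prod.cong) (auto simp: c_def)
    also have "\<dots> = t ^ (DIM('a) - 1)" using e by (simp add: card_Diff_singleton)
    finally show ?thesis using d by (simp add: c_def)
  qed
  finally have P: "(\<Prod>j\<in>Basis. \<bar>c j\<bar>) = t ^ (DIM('a) - 1) * d" by simp
  have L: "lborel = density (distr lborel borel T) (\<lambda>_. ennreal (t ^ (DIM('a) - 1) * d))"
    using lborel_affine_euclidean[of c "a *\<^sub>R e"] t d unfolding T_def [abs_def] P
    by (auto simp: c_def)
  have "(\<integral>\<^sup>+p. s p \<partial>cylm e) = (\<integral>\<^sup>+x. s (cyl e x) \<partial>lborel)"
    by (rule nn_integral_cylm) measurable
  also have "\<dots> = (\<integral>\<^sup>+x. s (cyl e x) \<partial>density (distr lborel borel T) (\<lambda>_. ennreal (t ^ (DIM('a) - 1) * d)))"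
    by (rule arg_cong[OF L, of "\<lambda>M. \<integral>\<^sup>+x. s (cyl e x) \<partial>M"])
  also have "\<dots> = ennreal (t ^ (DIM('a) - 1) * d) * (\<integral>\<^sup>+x. s (cyl e (T x)) \<partial>lborel)"
    by (simp add: nn_integral_density nn_integral_distr nn_integral_cmult)
  also have "(\<integral>\<^sup>+x. s (cyl e (T x)) \<partial>lborel) = (\<integral>\<^sup>+p. s (t * fst p, a + d * snd p) \<partial>cylm e)"
    by (subst nn_integral_cylm) (auto simp: cylT)
  finally show ?thesis .
qed

text \<open>The weight \<open>r^k\<close> and the box \<open>r < t\<close>, \<open>a < z \<le> b\<close> scale homogeneously; these boxes
  determine a measure.\<close>

lemma cylm_box:
  fixes e :: "'a::euclidean_space"
  assumes e: "e \<in> Basis"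
  shows "(\<integral>\<^sup>+p. ennreal (fst p ^ k) * indicator ({..<t} \<times> {a<..b}) p \<partial>cylm e) =
    (if 0 < t \<and> a < b then ennreal (t ^ (DIM('a) - 1 + k) * (b - a)) *
       (\<integral>\<^sup>+p. ennreal (fst p ^ k) * indicator ({..<1} \<times> {0<..1}) p \<partial>cylm e) else 0)"
proof (cases "0 < t \<and> a < b")
  case True
  then have t: "0 < t" and ab: "0 < b - a" by auto
  have "(\<integral>\<^sup>+p. ennreal (fst p ^ k) * indicator ({..<t} \<times> {a<..b}) p \<partial>cylm e)
     = ennreal (t ^ (DIM('a) - 1) * (b - a)) *
       (\<integral>\<^sup>+p. ennreal ((t * fst p) ^ k) * indicator ({..<t} \<times> {a<..b}) (t * fst p, a + (b - a) * snd p) \<partial>cylm e)"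
    by (subst nn_integral_cylm_scale[OF _ e t ab, of _ a]) auto
  also have "(\<integral>\<^sup>+p. ennreal ((t * fst p) ^ k) * indicator ({..<t} \<times> {a<..b}) (t * fst p, a + (b - a) * snd p) \<partial>cylm e)
     = (\<integral>\<^sup>+p. ennreal (t ^ k) * (ennreal (fst p ^ k) * indicator ({..<1} \<times> {0<..1}) p) \<partial>cylm e)"
  proof (intro nn_integral_cong)
    fix p :: "real \<times> real"
    have "indicator ({..<t} \<times> {a<..b}) (t * fst p, a + (b - a) * snd p) = (indicator ({..<1} \<times> {0<..1}) p :: ennreal)"
    proof -
      have "a + (b - a) * snd p \<le> b \<longleftrightarrow> (b - a) * snd p \<le> (b - a) * 1" by (simp add: algebra_simps)
      also have "\<dots> \<longleftrightarrow> snd p \<le> 1" using ab by (subst mult_le_cancel_left_pos) auto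
      finally show ?thesis using t ab by (cases p) (auto simp: indicator_def zero_less_mult_iff)
    qed
    then show "ennreal ((t * fst p) ^ k) * indicator ({..<t} \<times> {a<..b}) (t * fst p, a + (b - a) * snd p)
       = ennreal (t ^ k) * (ennreal (fst p ^ k) * indicator ({..<1} \<times> {0<..1}) p)"
      using t by (simp add: power_mult_distrib ennreal_mult' mult.assoc)
  qed
  also have "\<dots> = ennreal (t ^ k) * (\<integral>\<^sup>+p. ennreal (fst p ^ k) * indicator ({..<1} \<times> {0<..1}) p \<partial>cylm e)"
    by (rule nn_integral_cmult) measurable
  also have "ennreal (t ^ (DIM('a) - 1) * (b - a)) * \<dots> = ennreal (t ^ (DIM('a) - 1 + k) * (b - a)) *
      (\<integral>\<^sup>+p. ennreal (fst p ^ k) * indicator ({..<1} \<times> {0<..1}) p \<partial>cylm e)"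
  proof -
    have "ennreal (t ^ (DIM('a) - 1) * (b - a)) * ennreal (t ^ k) = ennreal (t ^ (DIM('a) - 1 + k) * (b - a))"
      unfolding power_add using t ab by (subst ennreal_mult[symmetric]) (simp_all only: mult_ac mult_nonneg_nonneg zero_le_power less_imp_le)
    then show ?thesis by (simp only: mult.assoc[symmetric])
  qed
  finally show ?thesis by (simp only: if_P[OF True])
next
  case False
  have "(\<integral>\<^sup>+p. ennreal (fst p ^ k) * indicator ({..<t} \<times> {a<..b}) p \<partial>cylm e) = 0"
  proof (subst nn_integral_0_iff_AE)
    show "AE p in cylm e. ennreal (fst p ^ k) * indicator ({..<t} \<times> {a<..b}) p = 0"
    proof (subst AE_cylm_iff)
      have "ennreal (fst (cyl e x) ^ k) * indicator ({..<t} \<times> {a<..b}) (cyl e x) = 0" for x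
      proof -
        have "\<not> (fst (cyl e x) < t \<and> a < x \<bullet> e \<and> x \<bullet> e \<le> b)"
          using False fst_cyl_nonneg[of e x] by linarith
        then show ?thesis by (auto simp: indicator_def mem_Times_iff)
      qed
      then show "AE x in lborel. ennreal (fst (cyl e x) ^ k) * indicator ({..<t} \<times> {a<..b}) (cyl e x) = 0"
        by simp
    qed measurable
  qed measurable
  then show ?thesis by (simp only: if_not_P[OF False])
qed

text \<open>Finiteness holds because the box corresponds to a bounded set. For positivity a second
  basis vector, available from dimension 2 on, gives a nonempty open set on which the distance from
  the axis exceeds 1/2.\<close>

lemma cylm_unit_box:
  fixes e :: "'a::euclidean_space"
  assumes e: "e \<in> Basis" and D: "2 \<le> DIM('a)"
  shows "0 < (\<integral>\<^sup>+p. ennreal (fst p ^ k) * indicator ({..<1} \<times> {0<..1}) p \<partial>cylm e)"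
    and "(\<integral>\<^sup>+p. ennreal (fst p ^ k) * indicator ({..<1} \<times> {0<..1}) p \<partial>cylm e) < \<infinity>"
proof -
  have e1: "norm e = 1" using e by simp
  have eq: "(\<integral>\<^sup>+p. ennreal (fst p ^ k) * indicator ({..<1} \<times> {0<..1}) p \<partial>cylm e) =
     (\<integral>\<^sup>+x. ennreal (fst (cyl e x) ^ k) * indicator ({..<1} \<times> {0<..1}) (cyl e x) \<partial>lborel)"
    by (rule nn_integral_cylm) measurable
  have "\<dots> \<le> (\<integral>\<^sup>+x. indicator (ball 0 3) x \<partial>(lborel :: 'a measure))"
  proof (rule nn_integral_mono)
    fix x :: 'a
    show "ennreal (fst (cyl e x) ^ k) * indicator ({..<1} \<times> {0<..1}) (cyl e x) \<le> indicator (ball 0 3) x"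
    proof (cases "cyl e x \<in> {..<1} \<times> {0<..1}")
      case True
      then have b: "fst (cyl e x) < 1" "0 < snd (cyl e x)" "snd (cyl e x) \<le> 1"
        by (auto simp: mem_Times_iff)
      then have "norm x < 3" using norm_le_cyl(1)[OF e1, of x] by auto
      moreover have "fst (cyl e x) ^ k \<le> 1" using b by (intro power_le_one) auto
      ultimately show ?thesis using True by (simp add: ennreal_le_1)
    qed auto
  qed
  also have "\<dots> < \<infinity>" using emeasure_lborel_ball_finite[of "0::'a" 3] by simp
  finally show "(\<integral>\<^sup>+p. ennreal (fst p ^ k) * indicator ({..<1} \<times> {0<..1}) p \<partial>cylm e) < \<infinity>"
    using eq by simp
  obtain j :: 'a where j: "j \<in> Basis" "j \<noteq> e"
  proof -
    have "card (Basis :: 'a set) \<noteq> card {e}" using D by simp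
    then have "(Basis :: 'a set) \<noteq> {e}" by metis
    then show ?thesis using that e by blast
  qed
  define U where "U = cyl e -` ({1/2<..<1} \<times> {0<..<1})"
  have "continuous_on UNIV (cyl e)" unfolding cyl_def [abs_def] by (intro continuous_intros)
  then have U: "open U" unfolding U_def
    by (intro open_vimage open_Times) auto
  have "cyl e ((3/4) *\<^sub>R j + (1/2) *\<^sub>R e) = (3/4, 1/2)"
    using j e by (simp add: cyl_def inner_add_left inner_Basis)
  then have "(3/4) *\<^sub>R j + (1/2) *\<^sub>R e \<in> U" by (auto simp: U_def)
  then have "U \<noteq> {}" by blast
  then have Upos: "0 < emeasure lborel U"
    using U open_not_negligible[of U]
    by (auto simp: negligible_iff_null_sets null_sets_def zero_less_iff_neq_zero)
  have "0 < ennreal ((1/2)^k) * emeasure lborel U"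
    using Upos by (simp add: ennreal_zero_less_mult_iff)
  also have "\<dots> = (\<integral>\<^sup>+x. ennreal ((1/2)^k) * indicator U x \<partial>lborel)"
    using U by (simp add: nn_integral_cmult borel_open)
  also have "\<dots> \<le> (\<integral>\<^sup>+x. ennreal (fst (cyl e x) ^ k) * indicator ({..<1} \<times> {0<..1}) (cyl e x) \<partial>lborel)"
  proof (rule nn_integral_mono)
    fix x :: 'a
    show "ennreal ((1/2)^k) * indicator U x \<le> ennreal (fst (cyl e x) ^ k) * indicator ({..<1} \<times> {0<..1}) (cyl e x)"
    proof (cases "x \<in> U")
      case True
      then have b: "1/2 < fst (cyl e x)" "fst (cyl e x) < 1" "0 < snd (cyl e x)" "snd (cyl e x) < 1"
        by (auto simp: U_def mem_Times_iff)
      then have "(1/2)^k \<le> fst (cyl e x) ^ k" by (intro power_mono) auto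
      then show ?thesis using b by (simp add: ennreal_leI indicator_def mem_Times_iff)
    qed auto
  qed
  finally show "0 < (\<integral>\<^sup>+p. ennreal (fst p ^ k) * indicator ({..<1} \<times> {0<..1}) p \<partial>cylm e)"
    using eq by simp
qed

text \<open>On boxes both measures scale alike, because \<open>DIM('a) - 1\<close> plus the exponent
  of the weight is \<open>DIM('b) - 1\<close>. They therefore differ on all boxes by one constant,
  read off from the unit box. For dimensions 3 and 5 this constant is pi.\<close>

lemma cylm_dim_change:
  fixes e :: "'a::euclidean_space" and e' :: "'b::euclidean_space"
  assumes e: "e \<in> Basis" and e': "e' \<in> Basis" and D: "2 \<le> DIM('a)" "DIM('a) \<le> DIM('b)"
  obtains c where "c > 0"
    "cylm e' = density (cylm e) (\<lambda>p. ennreal (c * fst p ^ (DIM('b) - DIM('a))))"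
proof -
  let ?m = "DIM('b) - DIM('a)"
  define v where "v = (\<integral>\<^sup>+p. ennreal (fst p ^ ?m) * indicator ({..<1} \<times> {0<..1}) p \<partial>cylm e)"
  define v' where "v' = (\<integral>\<^sup>+p. ennreal (fst p ^ 0) * indicator ({..<1} \<times> {0<..1}) p \<partial>cylm e')"
  have v: "0 < v" "v < \<infinity>" unfolding v_def using cylm_unit_box[OF e D(1)] by auto
  have D': "2 \<le> DIM('b)" using D by simp
  have v': "0 < v'" "v' < \<infinity>" unfolding v'_def
    using cylm_unit_box(1)[OF e' D', of 0] cylm_unit_box(2)[OF e' D', of 0] by blast+
  obtain vr vr' where vr: "v = ennreal vr" "v' = ennreal vr'" "0 < vr" "0 < vr'"
    using v v' by (cases v; cases v') auto
  define c where "c = vr' / vr"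
  have c: "c > 0" using vr by (simp add: c_def)
  \<comment> \<open>The first factor is unbounded below, which does not spoil finiteness since the
    measures live on nonnegative radii. Empty boxes belong to the family, so it is closed under
    intersection.\<close>
  let ?E = "{{..<t} \<times> {a<..b} | (t::real) (a::real) (b::real). True}"
  have gen: "sets (borel :: (real \<times> real) measure) = sigma_sets UNIV ?E"
  proof -
    let ?I = "range (\<lambda>(a, b). {a<..b::real})"
    have L: "borel = sigma UNIV (range (\<lambda>a. {..<a::real}))"
      using borel_eq_lessThan[where 'a=real] by (simp only: eucl_lessThan)
    have ex: "\<exists>n::nat. x < real n" "\<exists>n::nat. - real n < x \<and> x \<le> real n" for x :: real
      using reals_Archimedean2[of x] reals_Archimedean2[of "\<bar>x\<bar>"]
      by (auto, metis abs_less_iff less_imp_le minus_less_iff)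
    have c1: "\<exists>E\<subseteq>range (\<lambda>a. {..<a::real}). countable E \<and> UNIV = \<Union> E"
      using ex(1) by (intro exI[of _ "range (\<lambda>n::nat. {..<real n})"]) auto
    have c2: "\<exists>E\<subseteq>?I. countable E \<and> UNIV = \<Union> E"
      using ex(2) by (intro exI[of _ "range (\<lambda>n::nat. {- real n<..real n})"]) auto
    have "sets (borel :: (real \<times> real) measure) = sets (borel \<Otimes>\<^sub>M borel)"
      by (rule arg_cong[OF borel_prod[symmetric]])
    also have "borel \<Otimes>\<^sub>M borel = sigma UNIV (range (\<lambda>a. {..<a::real})) \<Otimes>\<^sub>M sigma UNIV ?I"
      by (rule arg_cong2[where f=pair_measure, OF L borel_sigma_sets_Ioc])
    also have "sets \<dots> = sets (sigma (UNIV \<times> UNIV) {a \<times> b | a b. a \<in> range lessThan \<and> b \<in> ?I})"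
      by (subst sigma_prod[OF c1 _ c2]) auto
    also have "{a \<times> b | a b. a \<in> range lessThan \<and> b \<in> ?I} = ?E" by auto
    finally show ?thesis by (simp add: sets_measure_of)
  qed
  have "cylm e' = density (cylm e) (\<lambda>p. ennreal (c * fst p ^ ?m))"
  proof (rule measure_eqI_generator_eq[where E="?E" and \<Omega>=UNIV and A="\<lambda>n. {..<real n} \<times> {- real n<..real n}"])
    show "Int_stable ?E"
    proof (rule Int_stableI)
      fix X Y assume "X \<in> ?E" "Y \<in> ?E"
      then obtain t a b t' a' b' where "X = {..<t} \<times> {a<..b}" "Y = {..<t'} \<times> {a'<..b'}" by auto
      then have "X \<inter> Y = {..<min t t'} \<times> {max a a'<..min b b'}" by auto
      then show "X \<inter> Y \<in> ?E" by blast
    qed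
    show "?E \<subseteq> Pow UNIV" by simp
    show "sets (cylm e') = sigma_sets UNIV ?E" using gen by simp
    show "sets (density (cylm e) (\<lambda>p. ennreal (c * fst p ^ ?m))) = sigma_sets UNIV ?E" using gen by simp
    show "range (\<lambda>n. {..<real n} \<times> {- real n<..real n}) \<subseteq> ?E" by auto
    show "(\<Union>n. {..<real n} \<times> {- real n<..real n}) = UNIV"
    proof -
      have "\<exists>n. x \<in> {..<real n} \<times> {- real n<..real n}" for x
      proof -
        obtain n where "real n > max (fst x) \<bar>snd x\<bar>" using reals_Archimedean2 by blast
        then show ?thesis by (intro exI[of _ n]) (auto simp: mem_Times_iff)
      qed
      then show ?thesis by (intro UNIV_eq_I[symmetric]) (simp only: UN_iff bex_UNIV)
    qed
    have box': "emeasure (cylm e') ({..<t} \<times> {a<..b}) = (if 0 < t \<and> a < b then ennreal (t ^ (DIM('b) - 1) * (b - a)) * v' else 0)" for t a b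
      using cylm_box[OF e', of 0 t a b] by (simp add: v'_def)
    show "emeasure (cylm e') ({..<real n} \<times> {- real n<..real n}) \<noteq> \<infinity>" for n :: nat
      unfolding box' using v' by (auto simp: ennreal_mult_eq_top_iff)
    fix X assume "X \<in> ?E"
    then obtain t a b where X: "X = {..<t} \<times> {a<..b}" by blast
    have "emeasure (density (cylm e) (\<lambda>p. ennreal (c * fst p ^ ?m))) X
        = (\<integral>\<^sup>+p. ennreal c * (ennreal (fst p ^ ?m) * indicator X p) \<partial>cylm e)"
      using c X by (subst emeasure_density) (auto simp: ennreal_mult' mult.assoc)
    also have "\<dots> = ennreal c * (\<integral>\<^sup>+p. ennreal (fst p ^ ?m) * indicator X p \<partial>cylm e)"
      using X by (intro nn_integral_cmult) auto
    also have "\<dots> = ennreal c * (if 0 < t \<and> a < b then ennreal (t ^ (DIM('a) - 1 + ?m) * (b - a)) * v else 0)"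
      unfolding X v_def by (subst cylm_box[OF e]) auto
    also have "\<dots> = emeasure (cylm e') X"
    proof -
      have "DIM('a) - 1 + ?m = DIM('b) - 1" using D by simp
      moreover have "ennreal c * v = v'" using vr by (simp add: c_def ennreal_mult[symmetric])
      ultimately show ?thesis unfolding X box'
        by (auto simp: mult_ac)
    qed
    finally show "emeasure (cylm e') X = emeasure (density (cylm e) (\<lambda>p. ennreal (c * fst p ^ ?m))) X" by (rule sym)
  qed
  then show ?thesis by (rule that[OF c])
qed

lemma cylm_bounded_finite:
  fixes e :: "'a::euclidean_space"
  assumes "norm e = 1"
  shows "emeasure (cylm e) ({..<t} \<times> {-b..b}) < \<infinity>"
proof -
  have "emeasure (cylm e) ({..<t} \<times> {-b..b}) = emeasure lborel (cyl e -` ({..<t} \<times> {-b..b}))"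
    by (rule emeasure_cylm) auto
  also have "\<dots> \<le> emeasure lborel (cball (0::'a) (\<bar>t\<bar> + \<bar>b\<bar>))"
  proof (rule emeasure_mono)
    show "cyl e -` ({..<t} \<times> {-b..b}) \<subseteq> cball 0 (\<bar>t\<bar> + \<bar>b\<bar>)"
    proof
      fix x assume "x \<in> cyl e -` ({..<t} \<times> {-b..b})"
      then have "fst (cyl e x) < t" "\<bar>snd (cyl e x)\<bar> \<le> b" by (auto simp: mem_Times_iff)
      then show "x \<in> cball 0 (\<bar>t\<bar> + \<bar>b\<bar>)" using norm_le_cyl(1)[OF assms, of x] by auto
    qed
  qed auto
  also have "\<dots> < \<infinity>" by (rule emeasure_lborel_cball_finite)
  finally show ?thesis .
qed

lemma sigma_finite_cylm:
  assumes "norm e = 1"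
  shows "sigma_finite_measure (cylm e)"
proof
  let ?A = "\<lambda>n::nat. {..<real n} \<times> {- real n..real n}"
  have "\<exists>n. x \<in> ?A n" for x
  proof -
    obtain n where "real n > max (fst x) \<bar>snd x\<bar>" using reals_Archimedean2 by blast
    then show ?thesis by (intro exI[of _ n]) (auto simp: mem_Times_iff)
  qed
  then have "(\<Union>n. ?A n) = UNIV" by (intro UNIV_eq_I[symmetric]) (simp only: UN_iff bex_UNIV)
  moreover have "?A n \<in> sets (cylm e)" for n by (simp add: borel_Times)
  moreover have "emeasure (cylm e) (?A n) \<noteq> \<infinity>" for n
    using cylm_bounded_finite[OF assms, of n n] by simp
  ultimately show "\<exists>A. countable A \<and> A \<subseteq> sets (cylm e) \<and> \<Union> A = space (cylm e) \<and> (\<forall>a\<in>A. emeasure (cylm e) a \<noteq> \<infinity>)"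
    by (intro exI[of _ "range ?A"] conjI countable_image) auto
qed

text \<open>Two points with the same cylindrical coordinates are exchanged by a Householder reflection
  that fixes the axis.\<close>

lemma cyl_reflection:
  fixes e w w' :: "'a::euclidean_space"
  assumes "cyl e w = cyl e w'" and "norm e = 1"
  obtains H where "orthogonal_transformation H" "H w = w'" "\<And>x. H (H x) = x" "\<And>x. cyl e (H x) = cyl e x"
proof (cases "w = w'")
  case True
  then show ?thesis by (intro that[of "\<lambda>x. x"]) auto
next
  case False
  define v where "v = w - w'"
  define H where "H x = x - (2 * (x \<bullet> v) / (v \<bullet> v)) *\<^sub>R v" for x
  have vv: "v \<bullet> v \<noteq> 0" using False by (simp add: v_def)
  have ve: "v \<bullet> e = 0" using arg_cong[OF assms(1), of snd] by (simp add: v_def inner_diff_left)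
  have nw: "w \<bullet> w = w' \<bullet> w'"
    using norm_cyl[OF assms(2), of w] norm_cyl[OF assms(2), of w'] assms(1) by (simp add: power2_norm_eq_inner)
  have HH: "H x \<bullet> H y = x \<bullet> y" for x y
  proof -
    define p q where "p = 2 * (x \<bullet> v) / (v \<bullet> v)" and "q = 2 * (y \<bullet> v) / (v \<bullet> v)"
    have "H x \<bullet> H y = x \<bullet> y - q * (x \<bullet> v) - p * (y \<bullet> v) + p * (q * (v \<bullet> v))"
      unfolding H_def p_def[symmetric] q_def[symmetric]
      by (simp add: inner_diff_left inner_diff_right inner_commute[of v y] algebra_simps)
    also have "q * (v \<bullet> v) = 2 * (y \<bullet> v)" using vv by (simp add: q_def)
    also have "q * (x \<bullet> v) = p * (y \<bullet> v)" by (simp add: p_def q_def)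
    finally show ?thesis by simp
  qed
  have He: "H x \<bullet> e = x \<bullet> e" for x by (simp add: H_def inner_diff_left ve)
  have lin: "linear H"
    unfolding H_def [abs_def]
    by (rule linearI) (simp_all add: inner_add_left add_divide_distrib scaleR_add_left distrib_left
        scaleR_diff_right)
  show ?thesis
  proof (rule that)
    show "orthogonal_transformation H"
      using lin HH by (simp add: orthogonal_transformation_def)
    have "2 * (w \<bullet> v) = v \<bullet> v" using nw by (simp add: v_def inner_diff_left inner_diff_right inner_commute)
    then show "H w = w'" using vv by (simp add: H_def) (simp add: v_def)
    have "H x \<bullet> v = - (x \<bullet> v)" for x using vv by (simp add: H_def inner_diff_left)
    then show "H (H x) = x" for x
      using vv by (simp add: H_def [of "H x"]) (simp add: H_def)
    fix x
    have "(fst (cyl e (H x)))\<^sup>2 = (fst (cyl e x))\<^sup>2"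
      using norm_cyl[OF assms(2), of x] norm_cyl[OF assms(2), of "H x"] HH[of x x] He[of x]
      by (simp add: power2_norm_eq_inner)
    then have "fst (cyl e (H x)) = fst (cyl e x)" by (simp add: power2_eq_iff_nonneg)
    then show "cyl e (H x) = cyl e x" using He by (intro prod_eqI) auto
  qed
qed

text \<open>Lebesgue measure is determined by its values on boxes. Since \<open>H\<close> is its own
  inverse, the preimage of a box is its image, and orthogonal maps preserve the measure of
  images.\<close>

lemma nn_integral_lborel_orthogonal:
  fixes H :: "real^'n::{finite,wellorder} \<Rightarrow> real^'n::_"
  assumes H: "orthogonal_transformation H" and inv: "\<And>x. H (H x) = x"
    and [measurable]: "f \<in> borel_measurable borel"
  shows "(\<integral>\<^sup>+x. f (H x) \<partial>lborel) = (\<integral>\<^sup>+x. f x \<partial>lborel)"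
proof -
  have [measurable]: "H \<in> borel_measurable borel"
    by (intro borel_measurable_continuous_onI linear_continuous_on linear_linear[THEN iffD2]
        orthogonal_transformation_linear H)
  have "lborel = distr lborel borel H"
  proof (rule lborel_eqI)
    fix l u :: "real^'n::_" assume lu: "\<And>b. b \<in> Basis \<Longrightarrow> l \<bullet> b \<le> u \<bullet> b"
    have im: "H -` box l u = H ` box l u"
    proof safe
      fix x assume "H x \<in> box l u"
      then show "x \<in> H ` box l u" by (intro image_eqI[of _ _ "H x"]) (auto simp: inv)
    qed (simp add: inv)
    have b: "box l u \<in> lmeasurable" by (rule lmeasurable_box)
    have "emeasure (distr lborel borel H) (box l u) = emeasure lborel (H -` box l u)"
      by (subst emeasure_distr) auto
    also have "\<dots> = emeasure lebesgue (H ` box l u)"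
    proof -
      have "H -` box l u \<in> sets borel"
        using measurable_sets[OF \<open>H \<in> borel_measurable borel\<close>, of "box l u"] by simp
      then show ?thesis unfolding im by simp
    qed
    also have "\<dots> = ennreal (measure lebesgue (H ` box l u))"
      using measurable_orthogonal_image[OF H b] by (simp add: emeasure_eq_measure2)
    also have "\<dots> = ennreal (measure lebesgue (box l u))"
      using measure_orthogonal_image[OF H b] by simp
    also have "\<dots> = (\<Prod>b\<in>Basis. (u - l) \<bullet> b)"
      using lu by (simp add: measure_lborel_box_eq)
    finally show "emeasure (distr lborel borel H) (box l u) = (\<Prod>b\<in>Basis. (u - l) \<bullet> b)" .
  qed simp
  then have "(\<integral>\<^sup>+x. f x \<partial>lborel) = (\<integral>\<^sup>+x. f x \<partial>distr lborel borel H)" by simp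
  also have "\<dots> = (\<integral>\<^sup>+x. f (H x) \<partial>lborel)" by (subst nn_integral_distr) auto
  finally show ?thesis ..
qed

text \<open>The reflection that exchanges the two points leaves the density
  \<open>s (cyl e y)\<close> and all distances unchanged. Consequently the potential of a
  cylindrical density is again a function of the cylindrical coordinates.\<close>

lemma riesz_potential_cyl:
  fixes e w w' :: "real^'n::{finite,wellorder}"
  assumes "cyl e w = cyl e w'" "norm e = 1" and [measurable]: "s \<in> borel_measurable borel"
  shows "(\<integral>\<^sup>+y. s (cyl e y) * riesz l (w - y) \<partial>lborel) = (\<integral>\<^sup>+y. s (cyl e y) * riesz l (w' - y) \<partial>lborel)"
proof -
  obtain H where H: "orthogonal_transformation H" "H w = w'" "\<And>x. H (H x) = x" "\<And>x. cyl e (H x) = cyl e x"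
    using cyl_reflection[OF assms(1,2)] by metis
  have "norm (w' - H y) = norm (w - y)" for y
    using orthogonal_transformation_norm[OF H(1), of "w - y"] H(2)
      linear_diff[OF orthogonal_transformation_linear[OF H(1)], of w y] by simp
  then have "riesz l (w - y) = riesz l (w' - H y)" for y by (simp add: riesz_def)
  then have "(\<integral>\<^sup>+y. s (cyl e y) * riesz l (w - y) \<partial>lborel) = (\<integral>\<^sup>+y. s (cyl e (H y)) * riesz l (w' - H y) \<partial>lborel)"
    by (simp add: H(4))
  also have "\<dots> = (\<integral>\<^sup>+y. s (cyl e y) * riesz l (w' - y) \<partial>lborel)"
    by (rule nn_integral_lborel_orthogonal[OF H(1,3)]) measurable
  finally show ?thesis .
qed

section \<open>Reduced densities\<close>

definition cut :: "real set \<Rightarrow> (real \<times> real \<Rightarrow> real) \<Rightarrow> real \<times> real \<Rightarrow> real" where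
  "cut X s p = (if snd p \<in> X then s p else 0)"

text \<open>Moves the density by \<open>- a\<close>: what lay near height \<open>a\<close> comes to
  lie near height 0.\<close>

definition shift :: "real \<Rightarrow> (real \<times> real \<Rightarrow> real) \<Rightarrow> real \<times> real \<Rightarrow> real" where
  "shift a s p = s (fst p, snd p + a)"

definition dens :: "'a::euclidean_space \<Rightarrow> (real \<times> real \<Rightarrow> real) \<Rightarrow> 'a \<Rightarrow> ennreal" where
  "dens e s x = ennreal (s (cyl e x))"

lemma dens_measurable [measurable]:
  assumes [measurable]: "s \<in> borel_measurable borel"
  shows "dens e s \<in> borel_measurable borel"
  unfolding dens_def [abs_def] by measurable

lemma cut_measurable [measurable]:
  assumes [measurable]: "s \<in> borel_measurable borel" "X \<in> sets borel"
  shows "cut X s \<in> borel_measurable borel"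
proof -
  have "{p \<in> space (borel :: (real \<times> real) measure). snd p \<in> X} \<in> sets borel" by measurable
  then show ?thesis unfolding cut_def [abs_def] by (intro measurable_If) auto
qed

lemma shift_measurable [measurable]:
  assumes "s \<in> borel_measurable borel"
  shows "shift a s \<in> borel_measurable borel"
  unfolding shift_def [abs_def]
  by (rule measurable_compose[OF _ assms]) (intro borel_measurable_continuous_onI continuous_intros)

lemma dens_cut: "dens e (cut X s) x = dens e s x * indicator {x. x \<bullet> e \<in> X} x"
  by (simp add: dens_def cut_def)

lemma dens_add:
  assumes "\<And>p. 0 \<le> s p" "\<And>p. 0 \<le> t p"
  shows "dens e (\<lambda>p. s p + t p) = (\<lambda>x. dens e s x + dens e t x)"
  using assms by (intro ext) (simp add: dens_def)

lemma dens_shift: "norm e = 1 \<Longrightarrow> dens e (shift a s) = (\<lambda>x. dens e s (x + a *\<^sub>R e))"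
  by (auto simp: dens_def shift_def cyl_shift)

text \<open>Up to \<open>T\<close> one factor x is bounded by \<open>T\<close>; beyond
  \<open>T\<close> the decreasing power \<open>x powr (2 - \<gamma>)\<close> is bounded by its value
  at \<open>T\<close>. As \<open>T\<close> grows the coefficient of \<open>x powr \<gamma>\<close>
  tends to 0, so the square integral costs an arbitrarily small part of the pressure. This is where
  the exponent has to exceed 2.\<close>

lemma power2_le_powr_interpolation:
  fixes x T \<gamma> :: real
  assumes "0 \<le> x" "0 < T" "2 < \<gamma>"
  shows "x\<^sup>2 \<le> T * x + T powr (2 - \<gamma>) * x powr \<gamma>"
proof (cases "x \<le> T")
  case True
  then have "x\<^sup>2 \<le> T * x" using assms by (simp add: power2_eq_square mult_right_mono)
  then show ?thesis by (smt (verit) mult_nonneg_nonneg powr_ge_zero)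
next
  case False
  then have x: "T < x" "0 < x" using assms by auto
  have "x\<^sup>2 = x powr (2 - \<gamma>) * x powr \<gamma>"
    using x by (simp flip: powr_add add: powr_numeral)
  also have "\<dots> \<le> T powr (2 - \<gamma>) * x powr \<gamma>"
    using x assms by (intro mult_right_mono powr_mono2') auto
  finally show ?thesis using x assms by (smt (verit) mult_nonneg_nonneg)
qed

abbreviation e5 :: "real^5" where "e5 \<equiv> axis 3 1"

text \<open>\<open>w\<close> is the weight of the five-dimensional form and \<open>c5\<close> the
  factor of \<open>cylm_dim_change\<close>. Only the sign of \<open>w\<close> is fixed here, so the
  same results are available with weight 1 when finiteness of the five-dimensional form itself is
  wanted.\<close>

locale star =
  fixes \<gamma> w Rc c5 :: real
  assumes \<gamma>: "2 < \<gamma>" and w: "0 \<le> w" and Rc: "0 < Rc" and c5: "0 < c5"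
    and lift_measure: "cylm e5 = density (cylm e3) (\<lambda>p. ennreal (c5 * fst p ^ 2))"
begin

text \<open>Nonnegativity and the support condition hold at every point and measurability is Borel,
  so that these functions can be cut, shifted and added without regard to null sets. Values at
  negative radii are harmless because \<open>cylm e3\<close> gives them no mass.\<close>

definition St :: "(real \<times> real \<Rightarrow> real) set" where
  "St = {s. s \<in> borel_measurable borel \<and> (\<forall>p. 0 \<le> s p) \<and> (\<forall>p. Rc \<le> fst p \<longrightarrow> s p = 0) \<and>
            integrable (cylm e3) s \<and> integrable (cylm e3) (\<lambda>p. s p powr \<gamma>)}"

definition ms :: "(real \<times> real \<Rightarrow> real) \<Rightarrow> real" where
  "ms s = (LINT p|cylm e3. s p)"

definition pw :: "(real \<times> real \<Rightarrow> real) \<Rightarrow> real" where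
  "pw s = (LINT p|cylm e3. s p powr \<gamma>)"

definition n2 :: "(real \<times> real \<Rightarrow> real) \<Rightarrow> real" where
  "n2 s = (LINT p|cylm e3. (s p)\<^sup>2)"

definition BBe :: "(real \<times> real \<Rightarrow> real) \<Rightarrow> (real \<times> real \<Rightarrow> real) \<Rightarrow> ennreal" where
  "BBe s t = ennreal (1/2) * kint (riesz 1) (dens e3 s) (dens e3 t) +
             ennreal w * kint (riesz 3) (dens e5 s) (dens e5 t)"

definition BB :: "(real \<times> real \<Rightarrow> real) \<Rightarrow> (real \<times> real \<Rightarrow> real) \<Rightarrow> real" where
  "BB s t = enn2real (BBe s t)"

definition C5 :: real where "C5 = c5 * Rc\<^sup>2"

text \<open>Arises as \<open>1/2 * (1 + 1)\<^sup>2 + w * (1 + C5)\<^sup>2\<close>: the estimates in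
  both spaces carry a factor \<open>(1 + c)\<^sup>2\<close>, with \<open>c = 1\<close> for
  \<open>real^3\<close> and \<open>c = C5\<close> for the lift.\<close>

definition Cw :: real where "Cw = 2 + w * (1 + C5)\<^sup>2"

lemma C5_pos: "0 < C5" using c5 Rc by (simp add: C5_def)

lemma Cw_pos: "0 < Cw" using w by (simp add: Cw_def add_pos_nonneg)

lemma norm_e3: "norm e3 = 1" and norm_e5: "norm e5 = 1"
  by simp_all

section \<open>Reduced densities and their mass, pressure and square integrals\<close>

lemma StD:
  assumes "s \<in> St"
  shows "s \<in> borel_measurable borel" "0 \<le> s p" "Rc \<le> fst p \<Longrightarrow> s p = 0"
    "integrable (cylm e3) s" "integrable (cylm e3) (\<lambda>p. s p powr \<gamma>)"
  using assms unfolding St_def by blast+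

lemma St_le:
  assumes "s \<in> St" and [measurable]: "t \<in> borel_measurable borel" and "\<And>p. 0 \<le> t p" "\<And>p. t p \<le> s p"
  shows "t \<in> St"
proof -
  note [measurable] = StD(1)[OF assms(1)]
  have "t p = 0" if "Rc \<le> fst p" for p using assms StD(3)[OF assms(1) that] by (metis order_antisym)
  moreover have "integrable (cylm e3) t"
    using assms by (intro Bochner_Integration.integrable_bound[OF StD(4)[OF assms(1)]]) (auto simp: abs_of_nonneg StD(2))
  moreover have "integrable (cylm e3) (\<lambda>p. t p powr \<gamma>)"
    using assms \<gamma> by (intro Bochner_Integration.integrable_bound[OF StD(5)[OF assms(1)]]) (auto intro!: powr_mono2)
  ultimately show ?thesis using assms by (auto simp: St_def)
qed

lemma St_cut: "s \<in> St \<Longrightarrow> X \<in> sets borel \<Longrightarrow> cut X s \<in> St"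
  by (rule St_le[of s]) (auto simp: cut_def [of X s] StD intro: cut_measurable)

lemma St_add:
  assumes s: "s \<in> St" and t: "t \<in> St"
  shows "(\<lambda>p. s p + t p) \<in> St"
proof -
  note [measurable] = StD(1)[OF s] StD(1)[OF t]
  have "integrable (cylm e3) (\<lambda>p. (s p + t p) powr \<gamma>)"
  proof (rule Bochner_Integration.integrable_bound)
    show "integrable (cylm e3) (\<lambda>p. 2 powr \<gamma> * (s p powr \<gamma> + t p powr \<gamma>))"
      using StD(5)[OF s] StD(5)[OF t] by simp
    show "AE p in cylm e3. norm ((s p + t p) powr \<gamma>) \<le> norm (2 powr \<gamma> * (s p powr \<gamma> + t p powr \<gamma>))"
    proof (rule AE_I2)
      fix p
      have nn: "0 \<le> s p" "0 \<le> t p" using StD(2) s t by auto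
      have "(s p + t p) powr \<gamma> \<le> (2 * max (s p) (t p)) powr \<gamma>"
        using nn \<gamma> by (intro powr_mono2) auto
      also have "\<dots> = 2 powr \<gamma> * max (s p) (t p) powr \<gamma>"
        using nn by (simp add: powr_mult)
      also have "\<dots> \<le> 2 powr \<gamma> * (s p powr \<gamma> + t p powr \<gamma>)"
        by (intro mult_left_mono) (auto simp: max_def)
      finally show "norm ((s p + t p) powr \<gamma>) \<le> norm (2 powr \<gamma> * (s p powr \<gamma> + t p powr \<gamma>))"
        by simp
    qed
  qed measurable
  moreover have "integrable (cylm e3) (\<lambda>p. s p + t p)" using StD(4) s t by auto
  ultimately show ?thesis using s t unfolding St_def by auto
qed

lemma integrable_shift:
  fixes s :: "real \<times> real \<Rightarrow> real"
  assumes [measurable]: "s \<in> borel_measurable borel" and nn: "\<And>p. 0 \<le> s p"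
  shows "integrable (cylm e3) s \<Longrightarrow> integrable (cylm e3) (shift a s)"
    and "(LINT p|cylm e3. shift a s p) = (LINT p|cylm e3. s p)"
proof -
  have eq: "(\<integral>\<^sup>+p. ennreal (shift a s p) \<partial>cylm e3) = (\<integral>\<^sup>+p. ennreal (s p) \<partial>cylm e3)"
    unfolding shift_def using nn_integral_cylm_shift[of "\<lambda>p. ennreal (s p)" e3 a] norm_e3 by simp
  have nn': "0 \<le> shift a s p" for p using nn by (simp add: shift_def)
  show "integrable (cylm e3) s \<Longrightarrow> integrable (cylm e3) (shift a s)"
    using nn nn' eq by (auto simp: integrable_iff_bounded)
  show "(LINT p|cylm e3. shift a s p) = (LINT p|cylm e3. s p)"
    using nn nn' by (simp add: integral_eq_nn_integral eq)
qed

lemma St_shift: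
  assumes "s \<in> St"
  shows "shift a s \<in> St"
proof -
  note [measurable] = StD(1)[OF assms]
  have "(\<lambda>p. shift a s p powr \<gamma>) = shift a (\<lambda>p. s p powr \<gamma>)" by (auto simp: shift_def)
  then have "integrable (cylm e3) (\<lambda>p. shift a s p powr \<gamma>)"
    using integrable_shift(1)[OF _ _ StD(5)[OF assms], of a] by simp
  moreover have "integrable (cylm e3) (shift a s)"
    using integrable_shift(1)[OF _ StD(2)[OF assms] StD(4)[OF assms]] by simp
  moreover have "shift a s \<in> borel_measurable borel" by measurable
  moreover have "0 \<le> shift a s p" "Rc \<le> fst p \<Longrightarrow> shift a s p = 0" for p
    using StD(2,3)[OF assms] by (auto simp: shift_def)
  ultimately show ?thesis unfolding St_def by auto
qed

lemma ms_shift: "s \<in> St \<Longrightarrow> ms (shift a s) = ms s"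
  unfolding ms_def by (intro integrable_shift(2)) (auto simp: StD)

lemma pw_shift:
  assumes "s \<in> St" shows "pw (shift a s) = pw s"
proof -
  note [measurable] = StD(1)[OF assms]
  have "(\<lambda>p. shift a s p powr \<gamma>) = shift a (\<lambda>p. s p powr \<gamma>)" by (auto simp: shift_def)
  then show ?thesis unfolding pw_def
    using integrable_shift(2)[of "\<lambda>p. s p powr \<gamma>" a] by simp
qed

lemma ms_nonneg: "s \<in> St \<Longrightarrow> 0 \<le> ms s"
  unfolding ms_def by (intro integral_nonneg_AE AE_I2) (auto simp: StD)

lemma pw_nonneg: "0 \<le> pw s"
  unfolding pw_def by (intro integral_nonneg_AE AE_I2) auto

lemma n2_nonneg: "0 \<le> n2 s"
  unfolding n2_def by (intro integral_nonneg_AE AE_I2) auto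

lemma ms_add: "s \<in> St \<Longrightarrow> t \<in> St \<Longrightarrow> ms (\<lambda>p. s p + t p) = ms s + ms t"
  unfolding ms_def by (simp add: StD)

lemma ms_mono: "s \<in> St \<Longrightarrow> t \<in> St \<Longrightarrow> (\<And>p. s p \<le> t p) \<Longrightarrow> ms s \<le> ms t"
  unfolding ms_def by (intro integral_mono) (auto simp: StD)

lemma pw_mono: "s \<in> St \<Longrightarrow> t \<in> St \<Longrightarrow> (\<And>p. s p \<le> t p) \<Longrightarrow> pw s \<le> pw t"
  unfolding pw_def using \<gamma> by (intro integral_mono powr_mono2) (auto simp: StD)

lemma pw_add_disjoint:
  assumes "s \<in> St" "t \<in> St" "\<And>p. s p = 0 \<or> t p = 0"
  shows "pw (\<lambda>p. s p + t p) = pw s + pw t"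
proof -
  have "(s p + t p) powr \<gamma> = s p powr \<gamma> + t p powr \<gamma>" for p
    using assms(3)[of p] \<gamma> by auto
  then show ?thesis unfolding pw_def using assms by (simp add: StD)
qed

lemma n2_integrable:
  assumes "s \<in> St"
  shows "integrable (cylm e3) (\<lambda>p. (s p)\<^sup>2)"
proof (rule Bochner_Integration.integrable_bound)
  note [measurable] = StD(1)[OF assms]
  show "integrable (cylm e3) (\<lambda>p. s p + s p powr \<gamma>)" using StD[OF assms] by simp
  show "AE p in cylm e3. norm ((s p)\<^sup>2) \<le> norm (s p + s p powr \<gamma>)"
    using power2_le_powr_interpolation[of _ 1 \<gamma>] \<gamma> StD(2)[OF assms] by (auto simp: abs_of_nonneg)
  show "(\<lambda>p. (s p)\<^sup>2) \<in> borel_measurable (cylm e3)" by measurable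
qed

lemma n2_le:
  assumes "s \<in> St" "0 < T"
  shows "n2 s \<le> T * ms s + T powr (2 - \<gamma>) * pw s"
proof -
  have "n2 s \<le> (LINT p|cylm e3. T * s p + T powr (2 - \<gamma>) * s p powr \<gamma>)"
    unfolding n2_def using power2_le_powr_interpolation[OF StD(2)[OF assms(1)] assms(2) \<gamma>] StD[OF assms(1)]
    by (intro integral_mono n2_integrable assms) auto
  also have "\<dots> = T * ms s + T powr (2 - \<gamma>) * pw s"
    using StD[OF assms(1)] by (simp add: ms_def pw_def)
  finally show ?thesis .
qed

lemma n2_mono: "s \<in> St \<Longrightarrow> t \<in> St \<Longrightarrow> (\<And>p. s p \<le> t p) \<Longrightarrow> n2 s \<le> n2 t"
  unfolding n2_def by (intro integral_mono power_mono n2_integrable) (auto simp: StD)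

lemma nn_dens3:
  assumes "s \<in> St"
  shows "(\<integral>\<^sup>+x. dens e3 s x \<partial>lborel) = ennreal (ms s)"
    and "(\<integral>\<^sup>+x. (dens e3 s x)\<^sup>2 \<partial>lborel) = ennreal (n2 s)"
proof -
  note [measurable] = StD(1)[OF assms]
  have "(\<integral>\<^sup>+x. dens e3 s x \<partial>lborel) = (\<integral>\<^sup>+p. ennreal (s p) \<partial>cylm e3)"
    unfolding dens_def by (subst nn_integral_cylm) auto
  then show "(\<integral>\<^sup>+x. dens e3 s x \<partial>lborel) = ennreal (ms s)"
    unfolding ms_def using StD[OF assms] by (simp add: nn_integral_eq_integral)
  have "(\<integral>\<^sup>+x. (dens e3 s x)\<^sup>2 \<partial>lborel) = (\<integral>\<^sup>+p. ennreal ((s p)\<^sup>2) \<partial>cylm e3)"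
    unfolding dens_def using StD(2)[OF assms] by (subst nn_integral_cylm) (auto simp: ennreal_power)
  then show "(\<integral>\<^sup>+x. (dens e3 s x)\<^sup>2 \<partial>lborel) = ennreal (n2 s)"
    unfolding n2_def using n2_integrable[OF assms] by (simp add: nn_integral_eq_integral)
qed

lemma AE_cylm_fst: "AE p in cylm e. 0 \<le> fst p" for e :: "'a::euclidean_space"
  by (subst AE_cylm_iff) auto

lemma nn_integral_lift:
  assumes [measurable]: "u \<in> borel_measurable borel"
  shows "(\<integral>\<^sup>+p. u p \<partial>cylm e5) = (\<integral>\<^sup>+p. u p * ennreal (c5 * fst p ^ 2) \<partial>cylm e3)"
  unfolding lift_measure by (subst nn_integral_density) (auto simp: mult.commute)

text \<open>On the support the lifted measure has density \<open>c5 * fst p ^ 2\<close>, at most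
  \<open>C5\<close>. The cylinder thus turns every integral bound in \<open>real^3\<close> into one
  for the lift.\<close>

lemma nn_integral_lift_le:
  assumes [measurable]: "u \<in> borel_measurable borel" and "\<And>p. Rc \<le> fst p \<Longrightarrow> u p = 0"
  shows "(\<integral>\<^sup>+p. u p \<partial>cylm e5) \<le> ennreal C5 * (\<integral>\<^sup>+p. u p \<partial>cylm e3)"
proof -
  have "(\<integral>\<^sup>+p. u p * ennreal (c5 * fst p ^ 2) \<partial>cylm e3) \<le> (\<integral>\<^sup>+p. ennreal C5 * u p \<partial>cylm e3)"
  proof (rule nn_integral_mono_AE)
    show "AE p in cylm e3. u p * ennreal (c5 * fst p ^ 2) \<le> ennreal C5 * u p"
      using AE_cylm_fst
    proof eventually_elim
      case (elim p)
      show ?case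
      proof (cases "Rc \<le> fst p")
        case False
        then have "c5 * fst p ^ 2 \<le> C5" unfolding C5_def using elim c5
          by (intro mult_left_mono power_mono) auto
        then have "ennreal (c5 * fst p ^ 2) * u p \<le> ennreal C5 * u p"
          by (intro mult_right_mono ennreal_leI) auto
        then show ?thesis by (simp only: mult.commute)
      qed (use assms(2) in simp)
    qed
  qed
  also have "\<dots> = ennreal C5 * (\<integral>\<^sup>+p. u p \<partial>cylm e3)"
    by (rule nn_integral_cmult) measurable
  finally show ?thesis by (simp add: nn_integral_lift)
qed

lemma nn_dens5:
  assumes "s \<in> St"
  shows "(\<integral>\<^sup>+x. dens e5 s x \<partial>lborel) \<le> ennreal (C5 * ms s)"
    and "(\<integral>\<^sup>+x. (dens e5 s x)\<^sup>2 \<partial>lborel) \<le> ennreal (C5 * n2 s)"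
proof -
  note [measurable] = StD(1)[OF assms]
  have "(\<integral>\<^sup>+x. dens e5 s x \<partial>lborel) = (\<integral>\<^sup>+p. ennreal (s p) \<partial>cylm e5)"
    unfolding dens_def by (subst nn_integral_cylm) auto
  also have "\<dots> \<le> ennreal C5 * (\<integral>\<^sup>+p. ennreal (s p) \<partial>cylm e3)"
    by (rule nn_integral_lift_le) (auto simp: StD[OF assms])
  also have "\<dots> = ennreal (C5 * ms s)"
    unfolding ms_def using StD[OF assms] C5_pos by (simp add: nn_integral_eq_integral ennreal_mult')
  finally show "(\<integral>\<^sup>+x. dens e5 s x \<partial>lborel) \<le> ennreal (C5 * ms s)" .
  have "(\<integral>\<^sup>+x. (dens e5 s x)\<^sup>2 \<partial>lborel) = (\<integral>\<^sup>+p. ennreal ((s p)\<^sup>2) \<partial>cylm e5)"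
    unfolding dens_def using StD(2)[OF assms] by (subst nn_integral_cylm) (auto simp: ennreal_power)
  also have "\<dots> \<le> ennreal C5 * (\<integral>\<^sup>+p. ennreal ((s p)\<^sup>2) \<partial>cylm e3)"
    by (rule nn_integral_lift_le) (auto simp: StD[OF assms])
  also have "\<dots> = ennreal (C5 * n2 s)"
    unfolding n2_def using n2_integrable[OF assms] C5_pos by (simp add: nn_integral_eq_integral ennreal_mult')
  finally show "(\<integral>\<^sup>+x. (dens e5 s x)\<^sup>2 \<partial>lborel) \<le> ennreal (C5 * n2 s)" .
qed

lemma BBe_le:
  assumes "0 \<le> X" "kint (riesz 1) (dens e3 s) (dens e3 t) \<le> ennreal ((1 + 1)\<^sup>2 * X)"
    "kint (riesz 3) (dens e5 s) (dens e5 t) \<le> ennreal ((1 + C5)\<^sup>2 * X)"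
  shows "BBe s t \<le> ennreal (Cw * X)"
proof -
  have "BBe s t \<le> ennreal (1/2) * ennreal ((1 + 1)\<^sup>2 * X) + ennreal w * ennreal ((1 + C5)\<^sup>2 * X)"
    unfolding BBe_def using assms(2,3) by (intro add_mono mult_left_mono) auto
  also have "\<dots> = ennreal (1/2 * ((1 + 1)\<^sup>2 * X) + w * ((1 + C5)\<^sup>2 * X))"
    using assms(1) w by (simp only: ennreal_mult'[symmetric] ennreal_plus[symmetric] zero_le_power2
        zero_le_mult_iff zero_le_divide_iff zero_le_one zero_le_numeral mult_nonneg_nonneg simp_thms)
  also have "1/2 * ((1 + 1)\<^sup>2 * X) + w * ((1 + C5)\<^sup>2 * X) = Cw * X"
    by (simp add: Cw_def algebra_simps)
  finally show ?thesis .
qed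

section \<open>Upper and lower bounds for the interaction form\<close>

lemma BB_le: "BBe s t \<le> ennreal X \<Longrightarrow> 0 \<le> X \<Longrightarrow> BB s t \<le> X"
  unfolding BB_def by (rule enn2real_leI)

text \<open>Stated for a general axis so that it covers both spaces; \<open>c\<close> is the price
  for passing from \<open>cylm e3\<close> to the space at hand. Terms linear in a square integral
  carry \<open>c\<close>, products of two masses carry \<open>c * c\<close>, and
  \<open>(1 + c)\<^sup>2\<close> dominates both.\<close>

lemma kint_bound:
  fixes e :: "'a::euclidean_space"
  assumes s: "s \<in> St" and t: "t \<in> St" and e: "norm e = 1" and l: "0 < l" "l \<le> 3" and c: "0 \<le> c"
    and m: "\<And>u. u \<in> St \<Longrightarrow> (\<integral>\<^sup>+x. dens e u x \<partial>lborel) \<le> ennreal (c * ms u)"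
    and q: "\<And>u. u \<in> St \<Longrightarrow> (\<integral>\<^sup>+x. (dens e u x)\<^sup>2 \<partial>lborel) \<le> ennreal (c * n2 u)"
    and near: "(\<integral>\<^sup>+x. riesz_near l \<epsilon> (x::'a) \<partial>lborel) \<le> ennreal \<kappa>"
    and par: "0 \<le> \<kappa>" "0 < \<epsilon>" "\<epsilon> \<le> 1" "1 \<le> D" "0 < \<tau>" "0 \<le> \<delta>"
    and slab: "\<And>a. ms (cut {z. \<bar>z - a\<bar> < D} t) \<le> \<delta>"
  shows "kint (riesz l) (dens e s) (dens e t) \<le>
    ennreal ((1 + c)\<^sup>2 * (\<kappa> * (\<tau> * n2 s + n2 t / \<tau>) + \<delta> * ms s / \<epsilon>^3 + ms s * ms t / D))"
proof -
  note [measurable] = StD(1)[OF s] StD(1)[OF t]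
  note nn = n2_nonneg[of s] n2_nonneg[of t] ms_nonneg[OF s] ms_nonneg[OF t]
  have T1: "kint (riesz_near l \<epsilon>) (dens e s) (dens e t) \<le> ennreal (\<kappa> * (\<tau> * (c * n2 s) + 1 / \<tau> * (c * n2 t)))"
  proof -
    have "kint (riesz_near l \<epsilon>) (dens e s) (dens e t) \<le> (\<integral>\<^sup>+x. riesz_near l \<epsilon> (x::'a) \<partial>lborel) *
      (ennreal \<tau> * (\<integral>\<^sup>+x. (dens e s x)^2 \<partial>lborel) + ennreal (1/\<tau>) * (\<integral>\<^sup>+x. (dens e t x)^2 \<partial>lborel))"
      by (rule kint_young) (use par in measurable)
    also have "\<dots> \<le> ennreal \<kappa> * (ennreal \<tau> * ennreal (c * n2 s) + ennreal (1/\<tau>) * ennreal (c * n2 t))"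
      by (intro mult_mono add_mono near q s t) auto
    also have "\<dots> = ennreal (\<kappa> * (\<tau> * (c * n2 s) + 1 / \<tau> * (c * n2 t)))"
      using nn par c by (simp add: ennreal_mult'[symmetric] ennreal_plus[symmetric] del: ennreal_plus)
    finally show ?thesis .
  qed
  have T2: "kint (\<lambda>x. indicator {x. \<bar>x \<bullet> e\<bar> < D} x) (dens e s) (dens e t) \<le> ennreal (c * \<delta>) * ennreal (c * ms s)"
  proof -
    have "(\<integral>\<^sup>+x. dens e t x * indicator {x. \<bar>x \<bullet> e - a\<bar> < D} x \<partial>lborel) \<le> ennreal (c * \<delta>)" for a
    proof -
      have "{z. \<bar>z - a\<bar> < D} \<in> sets borel" by measurable
      then have "(\<integral>\<^sup>+x. dens e (cut {z. \<bar>z - a\<bar> < D} t) x \<partial>lborel) \<le> ennreal (c * ms (cut {z. \<bar>z - a\<bar> < D} t))"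
        by (intro m St_cut t)
      also have "\<dots> \<le> ennreal (c * \<delta>)"
        by (intro ennreal_leI mult_left_mono slab c)
      finally show ?thesis by (simp add: dens_cut)
    qed
    then have "kint (\<lambda>x. indicator {x. \<bar>x \<bullet> e\<bar> < D} x) (dens e s) (dens e t) \<le> ennreal (c * \<delta>) * (\<integral>\<^sup>+x. dens e s x \<partial>lborel)"
      by (intro kint_slab_le) measurable
    also have "\<dots> \<le> ennreal (c * \<delta>) * ennreal (c * ms s)"
      by (intro mult_left_mono m s) auto
    finally show ?thesis .
  qed
  have "kint (riesz l) (dens e s) (dens e t) \<le> kint (riesz_near l \<epsilon>) (dens e s) (dens e t)
    + ennreal (1 / \<epsilon>^l) * kint (\<lambda>x. indicator {x. \<bar>x \<bullet> e\<bar> < D} x) (dens e s) (dens e t)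
    + ennreal (1 / D) * ((\<integral>\<^sup>+x. dens e s x \<partial>lborel) * (\<integral>\<^sup>+x. dens e t x \<partial>lborel))"
    using par l e by (intro kint_riesz_split) auto
  also have "\<dots> \<le> ennreal (\<kappa> * (\<tau> * (c * n2 s) + 1 / \<tau> * (c * n2 t)))
    + ennreal (1 / \<epsilon>^l) * (ennreal (c * \<delta>) * ennreal (c * ms s))
    + ennreal (1 / D) * (ennreal (c * ms s) * ennreal (c * ms t))"
    by (intro add_mono mult_left_mono mult_mono T1 T2 m s t) auto
  also have "\<dots> = ennreal (\<kappa> * (\<tau> * (c * n2 s) + 1 / \<tau> * (c * n2 t))
     + 1 / \<epsilon>^l * ((c * \<delta>) * (c * ms s)) + 1 / D * ((c * ms s) * (c * ms t)))"
    using nn par c by (simp add: ennreal_mult'[symmetric] ennreal_plus[symmetric] del: ennreal_plus)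
  also have "\<dots> \<le> ennreal ((1 + c)\<^sup>2 * (\<kappa> * (\<tau> * n2 s + n2 t / \<tau>) + \<delta> * ms s / \<epsilon>^3 + ms s * ms t / D))"
  proof (rule ennreal_leI)
    have c1: "c \<le> (1 + c)\<^sup>2" "c * c \<le> (1 + c)\<^sup>2" using c by (auto simp: power2_eq_square algebra_simps)
    have "\<kappa> * (\<tau> * (c * n2 s) + 1 / \<tau> * (c * n2 t)) = c * (\<kappa> * (\<tau> * n2 s + n2 t / \<tau>))"
      by (simp add: algebra_simps)
    also have "\<dots> \<le> (1 + c)\<^sup>2 * (\<kappa> * (\<tau> * n2 s + n2 t / \<tau>))"
      using nn par by (intro mult_right_mono c1) auto
    finally have 1: "\<kappa> * (\<tau> * (c * n2 s) + 1 / \<tau> * (c * n2 t)) \<le> (1 + c)\<^sup>2 * (\<kappa> * (\<tau> * n2 s + n2 t / \<tau>))" .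
    \<comment> \<open>Since \<open>\<epsilon> \<le> 1\<close>, the exponent 3 dominates both
      exponents that occur, 1 and 3.\<close>
    have "1 / \<epsilon>^l \<le> 1 / \<epsilon>^3"
      using par l by (intro divide_left_mono power_decreasing) auto
    then have "1 / \<epsilon>^l * ((c * \<delta>) * (c * ms s)) \<le> 1 / \<epsilon>^3 * ((c * \<delta>) * (c * ms s))"
      using nn par c by (intro mult_right_mono) auto
    also have "\<dots> = (c * c) * (\<delta> * ms s / \<epsilon>^3)" by simp
    also have "\<dots> \<le> (1 + c)\<^sup>2 * (\<delta> * ms s / \<epsilon>^3)"
      using nn par by (intro mult_right_mono c1) auto
    finally have 2: "1 / \<epsilon>^l * ((c * \<delta>) * (c * ms s)) \<le> (1 + c)\<^sup>2 * (\<delta> * ms s / \<epsilon>^3)" .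
    have "1 / D * ((c * ms s) * (c * ms t)) = (c * c) * (ms s * ms t / D)" by simp
    also have "\<dots> \<le> (1 + c)\<^sup>2 * (ms s * ms t / D)"
      using nn par by (intro mult_right_mono c1) auto
    finally have 3: "1 / D * ((c * ms s) * (c * ms t)) \<le> (1 + c)\<^sup>2 * (ms s * ms t / D)" .
    show "\<kappa> * (\<tau> * (c * n2 s) + 1 / \<tau> * (c * n2 t)) + 1 / \<epsilon>^l * ((c * \<delta>) * (c * ms s)) + 1 / D * ((c * ms s) * (c * ms t))
      \<le> (1 + c)\<^sup>2 * (\<kappa> * (\<tau> * n2 s + n2 t / \<tau>) + \<delta> * ms s / \<epsilon>^3 + ms s * ms t / D)"
      using 1 2 3 by (simp only: distrib_left)
  qed
  finally show ?thesis .
qed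

text \<open>The three terms are the singular part, the part inside slabs and the far part. With
  \<open>\<kappa>\<close> small and \<open>D\<close> large the form can stay away from 0 only if
  some slab carries mass; this is the source of nonvanishing.\<close>

lemma BBe_bound:
  assumes s: "s \<in> St" and t: "t \<in> St"
    and near: "(\<integral>\<^sup>+x. riesz_near 1 \<epsilon> (x::real^3) \<partial>lborel) \<le> ennreal \<kappa>"
      "(\<integral>\<^sup>+x. riesz_near 3 \<epsilon> (x::real^5) \<partial>lborel) \<le> ennreal \<kappa>"
    and par: "0 \<le> \<kappa>" "0 < \<epsilon>" "\<epsilon> \<le> 1" "1 \<le> D" "0 < \<tau>" "0 \<le> \<delta>"
    and slab: "\<And>a. ms (cut {z. \<bar>z - a\<bar> < D} t) \<le> \<delta>"
  shows "BBe s t \<le> ennreal (Cw * (\<kappa> * (\<tau> * n2 s + n2 t / \<tau>) + \<delta> * ms s / \<epsilon>^3 + ms s * ms t / D))"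
proof (rule BBe_le)
  show "0 \<le> \<kappa> * (\<tau> * n2 s + n2 t / \<tau>) + \<delta> * ms s / \<epsilon>^3 + ms s * ms t / D"
    using par n2_nonneg[of s] n2_nonneg[of t] ms_nonneg[OF s] ms_nonneg[OF t] by auto
  show "kint (riesz 1) (dens e3 s) (dens e3 t)
    \<le> ennreal ((1 + 1)\<^sup>2 * (\<kappa> * (\<tau> * n2 s + n2 t / \<tau>) + \<delta> * ms s / \<epsilon>^3 + ms s * ms t / D))"
    by (rule kint_bound[OF s t norm_e3 _ _ _ _ _ near(1) par slab]) (auto simp: nn_dens3)
  show "kint (riesz 3) (dens e5 s) (dens e5 t)
    \<le> ennreal ((1 + C5)\<^sup>2 * (\<kappa> * (\<tau> * n2 s + n2 t / \<tau>) + \<delta> * ms s / \<epsilon>^3 + ms s * ms t / D))"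
    by (rule kint_bound[OF s t norm_e5 _ _ _ _ _ near(2) par slab])
      (use C5_pos in \<open>auto simp: nn_dens5\<close>)
qed

definition K1 :: real where
  "K1 = enn2real (\<integral>\<^sup>+x. riesz_near 1 1 (x::real^3) \<partial>lborel) +
        enn2real (\<integral>\<^sup>+x. riesz_near 3 1 (x::real^5) \<partial>lborel)"

text \<open>The summand 2 accounts for the slab term and the far term, both equal to the product of
  the masses when \<open>\<epsilon>\<close> and \<open>D\<close> are 1.\<close>

definition Kb :: real where "Kb = Cw * (K1 + 2)"

lemma K1_nonneg: "0 \<le> K1" by (simp add: K1_def)

lemma Kb_pos: "0 < Kb" using Cw_pos K1_nonneg by (simp add: Kb_def)

lemma near_le_K1:
  "(\<integral>\<^sup>+x. riesz_near 1 1 (x::real^3) \<partial>lborel) \<le> ennreal K1"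
  "(\<integral>\<^sup>+x. riesz_near 3 1 (x::real^5) \<partial>lborel) \<le> ennreal K1"
proof -
  have 3: "(\<integral>\<^sup>+x. riesz_near 1 1 (x::real^3) \<partial>lborel) < top" using riesz_near_integrable[where 'a="real^3" and l=1] by simp
  have 5: "(\<integral>\<^sup>+x. riesz_near 3 1 (x::real^5) \<partial>lborel) < top" using riesz_near_integrable[where 'a="real^5" and l=3] by simp
  show "(\<integral>\<^sup>+x. riesz_near 1 1 (x::real^3) \<partial>lborel) \<le> ennreal K1"
    using 3 unfolding K1_def by (subst ennreal_plus) auto
  show "(\<integral>\<^sup>+x. riesz_near 3 1 (x::real^5) \<partial>lborel) \<le> ennreal K1"
    using 5 unfolding K1_def by (subst ennreal_plus) auto
qed

lemma near_small:
  assumes "0 < \<theta>"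
  obtains \<epsilon> where "0 < \<epsilon>" "\<epsilon> \<le> 1" "(\<integral>\<^sup>+x. riesz_near 1 \<epsilon> (x::real^3) \<partial>lborel) \<le> ennreal \<theta>"
    "(\<integral>\<^sup>+x. riesz_near 3 \<epsilon> (x::real^5) \<partial>lborel) \<le> ennreal \<theta>"
proof -
  obtain a where a: "0 < a" "a \<le> 1" "(\<integral>\<^sup>+x. riesz_near 1 a (x::real^3) \<partial>lborel) \<le> ennreal \<theta>"
    using riesz_near_small[of 1 \<theta>, where 'a="real^3"] assms by auto
  obtain b where b: "0 < b" "b \<le> 1" "(\<integral>\<^sup>+x. riesz_near 3 b (x::real^5) \<partial>lborel) \<le> ennreal \<theta>"
    using riesz_near_small[of 3 \<theta>, where 'a="real^5"] assms by auto
  have "(\<integral>\<^sup>+x. riesz_near 1 (min a b) (x::real^3) \<partial>lborel) \<le> (\<integral>\<^sup>+x. riesz_near 1 a (x::real^3) \<partial>lborel)"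
    "(\<integral>\<^sup>+x. riesz_near 3 (min a b) (x::real^5) \<partial>lborel) \<le> (\<integral>\<^sup>+x. riesz_near 3 b (x::real^5) \<partial>lborel)"
    by (intro nn_integral_mono riesz_near_mono; simp)+
  then show ?thesis using a b by (intro that[of "min a b"]) (auto intro: order_trans)
qed

lemma BBe_upper:
  assumes s: "s \<in> St" and t: "t \<in> St" and \<tau>: "0 < \<tau>"
  shows "BBe s t \<le> ennreal (Kb * (\<tau> * n2 s + n2 t / \<tau> + ms s * ms t))"
proof -
  \<comment> \<open>With \<open>\<epsilon>\<close> and \<open>D\<close> equal to 1 the whole mass of
    \<open>t\<close> serves as the slab bound, so no concentration hypothesis remains.\<close>
  have "BBe s t \<le> ennreal (Cw * (K1 * (\<tau> * n2 s + n2 t / \<tau>) + ms t * ms s / 1^3 + ms s * ms t / 1))"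
  proof (rule BBe_bound[OF s t near_le_K1 K1_nonneg])
    fix a :: real
    have "{z. \<bar>z - a\<bar> < 1} \<in> sets borel" by measurable
    then show "ms (cut {z. \<bar>z - a\<bar> < 1} t) \<le> ms t"
      by (intro ms_mono St_cut t) (auto simp: cut_def StD[OF t])
  qed (use \<tau> ms_nonneg[OF t] in auto)
  also have "\<dots> \<le> ennreal (Kb * (\<tau> * n2 s + n2 t / \<tau> + ms s * ms t))"
  proof (rule ennreal_leI)
    have X: "0 \<le> \<tau> * n2 s + n2 t / \<tau>" using \<tau> n2_nonneg by auto
    have Y: "0 \<le> ms s * ms t" using ms_nonneg s t by auto
    have "Cw * (K1 * (\<tau> * n2 s + n2 t / \<tau>) + ms t * ms s / 1^3 + ms s * ms t / 1)
        \<le> Cw * ((K1 + 2) * (\<tau> * n2 s + n2 t / \<tau> + ms s * ms t))"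
    proof (intro mult_left_mono)
      have "0 \<le> K1 * (ms s * ms t)" using K1_nonneg Y by simp
      moreover have "K1 * P + Q + Q \<le> (K1 + 2) * (P + Q)" if "0 \<le> P" "0 \<le> K1 * Q" for P Q
        using that by (simp add: algebra_simps)
      ultimately show "K1 * (\<tau> * n2 s + n2 t / \<tau>) + ms t * ms s / 1^3 + ms s * ms t / 1
        \<le> (K1 + 2) * (\<tau> * n2 s + n2 t / \<tau> + ms s * ms t)"
        using X by (simp only: mult.commute[of "ms t"] power_one div_by_1)
    qed (use Cw_pos in simp)
    then show "Cw * (K1 * (\<tau> * n2 s + n2 t / \<tau>) + ms t * ms s / 1^3 + ms s * ms t / 1)
      \<le> Kb * (\<tau> * n2 s + n2 t / \<tau> + ms s * ms t)" by (simp add: Kb_def)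
  qed
  finally show ?thesis .
qed

lemma BBe_finite: "s \<in> St \<Longrightarrow> t \<in> St \<Longrightarrow> BBe s t < top"
  using BBe_upper[of s t 1] by (auto intro: le_less_trans)

lemma BBe_eq: "s \<in> St \<Longrightarrow> t \<in> St \<Longrightarrow> BBe s t = ennreal (BB s t)"
  unfolding BB_def using BBe_finite by simp

lemma BB_upper:
  assumes s: "s \<in> St" and t: "t \<in> St" and \<tau>: "0 < \<tau>"
  shows "BB s t \<le> Kb * (\<tau> * n2 s + n2 t / \<tau> + ms s * ms t)"
proof (rule BB_le[OF BBe_upper[OF assms]])
  show "0 \<le> Kb * (\<tau> * n2 s + n2 t / \<tau> + ms s * ms t)"
    using Kb_pos \<tau> n2_nonneg[of s] n2_nonneg[of t] ms_nonneg[OF s] ms_nonneg[OF t] by auto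
qed

lemma BB_bound:
  assumes s: "s \<in> St" and t: "t \<in> St"
    and near: "(\<integral>\<^sup>+x. riesz_near 1 \<epsilon> (x::real^3) \<partial>lborel) \<le> ennreal \<kappa>"
      "(\<integral>\<^sup>+x. riesz_near 3 \<epsilon> (x::real^5) \<partial>lborel) \<le> ennreal \<kappa>"
    and par: "0 \<le> \<kappa>" "0 < \<epsilon>" "\<epsilon> \<le> 1" "1 \<le> D" "0 < \<tau>" "0 \<le> \<delta>"
    and slab: "\<And>a. ms (cut {z. \<bar>z - a\<bar> < D} t) \<le> \<delta>"
  shows "BB s t \<le> Cw * (\<kappa> * (\<tau> * n2 s + n2 t / \<tau>) + \<delta> * ms s / \<epsilon>^3 + ms s * ms t / D)"
proof (rule BB_le[OF BBe_bound[OF assms]])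
  show "0 \<le> Cw * (\<kappa> * (\<tau> * n2 s + n2 t / \<tau>) + \<delta> * ms s / \<epsilon>^3 + ms s * ms t / D)"
    using Cw_pos par n2_nonneg[of s] n2_nonneg[of t] ms_nonneg[OF s] ms_nonneg[OF t] by auto
qed

lemma BB_nonneg: "0 \<le> BB s t" by (simp add: BB_def)

lemma BB_commute:
  assumes "s \<in> St" "t \<in> St"
  shows "BB s t = BB t s"
proof -
  note [measurable] = StD(1)[OF assms(1)] StD(1)[OF assms(2)]
  have "kint (riesz 1) (dens e3 s) (dens e3 t) = kint (riesz 1) (dens e3 t) (dens e3 s)"
    "kint (riesz 3) (dens e5 s) (dens e5 t) = kint (riesz 3) (dens e5 t) (dens e5 s)"
    by (intro kint_commute riesz_minus; measurable)+
  then show ?thesis by (simp add: BB_def BBe_def)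
qed

lemma BB_add_left:
  assumes "s \<in> St" "s' \<in> St" "t \<in> St"
  shows "BB (\<lambda>p. s p + s' p) t = BB s t + BB s' t"
proof -
  note [measurable] = StD(1)[OF assms(1)] StD(1)[OF assms(2)] StD(1)[OF assms(3)]
  have "BBe (\<lambda>p. s p + s' p) t = BBe s t + BBe s' t"
    unfolding BBe_def by (simp add: dens_add StD(2)[OF assms(1)] StD(2)[OF assms(2)] kint_add_left distrib_left ac_simps)
  then show ?thesis
    unfolding BB_def using BBe_finite assms by (simp add: enn2real_plus)
qed

lemma BB_add_right:
  assumes "s \<in> St" "s' \<in> St" "t \<in> St"
  shows "BB t (\<lambda>p. s p + s' p) = BB t s + BB t s'"
  using BB_add_left[OF assms] BB_commute[OF St_add[OF assms(1,2)] assms(3)] assms BB_commute by metis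

lemma BB_mono:
  assumes "s \<in> St" "s' \<in> St" "t \<in> St" "t' \<in> St" "\<And>p. s p \<le> s' p" "\<And>p. t p \<le> t' p"
  shows "BB s t \<le> BB s' t'"
proof -
  have "BBe s t \<le> BBe s' t'"
    unfolding BBe_def
    by (intro add_mono mult_left_mono kint_mono mult_mono)
      (auto simp: dens_def simp del: split_paired_All intro!: ennreal_leI assms(5,6))
  then show ?thesis unfolding BB_def using BBe_finite[OF assms(2,4)] by (rule enn2real_mono)
qed

lemma BB_shift:
  assumes "s \<in> St" "t \<in> St"
  shows "BB (shift a s) (shift a t) = BB s t"
proof -
  note [measurable] = StD(1)[OF assms(1)] StD(1)[OF assms(2)]
  have "BBe (shift a s) (shift a t) = BBe s t"
    unfolding BBe_def by (simp add: dens_shift kint_shift)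
  then show ?thesis by (simp add: BB_def)
qed

lemma dens_neq_0: "dens e s x \<noteq> 0 \<Longrightarrow> s (cyl e x) \<noteq> 0"
  by (auto simp: dens_def)

lemma BB_far:
  assumes s: "s \<in> St" and t: "t \<in> St" and D: "1 \<le> D"
    and far: "\<And>p q. s p \<noteq> 0 \<Longrightarrow> t q \<noteq> 0 \<Longrightarrow> D \<le> \<bar>snd p - snd q\<bar>"
  shows "BB s t \<le> Cw * (ms s * ms t / D)"
proof (rule BB_le[OF BBe_le])
  note [measurable] = StD(1)[OF s] StD(1)[OF t]
  note nn = ms_nonneg[OF s] ms_nonneg[OF t]
  show nn': "0 \<le> ms s * ms t / D" using nn D by simp
  then show "0 \<le> Cw * (ms s * ms t / D)" using Cw_pos by (intro mult_nonneg_nonneg) auto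
  have f: "D \<le> \<bar>x \<bullet> e - y \<bullet> e\<bar>" if "dens e s x \<noteq> 0" "dens e t y \<noteq> 0" for e x y :: "'a::euclidean_space"
    using far[OF dens_neq_0[OF that(1)] dens_neq_0[OF that(2)]] by simp
  have "kint (riesz 1) (dens e3 s) (dens e3 t) \<le> ennreal (1 / D) * ((\<integral>\<^sup>+x. dens e3 s x \<partial>lborel) * (\<integral>\<^sup>+x. dens e3 t x \<partial>lborel))"
    using D f by (intro kint_riesz_far[where e=e3]) auto
  also have "\<dots> = ennreal (ms s * ms t / D)"
    using nn D by (simp add: nn_dens3 s t ennreal_mult[symmetric])
  also have "\<dots> \<le> ennreal ((1 + 1)\<^sup>2 * (ms s * ms t / D))"
    using nn' by (intro ennreal_leI) simp
  finally show "kint (riesz 1) (dens e3 s) (dens e3 t) \<le> ennreal ((1 + 1)\<^sup>2 * (ms s * ms t / D))" .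
  have "kint (riesz 3) (dens e5 s) (dens e5 t) \<le> ennreal (1 / D) * ((\<integral>\<^sup>+x. dens e5 s x \<partial>lborel) * (\<integral>\<^sup>+x. dens e5 t x \<partial>lborel))"
    using D f by (intro kint_riesz_far[where e=e5]) auto
  also have "\<dots> \<le> ennreal (1 / D) * (ennreal (C5 * ms s) * ennreal (C5 * ms t))"
    by (intro mult_left_mono mult_mono nn_dens5 s t) auto
  also have "\<dots> = ennreal (C5\<^sup>2 * (ms s * ms t / D))"
    using nn D C5_pos by (simp add: ennreal_mult[symmetric] power2_eq_square mult_ac)
  also have "\<dots> \<le> ennreal ((1 + C5)\<^sup>2 * (ms s * ms t / D))"
    using nn' C5_pos by (intro ennreal_leI mult_right_mono power_mono) auto
  finally show "kint (riesz 3) (dens e5 s) (dens e5 t) \<le> ennreal ((1 + C5)\<^sup>2 * (ms s * ms t / D))" .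
qed

text \<open>Only the Newtonian term is kept, the other one being nonnegative. Inside the cylinder
  two points whose heights differ by at most \<open>D\<close> have distance at most
  \<open>D + 2 * Rc\<close>; the factor 2 in front is that of the Newtonian energy.\<close>

lemma BB_lower:
  assumes s: "s \<in> St" and t: "t \<in> St" and D: "0 < D"
    and close: "\<And>p q. s p \<noteq> 0 \<Longrightarrow> t q \<noteq> 0 \<Longrightarrow> \<bar>snd p - snd q\<bar> \<le> D"
  shows "ms s * ms t / (2 * (D + 2 * Rc)) \<le> BB s t"
proof -
  note [measurable] = StD(1)[OF s] StD(1)[OF t]
  note nn = ms_nonneg[OF s] ms_nonneg[OF t]
  have cl: "norm (x - y) \<le> D + 2 * Rc" if "dens e3 s x \<noteq> 0" "dens e3 t y \<noteq> 0" for x y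
  proof -
    have 1: "\<bar>x \<bullet> e3 - y \<bullet> e3\<bar> \<le> D"
      using close[OF dens_neq_0[OF that(1)] dens_neq_0[OF that(2)]] by simp
    have 2: "fst (cyl e3 x) < Rc" "fst (cyl e3 y) < Rc"
      using dens_neq_0[OF that(1)] dens_neq_0[OF that(2)] StD(3)[OF s] StD(3)[OF t] by (meson not_less)+
    have "x - y = ((x - (x \<bullet> e3) *\<^sub>R e3) - (y - (y \<bullet> e3) *\<^sub>R e3)) + (x \<bullet> e3 - y \<bullet> e3) *\<^sub>R e3"
      by (simp add: algebra_simps)
    then have "norm (x - y) \<le> norm ((x - (x \<bullet> e3) *\<^sub>R e3) - (y - (y \<bullet> e3) *\<^sub>R e3)) + norm ((x \<bullet> e3 - y \<bullet> e3) *\<^sub>R e3)"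
      by (metis norm_triangle_ineq)
    also have "\<dots> \<le> (fst (cyl e3 x) + fst (cyl e3 y)) + \<bar>x \<bullet> e3 - y \<bullet> e3\<bar>"
    proof (rule add_mono)
      show "norm ((x - (x \<bullet> e3) *\<^sub>R e3) - (y - (y \<bullet> e3) *\<^sub>R e3)) \<le> fst (cyl e3 x) + fst (cyl e3 y)"
        unfolding cyl_def fst_conv by (rule norm_triangle_ineq4)
    qed simp
    finally show ?thesis using 1 2 by simp
  qed
  have pos: "0 < D + 2 * Rc" using D Rc by simp
  have "ennreal (ms s * ms t / (2 * (D + 2 * Rc))) = ennreal (1/2) * (ennreal (1 / (D + 2 * Rc)) * (ennreal (ms s) * ennreal (ms t)))"
  proof -
    have "ms s * ms t / (2 * (D + 2 * Rc)) = 1/2 * (1 / (D + 2 * Rc) * (ms s * ms t))" by simp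
    then show ?thesis using nn pos
      by (simp only:) (subst ennreal_mult', simp, subst ennreal_mult', simp, subst ennreal_mult', simp, rule refl)
  qed
  also have "\<dots> \<le> ennreal (1/2) * kint (riesz 1) (dens e3 s) (dens e3 t)"
    using kint_riesz_lower[of "dens e3 s" "dens e3 t", OF _ _ pos cl] 
    by (intro mult_left_mono) (auto simp: nn_dens3 s t)
  also have "\<dots> \<le> BBe s t" by (simp add: BBe_def)
  finally show ?thesis
    unfolding BBe_eq[OF s t] by (simp add: ennreal_le_iff BB_nonneg)
qed

text \<open>The bound carries no factor \<open>R\<close> although \<open>R\<close> interactions are
  summed. At bounded pressure it becomes small with the mass of the annulus, once
  \<open>\<tau>\<close> has been chosen small.\<close>

lemma BB_cuts:
  fixes R :: nat and a R' :: real
  assumes s: "s \<in> St" and \<tau>: "0 < \<tau>"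
  defines "g \<equiv> cut {z. real R < \<bar>z - a\<bar> \<and> \<bar>z - a\<bar> \<le> R'} s"
  shows "(\<Sum>L\<in>{R..<2*R}. BB (cut {z. \<bar>z - a\<bar> \<le> real L} s) (cut {z. real L < \<bar>z - a\<bar> \<and> \<bar>z - a\<bar> \<le> R'} s))
    \<le> Cw * (2 * (K1 * (\<tau> * n2 s + n2 g / \<tau>) + ms s * ms g))"
proof -
  note [measurable] = StD(1)[OF s]
  let ?A = "\<lambda>L::nat. cut {z. \<bar>z - a\<bar> \<le> real L} s"
  let ?B = "\<lambda>L::nat. cut {z. real L < \<bar>z - a\<bar> \<and> \<bar>z - a\<bar> \<le> R'} s"
  have A: "?A L \<in> St" for L by (rule St_cut[OF s]) measurable
  have B: "?B L \<in> St" for L by (rule St_cut[OF s]) measurable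
  have g: "g \<in> St" unfolding g_def by (rule St_cut[OF s]) measurable
  note nn = n2_nonneg[of s] n2_nonneg[of g] ms_nonneg[OF s] ms_nonneg[OF g]
  \<comment> \<open>One estimate for both spaces, used with \<open>c = 1\<close> and with
    \<open>c = C5\<close>.\<close>
  have *: "(\<Sum>L\<in>{R..<2*R}. kint (riesz l) (dens e (?A L)) (dens e (?B L)))
     \<le> ennreal ((1 + c)\<^sup>2 * (2 * (K1 * (\<tau> * n2 s + n2 g / \<tau>) + ms s * ms g)))"
    if e: "norm e = 1" and l: "0 < l" and c: "0 \<le> c"
      and m: "\<And>u. u \<in> St \<Longrightarrow> (\<integral>\<^sup>+x. dens e u x \<partial>lborel) \<le> ennreal (c * ms u)"
      and q: "\<And>u. u \<in> St \<Longrightarrow> (\<integral>\<^sup>+x. (dens e u x)\<^sup>2 \<partial>lborel) \<le> ennreal (c * n2 u)"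
      and near: "(\<integral>\<^sup>+x. riesz_near l 1 (x::'a) \<partial>lborel) \<le> ennreal K1"
    for e :: "'a::euclidean_space" and l c
  proof -
    have "(\<Sum>L\<in>{R..<2*R}. kint (riesz l) (dens e (?A L)) (dens e (?B L)))
      \<le> 2 * ((\<integral>\<^sup>+x. riesz_near l 1 (x::'a) \<partial>lborel) *
          (ennreal \<tau> * (\<integral>\<^sup>+x. (dens e s x)^2 \<partial>lborel) + ennreal (1/\<tau>) * (\<integral>\<^sup>+x. (dens e g x)^2 \<partial>lborel)))
       + 2 * ((\<integral>\<^sup>+x. dens e s x \<partial>lborel) * (\<integral>\<^sup>+x. dens e g x \<partial>lborel))"
      using kint_riesz_cuts[where f="dens e s" and e=e and l=l and t=\<tau> and R=R and a=a and R'=R'] e l \<tau>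
      by (simp add: dens_cut [abs_def] g_def)
    also have "\<dots> \<le> ennreal 2 * (ennreal K1 * (ennreal \<tau> * ennreal (c * n2 s) + ennreal (1/\<tau>) * ennreal (c * n2 g)))
       + ennreal 2 * (ennreal (c * ms s) * ennreal (c * ms g))"
      by (intro add_mono mult_mono near m q s g) auto
    also have "\<dots> = ennreal (2 * (K1 * (\<tau> * (c * n2 s) + 1/\<tau> * (c * n2 g))) + 2 * ((c * ms s) * (c * ms g)))"
      using nn \<tau> c K1_nonneg
      by (simp add: ennreal_mult'[symmetric] ennreal_plus[symmetric] del: ennreal_plus ennreal_numeral)
    also have "\<dots> \<le> ennreal ((1 + c)\<^sup>2 * (2 * (K1 * (\<tau> * n2 s + n2 g / \<tau>) + ms s * ms g)))"
    proof (rule ennreal_leI)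
      have c1: "c \<le> (1 + c)\<^sup>2" "c * c \<le> (1 + c)\<^sup>2" using c by (auto simp: power2_eq_square algebra_simps)
      have p1: "c * (K1 * (\<tau> * n2 s + n2 g / \<tau>)) \<le> (1 + c)\<^sup>2 * (K1 * (\<tau> * n2 s + n2 g / \<tau>))"
        using nn \<tau> K1_nonneg by (intro mult_right_mono c1) auto
      have p2: "(c * c) * (ms s * ms g) \<le> (1 + c)\<^sup>2 * (ms s * ms g)"
        using nn by (intro mult_right_mono c1) auto
      have q: "K1 * (\<tau> * (c * n2 s) + 1/\<tau> * (c * n2 g)) = c * (K1 * (\<tau> * n2 s + n2 g / \<tau>))"
        "(c * ms s) * (c * ms g) = (c * c) * (ms s * ms g)" by (simp_all add: algebra_simps)
      have lin: "2 * (c * P) + 2 * ((c * c) * Q) \<le> (1 + c)\<^sup>2 * (2 * (P + Q))"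
        if "c * P \<le> (1 + c)\<^sup>2 * P" "(c * c) * Q \<le> (1 + c)\<^sup>2 * Q" for P Q
        using that by (simp only: distrib_left mult.left_commute[of _ 2])
      show "2 * (K1 * (\<tau> * (c * n2 s) + 1/\<tau> * (c * n2 g))) + 2 * ((c * ms s) * (c * ms g))
        \<le> (1 + c)\<^sup>2 * (2 * (K1 * (\<tau> * n2 s + n2 g / \<tau>) + ms s * ms g))"
        unfolding q by (rule lin[OF p1 p2])
    qed
    finally show ?thesis .
  qed
  let ?X = "2 * (K1 * (\<tau> * n2 s + n2 g / \<tau>) + ms s * ms g)"
  have X: "0 \<le> ?X" using nn \<tau> K1_nonneg by auto
  have k3: "(\<Sum>L\<in>{R..<2*R}. kint (riesz 1) (dens e3 (?A L)) (dens e3 (?B L))) \<le> ennreal ((1 + 1)\<^sup>2 * ?X)"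
    by (rule *[OF norm_e3 _ _ _ _ near_le_K1(1)]) (auto simp: nn_dens3)
  have k5: "(\<Sum>L\<in>{R..<2*R}. kint (riesz 3) (dens e5 (?A L)) (dens e5 (?B L))) \<le> ennreal ((1 + C5)\<^sup>2 * ?X)"
    by (rule *[OF norm_e5 _ _ _ _ near_le_K1(2)]) (use C5_pos in \<open>auto simp: nn_dens5\<close>)
  have "ennreal (\<Sum>L\<in>{R..<2*R}. BB (?A L) (?B L)) = (\<Sum>L\<in>{R..<2*R}. BBe (?A L) (?B L))"
    by (simp add: BBe_eq[OF A B] BB_nonneg)
  also have "\<dots> = ennreal (1/2) * (\<Sum>L\<in>{R..<2*R}. kint (riesz 1) (dens e3 (?A L)) (dens e3 (?B L)))
     + ennreal w * (\<Sum>L\<in>{R..<2*R}. kint (riesz 3) (dens e5 (?A L)) (dens e5 (?B L)))"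
    by (simp add: BBe_def sum.distrib sum_distrib_left)
  also have "\<dots> \<le> ennreal (1/2) * ennreal ((1 + 1)\<^sup>2 * ?X) + ennreal w * ennreal ((1 + C5)\<^sup>2 * ?X)"
    using k3 k5 by (intro add_mono mult_left_mono) auto
  also have "\<dots> = ennreal (1/2 * ((1 + 1)\<^sup>2 * ?X) + w * ((1 + C5)\<^sup>2 * ?X))"
    using X w by (simp only: ennreal_mult'[symmetric] ennreal_plus[symmetric] zero_le_power2
        zero_le_mult_iff zero_le_divide_iff zero_le_one zero_le_numeral mult_nonneg_nonneg simp_thms)
  also have "1/2 * ((1 + 1)\<^sup>2 * ?X) + w * ((1 + C5)\<^sup>2 * ?X) = Cw * ?X"
    by (simp add: Cw_def algebra_simps)
  finally show ?thesis using X Cw_pos by (simp add: ennreal_le_iff)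
qed

end

section \<open>The reduced energy\<close>

definition slab :: "real \<Rightarrow> real \<Rightarrow> real set" where
  "slab a R = {z. \<bar>z - a\<bar> \<le> R}"

text \<open>Open on the inner side and closed on the outer one, so that it is exactly what separates
  two concentric closed slabs.\<close>

definition annul :: "real \<Rightarrow> real \<Rightarrow> real \<Rightarrow> real set" where
  "annul a R R' = {z. R < \<bar>z - a\<bar> \<and> \<bar>z - a\<bar> \<le> R'}"

lemma mem_slab [simp]: "z \<in> slab a R \<longleftrightarrow> \<bar>z - a\<bar> \<le> R"
  by (simp add: slab_def)

lemma mem_annul [simp]: "z \<in> annul a R R' \<longleftrightarrow> R < \<bar>z - a\<bar> \<and> \<bar>z - a\<bar> \<le> R'"
  by (simp add: annul_def)

lemma slab_sets [measurable]: "slab a R \<in> sets borel"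
  unfolding slab_def by measurable

lemma annul_sets [measurable]: "annul a R R' \<in> sets borel"
  unfolding annul_def by measurable

lemma cut_split: "s = (\<lambda>p. cut X s p + cut (- X) s p)"
  by (auto simp: cut_def)

context star
begin

text \<open>Equals \<open>energy\<close> of every density represented by \<open>s\<close>, once
  \<open>w\<close> is chosen as in \<open>repr_energy\<close>.\<close>

definition F :: "(real \<times> real \<Rightarrow> real) \<Rightarrow> real" where
  "F s = pw s / (\<gamma> - 1) - BB s s"

lemma F_add:
  assumes s: "s \<in> St" and t: "t \<in> St" and "\<And>p. s p = 0 \<or> t p = 0"
  shows "F (\<lambda>p. s p + t p) = F s + F t - 2 * BB s t"
  using pw_add_disjoint[OF assms] BB_commute[OF t s]
  by (simp add: F_def BB_add_left BB_add_right St_add s t add_divide_distrib)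

lemma F_shift: "s \<in> St \<Longrightarrow> F (shift a s) = F s"
  by (simp add: F_def pw_shift BB_shift)

lemma ms_cut_split: "s \<in> St \<Longrightarrow> X \<in> sets borel \<Longrightarrow> ms s = ms (cut X s) + ms (cut (- X) s)"
  using ms_add[OF St_cut[of s X] St_cut[of s "- X"]] cut_split[of s X] by auto

lemma F_cut_split:
  assumes "s \<in> St" "X \<in> sets borel"
  shows "F s = F (cut X s) + F (cut (- X) s) - 2 * BB (cut X s) (cut (- X) s)"
proof -
  have "- X \<in> sets borel" using assms(2) by auto
  then show ?thesis
    using F_add[OF St_cut[OF assms] St_cut[OF assms(1)], of "- X"] cut_split[of s X]
    by (auto simp: cut_def)
qed

lemma ms_cut_le: "s \<in> St \<Longrightarrow> X \<in> sets borel \<Longrightarrow> ms (cut X s) \<le> ms s"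
  by (intro ms_mono St_cut) (auto simp: cut_def StD)

lemma pw_cut_le: "s \<in> St \<Longrightarrow> X \<in> sets borel \<Longrightarrow> pw (cut X s) \<le> pw s"
  by (intro pw_mono St_cut) (auto simp: cut_def StD)

lemma n2_cut_le: "s \<in> St \<Longrightarrow> X \<in> sets borel \<Longrightarrow> n2 (cut X s) \<le> n2 s"
  by (intro n2_mono St_cut) (auto simp: cut_def StD)

lemma ms_cut_mono:
  assumes "s \<in> St" "X \<in> sets borel" "Y \<in> sets borel" "X \<subseteq> Y"
  shows "ms (cut X s) \<le> ms (cut Y s)"
  using assms by (intro ms_mono St_cut) (auto simp: cut_def StD)

lemma ms_cut_Un:
  assumes s: "s \<in> St" and [measurable]: "X \<in> sets borel" "Y \<in> sets borel"
  shows "ms (cut (X \<union> Y) s) \<le> ms (cut X s) + ms (cut Y s)"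
    and "X \<inter> Y = {} \<Longrightarrow> ms (cut (X \<union> Y) s) = ms (cut X s) + ms (cut Y s)"
proof -
  have "ms (cut (X \<union> Y) s) \<le> ms (\<lambda>p. cut X s p + cut Y s p)"
    by (intro ms_mono St_add St_cut s sets.Un assms) (auto simp: cut_def StD(2)[OF s])
  then show "ms (cut (X \<union> Y) s) \<le> ms (cut X s) + ms (cut Y s)"
    using ms_add[OF St_cut[OF s assms(2)] St_cut[OF s assms(3)]] by simp
  assume "X \<inter> Y = {}"
  then have "cut (X \<union> Y) s = (\<lambda>p. cut X s p + cut Y s p)" by (intro ext) (auto simp: cut_def)
  then show "ms (cut (X \<union> Y) s) = ms (cut X s) + ms (cut Y s)"
    using ms_add[OF St_cut[OF s assms(2)] St_cut[OF s assms(3)]] by simp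
qed

section \<open>Tails, smallness, coercivity and nonvanishing\<close>

lemma tail_tendsto:
  assumes s: "s \<in> St"
  shows "(\<lambda>n. ms (cut {z. real n < \<bar>z\<bar>} s)) \<longlonglongrightarrow> 0"
    and "(\<lambda>n. pw (cut {z. real n < \<bar>z\<bar>} s)) \<longlonglongrightarrow> 0"
proof -
  note [measurable] = StD(1)[OF s]
  have ev: "eventually (\<lambda>n. cut {z. real n < \<bar>z\<bar>} s p = 0) sequentially" for p
  proof -
    obtain N where "\<bar>snd p\<bar> \<le> real N" using real_arch_simple by blast
    then have "cut {z. real n < \<bar>z\<bar>} s p = 0" if "N \<le> n" for n using that by (auto simp: cut_def)
    then show ?thesis by (auto simp: eventually_sequentially)
  qed
  have "(\<lambda>n. LINT p|cylm e3. cut {z. real n < \<bar>z\<bar>} s p) \<longlonglongrightarrow> (LINT p|cylm e3. 0)"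
  proof (rule integral_dominated_convergence[where w=s])
    show "AE p in cylm e3. (\<lambda>n. cut {z. real n < \<bar>z\<bar>} s p) \<longlonglongrightarrow> 0"
      using ev by (intro AE_I2 tendsto_eventually)
    show "AE p in cylm e3. norm (cut {z. real n < \<bar>z\<bar>} s p) \<le> s p" for n
      using StD(2)[OF s] by (auto simp: cut_def)
    show "cut {z. real n < \<bar>z\<bar>} s \<in> borel_measurable (cylm e3)" for n by measurable
  qed (use StD(4)[OF s] in auto)
  then show "(\<lambda>n. ms (cut {z. real n < \<bar>z\<bar>} s)) \<longlonglongrightarrow> 0" by (simp add: ms_def)
  have "(\<lambda>n. LINT p|cylm e3. cut {z. real n < \<bar>z\<bar>} s p powr \<gamma>) \<longlonglongrightarrow> (LINT p|cylm e3. 0)"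
  proof (rule integral_dominated_convergence[where w="\<lambda>p. s p powr \<gamma>"])
    show "AE p in cylm e3. (\<lambda>n. cut {z. real n < \<bar>z\<bar>} s p powr \<gamma>) \<longlonglongrightarrow> 0"
    proof (intro AE_I2 tendsto_eventually)
      show "eventually (\<lambda>n. cut {z. real n < \<bar>z\<bar>} s p powr \<gamma> = 0) sequentially" for p
        using ev[of p] by eventually_elim simp
    qed
    show "AE p in cylm e3. norm (cut {z. real n < \<bar>z\<bar>} s p powr \<gamma>) \<le> s p powr \<gamma>" for n
      by (auto simp: cut_def)
    show "(\<lambda>p. cut {z. real n < \<bar>z\<bar>} s p powr \<gamma>) \<in> borel_measurable (cylm e3)" for n by measurable
  qed (use StD(5)[OF s] in auto)
  then show "(\<lambda>n. pw (cut {z. real n < \<bar>z\<bar>} s)) \<longlonglongrightarrow> 0" by (simp add: pw_def)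
qed

text \<open>Interpolation with a threshold \<open>T\<close> for which the pressure contributes at
  most \<open>\<theta> / 2\<close>; smallness of the mass pays for the other half.
  \<open>P + 1\<close> in place of \<open>P\<close> keeps the quotient meaningful for
  \<open>P = 0\<close>.\<close>

lemma n2_small:
  assumes "0 < \<theta>" "0 \<le> P"
  obtains \<epsilon> where "0 < \<epsilon>" "\<And>t. t \<in> St \<Longrightarrow> ms t \<le> \<epsilon> \<Longrightarrow> pw t \<le> P \<Longrightarrow> n2 t \<le> \<theta>"
proof -
  define T where "T = (\<theta> / (2 * (P + 1))) powr (1 / (2 - \<gamma>))"
  have T: "0 < T" "T powr (2 - \<gamma>) = \<theta> / (2 * (P + 1))"
    using assms \<gamma> by (auto simp: T_def powr_powr)
  show ?thesis
  proof (rule that[of "\<theta> / (2 * T)"])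
    show "0 < \<theta> / (2 * T)" using assms T by simp
    fix t assume t: "t \<in> St" "ms t \<le> \<theta> / (2 * T)" "pw t \<le> P"
    have "n2 t \<le> T * ms t + T powr (2 - \<gamma>) * pw t" by (rule n2_le[OF t(1) T(1)])
    also have "T * ms t \<le> T * (\<theta> / (2 * T))" using t T by (intro mult_left_mono) auto
    also have "T * (\<theta> / (2 * T)) = \<theta> / 2" using T by simp
    also have "T powr (2 - \<gamma>) * pw t \<le> T powr (2 - \<gamma>) * (P + 1)" using t by (intro mult_left_mono) auto
    also have "\<dots> = \<theta> / 2" unfolding T(2) using assms by (simp add: field_simps)
    finally show "n2 t \<le> \<theta>" by simp
  qed
qed

text \<open>The order of choices matters: \<open>\<tau>\<close> is fixed from the bound
  \<open>N\<close> on the large partner, and only afterwards is the mass of \<open>t\<close> made so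
  small that its square integral is below \<open>\<theta> / 3 * \<tau>\<close>. Combined with
  \<open>BB_upper\<close> it shows that a density of small mass and bounded pressure interacts
  little with any bounded one.\<close>

lemma young_small:
  assumes "0 < \<theta>" "0 \<le> P" "0 \<le> N" "0 \<le> M"
  obtains \<epsilon> \<tau> where "0 < \<epsilon>" "0 < \<tau>" "\<And>s t. s \<in> St \<Longrightarrow> t \<in> St \<Longrightarrow> ms s \<le> M \<Longrightarrow> n2 s \<le> N \<Longrightarrow>
    ms t \<le> \<epsilon> \<Longrightarrow> pw t \<le> P \<Longrightarrow> \<tau> * n2 s + n2 t / \<tau> + ms s * ms t \<le> \<theta>"
proof -
  define \<tau> where "\<tau> = \<theta> / (3 * (N + 1))"
  have \<tau>: "0 < \<tau>" using assms by (simp add: \<tau>_def)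
  have "0 < \<theta> / 3 * \<tau>" using assms \<tau> by simp
  from n2_small[OF this assms(2)] obtain \<epsilon> where
    \<epsilon>: "0 < \<epsilon>" "\<And>t. t \<in> St \<Longrightarrow> ms t \<le> \<epsilon> \<Longrightarrow> pw t \<le> P \<Longrightarrow> n2 t \<le> \<theta> / 3 * \<tau>" by metis
  show ?thesis
  proof (rule that[of "min \<epsilon> (\<theta> / (3 * (M + 1)))" \<tau>])
    show "0 < min \<epsilon> (\<theta> / (3 * (M + 1)))" using \<epsilon> assms by simp
    fix s t assume s: "s \<in> St" "ms s \<le> M" "n2 s \<le> N"
      and t: "t \<in> St" "ms t \<le> min \<epsilon> (\<theta> / (3 * (M + 1)))" "pw t \<le> P"
    have "\<tau> * n2 s \<le> \<tau> * (N + 1)" using s \<tau> by (intro mult_left_mono) auto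
    also have "\<dots> = \<theta> / 3" using assms by (simp add: \<tau>_def field_simps)
    finally have 1: "\<tau> * n2 s \<le> \<theta> / 3" .
    have "n2 t / \<tau> \<le> \<theta> / 3 * \<tau> / \<tau>" using \<epsilon>(2)[OF t(1)] t \<tau> by (intro divide_right_mono) auto
    then have 2: "n2 t / \<tau> \<le> \<theta> / 3" using \<tau> by simp
    have "ms s * ms t \<le> (M + 1) * (\<theta> / (3 * (M + 1)))"
      using s t ms_nonneg assms by (intro mult_mono) auto
    also have "\<dots> = \<theta> / 3" using assms by (simp add: field_simps)
    finally show "\<tau> * n2 s + n2 t / \<tau> + ms s * ms t \<le> \<theta>" using 1 2 by linarith
  qed (rule \<tau>)
qed

lemma BB_tail:
  assumes s: "s \<in> St"
  shows "(\<lambda>n. BB s (cut {z. real n < \<bar>z\<bar>} s)) \<longlonglongrightarrow> 0"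
proof (rule tendstoI)
  fix e :: real assume e: "0 < e"
  have "0 < e / (2 * Kb)" using e Kb_pos by simp
  from young_small[OF this pw_nonneg[of s] n2_nonneg[of s] ms_nonneg[OF s]] obtain \<epsilon> \<tau> where
    \<epsilon>: "0 < \<epsilon>" "0 < \<tau>" "\<And>s' t. s' \<in> St \<Longrightarrow> t \<in> St \<Longrightarrow> ms s' \<le> ms s \<Longrightarrow> n2 s' \<le> n2 s \<Longrightarrow>
      ms t \<le> \<epsilon> \<Longrightarrow> pw t \<le> pw s \<Longrightarrow> \<tau> * n2 s' + n2 t / \<tau> + ms s' * ms t \<le> e / (2 * Kb)" by metis
  have "eventually (\<lambda>n. ms (cut {z. real n < \<bar>z\<bar>} s) < \<epsilon>) sequentially"
    using tail_tendsto(1)[OF s] \<epsilon> by (intro order_tendstoD)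
  then show "eventually (\<lambda>n. dist (BB s (cut {z. real n < \<bar>z\<bar>} s)) 0 < e) sequentially"
  proof eventually_elim
    case (elim n)
    have X: "{z. real n < \<bar>z\<bar>} \<in> sets borel" by measurable
    note t = St_cut[OF s X]
    have "\<tau> * n2 s + n2 (cut {z. real n < \<bar>z\<bar>} s) / \<tau> + ms s * ms (cut {z. real n < \<bar>z\<bar>} s) \<le> e / (2 * Kb)"
      using elim by (intro \<epsilon>(3)[OF s t _ _ _ pw_cut_le[OF s X]]) auto
    then have "BB s (cut {z. real n < \<bar>z\<bar>} s) \<le> Kb * (e / (2 * Kb))"
      using Kb_pos by (intro order_trans[OF BB_upper[OF s t \<epsilon>(2)]] mult_left_mono) auto
    also have "\<dots> < e" using e Kb_pos by simp
    finally show ?case using BB_nonneg by simp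
  qed
qed

text \<open>Cutting off the tail lowers the pressure term. The interaction lost is twice core with
  tail plus tail with tail, which is at most twice the interaction of all of \<open>s\<close> with
  the tail.\<close>

lemma F_truncate:
  assumes s: "s \<in> St"
  shows "F (cut {z. \<bar>z\<bar> \<le> real n} s) \<le> F s + 2 * BB s (cut {z. real n < \<bar>z\<bar>} s)"
proof -
  let ?X = "{z. \<bar>z\<bar> \<le> real n}"
  have X: "?X \<in> sets borel" by measurable
  then have X': "- ?X \<in> sets borel" by (rule borel_comp)
  have eq: "- ?X = {z. real n < \<bar>z\<bar>}" by auto
  define c t where "c = cut ?X s" and "t = cut (- ?X) s"
  have c: "c \<in> St" unfolding c_def by (rule St_cut[OF s X])
  have t: "t \<in> St" unfolding t_def by (rule St_cut[OF s X'])
  have ts: "s = (\<lambda>p. c p + t p)" unfolding c_def t_def by (rule cut_split)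
  have 1: "BB s s = BB c c + 2 * BB c t + BB t t"
    unfolding ts by (simp add: BB_add_left BB_add_right St_add c t BB_commute[OF t c])
  have 2: "BB s t = BB c t + BB t t"
    unfolding ts by (simp add: BB_add_left c t)
  have "pw c / (\<gamma> - 1) \<le> pw s / (\<gamma> - 1)"
    using pw_cut_le[OF s X] \<gamma> unfolding c_def by (intro divide_right_mono) auto
  then show ?thesis using 1 2 BB_nonneg[of t t] BB_nonneg[of c t]
    unfolding F_def eq[symmetric] c_def[symmetric] t_def[symmetric] by linarith
qed

text \<open>Interpolation bounds the interaction by half of the pressure term plus a constant that
  depends on the mass only.\<close>

lemma coercive:
  assumes "0 \<le> M"
  obtains C where "0 < C" "\<And>s. s \<in> St \<Longrightarrow> ms s \<le> M \<Longrightarrow> pw s / (2 * (\<gamma> - 1)) - C \<le> F s"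
proof -
  \<comment> \<open>Chosen such that \<open>2 * Kb * \<theta> = 1 / (2 * (\<gamma> - 1))\<close>,
    half of the pressure coefficient; \<open>T\<close> is the threshold whose power
    \<open>2 - \<gamma>\<close> equals \<open>\<theta>\<close>.\<close>
  define \<theta> where "\<theta> = 1 / (4 * Kb * (\<gamma> - 1))"
  define T where "T = \<theta> powr (1 / (2 - \<gamma>))"
  have \<theta>: "0 < \<theta>" using Kb_pos \<gamma> by (simp add: \<theta>_def)
  have T: "0 < T" "T powr (2 - \<gamma>) = \<theta>" using \<theta> \<gamma> by (auto simp: T_def powr_powr)
  define C where "C = Kb * (2 * (T * M) + M * M) + 1"
  show ?thesis
  proof (rule that[of C])
    show "0 < C" using Kb_pos T assms by (simp add: C_def add_nonneg_pos)
    fix s assume s: "s \<in> St" "ms s \<le> M"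
    have "n2 s \<le> T * ms s + \<theta> * pw s" using n2_le[OF s(1) T(1)] T(2) by simp
    also have "T * ms s \<le> T * M" using s T by simp
    finally have n: "n2 s \<le> T * M + \<theta> * pw s" by simp
    have m: "ms s * ms s \<le> M * M" using s ms_nonneg[OF s(1)] by (intro mult_mono) auto
    have "BB s s \<le> Kb * (1 * n2 s + n2 s / 1 + ms s * ms s)"
      by (rule BB_upper) (use s in auto)
    also have "\<dots> \<le> Kb * (2 * (T * M) + 2 * (\<theta> * pw s) + M * M)"
      using n m Kb_pos by (intro mult_left_mono) auto
    also have "\<dots> = C - 1 + 2 * Kb * \<theta> * pw s" by (simp add: C_def algebra_simps)
    also have "2 * Kb * \<theta> = 1 / (2 * (\<gamma> - 1))" using Kb_pos \<gamma> by (simp add: \<theta>_def field_simps)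
    finally have B: "BB s s \<le> C - 1 + pw s / (2 * (\<gamma> - 1))" by simp
    define q where "q = pw s / (2 * (\<gamma> - 1))"
    have "pw s / (\<gamma> - 1) = 2 * q" using \<gamma> by (simp add: q_def divide_simps)
    then show "pw s / (2 * (\<gamma> - 1)) - C \<le> F s"
      using B unfolding F_def q_def[symmetric] by linarith
  qed
qed

text \<open>Contrapositive of \<open>BB_bound\<close>: if all slabs of half-width \<open>D\<close>
  carried little mass, each of its three terms would be at most \<open>\<eta> / 4\<close>. The
  constants \<open>\<kappa>\<close>, \<open>\<delta>\<close> and \<open>D\<close> are adapted to
  these three terms in turn.\<close>

lemma nonvanishing:
  assumes "0 \<le> M" "0 \<le> N" "0 < \<eta>"
  obtains \<delta> R where "0 < \<delta>" "1 \<le> R"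
    "\<And>s. s \<in> St \<Longrightarrow> ms s \<le> M \<Longrightarrow> n2 s \<le> N \<Longrightarrow> \<eta> \<le> BB s s \<Longrightarrow> \<exists>a. \<delta> < ms (cut (slab a R) s)"
proof -
  define \<kappa> where "\<kappa> = \<eta> / (8 * Cw * (N + 1))"
  have \<kappa>: "0 < \<kappa>" using assms Cw_pos by (simp add: \<kappa>_def)
  from near_small[OF this] obtain \<epsilon> where \<epsilon>: "0 < \<epsilon>" "\<epsilon> \<le> 1"
    "(\<integral>\<^sup>+x. riesz_near 1 \<epsilon> (x::real^3) \<partial>lborel) \<le> ennreal \<kappa>"
    "(\<integral>\<^sup>+x. riesz_near 3 \<epsilon> (x::real^5) \<partial>lborel) \<le> ennreal \<kappa>" by metis
  define \<delta> where "\<delta> = \<eta> * \<epsilon>^3 / (4 * Cw * (M + 1))"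
  have \<delta>: "0 < \<delta>" using assms Cw_pos \<epsilon> by (simp add: \<delta>_def)
  define D where "D = max 1 (4 * Cw * M * M / \<eta>)"
  have D: "1 \<le> D" by (simp add: D_def)
  show ?thesis
  proof (rule that[OF \<delta> D])
    fix s assume s: "s \<in> St" "ms s \<le> M" "n2 s \<le> N" "\<eta> \<le> BB s s"
    show "\<exists>a. \<delta> < ms (cut (slab a D) s)"
    proof (rule ccontr)
      assume "\<not> ?thesis"
      then have le: "ms (cut (slab a D) s) \<le> \<delta>" for a by (meson not_le)
      have "ms (cut {z. \<bar>z - a\<bar> < D} s) \<le> \<delta>" for a
      proof -
        have "{z. \<bar>z - a\<bar> < D} \<in> sets borel" by measurable
        then have "ms (cut {z. \<bar>z - a\<bar> < D} s) \<le> ms (cut (slab a D) s)"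
          by (intro ms_cut_mono s) auto
        then show ?thesis using le[of a] by simp
      qed
      then have "BB s s \<le> Cw * (\<kappa> * (1 * n2 s + n2 s / 1) + \<delta> * ms s / \<epsilon>^3 + ms s * ms s / D)"
        using \<kappa> \<delta> D \<epsilon> s by (intro BB_bound) auto
      also have "\<dots> < \<eta>"
      proof -
        have "\<kappa> * (1 * n2 s + n2 s / 1) \<le> \<kappa> * (2 * N)" using s \<kappa> by (intro mult_left_mono) auto
        then have "Cw * (\<kappa> * (1 * n2 s + n2 s / 1)) \<le> Cw * (\<kappa> * (2 * N))" using Cw_pos by simp
        also have "\<dots> < Cw * (\<kappa> * (2 * (N + 1)))" using Cw_pos \<kappa> by simp
        also have "\<dots> = 2 * (Cw * (N + 1)) * \<kappa>" by (simp only: mult_ac)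
        also have "\<dots> = \<eta> / 4"
          unfolding \<kappa>_def mult.assoc[of 8] using Cw_pos assms by (simp add: divide_simps)
        finally have 1: "Cw * (\<kappa> * (1 * n2 s + n2 s / 1)) < \<eta> / 4" .
        have "\<delta> * ms s / \<epsilon>^3 \<le> \<delta> * (M + 1) / \<epsilon>^3"
          using s \<delta> \<epsilon> by (intro divide_right_mono mult_left_mono) auto
        then have "Cw * (\<delta> * ms s / \<epsilon>^3) \<le> Cw * (\<delta> * (M + 1) / \<epsilon>^3)"
          using Cw_pos by (intro mult_left_mono) auto
        also have "\<dots> = \<eta> / 4" using Cw_pos assms \<epsilon> by (simp add: \<delta>_def)
        finally have 2: "Cw * (\<delta> * ms s / \<epsilon>^3) \<le> \<eta> / 4" .
        have "ms s * ms s / D \<le> M * M / D"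
          using s ms_nonneg[OF s(1)] D by (intro divide_right_mono mult_mono) auto
        also have "\<dots> \<le> \<eta> / (4 * Cw)"
        proof -
          have "4 * Cw * M * M / \<eta> \<le> D" by (simp add: D_def)
          then have "4 * Cw * M * M \<le> D * \<eta>" using assms by (simp add: pos_divide_le_eq)
          then show ?thesis using D Cw_pos by (simp add: divide_le_eq le_divide_eq mult_ac)
        qed
        finally have "Cw * (ms s * ms s / D) \<le> Cw * (\<eta> / (4 * Cw))"
          using Cw_pos by (intro mult_left_mono) auto
        also have "\<dots> = \<eta> / 4" using Cw_pos by simp
        finally have 3: "Cw * (ms s * ms s / D) \<le> \<eta> / 4" .
        show ?thesis unfolding distrib_left[of Cw] using 1 2 3 assms(3) by linarith
      qed
      finally show False using s by simp
    qed
  qed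
qed

text \<open>Mass spread along the axis costs little pressure energy.\<close>

lemma block:
  obtains V where "0 < V" "\<And>\<mu> L. 0 \<le> \<mu> \<Longrightarrow> 0 < L \<Longrightarrow>
    \<exists>b\<in>St. ms b = \<mu> \<and> pw b = \<mu> powr \<gamma> * (V * L) powr (1 - \<gamma>) \<and> (\<forall>p. b p \<noteq> 0 \<longrightarrow> 0 < snd p \<and> snd p \<le> L)"
proof -
  define v where "v = (\<integral>\<^sup>+p. ennreal (fst p ^ 0) * indicator ({..<1} \<times> {0<..1}) p \<partial>cylm e3)"
  have v: "0 < v" "v < \<infinity>"
    unfolding v_def by (rule cylm_unit_box; simp)+
  \<comment> \<open>Scaling the unit box gives the area of the cross section, so
    \<open>V * L\<close> is the volume of the cylinder of length \<open>L\<close>.\<close>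
  define V where "V = Rc^2 * enn2real v"
  have V: "0 < V" using v Rc by (simp add: V_def enn2real_positive_iff)
  have em: "emeasure (cylm e3) ({..<Rc} \<times> {0<..L}) = ennreal (V * L)" if "0 < L" for L
  proof -
    have "emeasure (cylm e3) ({..<Rc} \<times> {0<..L}) = (\<integral>\<^sup>+p. ennreal (fst p ^ 0) * indicator ({..<Rc} \<times> {0<..L}) p \<partial>cylm e3)"
      by simp
    also have "\<dots> = ennreal (Rc^2 * (L - 0)) * v"
      using Rc that unfolding v_def by (subst cylm_box) auto
    also have "v = ennreal (enn2real v)" using v by simp
    also have "ennreal (Rc^2 * (L - 0)) * ennreal (enn2real v) = ennreal (V * L)"
      using that by (simp add: V_def ennreal_mult'[symmetric] mult_ac)
    finally show ?thesis .
  qed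
  show ?thesis
  proof (rule that[OF V])
    fix \<mu> L :: real assume \<mu>: "0 \<le> \<mu>" and L: "0 < L"
    let ?S = "{..<Rc} \<times> {0<..L}"
    define c where "c = \<mu> / (V * L)"
    define b where "b p = c * indicator ?S p" for p :: "real \<times> real"
    have c: "0 \<le> c" using \<mu> V L by (simp add: c_def)
    have S: "?S \<in> sets (cylm e3)" by simp
    have fin: "emeasure (cylm e3) ?S < \<infinity>" using em[OF L] by simp
    have meas: "measure (cylm e3) ?S = V * L" using em[OF L] V L by (simp add: measure_def)
    have pwb: "(\<lambda>p. b p powr \<gamma>) = (\<lambda>p. c powr \<gamma> * indicator ?S p)"
      using \<gamma> by (auto simp: b_def indicator_def)
    have int: "integrable (cylm e3) (indicator ?S :: _ \<Rightarrow> real)"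
      using S fin by (rule integrable_real_indicator)
    have "b \<in> St"
      unfolding St_def using c int by (auto simp: pwb) (auto simp: b_def [abs_def])
    moreover have "ms b = \<mu>"
      unfolding ms_def b_def using meas V L by (simp add: c_def)
    moreover have "pw b = \<mu> powr \<gamma> * (V * L) powr (1 - \<gamma>)"
    proof -
      have "pw b = c powr \<gamma> * (V * L)" unfolding pw_def pwb using meas by simp
      also have "\<dots> = \<mu> powr \<gamma> * ((V * L) powr 1 / (V * L) powr \<gamma>)"
        unfolding c_def using \<mu> V L by (simp add: powr_divide)
      finally show ?thesis by (simp only: powr_diff)
    qed
    moreover have "\<forall>p. b p \<noteq> 0 \<longrightarrow> 0 < snd p \<and> snd p \<le> L"
      by (auto simp: b_def indicator_def split: if_splits)
    ultimately show "\<exists>b\<in>St. ms b = \<mu> \<and> pw b = \<mu> powr \<gamma> * (V * L) powr (1 - \<gamma>) \<and> (\<forall>p. b p \<noteq> 0 \<longrightarrow> 0 < snd p \<and> snd p \<le> L)"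
      by blast
  qed
qed

lemma powr_tendsto_0: "0 < c \<Longrightarrow> a < 0 \<Longrightarrow> (\<lambda>n. (c * real n) powr a) \<longlonglongrightarrow> 0"
  by (intro tendsto_neg_powr filterlim_tendsto_pos_mult_at_top[OF tendsto_const] filterlim_real_sequentially)

text \<open>Compare both terms after multiplication by the length of the block: the pressure becomes
  a multiple of \<open>(V * L) powr (2 - \<gamma>)\<close>, which tends to 0, while the interaction
  stays bounded below, since all distances are at most the length plus a constant.\<close>

lemma negative_block:
  assumes \<mu>: "0 < \<mu>"
  obtains b where "b \<in> St" "ms b = \<mu>" "F b < 0"
proof -
  obtain V where V: "0 < V" "\<And>\<mu> L. 0 \<le> \<mu> \<Longrightarrow> 0 < L \<Longrightarrow>
    \<exists>b\<in>St. ms b = \<mu> \<and> pw b = \<mu> powr \<gamma> * (V * L) powr (1 - \<gamma>) \<and> (\<forall>p. b p \<noteq> 0 \<longrightarrow> 0 < snd p \<and> snd p \<le> L)"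
    using block by metis
  \<comment> \<open>Made so that the pressure term of a block of length n is
    \<open>k * (V * n) powr (2 - \<gamma>) / (6 * n)\<close>; the 6 comes from
    \<open>2 * (n + 2 * Rc) \<le> 6 * n\<close> for \<open>Rc \<le> n\<close>.\<close>
  define k where "k = \<mu> powr \<gamma> * (6 / V) / (\<gamma> - 1)"
  have "(\<lambda>n. k * (V * real n) powr (2 - \<gamma>)) \<longlonglongrightarrow> k * 0"
    using V \<gamma> by (intro tendsto_mult tendsto_const powr_tendsto_0) auto
  then have "eventually (\<lambda>n. k * (V * real n) powr (2 - \<gamma>) < \<mu> * \<mu>) sequentially"
    using \<mu> by (intro order_tendstoD) auto
  moreover have "eventually (\<lambda>n. Rc \<le> real n \<and> 1 \<le> n) sequentially"
    by (intro eventually_conj eventually_ge_at_top) (meson eventually_at_top_linorder nat_ceiling_le_eq)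
  ultimately have "eventually (\<lambda>n. k * (V * real n) powr (2 - \<gamma>) < \<mu> * \<mu> \<and> Rc \<le> real n \<and> 1 \<le> n) sequentially"
    by (rule eventually_conj)
  then obtain n where n: "k * (V * real n) powr (2 - \<gamma>) < \<mu> * \<mu>" "Rc \<le> real n" "1 \<le> n"
    by (auto simp: eventually_sequentially)
  have L: "0 < real n" using n by simp
  obtain b where b: "b \<in> St" "ms b = \<mu>" "pw b = \<mu> powr \<gamma> * (V * real n) powr (1 - \<gamma>)"
    "\<And>p. b p \<noteq> 0 \<Longrightarrow> 0 < snd p \<and> snd p \<le> real n"
    using V(2)[of \<mu> "real n"] \<mu> L by auto
  have "ms b * ms b / (2 * (real n + 2 * Rc)) \<le> BB b b"
  proof (rule BB_lower[OF b(1) b(1) L])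
    fix p q assume "b p \<noteq> 0" "b q \<noteq> 0"
    then show "\<bar>snd p - snd q\<bar> \<le> real n" using b(4)[of p] b(4)[of q] by auto
  qed
  moreover have "\<mu> * \<mu> / (6 * real n) \<le> ms b * ms b / (2 * (real n + 2 * Rc))"
    unfolding b(2) using n Rc \<mu> by (intro divide_left_mono) auto
  moreover have "pw b / (\<gamma> - 1) = k * (V * real n) powr (2 - \<gamma>) / (6 * real n)"
  proof -
    have "(V * real n) powr (2 - \<gamma>) = (V * real n) powr (1 - \<gamma>) * (V * real n)"
    proof -
      have "1 + (1 - \<gamma>) = 2 - \<gamma>" by simp
      then show ?thesis using powr_mult_base[of "V * real n" "1 - \<gamma>"] V(1) L by (simp only: mult.commute) simp
    qed
    then show ?thesis unfolding b(3) k_def using V(1) L \<gamma> by (simp add: field_simps)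
  qed
  moreover have "k * (V * real n) powr (2 - \<gamma>) / (6 * real n) < \<mu> * \<mu> / (6 * real n)"
    using n L by (intro divide_strict_right_mono) auto
  ultimately have "F b < 0" unfolding F_def by linarith
  then show ?thesis using b that by blast
qed

text \<open>Truncated copies of \<open>s\<close> and \<open>t\<close> and a long dilute block
  carrying the missing mass are placed one after another along the axis. Disjoint supports make the
  pressures add, the nonnegative interactions can only lower the energy, and the errors (two tails
  and the pressure of the block) vanish as the truncation grows. The block is what admits masses
  adding up to less than \<open>M\<close>.\<close>

lemma subadditive:
  assumes s: "s \<in> St" and t: "t \<in> St" and M: "ms s + ms t \<le> M"
    and h: "\<And>u. u \<in> St \<Longrightarrow> ms u = M \<Longrightarrow> h \<le> F u"
  shows "h \<le> F s + F t"
proof -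
  obtain V where V: "0 < V" "\<And>\<mu> L. 0 \<le> \<mu> \<Longrightarrow> 0 < L \<Longrightarrow>
    \<exists>b\<in>St. ms b = \<mu> \<and> pw b = \<mu> powr \<gamma> * (V * L) powr (1 - \<gamma>) \<and> (\<forall>p. b p \<noteq> 0 \<longrightarrow> 0 < snd p \<and> snd p \<le> L)"
    using block by metis
  let ?T = "\<lambda>s n. BB s (cut {z. real n < \<bar>z\<bar>} s)"
  let ?bd = "\<lambda>n. F s + 2 * ?T s n + (F t + 2 * ?T t n) + M powr \<gamma> * (V * real n) powr (1 - \<gamma>) / (\<gamma> - 1)"
  have lim: "?bd \<longlonglongrightarrow> F s + 2 * 0 + (F t + 2 * 0) + M powr \<gamma> * 0 / (\<gamma> - 1)"
    using V \<gamma> by (intro tendsto_intros BB_tail s t powr_tendsto_0) auto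
  have "h \<le> ?bd n" if n: "1 \<le> n" for n
  proof -
    let ?X = "{z. \<bar>z\<bar> \<le> real n}"
    have X: "?X \<in> sets borel" by measurable
    define s1 where "s1 = cut ?X s"
    define t0 where "t0 = cut ?X t"
    \<comment> \<open>The supports come to lie in [-n, n], in [n+1, 3n+1] and, for the block, in
      (3n+1, 4n+1].\<close>
    define t1 where "t1 = shift (- (2 * real n + 1)) t0"
    have s1: "s1 \<in> St" unfolding s1_def by (rule St_cut[OF s X])
    have t0: "t0 \<in> St" unfolding t0_def by (rule St_cut[OF t X])
    have t1: "t1 \<in> St" unfolding t1_def by (rule St_shift[OF t0])
    have sup1: "\<bar>snd p\<bar> \<le> real n" if "s1 p \<noteq> 0" for p using that by (auto simp: s1_def cut_def split: if_splits)
    have sup2: "real n + 1 \<le> snd p \<and> snd p \<le> 3 * real n + 1" if "t1 p \<noteq> 0" for p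
      using that by (auto simp: t1_def t0_def shift_def cut_def split: if_splits)
    define \<mu> where "\<mu> = M - ms s1 - ms t1"
    have mt: "ms t1 = ms t0" unfolding t1_def by (rule ms_shift[OF t0])
    have \<mu>: "0 \<le> \<mu>" "\<mu> \<le> M"
      using ms_cut_le[OF s X] ms_cut_le[OF t X] M ms_nonneg[OF s1] ms_nonneg[OF t0] mt
      unfolding \<mu>_def s1_def t0_def by auto
    obtain b0 where b0: "b0 \<in> St" "ms b0 = \<mu>" "pw b0 = \<mu> powr \<gamma> * (V * real n) powr (1 - \<gamma>)"
      "\<And>p. b0 p \<noteq> 0 \<Longrightarrow> 0 < snd p \<and> snd p \<le> real n"
      using V(2)[OF \<mu>(1), of "real n"] n by auto
    define b where "b = shift (- (3 * real n + 1)) b0"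
    have b: "b \<in> St" unfolding b_def by (rule St_shift[OF b0(1)])
    have sup3: "3 * real n + 1 < snd p" if "b p \<noteq> 0" for p
      using b0(4)[of "(fst p, snd p + - (3 * real n + 1))"] that unfolding b_def shift_def by simp
    define u where "u p = s1 p + t1 p" for p
    have u: "u \<in> St" unfolding u_def by (rule St_add[OF s1 t1])
    have d1: "s1 p = 0 \<or> t1 p = 0" for p using sup1[of p] sup2[of p] by linarith
    have d2: "u p = 0 \<or> b p = 0" for p
      using sup1[of p] sup2[of p] sup3[of p] unfolding u_def by linarith
    have Fu: "F u \<le> F s1 + F t0"
      using F_add[OF s1 t1 d1] BB_nonneg[of s1 t1] F_shift[OF t0] unfolding u_def t1_def by simp
    have "h \<le> F (\<lambda>p. u p + b p)"
    proof (rule h[OF St_add[OF u b]])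
      show "ms (\<lambda>p. u p + b p) = M"
        using ms_add[OF u b] ms_add[OF s1 t1] b0(2) ms_shift[OF b0(1)] unfolding u_def b_def \<mu>_def by simp
    qed
    also have "\<dots> \<le> F u + F b" using F_add[OF u b d2] BB_nonneg[of u b] by simp
    also have "F b \<le> M powr \<gamma> * (V * real n) powr (1 - \<gamma>) / (\<gamma> - 1)"
    proof -
      have "F b = F b0" unfolding b_def by (rule F_shift[OF b0(1)])
      also have "\<dots> \<le> pw b0 / (\<gamma> - 1)" using BB_nonneg by (simp add: F_def)
      also have "\<dots> \<le> M powr \<gamma> * (V * real n) powr (1 - \<gamma>) / (\<gamma> - 1)"
        unfolding b0(3) using \<mu> \<gamma> by (intro divide_right_mono mult_right_mono powr_mono2) auto
      finally show ?thesis .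
    qed
    also have "F u \<le> (F s + 2 * ?T s n) + (F t + 2 * ?T t n)"
      using Fu F_truncate[OF s, of n] F_truncate[OF t, of n] unfolding s1_def t0_def by linarith
    finally show ?thesis by simp
  qed
  then have "h \<le> F s + 2 * 0 + (F t + 2 * 0) + M powr \<gamma> * 0 / (\<gamma> - 1)"
    by (intro LIMSEQ_le_const[OF lim]) blast
  then show ?thesis by simp
qed

end

section \<open>Tightness of minimizing sequences\<close>

lemma cut_cut: "cut X (cut Y s) = cut (X \<inter> Y) s"
  by (intro ext) (auto simp: cut_def)

text \<open>These are Levy's concentration functions: \<open>Q i R\<close> is the largest mass found
  at scale \<open>R\<close>, a diagonal argument over the integers \<open>R\<close> makes it
  converge along a subsequence, and \<open>\<alpha>\<close> is the supremum of the limits. The index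
  type of the centres is left open, so that single centres and pairs of centres are both
  covered.\<close>

lemma concentration_subseq:
  fixes g :: "nat \<Rightarrow> 'i \<Rightarrow> nat \<Rightarrow> real"
  assumes bd: "\<And>i a R. 0 \<le> g i a R" "\<And>i a R. g i a R \<le> M"
    and mono: "\<And>i a R R'. R \<le> R' \<Longrightarrow> g i a R \<le> g i a R'"
  obtains \<phi> :: "nat \<Rightarrow> nat" and \<alpha> where "strict_mono \<phi>" "0 \<le> \<alpha>" "\<alpha> \<le> M"
    "\<And>\<epsilon>. 0 < \<epsilon> \<Longrightarrow> \<exists>R. \<forall>R'\<ge>R. \<forall>\<^sub>F i in sequentially. \<exists>a. \<alpha> - \<epsilon> < g (\<phi> i) a R'"
    "\<And>\<epsilon> R. 0 < \<epsilon> \<Longrightarrow> \<forall>\<^sub>F i in sequentially. \<forall>a. g (\<phi> i) a R < \<alpha> + \<epsilon>"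
proof -
  define Q where "Q i R = (SUP a. g i a R)" for i R
  have bdd: "bdd_above (range (\<lambda>a. g i a R))" for i R
    by (rule bdd_aboveI[of _ M]) (use bd(2) in auto)
  have up: "g i a R \<le> Q i R" for i a R unfolding Q_def by (rule cSUP_upper[OF _ bdd]) simp
  have QM: "0 \<le> Q i R" "Q i R \<le> M" for i R
    using bd(1) up[of i _ R] order_trans apply blast
    unfolding Q_def by (rule cSUP_least) (auto intro: bd)
  have Qmono: "Q i R \<le> Q i R'" if "R \<le> R'" for i R R'
    unfolding Q_def by (rule cSUP_mono[OF _ bdd]) (use mono[OF that] in auto)
  have nQ: "norm (Q i R) \<le> M" for i R using QM[of i R] by simp
  obtain \<phi> :: "nat \<Rightarrow> nat" where \<phi>: "strict_mono \<phi>" "\<And>R. \<exists>l. (\<lambda>i. Q (\<phi> i) R) \<longlonglongrightarrow> l"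
    by (rule function_convergent_subsequence[of "UNIV :: nat set" Q M]) (use nQ in auto)
  then obtain q where q: "\<And>R. (\<lambda>i. Q (\<phi> i) R) \<longlonglongrightarrow> q R" by metis
  have qM: "0 \<le> q R" "q R \<le> M" for R
    using LIMSEQ_le_const[OF q, of 0 R] LIMSEQ_le_const2[OF q, of R M] QM by auto
  have qmono: "q R \<le> q R'" if "R \<le> R'" for R R'
    using LIMSEQ_le[OF q q, of R R'] Qmono[OF that] by auto
  define \<alpha> where "\<alpha> = (SUP R. q R)"
  have bq: "bdd_above (range q)" by (rule bdd_aboveI[of _ M]) (use qM in auto)
  have qa: "q R \<le> \<alpha>" for R unfolding \<alpha>_def by (rule cSUP_upper[OF _ bq]) simp
  show ?thesis
  proof (rule that[OF \<phi>(1)])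
    show "0 \<le> \<alpha>" using qM(1)[of 0] qa[of 0] by simp
    show "\<alpha> \<le> M" unfolding \<alpha>_def by (rule cSUP_least) (auto intro: qM)
    fix \<epsilon> :: real assume \<epsilon>: "0 < \<epsilon>"
    show "\<exists>R. \<forall>R'\<ge>R. \<forall>\<^sub>F i in sequentially. \<exists>a. \<alpha> - \<epsilon> < g (\<phi> i) a R'"
    proof -
      have "\<alpha> - \<epsilon> < \<alpha>" using \<epsilon> by simp
      then obtain R where R: "\<alpha> - \<epsilon> < q R"
        unfolding \<alpha>_def using less_cSUP_iff[OF _ bq] by auto
      have "\<forall>\<^sub>F i in sequentially. \<exists>a. \<alpha> - \<epsilon> < g (\<phi> i) a R'" if "R \<le> R'" for R'
      proof -
        have "\<alpha> - \<epsilon> < q R'" using R qmono[OF that] by simp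
        then have "\<forall>\<^sub>F i in sequentially. \<alpha> - \<epsilon> < Q (\<phi> i) R'" using q by (intro order_tendstoD)
        then show ?thesis
        proof eventually_elim
          case (elim i)
          then show ?case unfolding Q_def using less_cSUP_iff[OF _ bdd] by auto
        qed
      qed
      then show ?thesis by blast
    qed
    fix R
    have "q R < \<alpha> + \<epsilon>" using qa[of R] \<epsilon> by simp
    then have "\<forall>\<^sub>F i in sequentially. Q (\<phi> i) R < \<alpha> + \<epsilon>" using q by (intro order_tendstoD)
    then show "\<forall>\<^sub>F i in sequentially. \<forall>a. g (\<phi> i) a R < \<alpha> + \<epsilon>"
      by eventually_elim (use up le_less_trans in blast)
  qed
qed

context star
begin

text \<open>What remains outside \<open>X\<close> lies in the annulus up to \<open>R'\<close> or at
  axial distance at least \<open>D\<close> from the slab. \<open>X\<close> may exceed the slab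
  because the remainder is also taken outside two slabs at once.\<close>

lemma BB_slab_rest:
  assumes s: "s \<in> St" and M: "ms s = M" and X: "X \<in> sets borel" "slab a L \<subseteq> X"
    and D: "1 \<le> D" "L + D \<le> R'"
  shows "BB (cut (slab a L) s) (cut (- X) s) \<le>
    BB (cut (slab a L) s) (cut (annul a L R') s) + Cw * (M * M / D)"
proof -
  let ?i = "cut (slab a L) s" and ?n = "cut (annul a L R') s"
    and ?f = "cut {z. R' < \<bar>z - a\<bar>} s"
  have i: "?i \<in> St" by (rule St_cut[OF s]) measurable
  have n: "?n \<in> St" by (rule St_cut[OF s]) measurable
  have f: "?f \<in> St" by (rule St_cut[OF s]) measurable
  have r: "cut (- X) s \<in> St" using X by (intro St_cut[OF s] borel_comp)
  have "BB ?i (cut (- X) s) \<le> BB ?i (\<lambda>p. ?n p + ?f p)"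
  proof (rule BB_mono[OF i i r St_add[OF n f]])
    fix p show "cut (- X) s p \<le> ?n p + ?f p"
      using X(2) StD(2)[OF s, of p] by (auto simp: cut_def subset_iff not_less)
  qed simp
  also have "\<dots> = BB ?i ?n + BB ?i ?f" by (rule BB_add_right[OF n f i])
  also have "BB ?i ?f \<le> Cw * (ms ?i * ms ?f / D)"
  proof (rule BB_far[OF i f D(1)])
    fix p q assume "?i p \<noteq> 0" "?f q \<noteq> 0"
    then have "\<bar>snd p - a\<bar> \<le> L" "R' < \<bar>snd q - a\<bar>" by (auto simp: cut_def split: if_splits)
    then show "D \<le> \<bar>snd p - snd q\<bar>" using D by linarith
  qed
  also have "\<dots> \<le> Cw * (M * M / D)"
  proof (intro mult_left_mono divide_right_mono mult_mono)
    show "ms ?i \<le> M" "ms ?f \<le> M" unfolding M[symmetric] by (intro ms_cut_le s; measurable)+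
    show "0 \<le> ms ?f" by (rule ms_nonneg[OF f])
    show "0 \<le> M" using M ms_nonneg[OF s] by simp
  qed (use D Cw_pos in auto)
  finally show ?thesis by simp
qed

lemma n2_le_mass: "s \<in> St \<Longrightarrow> ms s \<le> M \<Longrightarrow> pw s \<le> P \<Longrightarrow> n2 s \<le> M + P"
  using n2_le[of s 1] by simp

lemma ms_annulus:
  assumes s: "s \<in> St" and "R \<le> R'"
  shows "ms (cut (slab a R') s) = ms (cut (slab a R) s) + ms (cut (annul a R R') s)"
proof -
  have "slab a R' = slab a R \<union> (annul a R R')" using assms(2) by (auto simp: set_eq_iff)
  then have "ms (cut (slab a R') s) = ms (cut (slab a R \<union> (annul a R R')) s)" by simp
  also have "\<dots> = ms (cut (slab a R) s) + ms (cut (annul a R R') s)"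
    by (rule ms_cut_Un(2)[OF s]) (measurable, auto)
  finally show ?thesis .
qed

text \<open>If a slab holds at most about \<open>\<alpha>\<close> and little mass lies just around
  it, replace the remainder by a block of negative energy. Subadditivity then bounds the energy of
  the slab part from below by \<open>h\<close> plus a fixed amount. At nearly minimal total energy
  the remainder must itself have negative energy, hence a definite self-interaction, and so it
  cannot vanish.\<close>

lemma rest_nonvanishing:
  assumes h: "\<And>u. u \<in> St \<Longrightarrow> ms u = M \<Longrightarrow> h \<le> F u" and P: "0 \<le> P" and \<alpha>: "0 \<le> \<alpha>" "\<alpha> < M"
  obtains \<delta> R2 \<epsilon> D where "0 < \<delta>" "1 \<le> R2" "0 < \<epsilon>" "1 \<le> D"
    "\<And>s a R. s \<in> St \<Longrightarrow> ms s = M \<Longrightarrow> pw s \<le> P \<Longrightarrow> F s < h + \<epsilon> \<Longrightarrow>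
      ms (cut (annul a R (R + D)) s) \<le> \<epsilon> \<Longrightarrow> ms (cut (slab a R) s) \<le> \<alpha> + \<epsilon> \<Longrightarrow>
      \<exists>c. \<delta> < ms (cut (slab c R2 \<inter> - slab a R) s)"
proof -
  \<comment> \<open>Half of the missing mass; the other half is slack for a slab slightly heavier
    than \<open>\<alpha>\<close>.\<close>
  define \<mu> where "\<mu> = (M - \<alpha>) / 2"
  have \<mu>: "0 < \<mu>" using \<alpha> by (simp add: \<mu>_def)
  obtain b where b: "b \<in> St" "ms b = \<mu>" "F b < 0" using negative_block[OF \<mu>] by metis
  define \<kappa> where "\<kappa> = - F b"
  have \<kappa>: "0 < \<kappa>" using b by (simp add: \<kappa>_def)
  have M: "0 \<le> M" using \<alpha> by simp
  have MP: "0 \<le> M + P" using M P by simp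
  have k4: "0 < \<kappa> / 4" using \<kappa> by simp
  obtain \<delta> R2 where \<delta>: "0 < \<delta>" "1 \<le> R2"
    "\<And>s. s \<in> St \<Longrightarrow> ms s \<le> M \<Longrightarrow> n2 s \<le> M + P \<Longrightarrow> \<kappa> / 4 \<le> BB s s \<Longrightarrow> \<exists>a. \<delta> < ms (cut (slab a R2) s)"
    using nonvanishing[OF M MP k4] by metis
  have "0 < \<kappa> / (16 * Kb)" using \<kappa> Kb_pos by simp
  from young_small[OF this P MP M] obtain \<epsilon> \<tau> where \<epsilon>: "0 < \<epsilon>" "0 < \<tau>"
    "\<And>s t. s \<in> St \<Longrightarrow> t \<in> St \<Longrightarrow> ms s \<le> M \<Longrightarrow> n2 s \<le> M + P \<Longrightarrow>
       ms t \<le> \<epsilon> \<Longrightarrow> pw t \<le> P \<Longrightarrow> \<tau> * n2 s + n2 t / \<tau> + ms s * ms t \<le> \<kappa> / (16 * Kb)" by metis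
  define D where "D = max 1 (16 * Cw * (M * M) / \<kappa>)"
  have D: "1 \<le> D" by (simp add: D_def)
  have DM: "Cw * (M * M / D) \<le> \<kappa> / 16"
  proof -
    have "16 * Cw * (M * M) / \<kappa> \<le> D" by (simp add: D_def)
    then have "16 * Cw * (M * M) \<le> D * \<kappa>" using \<kappa> by (simp add: pos_divide_le_eq)
    then show ?thesis using D by (simp add: divide_le_eq mult_ac)
  qed
  show ?thesis
  proof (rule that[OF \<delta>(1,2) _ D])
    show "0 < min \<epsilon> (min \<mu> (\<kappa> / 4))" using \<epsilon> \<mu> \<kappa> by simp
    fix s a R
    assume s: "s \<in> St" "ms s = M" "pw s \<le> P" "F s < h + min \<epsilon> (min \<mu> (\<kappa> / 4))"
      and ann: "ms (cut (annul a R (R + D)) s) \<le> min \<epsilon> (min \<mu> (\<kappa> / 4))"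
      and inn: "ms (cut (slab a R) s) \<le> \<alpha> + min \<epsilon> (min \<mu> (\<kappa> / 4))"
    let ?i = "cut (slab a R) s" and ?n = "cut (annul a R (R + D)) s"
      and ?r = "cut (- slab a R) s"
    have X: "slab a R \<in> sets borel" by measurable
    have Xc: "- slab a R \<in> sets borel" using X by (rule borel_comp)
    have A: "(annul a R (R + D)) \<in> sets borel" by measurable
    note i = St_cut[OF s(1) X] and n = St_cut[OF s(1) A] and r = St_cut[OF s(1) Xc]
    have n2s: "n2 s \<le> M + P" using n2_le_mass[OF s(1), of M P] s by simp
    have "\<tau> * n2 ?i + n2 ?n / \<tau> + ms ?i * ms ?n \<le> \<kappa> / (16 * Kb)"
      using ms_cut_le[OF s(1) X] n2_cut_le[OF s(1) X] n2s s pw_cut_le[OF s(1) A] ann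
      by (intro \<epsilon>(3)[OF i n]) auto
    then have "BB ?i ?n \<le> Kb * (\<kappa> / (16 * Kb))"
      using Kb_pos by (intro order_trans[OF BB_upper[OF i n \<epsilon>(2)]] mult_left_mono) auto
    then have "BB ?i ?n \<le> \<kappa> / 16" using Kb_pos by simp
    then have BBir: "BB ?i ?r \<le> \<kappa> / 8"
      using BB_slab_rest[OF s(1,2) X order_refl D order_refl] DM by linarith
    have "ms ?i + ms b \<le> M"
    proof -
      have "min \<epsilon> (min \<mu> (\<kappa> / 4)) \<le> \<mu>" by simp
      moreover have "\<alpha> + 2 * \<mu> = M" by (simp add: \<mu>_def field_simps)
      ultimately show ?thesis using inn b(2) by linarith
    qed
    then have "h \<le> F ?i + F b" by (rule subadditive[OF i b(1) _ h])
    \<comment> \<open>The slab part has energy at least \<open>h + \<kappa>\<close>, the total is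
      below \<open>h + \<kappa> / 4\<close>, and twice the interaction is at most
      \<open>\<kappa> / 4\<close>.\<close>
    then have "F ?r \<le> - \<kappa> / 4"
    proof -
      have "min \<epsilon> (min \<mu> (\<kappa> / 4)) \<le> \<kappa> / 4" "F b = - \<kappa>" by (auto simp: \<kappa>_def)
      then show ?thesis
        using \<open>h \<le> F ?i + F b\<close> F_cut_split[OF s(1) X] s(4) BBir \<kappa> by linarith
    qed
    moreover have "- BB ?r ?r \<le> F ?r" using pw_nonneg[of ?r] \<gamma> by (simp add: F_def)
    ultimately have "\<kappa> / 4 \<le> BB ?r ?r" by simp
    moreover have "ms ?r \<le> M" "n2 ?r \<le> M + P"
      using ms_cut_le[OF s(1) Xc] n2_cut_le[OF s(1) Xc] n2s s by auto
    ultimately obtain c where "\<delta> < ms (cut (slab c R2) ?r)" using \<delta>(3)[OF r] by blast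
    then show "\<exists>c. \<delta> < ms (cut (slab c R2 \<inter> - slab a R) s)" by (auto simp: cut_cut)
  qed
qed

text \<open>Two bumps of mass \<open>\<delta>\<close> that are far apart gain interaction energy of order \<open>1/R\<close> when one is
  moved next to the other. Cutting at a height chosen by averaging over \<open>R, \<dots>, 2R - 1\<close> makes the
  interaction lost across the cuts \<open>o(1/R)\<close>.\<close>

lemma no_two_bumps:
  assumes h: "\<And>u. u \<in> St \<Longrightarrow> ms u = M \<Longrightarrow> h \<le> F u" and P: "0 \<le> P" and M: "0 \<le> M" and \<delta>: "0 < \<delta>"
  obtains \<epsilon> where "0 < \<epsilon>" "\<And>R::nat. 1 \<le> R \<Longrightarrow> Rc \<le> real R \<Longrightarrow> \<exists>\<eta>>0. \<exists>D\<ge>1. \<forall>s\<in>St. \<forall>a c.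
    \<not> (ms s = M \<and> pw s \<le> P \<and> F s < h + \<eta> \<and> 2 * (2 * real R + D) \<le> \<bar>a - c\<bar> \<and>
       \<delta> \<le> ms (cut (slab a R) s) \<and> \<delta> \<le> ms (cut (slab c R) s) \<and>
       ms (cut (annul a (real R) (2 * real R + D)) s) \<le> \<epsilon> \<and>
       ms (cut (annul c (real R) (2 * real R + D)) s) \<le> \<epsilon>)"
proof -
  have MP: "0 \<le> M + P" using M P by simp
  \<comment> \<open>The denominator 100 serves the final balance: with
    \<open>\<eta> = \<theta> / R\<close> the doubled gain is at least
    \<open>200 / 22 * \<eta>\<close>, while the losses are \<open>\<eta>\<close> for the energy
    defect, \<open>4 * \<eta>\<close> for the cuts around both bumps and \<open>\<eta>\<close> for
    distant pairs.\<close>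
  define \<theta> where "\<theta> = \<delta>\<^sup>2 / 100"
  have \<theta>: "0 < \<theta>" using \<delta> by (simp add: \<theta>_def)
  define k where "k = Cw * 2 * (K1 + 1)"
  have k: "0 < k" using Cw_pos K1_nonneg by (simp add: k_def)
  have "0 < \<theta> / k" using \<theta> k by simp
  from young_small[OF this P MP M] obtain \<epsilon> \<tau> where \<epsilon>: "0 < \<epsilon>" "0 < \<tau>"
    "\<And>s t. s \<in> St \<Longrightarrow> t \<in> St \<Longrightarrow> ms s \<le> M \<Longrightarrow> n2 s \<le> M + P \<Longrightarrow>
       ms t \<le> \<epsilon> \<Longrightarrow> pw t \<le> P \<Longrightarrow> \<tau> * n2 s + n2 t / \<tau> + ms s * ms t \<le> \<theta> / k" by metis
  show ?thesis
  proof (rule that[OF \<epsilon>(1)])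
    fix R :: nat assume R: "1 \<le> R" "Rc \<le> real R"
    define \<eta> where "\<eta> = \<theta> / real R"
    have \<eta>: "0 < \<eta>" using \<theta> R by (simp add: \<eta>_def)
    \<comment> \<open>Six distant interactions occur in the balance, two from the pair of bumps and
      four from the bumps and the remainder.\<close>
    define D where "D = max 1 (6 * Cw * (M * M) / \<eta>)"
    have D: "1 \<le> D" by (simp add: D_def)
    have DM: "6 * (Cw * (M * M / D)) \<le> \<eta>"
    proof -
      have "6 * Cw * (M * M) / \<eta> \<le> D" by (simp add: D_def)
      then have "6 * Cw * (M * M) \<le> D * \<eta>" using \<eta> by (simp add: pos_divide_le_eq)
      then show ?thesis using D by (simp add: divide_le_eq mult_ac)
    qed
    define R' where "R' = 2 * real R + D"
    have False if s: "s \<in> St" "ms s = M" "pw s \<le> P" "F s < h + \<eta>" and ac: "2 * R' \<le> \<bar>a - c\<bar>"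
      and bump: "\<delta> \<le> ms (cut (slab a R) s)" "\<delta> \<le> ms (cut (slab c R) s)"
      and ann: "ms (cut (annul a (real R) R') s) \<le> \<epsilon>"
        "ms (cut (annul c (real R) R') s) \<le> \<epsilon>" for s a c
    proof -
      have n2s: "n2 s \<le> M + P" using n2_le_mass[OF s(1), of M P] s by simp
      let ?J = "\<lambda>a L. BB (cut (slab a (real L)) s) (cut (annul a (real L) R') s)"
      have sum: "(\<Sum>L\<in>{R..<2*R}. ?J b L) \<le> \<theta>"
        if "ms (cut (annul b (real R) R') s) \<le> \<epsilon>" for b
      proof -
        let ?g = "cut (annul b (real R) R') s"
        have A: "(annul b (real R) R') \<in> sets borel" by measurable
        note g = St_cut[OF s(1) A]
        have Y: "\<tau> * n2 s + n2 ?g / \<tau> + ms s * ms ?g \<le> \<theta> / k"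
          using s n2s pw_cut_le[OF s(1) A] that by (intro \<epsilon>(3)[OF s(1) g]) auto
        have "(\<Sum>L\<in>{R..<2*R}. ?J b L) \<le> Cw * (2 * (K1 * (\<tau> * n2 s + n2 ?g / \<tau>) + ms s * ms ?g))"
          using BB_cuts[OF s(1) \<epsilon>(2), where R=R and a=b and R'=R'] unfolding slab_def annul_def .
        also have "\<dots> \<le> Cw * (2 * ((K1 + 1) * (\<tau> * n2 s + n2 ?g / \<tau> + ms s * ms ?g)))"
        proof -
          have le: "K1 * p + q \<le> (K1 + 1) * (p + q)" if "0 \<le> p" "0 \<le> q" for p q
            using that K1_nonneg by (simp add: algebra_simps)
          have "0 \<le> \<tau> * n2 s + n2 ?g / \<tau>" "0 \<le> ms s * ms ?g"
            using \<epsilon>(2) n2_nonneg[of s] n2_nonneg[of ?g] ms_nonneg[OF s(1)] ms_nonneg[OF g] by auto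
          from le[OF this] show ?thesis using Cw_pos by (intro mult_left_mono) auto
        qed
        also have "\<dots> = k * (\<tau> * n2 s + n2 ?g / \<tau> + ms s * ms ?g)" by (simp only: k_def mult_ac)
        also have "\<dots> \<le> k * (\<theta> / k)" using k Y by (intro mult_left_mono) auto
        also have "\<dots> = \<theta>" using k by simp
        finally show ?thesis .
      qed
      \<comment> \<open>Averaging: the \<open>R\<close> terms have total at most
        \<open>2 * \<theta>\<close>, which is \<open>2 * \<eta> * R\<close>.\<close>
      have "\<exists>L\<in>{R..<2*R}. ?J a L + ?J c L \<le> 2 * \<eta>"
      proof (rule ccontr)
        assume "\<not> ?thesis"
        then have "(\<Sum>L\<in>{R..<2*R}. 2 * \<eta>) < (\<Sum>L\<in>{R..<2*R}. ?J a L + ?J c L)"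
          using R by (intro sum_strict_mono) (auto simp: not_le)
        also have "\<dots> \<le> \<theta> + \<theta>" using sum[OF ann(1)] sum[OF ann(2)] by (simp add: sum.distrib)
        finally show False using R by (simp add: \<eta>_def)
      qed
      then obtain L where L: "R \<le> L" "L < 2 * R" "?J a L + ?J c L \<le> 2 * \<eta>" by auto
      have L': "real R \<le> real L" "real L + 1 \<le> 2 * real R" using L by auto
      let ?A = "slab a (real L)" and ?C = "slab c (real L)"
      have A: "?A \<in> sets borel" and C: "?C \<in> sets borel" by measurable
      have U: "?A \<union> ?C \<in> sets borel" using A C by auto
      have Uc: "- (?A \<union> ?C) \<in> sets borel" using U by (rule borel_comp)
      define i where "i = cut ?A s"
      define j where "j = cut ?C s"
      define r where "r = cut (- (?A \<union> ?C)) s"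
      have i: "i \<in> St" unfolding i_def by (rule St_cut[OF s(1) A])
      have j: "j \<in> St" unfolding j_def by (rule St_cut[OF s(1) C])
      have r: "r \<in> St" unfolding r_def by (rule St_cut[OF s(1) Uc])
      have i0: "\<bar>snd p - a\<bar> \<le> real L" if "i p \<noteq> 0" for p
        using that by (auto simp: i_def cut_def split: if_splits)
      have j0: "\<bar>snd p - c\<bar> \<le> real L" if "j p \<noteq> 0" for p
        using that by (auto simp: j_def cut_def split: if_splits)
      have dis: "\<not> (\<bar>z - a\<bar> \<le> real L \<and> \<bar>z - c\<bar> \<le> real L)" for z
      proof (intro notI, elim conjE)
        assume "\<bar>z - a\<bar> \<le> real L" "\<bar>z - c\<bar> \<le> real L"
        then have "\<bar>a - c\<bar> \<le> 2 * real L" by arith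
        then have "2 * R' \<le> 2 * real L" by (rule order_trans[OF ac])
        then have "2 * real R + D \<le> real L" by (simp add: R'_def)
        then show False using L' D by linarith
      qed
      have ij: "cut (?A \<union> ?C) s = (\<lambda>p. i p + j p)"
        using dis by (intro ext) (auto simp: i_def j_def cut_def)
      have Fs: "F s = F i + F j - 2 * BB i j + F r - 2 * (BB i r + BB j r)"
      proof -
        have "i p = 0 \<or> j p = 0" for p using i0[of p] j0[of p] dis[of "snd p"] by blast
        from F_add[OF i j this] show ?thesis
          using F_cut_split[OF s(1) U] BB_add_left[OF i j r] unfolding ij r_def[symmetric] by simp
      qed
      \<comment> \<open>Recentres the second bump at height \<open>a + 2 * L + 1\<close>, beside the
        first one with a gap of 1.\<close>
      define b where "b = c - a - 2 * real L - 1"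
      define j' where "j' = shift b j"
      have j': "j' \<in> St" unfolding j'_def by (rule St_shift[OF j])
      have j'0: "\<bar>snd p - (a + 2 * real L + 1)\<bar> \<le> real L" if "j' p \<noteq> 0" for p
      proof -
        have "\<bar>snd p + b - c\<bar> \<le> real L" using j0[of "(fst p, snd p + b)"] that by (simp add: j'_def shift_def)
        then show ?thesis unfolding b_def by linarith
      qed
      have mj': "ms j' = ms j" unfolding j'_def by (rule ms_shift[OF j])
      define f where "f p = i p + j' p" for p
      have f: "f \<in> St" unfolding f_def by (rule St_add[OF i j'])
      have "i p = 0 \<or> j' p = 0" for p using i0[of p] j'0[of p] by linarith
      from F_add[OF i j' this] have Ff: "F f = F i + F j - 2 * BB i j'"
        unfolding f_def by (simp add: j'_def F_shift[OF j])
      have "ms f = ms i + ms j" unfolding f_def using ms_add[OF i j'] mj' by simp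
      moreover have "ms s = ms i + ms j + ms r"
        using ms_cut_split[OF s(1) U] ms_add[OF i j] unfolding ij r_def[symmetric] by simp
      ultimately have "h \<le> F f + F r"
        using s(2) by (intro subadditive[OF f r _ h]) auto
      then have "2 * BB i j' \<le> \<eta> + 2 * BB i j + 2 * (BB i r + BB j r)"
        using Fs Ff s(4) by linarith
      moreover have "BB i j \<le> Cw * (M * M / D)"
      proof -
        have "BB i j \<le> Cw * (ms i * ms j / D)"
        proof (rule BB_far[OF i j D])
          fix p q assume "i p \<noteq> 0" "j q \<noteq> 0"
          then have "\<bar>snd p - a\<bar> \<le> real L" "\<bar>snd q - c\<bar> \<le> real L" using i0 j0 by auto
          then have "\<bar>a - c\<bar> \<le> 2 * real L + \<bar>snd p - snd q\<bar>" by arith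
          then have "2 * R' \<le> 2 * real L + \<bar>snd p - snd q\<bar>" by (rule order_trans[OF ac])
          then show "D \<le> \<bar>snd p - snd q\<bar>" using L' D by (simp add: R'_def)
        qed
        also have "\<dots> \<le> Cw * (M * M / D)"
          using ms_cut_le[OF s(1) A] ms_cut_le[OF s(1) C] ms_nonneg[OF i] ms_nonneg[OF j] s(2) D Cw_pos M
          unfolding i_def[symmetric] j_def[symmetric]
          by (intro mult_left_mono divide_right_mono mult_mono) auto
        finally show ?thesis .
      qed
      moreover have "BB i r + BB j r \<le> ?J a L + ?J c L + 2 * (Cw * (M * M / D))"
      proof -
        have LD: "real L + D \<le> R'" using L' unfolding R'_def by simp
        have add2: "x + y \<le> p + q + 2 * K" if "x \<le> p + K" "y \<le> q + K" for x y p q K :: real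
          using that by simp
        show ?thesis
          unfolding i_def j_def r_def
          by (rule add2[OF BB_slab_rest[OF s(1,2) U Un_upper1 D LD] BB_slab_rest[OF s(1,2) U Un_upper2 D LD]])
      qed
      \<comment> \<open>The constant is generous: \<open>L \<le> 2 * R - 1\<close> and
        \<open>Rc \<le> R\<close> already give
        \<open>2 * (4 * L + 1 + 2 * Rc) \<le> 20 * R\<close>.\<close>
      moreover have "\<delta>\<^sup>2 / (22 * real R) \<le> BB i j'"
      proof -
        have "ms i * ms j' / (2 * (4 * real L + 1 + 2 * Rc)) \<le> BB i j'"
        proof (rule BB_lower[OF i j'])
          fix p q assume "i p \<noteq> 0" "j' q \<noteq> 0"
          then show "\<bar>snd p - snd q\<bar> \<le> 4 * real L + 1" using i0[of p] j'0[of q] by linarith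
        qed simp
        moreover have "\<delta>\<^sup>2 / (22 * real R) \<le> ms i * ms j' / (2 * (4 * real L + 1 + 2 * Rc))"
        proof (rule frac_le)
          have "\<delta> \<le> ms i"
            using bump(1) ms_cut_mono[OF s(1) _ A, of "slab a R"] L' unfolding i_def by force
          moreover have "\<delta> \<le> ms j'"
            using bump(2) ms_cut_mono[OF s(1) _ C, of "slab c R"] L' unfolding mj' j_def by force
          ultimately show "\<delta>\<^sup>2 \<le> ms i * ms j'"
            using \<delta> unfolding power2_eq_square by (intro mult_mono) auto
          then show "0 \<le> ms i * ms j'" using \<delta> by (meson order_trans zero_le_power2)
          show "0 < 2 * (4 * real L + 1 + 2 * Rc)" using Rc by simp
          have "2 * (4 * x + 1 + 2 * Rc) \<le> 22 * y" if "x + 1 \<le> 2 * y" "Rc \<le> y" "0 \<le> y" for x y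
            using that by simp
          then show "2 * (4 * real L + 1 + 2 * Rc) \<le> 22 * real R" using L' R by simp
        qed
        ultimately show ?thesis by linarith
      qed
      moreover have "\<delta>\<^sup>2 / (22 * real R) = 100 / 22 * \<eta>" by (simp add: \<eta>_def \<theta>_def)
      moreover note L(3)
      moreover have "2 * (100 / 22 * \<eta>) \<le> \<eta> + 4 * \<eta> + 6 * K"
        if "2 * x \<le> \<eta> + 2 * y + 2 * z" "y \<le> K" "z \<le> q + 2 * K" "d \<le> x" "d = 100 / 22 * \<eta>" "q \<le> 2 * \<eta>"
        for x y z K q d :: real using that by argo
      ultimately have "2 * (100 / 22 * \<eta>) \<le> \<eta> + 4 * \<eta> + 6 * (Cw * (M * M / D))" by blast
      moreover have False if "2 * (100 / 22 * \<eta>) \<le> \<eta> + 4 * \<eta> + K" "K \<le> \<eta>" for K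
        using that \<eta> by argo
      ultimately show False using DM by blast
    qed
    then show "\<exists>\<eta>>0. \<exists>D\<ge>1. \<forall>s\<in>St. \<forall>a c.
      \<not> (ms s = M \<and> pw s \<le> P \<and> F s < h + \<eta> \<and> 2 * (2 * real R + D) \<le> \<bar>a - c\<bar> \<and>
       \<delta> \<le> ms (cut (slab a R) s) \<and> \<delta> \<le> ms (cut (slab c R) s) \<and>
       ms (cut (annul a (real R) (2 * real R + D)) s) \<le> \<epsilon> \<and>
       ms (cut (annul c (real R) (2 * real R + D)) s) \<le> \<epsilon>)"
      using \<eta> D unfolding R'_def by blast
  qed
qed

text \<open>Serves the finitely many early members of a sequence, which asymptotic statements do not
  reach.\<close>

lemma slab_mass_large:
  assumes s: "s \<in> St" and "0 < \<epsilon>"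
  shows "\<exists>R. ms s - \<epsilon> \<le> ms (cut (slab a R) s)"
proof -
  have "eventually (\<lambda>n. ms (cut {z. real n < \<bar>z\<bar>} s) < \<epsilon>) sequentially"
    using tail_tendsto(1)[OF s] assms(2) by (intro order_tendstoD)
  then obtain n :: nat where n: "ms (cut {z. real n < \<bar>z\<bar>} s) < \<epsilon>" by (auto simp: eventually_sequentially)
  have X: "{z. \<bar>z\<bar> \<le> real n} \<in> sets borel" by measurable
  have "- {z. \<bar>z\<bar> \<le> real n} = {z. real n < \<bar>z\<bar>}" by auto
  then have "ms s - \<epsilon> \<le> ms (cut {z. \<bar>z\<bar> \<le> real n} s)" using ms_cut_split[OF s X] n by simp
  also have "\<dots> \<le> ms (cut (slab a (real n + \<bar>a\<bar>)) s)"
    by (rule ms_cut_mono[OF s X]) (measurable, auto)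
  finally show ?thesis by blast
qed

text \<open>\<open>\<alpha>\<close> and \<open>\<beta>\<close> are the limiting concentrations at
  one and at two centres. If \<open>\<alpha> < M\<close>, the remainder around a nearly optimal slab
  does not vanish, so \<open>\<beta>\<close> exceeds \<open>\<alpha>\<close> by a fixed amount.
  Nearly optimal pairs then consist of two substantial bumps, far apart since one slab cannot hold
  more than about \<open>\<alpha>\<close>, and with nearly empty surroundings since larger pairs of
  slabs cannot hold more than about \<open>\<beta>\<close>; \<open>no_two_bumps\<close> excludes
  this. Hence \<open>\<alpha> = M\<close>, and as slabs with more than half of the mass must meet,
  the centres are fixed up to bounded distances.\<close>

theorem minimizing_tight:
  assumes h: "\<And>u. u \<in> St \<Longrightarrow> ms u = M \<Longrightarrow> h \<le> F u" and M: "0 < M"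
    and s: "\<And>i::nat. s i \<in> St" "\<And>i. ms (s i) = M" and lim: "(\<lambda>i. F (s i)) \<longlonglongrightarrow> h"
  obtains \<phi> :: "nat \<Rightarrow> nat" and a :: "nat \<Rightarrow> real" where "strict_mono \<phi>"
    "\<And>\<epsilon>. 0 < \<epsilon> \<Longrightarrow> \<exists>R. \<forall>i. M - \<epsilon> \<le> ms (cut (slab (a i) R) (s (\<phi> i)))"
proof -
  have M0: "0 \<le> M" using M by simp
  obtain C where C: "\<And>s. s \<in> St \<Longrightarrow> ms s \<le> M \<Longrightarrow> pw s / (2 * (\<gamma> - 1)) - C \<le> F s"
    using coercive[OF M0] by metis
  obtain B where B: "\<And>i. F (s i) \<le> B"
    using convergent_imp_Bseq[OF convergentI[OF lim]] unfolding Bseq_def real_norm_def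
    by (meson abs_le_D1)
  define P where "P = 2 * (\<gamma> - 1) * (B + C)"
  have pwP: "pw (s i) \<le> P" for i
  proof -
    have "pw (s i) / (2 * (\<gamma> - 1)) \<le> B + C" using C[OF s(1), of i] s(2)[of i] B[of i] by simp
    then show ?thesis using \<gamma> by (simp add: P_def divide_le_eq mult.commute)
  qed
  have P: "0 \<le> P" using pwP[of 0] pw_nonneg[of "s 0"] by linarith
  have Us: "slab b R \<union> slab b' R \<in> sets borel" for b b' R by (intro sets.Un) measurable
  obtain \<phi>1 \<alpha> where \<phi>1: "strict_mono (\<phi>1 :: nat \<Rightarrow> nat)" "0 \<le> \<alpha>" "\<alpha> \<le> M"
    "\<And>\<epsilon>. 0 < \<epsilon> \<Longrightarrow> \<exists>R::nat. \<forall>R'\<ge>R. \<forall>\<^sub>F i in sequentially. \<exists>a. \<alpha> - \<epsilon> < ms (cut (slab a (real R')) (s (\<phi>1 i)))"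
    "\<And>\<epsilon> R::nat. 0 < \<epsilon> \<Longrightarrow> \<forall>\<^sub>F i in sequentially. \<forall>a. ms (cut (slab a (real R)) (s (\<phi>1 i))) < \<alpha> + \<epsilon>"
  proof (rule concentration_subseq[of "\<lambda>i a R. ms (cut (slab a (real R)) (s i))" M])
    show "0 \<le> ms (cut (slab a (real R)) (s i))" for i a R by (intro ms_nonneg St_cut s) measurable
    show "ms (cut (slab a (real R)) (s i)) \<le> M" for i a R
      unfolding s(2)[of i, symmetric] by (rule ms_cut_le[OF s(1)]) measurable
    show "ms (cut (slab a (real R)) (s i)) \<le> ms (cut (slab a (real R')) (s i))" if "R \<le> R'" for i a R R'
      by (rule ms_cut_mono[OF s(1)]) (measurable, use that in auto)
  qed blast
  obtain \<phi>2 \<beta> where \<phi>2: "strict_mono (\<phi>2 :: nat \<Rightarrow> nat)"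
    "\<And>\<epsilon>. 0 < \<epsilon> \<Longrightarrow> \<exists>R::nat. \<forall>R'\<ge>R. \<forall>\<^sub>F i in sequentially. \<exists>a.
       \<beta> - \<epsilon> < ms (cut (slab (fst a) (real R') \<union> slab (snd a) (real R')) (s (\<phi>1 (\<phi>2 i))))"
    "\<And>\<epsilon> R::nat. 0 < \<epsilon> \<Longrightarrow> \<forall>\<^sub>F i in sequentially. \<forall>a.
       ms (cut (slab (fst a) (real R) \<union> slab (snd a) (real R)) (s (\<phi>1 (\<phi>2 i)))) < \<beta> + \<epsilon>"
  proof (rule concentration_subseq[of "\<lambda>i a R. ms (cut (slab (fst a) (real R) \<union> slab (snd a) (real R)) (s (\<phi>1 i)))" M])
    show "0 \<le> ms (cut (slab (fst a) (real R) \<union> slab (snd a) (real R)) (s (\<phi>1 i)))" for i a R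
      by (intro ms_nonneg St_cut s Us)
    show "ms (cut (slab (fst a) (real R) \<union> slab (snd a) (real R)) (s (\<phi>1 i))) \<le> M" for i a R
      unfolding s(2)[of "\<phi>1 i", symmetric] by (rule ms_cut_le[OF s(1) Us])
    show "ms (cut (slab (fst a) (real R) \<union> slab (snd a) (real R)) (s (\<phi>1 i)))
      \<le> ms (cut (slab (fst a) (real R') \<union> slab (snd a) (real R')) (s (\<phi>1 i)))" if "R \<le> R'" for i a R R'
      by (rule ms_cut_mono[OF s(1) Us Us]) (use that in auto)
  qed blast
  define \<phi> where "\<phi> i = \<phi>1 (\<phi>2 i)" for i
  have \<phi>: "strict_mono \<phi>" using strict_mono_o[OF \<phi>1(1) \<phi>2(1)] by (simp add: \<phi>_def [abs_def] o_def)
  define t where "t i = s (\<phi> i)" for i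
  have t: "t i \<in> St" "ms (t i) = M" "pw (t i) \<le> P" for i using s pwP by (auto simp: t_def)
  have limt: "(\<lambda>i. F (t i)) \<longlonglongrightarrow> h"
    using LIMSEQ_subseq_LIMSEQ[OF lim \<phi>] by (simp add: t_def o_def)
  have Flt: "\<forall>\<^sub>F i in sequentially. F (t i) < h + \<epsilon>" if "0 < \<epsilon>" for \<epsilon>
    using limt that by (intro order_tendstoD) auto
  have one_ge: "\<exists>R::nat. \<forall>R'\<ge>R. \<forall>\<^sub>F i in sequentially. \<exists>a. \<alpha> - \<epsilon> < ms (cut (slab a (real R')) (t i))"
    if "0 < \<epsilon>" for \<epsilon>
  proof -
    obtain R where R: "\<forall>R'\<ge>R. \<forall>\<^sub>F i in sequentially. \<exists>a. \<alpha> - \<epsilon> < ms (cut (slab a (real R')) (s (\<phi>1 i)))"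
      using \<phi>1(4)[OF \<open>0 < \<epsilon>\<close>] by blast
    show ?thesis
    proof (intro exI[of _ R] allI impI)
      fix R' assume "R \<le> R'"
      then have "\<forall>\<^sub>F i in sequentially. \<exists>a. \<alpha> - \<epsilon> < ms (cut (slab a (real R')) (s (\<phi>1 i)))" using R by blast
      from eventually_subseq[OF \<phi>2(1) this]
      show "\<forall>\<^sub>F i in sequentially. \<exists>a. \<alpha> - \<epsilon> < ms (cut (slab a (real R')) (t i))" by (simp add: t_def \<phi>_def)
    qed
  qed
  have one_lt: "\<forall>\<^sub>F i in sequentially. \<forall>a. ms (cut (slab a (real R)) (t i)) < \<alpha> + \<epsilon>" if "0 < \<epsilon>" for \<epsilon> and R :: nat
    using eventually_subseq[OF \<phi>2(1) \<phi>1(5)[OF that, of R]] by (simp add: t_def \<phi>_def)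
  have two_ge: "\<exists>R::nat. \<forall>R'\<ge>R. \<forall>\<^sub>F i in sequentially. \<exists>a c. \<beta> - \<epsilon> < ms (cut (slab a (real R') \<union> slab c (real R')) (t i))"
    if "0 < \<epsilon>" for \<epsilon>
    using \<phi>2(2)[OF that] by (simp add: t_def \<phi>_def)
  have two_lt: "\<forall>\<^sub>F i in sequentially. \<forall>a c. ms (cut (slab a (real R) \<union> slab c (real R)) (t i)) < \<beta> + \<epsilon>"
    if "0 < \<epsilon>" for \<epsilon> and R :: nat
    using \<phi>2(3)[OF that, of R] by (simp add: t_def \<phi>_def)
  have slb: "slab a R \<in> sets borel" for a R by measurable
  have annb: "(annul a R R') \<in> sets borel" for a R R' :: real by measurable
  have "\<alpha> = M"
  proof (rule ccontr)
    assume "\<alpha> \<noteq> M"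
    then have aM: "\<alpha> < M" using \<phi>1(3) by simp
    obtain \<delta> R2 \<epsilon>1 D1 where d: "0 < \<delta>" "1 \<le> R2" "0 < \<epsilon>1" "1 \<le> D1"
      "\<And>s a R. s \<in> St \<Longrightarrow> ms s = M \<Longrightarrow> pw s \<le> P \<Longrightarrow> F s < h + \<epsilon>1 \<Longrightarrow>
        ms (cut (annul a R (R + D1)) s) \<le> \<epsilon>1 \<Longrightarrow> ms (cut (slab a R) s) \<le> \<alpha> + \<epsilon>1 \<Longrightarrow>
        \<exists>c. \<delta> < ms (cut (slab c R2 \<inter> - slab a R) s)"
      using rest_nonvanishing[OF h P \<phi>1(2) aM] by metis
    \<comment> \<open>A slab nearly optimal for \<open>\<alpha>\<close> leaves almost nothing in its
      annulus, since the larger slab cannot hold more either. The mass that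
      \<open>rest_nonvanishing\<close> finds outside it comes on top of
      \<open>\<alpha>\<close>.\<close>
    have ab: "\<alpha> + \<delta> \<le> \<beta>"
    proof (rule ccontr)
      assume nab: "\<not> ?thesis"
      define \<epsilon> where "\<epsilon> = min \<epsilon>1 ((\<alpha> + \<delta> - \<beta>) / 4)"
      have "\<epsilon> \<le> (\<alpha> + \<delta> - \<beta>) / 4" unfolding \<epsilon>_def by (rule min.cobounded2)
      moreover have "0 < \<epsilon>" "\<epsilon> \<le> \<epsilon>1" using nab d(3) by (auto simp: \<epsilon>_def)
      ultimately have \<epsilon>: "0 < \<epsilon>" "0 < \<epsilon> / 2" "\<epsilon> \<le> \<epsilon>1" "4 * \<epsilon> \<le> \<alpha> + \<delta> - \<beta>" by auto
      obtain R0 where R0: "\<forall>R'\<ge>R0. \<forall>\<^sub>F i in sequentially. \<exists>a. \<alpha> - \<epsilon> / 2 < ms (cut (slab a (real R')) (t i))"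
        using one_ge[OF \<epsilon>(2)] by blast
      define R where "R = max R0 (nat \<lceil>R2\<rceil>)"
      have RR: "R0 \<le> R" "R2 \<le> real R" unfolding R_def
        using real_nat_ceiling_ge[of R2] by (auto simp: of_nat_max le_max_iff_disj)
      define N where "N = R + nat \<lceil>D1\<rceil>"
      have N: "real R + D1 \<le> real N" using real_nat_ceiling_ge[of D1] by (simp add: N_def)
      have "\<forall>\<^sub>F i in sequentially. (\<exists>a. \<alpha> - \<epsilon> / 2 < ms (cut (slab a (real R)) (t i))) \<and>
        (\<forall>a. ms (cut (slab a (real N)) (t i)) < \<alpha> + \<epsilon> / 2) \<and> F (t i) < h + \<epsilon>1 \<and>
        (\<forall>a c. ms (cut (slab a (real R) \<union> slab c (real R)) (t i)) < \<beta> + \<epsilon>)"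
        using R0 RR(1) by (intro eventually_conj one_lt[OF \<epsilon>(2)] Flt[OF d(3)] two_lt[OF \<epsilon>(1)]) blast
      then obtain i where i: "\<exists>a. \<alpha> - \<epsilon> / 2 < ms (cut (slab a (real R)) (t i))"
        "\<And>a. ms (cut (slab a (real N)) (t i)) < \<alpha> + \<epsilon> / 2" "F (t i) < h + \<epsilon>1"
        "\<And>a c. ms (cut (slab a (real R) \<union> slab c (real R)) (t i)) < \<beta> + \<epsilon>"
        using eventually_happens'[OF sequentially_bot] by (smt (verit))
      obtain a where a: "\<alpha> - \<epsilon> / 2 < ms (cut (slab a (real R)) (t i))" using i(1) by blast
      have "ms (cut (slab a (real R)) (t i)) + ms (cut (annul a (real R) (real R + D1)) (t i))
        = ms (cut (slab a (real R + D1)) (t i))"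
        using d(4) by (subst ms_annulus[OF t(1), of "real R" "real R + D1"]) auto
      also have "\<dots> \<le> ms (cut (slab a (real N)) (t i))"
        by (rule ms_cut_mono[OF t(1) slb slb]) (use N in auto)
      also have "\<dots> < \<alpha> + \<epsilon> / 2" by (rule i(2))
      finally have sum: "ms (cut (slab a (real R)) (t i)) + ms (cut (annul a (real R) (real R + D1)) (t i)) < \<alpha> + \<epsilon> / 2" .
      have "0 \<le> ms (cut (annul a (real R) (real R + D1)) (t i))"
        by (intro ms_nonneg St_cut t annb)
      then obtain c where c: "\<delta> < ms (cut (slab c R2 \<inter> - slab a (real R)) (t i))"
        using d(5)[OF t(1,2,3) i(3), of a "real R"] sum a \<epsilon> by force
      have Y: "slab c R2 \<inter> - slab a (real R) \<in> sets borel" by (intro sets.Int slb borel_comp)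
      have "\<alpha> - \<epsilon> / 2 + \<delta> < ms (cut (slab a (real R)) (t i)) + ms (cut (slab c R2 \<inter> - slab a (real R)) (t i))"
        using a c by simp
      also have "\<dots> = ms (cut (slab a (real R) \<union> (slab c R2 \<inter> - slab a (real R))) (t i))"
        by (rule ms_cut_Un(2)[OF t(1) slb Y, symmetric]) auto
      also have "\<dots> \<le> ms (cut (slab a (real R) \<union> slab c (real R)) (t i))"
        by (rule ms_cut_mono[OF t(1) sets.Un[OF slb Y] Us]) (use RR in auto)
      also have "\<dots> < \<beta> + \<epsilon>" by (rule i(4))
      finally show False using \<epsilon> by linarith
    qed
    have d2: "0 < \<delta> / 2" using d by simp
    obtain \<epsilon>' where \<epsilon>': "0 < \<epsilon>'" "\<And>R::nat. 1 \<le> R \<Longrightarrow> Rc \<le> real R \<Longrightarrow> \<exists>\<eta>>0. \<exists>D\<ge>1. \<forall>s\<in>St. \<forall>a c.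
      \<not> (ms s = M \<and> pw s \<le> P \<and> F s < h + \<eta> \<and> 2 * (2 * real R + D) \<le> \<bar>a - c\<bar> \<and>
       \<delta> / 2 \<le> ms (cut (slab a R) s) \<and> \<delta> / 2 \<le> ms (cut (slab c R) s) \<and>
       ms (cut (annul a (real R) (2 * real R + D)) s) \<le> \<epsilon>' \<and>
       ms (cut (annul c (real R) (2 * real R + D)) s) \<le> \<epsilon>')"
      using no_two_bumps[OF h P M0 d2] by metis
    define \<epsilon> where "\<epsilon> = min (\<epsilon>' / 2) (\<delta> / 8)"
    have \<epsilon>: "0 < \<epsilon>" "2 * \<epsilon> \<le> \<epsilon>'" "8 * \<epsilon> \<le> \<delta>" using \<epsilon>' d by (auto simp: \<epsilon>_def)
    obtain R0 where R0: "\<forall>R'\<ge>R0. \<forall>\<^sub>F i in sequentially. \<exists>a c. \<beta> - \<epsilon> < ms (cut (slab a (real R') \<union> slab c (real R')) (t i))"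
      using two_ge[OF \<epsilon>(1)] by blast
    define R where "R = max R0 (max 1 (nat \<lceil>Rc\<rceil>))"
    have RR: "R0 \<le> R" "1 \<le> R" "Rc \<le> real R"
      unfolding R_def using real_nat_ceiling_ge[of Rc] by (auto simp: max_def)
    obtain \<eta> D where \<eta>: "0 < \<eta>" "1 \<le> D" "\<And>s a c. s \<in> St \<Longrightarrow>
      \<not> (ms s = M \<and> pw s \<le> P \<and> F s < h + \<eta> \<and> 2 * (2 * real R + D) \<le> \<bar>a - c\<bar> \<and>
       \<delta> / 2 \<le> ms (cut (slab a R) s) \<and> \<delta> / 2 \<le> ms (cut (slab c R) s) \<and>
       ms (cut (annul a (real R) (2 * real R + D)) s) \<le> \<epsilon>' \<and>
       ms (cut (annul c (real R) (2 * real R + D)) s) \<le> \<epsilon>')"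
      using \<epsilon>'(2)[OF RR(2,3)] by metis
    define N where "N = 2 * R + nat \<lceil>D\<rceil>"
    have N: "2 * real R + D \<le> real N" using real_nat_ceiling_ge[of D] by (simp add: N_def)
    have "\<forall>\<^sub>F i in sequentially. (\<exists>a c. \<beta> - \<epsilon> < ms (cut (slab a (real R) \<union> slab c (real R)) (t i))) \<and>
      (\<forall>a c. ms (cut (slab a (real N) \<union> slab c (real N)) (t i)) < \<beta> + \<epsilon>) \<and>
      (\<forall>a. ms (cut (slab a (real (3 * N))) (t i)) < \<alpha> + \<epsilon>) \<and> F (t i) < h + \<eta>"
      using R0 RR(1) by (intro eventually_conj one_lt[OF \<epsilon>(1)] Flt[OF \<eta>(1)] two_lt[OF \<epsilon>(1)]) blast
    then obtain i where i: "\<exists>a c. \<beta> - \<epsilon> < ms (cut (slab a (real R) \<union> slab c (real R)) (t i))"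
      "\<And>a c. ms (cut (slab a (real N) \<union> slab c (real N)) (t i)) < \<beta> + \<epsilon>"
      "\<And>a. ms (cut (slab a (real (3 * N))) (t i)) < \<alpha> + \<epsilon>" "F (t i) < h + \<eta>"
      using eventually_happens'[OF sequentially_bot] by (smt (verit))
    obtain a c where ac: "\<beta> - \<epsilon> < ms (cut (slab a (real R) \<union> slab c (real R)) (t i))" using i(1) by blast
    have le: "ms (cut (slab b (real R)) (t i)) < \<alpha> + \<epsilon>" for b
    proof -
      have "ms (cut (slab b (real R)) (t i)) \<le> ms (cut (slab b (real (3 * N))) (t i))"
        by (rule ms_cut_mono[OF t(1) slb slb]) (use N \<eta>(2) in auto)
      then show ?thesis using i(3)[of b] by simp
    qed
    have un: "ms (cut (slab a (real R) \<union> slab c (real R)) (t i)) \<le> ms (cut (slab a (real R)) (t i)) + ms (cut (slab c (real R)) (t i))"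
      by (rule ms_cut_Un(1)[OF t(1) slb slb])
    \<comment> \<open>Each bump holds less than \<open>\<alpha> + \<epsilon>\<close> and both
      together more than \<open>\<alpha> + \<delta> - \<epsilon>\<close>, so neither falls below
      \<open>\<delta> - 2 * \<epsilon>\<close>.\<close>
    have big: "\<delta> / 2 \<le> ms (cut (slab a (real R)) (t i))" "\<delta> / 2 \<le> ms (cut (slab c (real R)) (t i))"
      using un ac le[of a] le[of c] ab \<epsilon> by linarith+
    \<comment> \<open>Close centres would put both slabs into the single slab of half-width
      \<open>3 * N\<close> about \<open>a\<close>, whose mass is below
      \<open>\<alpha> + \<epsilon>\<close>.\<close>
    have far: "2 * (2 * real R + D) \<le> \<bar>a - c\<bar>"
    proof (rule ccontr)
      assume "\<not> ?thesis"
      then have lt: "\<bar>a - c\<bar> < 2 * real N" using N by argo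
      have "slab a (real R) \<union> slab c (real R) \<subseteq> slab a (real (3 * N))"
      proof
        fix z assume "z \<in> slab a (real R) \<union> slab c (real R)"
        then have "\<bar>z - a\<bar> \<le> real R \<or> \<bar>z - c\<bar> \<le> real R" by auto
        moreover have "real R \<le> real N" using N \<eta>(2) by linarith
        ultimately have "\<bar>z - a\<bar> \<le> 3 * real N" using lt by linarith
        then show "z \<in> slab a (real (3 * N))" by simp
      qed
      then have "ms (cut (slab a (real R) \<union> slab c (real R)) (t i)) \<le> ms (cut (slab a (real (3 * N))) (t i))"
        by (rule ms_cut_mono[OF t(1) Us slb])
      then show False using ac i(3)[of a] ab \<epsilon> by linarith
    qed
    \<comment> \<open>The distance of the centres keeps the annulus disjoint from both slabs.
      Enlarging the slabs to half-width \<open>N\<close> collects its mass too, and this gains less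
      than \<open>2 * \<epsilon>\<close>.\<close>
    have ann: "ms (cut (annul b (real R) (2 * real R + D)) (t i)) \<le> \<epsilon>'"
      if "b = a \<or> b = c" for b
    proof -
      let ?A = "(annul b (real R) (2 * real R + D))"
      let ?U = "slab a (real R) \<union> slab c (real R)"
      have disj: "?U \<inter> ?A = {}"
      proof -
        have nf: False if "\<bar>z - a\<bar> \<le> real R \<or> \<bar>z - c\<bar> \<le> real R" "real R < \<bar>z - b\<bar>" "\<bar>z - b\<bar> \<le> 2 * real R + D" for z
        proof -
          have "\<bar>a - c\<bar> \<le> real R + (2 * real R + D)" using that \<open>b = a \<or> b = c\<close> by auto
          then show False using order_trans[OF far] \<eta>(2) by fastforce
        qed
        show ?thesis
        proof (rule equals0I)
          fix z assume z: "z \<in> ?U \<inter> ?A"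
          show False by (rule nf[of z]) (use z in auto)
        qed
      qed
      have "ms (cut ?U (t i)) + ms (cut ?A (t i)) = ms (cut (?U \<union> ?A) (t i))"
        by (rule ms_cut_Un(2)[OF t(1) Us annb disj, symmetric])
      also have "\<dots> \<le> ms (cut (slab a (real N) \<union> slab c (real N)) (t i))"
        by (rule ms_cut_mono[OF t(1) sets.Un[OF Us annb] Us]) (use N \<eta>(2) that in auto)
      also have "\<dots> < \<beta> + \<epsilon>" by (rule i(2))
      finally show ?thesis using ac \<epsilon> by linarith
    qed
    show False using \<eta>(3)[OF t(1), of i a c] t(2,3)[of i] i(4) far big ann[of a] ann[of c] by blast
  qed
  obtain R0 where R0: "\<forall>R'\<ge>R0. \<forall>\<^sub>F i in sequentially. \<exists>a. M - M / 4 < ms (cut (slab a (real R')) (t i))"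
    using one_ge[of "M / 4"] M \<open>\<alpha> = M\<close> by auto
  \<comment> \<open>The centres are chosen at the fixed level of three quarters of the mass, so they
    do not depend on the tolerance; for early members the choice may be arbitrary.\<close>
  define a where "a i = (SOME a. M - M / 4 < ms (cut (slab a (real R0)) (t i)))" for i
  show ?thesis
  proof (rule that[OF \<phi>])
    fix \<epsilon> :: real assume \<epsilon>: "0 < \<epsilon>"
    define e where "e = min \<epsilon> (M / 4)"
    have e: "0 < e" "e \<le> \<epsilon>" "e \<le> M / 4" using \<epsilon> M by (auto simp: e_def)
    obtain R1 where R1: "\<forall>R'\<ge>R1. \<forall>\<^sub>F i in sequentially. \<exists>a. M - e < ms (cut (slab a (real R')) (t i))"
      using one_ge[OF e(1)] \<open>\<alpha> = M\<close> by auto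
    have "\<forall>\<^sub>F i in sequentially. (\<exists>a. M - M / 4 < ms (cut (slab a (real R0)) (t i))) \<and>
      (\<exists>a. M - e < ms (cut (slab a (real R1)) (t i)))"
      using R0 R1 by (intro eventually_conj) auto
    then have "\<forall>\<^sub>F i in sequentially. M - \<epsilon> \<le> ms (cut (slab (a i) (real R0 + 2 * real R1)) (t i))"
    proof eventually_elim
      case (elim i)
      have ai: "M - M / 4 < ms (cut (slab (a i) (real R0)) (t i))"
        unfolding a_def using elim by (intro someI_ex[of "\<lambda>a. M - M / 4 < ms (cut (slab a (real R0)) (t i))"]) blast
      obtain b where b: "M - e < ms (cut (slab b (real R1)) (t i))" using elim by blast
      \<comment> \<open>Disjoint slabs would carry more than \<open>3 * M / 4\<close> each.\<close>
      have near: "\<bar>a i - b\<bar> \<le> real R0 + real R1"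
      proof (rule ccontr)
        assume *: "\<not> ?thesis"
        have "slab (a i) (real R0) \<inter> slab b (real R1) = {}"
          using * by auto
        then have "ms (cut (slab (a i) (real R0) \<union> slab b (real R1)) (t i))
          = ms (cut (slab (a i) (real R0)) (t i)) + ms (cut (slab b (real R1)) (t i))"
          by (rule ms_cut_Un(2)[OF t(1) slb slb])
        moreover have "ms (cut (slab (a i) (real R0) \<union> slab b (real R1)) (t i)) \<le> M"
          using ms_cut_le[OF t(1) sets.Un[OF slb slb]] t(2) by metis
        ultimately show False using ai b e M by linarith
      qed
      have "ms (cut (slab b (real R1)) (t i)) \<le> ms (cut (slab (a i) (real R0 + 2 * real R1)) (t i))"
      proof (rule ms_cut_mono[OF t(1) slb slb])
        show "slab b (real R1) \<subseteq> slab (a i) (real R0 + 2 * real R1)" using near by auto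
      qed
      then show ?case using b e by linarith
    qed
    then obtain i0 where i0: "\<And>i. i0 \<le> i \<Longrightarrow> M - \<epsilon> \<le> ms (cut (slab (a i) (real R0 + 2 * real R1)) (t i))"
      by (auto simp: eventually_sequentially)
    have "\<forall>i. \<exists>R. M - \<epsilon> \<le> ms (cut (slab (a i) R) (t i))"
      using slab_mass_large[OF t(1) \<epsilon>] t(2) by metis
    then obtain Rf where Rf: "\<And>i. M - \<epsilon> \<le> ms (cut (slab (a i) (Rf i)) (t i))" by metis
    \<comment> \<open>The sum enlarges the radius so that it also serves the finitely many members
      before \<open>i0\<close>.\<close>
    define R where "R = real R0 + 2 * real R1 + (\<Sum>i<i0. \<bar>Rf i\<bar>)"
    have "M - \<epsilon> \<le> ms (cut (slab (a i) R) (t i))" for i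
    proof (cases "i0 \<le> i")
      case True
      have "real R0 + 2 * real R1 \<le> R" unfolding R_def by (simp add: sum_nonneg)
      then have "ms (cut (slab (a i) (real R0 + 2 * real R1)) (t i)) \<le> ms (cut (slab (a i) R) (t i))"
        by (intro ms_cut_mono[OF t(1) slb slb]) auto
      then show ?thesis using i0[OF True] by simp
    next
      case False
      then have "\<bar>Rf i\<bar> \<le> (\<Sum>i<i0. \<bar>Rf i\<bar>)" by (intro member_le_sum) auto
      then have "Rf i \<le> R" unfolding R_def by simp
      then have "ms (cut (slab (a i) (Rf i)) (t i)) \<le> ms (cut (slab (a i) R) (t i))"
        by (intro ms_cut_mono[OF t(1) slb slb]) auto
      then show ?thesis using Rf[of i] by simp
    qed
    then show "\<exists>R. \<forall>i. M - \<epsilon> \<le> ms (cut (slab (a i) R) (s (\<phi> i)))" by (auto simp: t_def)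
  qed
qed

end

section \<open>Weak convergence\<close>

text \<open>Inner regularity gives a compact K inside the set, outer regularity an open U around K
  of almost the same measure, and compactness finitely many basis sets between K and U. A countable
  basis has only countably many finite subsets, which makes a diagonal argument over sets
  possible.\<close>

lemma approx_by_basis:
  fixes E :: "'a::euclidean_space set"
  assumes B: "topological_basis B" and E: "E \<in> sets borel" "bounded E" and \<delta>: "0 < \<delta>"
  obtains A where "A \<subseteq> B" "finite A" "emeasure lborel (E - \<Union>A) < ennreal \<delta>" "emeasure lborel (\<Union>A - E) < ennreal \<delta>"
proof -
  have "E \<in> sets lebesgue" using E(1) by simp
  from sets_lebesgue_inner_closed[OF this \<delta>] obtain K where
    K: "closed K" "K \<subseteq> E" "emeasure lebesgue (E - K) < ennreal \<delta>" by metis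
  have cK: "compact K" using K E by (meson bounded_subset compact_eq_bounded_closed)
  have Kb: "K \<in> sets borel" using K by (rule_tac borel_closed)
  from outer_regular_lborel[OF Kb \<delta>] obtain U where
    U: "open U" "K \<subseteq> U" "emeasure lborel (U - K) < ennreal \<delta>" by metis
  have "\<exists>A\<subseteq>{b\<in>B. b \<subseteq> U}. finite A \<and> K \<subseteq> \<Union>A"
  proof (rule compactE[OF cK])
    show "K \<subseteq> \<Union>{b\<in>B. b \<subseteq> U}"
    proof
      fix x assume "x \<in> K"
      then obtain b where "b \<in> B" "x \<in> b" "b \<subseteq> U"
        using topological_basisE[OF B U(1)] U(2) by blast
      then show "x \<in> \<Union>{b\<in>B. b \<subseteq> U}" by blast
    qed
    show "open b" if "b \<in> {b\<in>B. b \<subseteq> U}" for b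
      using that topological_basis_open[OF B] by blast
  qed blast
  then obtain A where A: "A \<subseteq> {b\<in>B. b \<subseteq> U}" "finite A" "K \<subseteq> \<Union>A" by blast
  have Ao: "open (\<Union>A)" using A topological_basis_open[OF B] by (intro open_Union) blast
  have "emeasure lborel (E - \<Union>A) \<le> emeasure lborel (E - K)"
    using A E(1) Kb by (intro emeasure_mono) auto
  also have "\<dots> < ennreal \<delta>" using K(3) E(1) Kb by simp
  finally have 1: "emeasure lborel (E - \<Union>A) < ennreal \<delta>" .
  have "emeasure lborel (\<Union>A - E) \<le> emeasure lborel (U - K)"
    using A K U Kb by (intro emeasure_mono) auto
  also have "\<dots> < ennreal \<delta>" by (rule U(3))
  finally show ?thesis using 1 A that by blast
qed

text \<open>On \<open>D\<close> the function is at most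
  \<open>\<tau> * (f x)\<^sup>2 + 1 / \<tau>\<close>. A common bound on square integrals thus makes
  a family uniformly integrable.\<close>

lemma set_integral_le_L2:
  fixes f :: "'a \<Rightarrow> real"
  assumes f: "integrable M f" "integrable M (\<lambda>x. (f x)\<^sup>2)" "\<And>x. 0 \<le> f x" "(LINT x|M. (f x)\<^sup>2) \<le> C"
    and D: "D \<in> sets M" "emeasure M D \<le> ennreal \<delta>" "0 \<le> \<delta>" and \<tau>: "0 < \<tau>"
  shows "(LINT x|M. f x * indicator D x) \<le> \<tau> * C + \<delta> / \<tau>"
proof -
  have fin: "emeasure M D < \<infinity>" using D(2) by (auto intro: le_less_trans)
  have m: "measure M D \<le> \<delta>" using D by (simp add: measure_def enn2real_leI)
  have "(LINT x|M. f x * indicator D x) \<le> (LINT x|M. \<tau> * (f x)\<^sup>2 + indicator D x / \<tau>)"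
  proof (rule integral_mono)
    show "integrable M (\<lambda>x. f x * indicator D x)"
      by (rule integrable_real_mult_indicator[OF D(1) f(1)])
    show "integrable M (\<lambda>x. \<tau> * (f x)\<^sup>2 + indicator D x / \<tau>)"
      using f D fin by (intro Bochner_Integration.integrable_add integrable_mult_right integrable_divide integrable_real_indicator) auto
    fix x
    have "0 \<le> (\<tau> * f x - 1/2)\<^sup>2" by simp
    then have "\<tau> * f x \<le> \<tau> * \<tau> * (f x)\<^sup>2 + 1" by (simp add: power2_eq_square algebra_simps)
    then have "f x \<le> \<tau> * (f x)\<^sup>2 + 1 / \<tau>" using \<tau> by (simp add: field_simps)
    then show "f x * indicator D x \<le> \<tau> * (f x)\<^sup>2 + indicator D x / \<tau>"
      using \<tau> by (simp add: indicator_def)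
  qed
  also have "\<dots> = \<tau> * (LINT x|M. (f x)\<^sup>2) + measure M D / \<tau>"
    using f D fin by (subst Bochner_Integration.integral_add) (auto intro!: integrable_real_indicator integrable_divide)
  also have "\<dots> \<le> \<tau> * C + \<delta> / \<tau>"
    using f m \<tau> by (intro add_mono mult_left_mono divide_right_mono) auto
  finally show ?thesis .
qed

text \<open>This is weak sequential compactness in L^2, expressed by set integrals. A diagonal
  subsequence converges on the finite unions of basis sets, and uniform integrability carries the
  Cauchy property over to every bounded Borel set.\<close>

lemma L2_bounded_subseq_set_convergent:
  fixes f :: "nat \<Rightarrow> 'a::euclidean_space \<Rightarrow> real"
  assumes f: "\<And>i. integrable lborel (f i)" "\<And>i. integrable lborel (\<lambda>x. (f i x)\<^sup>2)" "\<And>i x. 0 \<le> f i x"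
    "\<And>i. (LINT x|lborel. (f i x)\<^sup>2) \<le> C" "\<And>i. (LINT x|lborel. f i x) \<le> M"
  obtains \<phi> :: "nat \<Rightarrow> nat" where "strict_mono \<phi>"
    "\<And>E. E \<in> sets borel \<Longrightarrow> bounded E \<Longrightarrow> convergent (\<lambda>i. LINT x|lborel. f (\<phi> i) x * indicator E x)"
proof -
  obtain B :: "'a set set" where B: "countable B" "topological_basis B"
    using ex_countable_basis by blast
  define S where "S = {A. A \<subseteq> B \<and> finite A}"
  have cS: "countable S" unfolding S_def
    using countable_Collect_finite_subset[OF B(1)] by (simp add: conj_commute)
  define g where "g i A = (LINT x|lborel. f i x * indicator (\<Union>A) x)" for i A
  have Sb: "\<Union>A \<in> sets borel" if "A \<in> S" for A
    using that topological_basis_open[OF B(2)] unfolding S_def by (intro borel_open open_Union) blast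
  have gM: "norm (g i A) \<le> M" if "A \<in> S" for i A
  proof -
    have "0 \<le> g i A" unfolding g_def using f(3) by (intro integral_nonneg_AE AE_I2) auto
    moreover have "g i A \<le> (LINT x|lborel. f i x)" unfolding g_def
      using Sb[OF that] f by (intro integral_mono integrable_real_mult_indicator) (auto simp: indicator_def)
    ultimately show ?thesis using f(5)[of i] by simp
  qed
  obtain \<phi> :: "nat \<Rightarrow> nat" where \<phi>: "strict_mono \<phi>" "\<And>A. A \<in> S \<Longrightarrow> \<exists>l. (\<lambda>n. g (\<phi> n) A) \<longlonglongrightarrow> l"
    by (rule function_convergent_subsequence[of S g M, OF cS]) (use gM in blast)+
  have "0 \<le> (LINT x|lborel. (f 0 x)\<^sup>2)" by (intro Bochner_Integration.integral_nonneg) simp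
  then have C: "0 \<le> C" by (rule order_trans[OF _ f(4)])
  show ?thesis
  proof (rule that[OF \<phi>(1)])
    fix E :: "'a set" assume E: "E \<in> sets borel" "bounded E"
    let ?x = "\<lambda>i. LINT x|lborel. f (\<phi> i) x * indicator E x"
    have "Cauchy ?x"
    proof (rule metric_CauchyI)
      fix e :: real assume e: "0 < e"
      define \<tau> where "\<tau> = e / (16 * (C + 1))"
      have \<tau>: "0 < \<tau>" "\<tau> * C \<le> e / 16" using e C by (auto simp: \<tau>_def divide_le_eq le_divide_eq mult_left_mono field_simps)
      define \<delta> where "\<delta> = \<tau> * e / 16"
      have \<delta>: "0 < \<delta>" "\<delta> / \<tau> = e / 16" using e \<tau>(1) by (auto simp: \<delta>_def)
      obtain A where A: "A \<subseteq> B" "finite A" "emeasure lborel (E - \<Union>A) < ennreal \<delta>" "emeasure lborel (\<Union>A - E) < ennreal \<delta>"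
        by (rule approx_by_basis[OF B(2) E \<delta>(1)])
      have AS: "A \<in> S" using A by (simp add: S_def)
      note Ab = Sb[OF AS]
      have xy: "dist (?x i) (g (\<phi> i) A) \<le> e / 4" for i
      proof -
        note fi = f(1)[of "\<phi> i"] f(2)[of "\<phi> i"] f(3)[of "\<phi> i"] f(4)[of "\<phi> i"]
        have D: "E - \<Union>A \<in> sets lborel" "\<Union>A - E \<in> sets lborel" using E Ab by auto
        note ii = integrable_real_mult_indicator[OF D(1) fi(1)] integrable_real_mult_indicator[OF D(2) fi(1)]
        have "?x i - g (\<phi> i) A = (LINT x|lborel. f (\<phi> i) x * indicator E x - f (\<phi> i) x * indicator (\<Union>A) x)"
          unfolding g_def using E Ab fi
          by (intro Bochner_Integration.integral_diff[symmetric] integrable_real_mult_indicator) auto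
        also have "\<dots> = (LINT x|lborel. f (\<phi> i) x * indicator (E - \<Union>A) x - f (\<phi> i) x * indicator (\<Union>A - E) x)"
          by (intro Bochner_Integration.integral_cong) (auto simp: indicator_def)
        also have "\<dots> = (LINT x|lborel. f (\<phi> i) x * indicator (E - \<Union>A) x) - (LINT x|lborel. f (\<phi> i) x * indicator (\<Union>A - E) x)"
          by (rule Bochner_Integration.integral_diff[OF ii])
        finally have eq: "?x i - g (\<phi> i) A = \<dots>" .
        have le: "(LINT x|lborel. f (\<phi> i) x * indicator (E - \<Union>A) x) \<le> \<tau> * C + \<delta> / \<tau>"
          "(LINT x|lborel. f (\<phi> i) x * indicator (\<Union>A - E) x) \<le> \<tau> * C + \<delta> / \<tau>"
          using A \<delta>(1) \<tau>(1) by (intro set_integral_le_L2[OF fi] D; simp)+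
        have ge: "0 \<le> (LINT x|lborel. f (\<phi> i) x * indicator (E - \<Union>A) x)"
          "0 \<le> (LINT x|lborel. f (\<phi> i) x * indicator (\<Union>A - E) x)"
          using fi(3) by (intro integral_nonneg_AE AE_I2; simp)+
        have "\<bar>?x i - g (\<phi> i) A\<bar> \<le> e / 4" unfolding eq abs_le_iff
          using le ge \<tau>(2) \<delta>(2) by linarith
        then show ?thesis by (simp add: dist_real_def)
      qed
      have "Cauchy (\<lambda>n. g (\<phi> n) A)" using \<phi>(2)[OF AS] by (auto simp: Cauchy_convergent_iff convergent_def)
      then obtain N where N: "\<And>m n. N \<le> m \<Longrightarrow> N \<le> n \<Longrightarrow> dist (g (\<phi> m) A) (g (\<phi> n) A) < e / 4"
        using e unfolding Cauchy_def by (metis zero_less_divide_iff zero_less_numeral)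
      have "dist (?x m) (?x n) < e" if "N \<le> m" "N \<le> n" for m n
        using xy[of m] xy[of n] N[OF that] e
        using dist_triangle[of "?x m" "?x n" "g (\<phi> m) A"] dist_triangle[of "g (\<phi> m) A" "?x n" "g (\<phi> n) A"]
        by (simp add: dist_commute)
      then show "\<exists>N. \<forall>m\<ge>N. \<forall>n\<ge>N. dist (?x m) (?x n) < e" by blast
    qed
    then show "convergent ?x" by (simp add: Cauchy_convergent_iff)
  qed
qed

text \<open>Rounding \<open>g\<close> down to multiples of \<open>1 / k0\<close> leaves finitely
  many values, so convergence on level sets passes to the rounded function. The error is at most the
  total mass times \<open>1 / k0\<close>, uniformly along the sequence.\<close>

lemma integral_conv_bounded:
  fixes s :: "nat \<Rightarrow> 'a \<Rightarrow> real" and t :: "'a \<Rightarrow> real"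
  assumes s: "\<And>i. integrable N (s i)" "\<And>i x. 0 \<le> s i x" "\<And>i. (LINT x|N. s i x) \<le> M"
    and t: "integrable N t" "\<And>x. 0 \<le> t x" "(LINT x|N. t x) \<le> M"
    and conv: "\<And>S. S \<in> sets N \<Longrightarrow> (\<lambda>i. LINT x|N. s i x * indicator S x) \<longlonglongrightarrow> (LINT x|N. t x * indicator S x)"
    and g: "g \<in> borel_measurable N" "\<And>x. \<bar>g x\<bar> \<le> B"
  shows "(\<lambda>i. LINT x|N. s i x * g x) \<longlonglongrightarrow> (LINT x|N. t x * g x)"
proof (rule LIMSEQ_I)
  fix e :: real assume e: "0 < e"
  have "0 \<le> (LINT x|N. t x)" by (intro Bochner_Integration.integral_nonneg t)
  then have M: "0 \<le> M" by (rule order_trans[OF _ t(3)])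
  obtain k0 where k0: "4 * (M + 1) / e < real k0" using reals_Archimedean2 by blast
  have kpos: "0 < real k0" using k0 e M by (smt (verit) divide_nonneg_pos)
  have Mk: "M / real k0 < e / 4" using k0 kpos e M by (simp add: field_simps)
  define v where "v x = \<lfloor>real k0 * g x\<rfloor>" for x
  define K where "K = \<lceil>real k0 * B\<rceil> + 1"
  have v: "v x \<in> {-K..K}" for x
  proof -
    have "\<bar>real k0 * g x\<bar> \<le> real k0 * B" using g(2)[of x] kpos by (simp add: abs_mult)
    then show ?thesis unfolding v_def K_def by (simp add: abs_le_iff) linarith
  qed
  have [measurable]: "g \<in> borel_measurable N" by (rule g)
  define Sv where "Sv j = {x \<in> space N. v x = j}" for j
  have Sv: "Sv j \<in> sets N" for j unfolding Sv_def v_def by measurable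
  define gk where "gk x = real_of_int (v x) / real k0" for x
  have gm: "gk \<in> borel_measurable N" unfolding gk_def v_def by measurable
  have gg: "\<bar>g x - gk x\<bar> \<le> 1 / real k0" for x
  proof -
    have "\<bar>real k0 * g x - of_int (v x)\<bar> \<le> 1" unfolding v_def by linarith
    moreover have "g x - gk x = (real k0 * g x - of_int (v x)) / real k0"
      using kpos by (simp add: gk_def diff_divide_distrib)
    ultimately show ?thesis using kpos by (simp add: divide_right_mono)
  qed
  have B: "0 \<le> B" using g(2)[of undefined] by simp
  have gkB: "\<bar>gk x\<bar> \<le> B + 1 / real k0" for x using gg[of x] g(2)[of x] by linarith
  have int: "integrable N (\<lambda>x. u x * g x)" "integrable N (\<lambda>x. u x * gk x)" if u: "integrable N u" for u
  proof -
    note [measurable] = gm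
    have [measurable]: "u \<in> borel_measurable N" using u by auto
    show "integrable N (\<lambda>x. u x * g x)"
      using g(2) by (intro Bochner_Integration.integrable_bound[OF integrable_mult_right[OF u, of B]])
        (auto simp: abs_mult mult.commute[of B] intro!: mult_left_mono order_trans[OF g(2) abs_ge_self])
    show "integrable N (\<lambda>x. u x * gk x)"
      using gkB by (intro Bochner_Integration.integrable_bound[OF integrable_mult_right[OF u, of "B + 1 / real k0"]])
        (auto simp: abs_mult mult.commute[of "B + 1 / real k0"] intro!: mult_left_mono order_trans[OF gkB abs_ge_self])
  qed
  have approx: "\<bar>(LINT x|N. u x * g x) - (LINT x|N. u x * gk x)\<bar> < e / 4"
    if u: "integrable N u" "\<And>x. 0 \<le> u x" "(LINT x|N. u x) \<le> M" for u
  proof -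
    have "(LINT x|N. u x * g x) - (LINT x|N. u x * gk x) = (LINT x|N. u x * g x - u x * gk x)"
      by (rule Bochner_Integration.integral_diff[OF int[OF u(1)], symmetric])
    then have "\<bar>(LINT x|N. u x * g x) - (LINT x|N. u x * gk x)\<bar> \<le> (LINT x|N. \<bar>u x * g x - u x * gk x\<bar>)" by simp
    also have "\<dots> \<le> (LINT x|N. u x / real k0)"
    proof (rule integral_mono)
      show "integrable N (\<lambda>x. \<bar>u x * g x - u x * gk x\<bar>)" using int[OF u(1)] by simp
      show "integrable N (\<lambda>x. u x / real k0)" using u by simp
      fix x show "\<bar>u x * g x - u x * gk x\<bar> \<le> u x / real k0"
        using mult_left_mono[OF gg[of x] u(2)[of x]] u(2)[of x]
        by (simp add: right_diff_distrib[symmetric] abs_mult)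
    qed
    also have "\<dots> = (LINT x|N. u x) / real k0" by simp
    also have "\<dots> \<le> M / real k0" using u(3) kpos by (intro divide_right_mono) auto
    finally show ?thesis using Mk by linarith
  qed
  have decomp: "(LINT x|N. u x * gk x) = (\<Sum>j\<in>{-K..K}. of_int j / real k0 * (LINT x|N. u x * indicator (Sv j) x))"
    if u: "integrable N u" for u
  proof -
    have "(LINT x|N. u x * gk x) = (LINT x|N. (\<Sum>j\<in>{-K..K}. of_int j / real k0 * (u x * indicator (Sv j) x)))"
    proof (rule Bochner_Integration.integral_cong[OF refl])
      fix x assume x: "x \<in> space N"
      have "(\<Sum>j\<in>{-K..K}. of_int j / real k0 * (u x * indicator (Sv j) x))
        = (\<Sum>j\<in>{-K..K}. if j = v x then of_int j / real k0 * u x else 0)"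
        using x by (intro sum.cong) (auto simp: Sv_def indicator_def)
      also have "\<dots> = of_int (v x) / real k0 * u x" using v[of x] by simp
      finally show "u x * gk x = (\<Sum>j\<in>{-K..K}. of_int j / real k0 * (u x * indicator (Sv j) x))"
        by (simp add: gk_def)
    qed
    also have "\<dots> = (\<Sum>j\<in>{-K..K}. LINT x|N. of_int j / real k0 * (u x * indicator (Sv j) x))"
      by (intro Bochner_Integration.integral_sum integrable_mult_right integrable_real_mult_indicator[OF Sv u])
    finally show ?thesis by simp
  qed
  have "(\<lambda>i. LINT x|N. s i x * gk x) \<longlonglongrightarrow> (LINT x|N. t x * gk x)"
    unfolding decomp[OF s(1)] decomp[OF t(1)]
    by (intro tendsto_sum tendsto_mult tendsto_const conv Sv)
  from LIMSEQ_D[OF this, of "e / 4"] e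
  obtain n0 where n0: "\<And>n. n0 \<le> n \<Longrightarrow> \<bar>(LINT x|N. s n x * gk x) - (LINT x|N. t x * gk x)\<bar> < e / 4"
    by auto
  have "norm ((LINT x|N. s n x * g x) - (LINT x|N. t x * g x)) < e" if "n0 \<le> n" for n
    using n0[OF that] approx[OF s(1,2,3), of n] approx[OF t] e unfolding real_norm_def by linarith
  then show "\<exists>no. \<forall>n\<ge>no. norm ((LINT x|N. s n x * g x) - (LINT x|N. t x * g x)) < e" by blast
qed

lemma young_scaled:
  fixes p x d t :: real
  assumes p: "1 < p" and "0 \<le> x" "0 < t"
  shows "x * \<bar>d\<bar> \<le> t powr p * x powr p + \<bar>d\<bar> powr (p / (p - 1)) / t powr (p / (p - 1))"
proof -
  define q where "q = p / (p - 1)"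
  have q: "1 < q" "1 / p + 1 / q = 1" using p by (auto simp: q_def field_simps)
  have "x * \<bar>d\<bar> = (t * x) * (\<bar>d\<bar> / t)" using assms by simp
  also have "\<dots> \<le> (t * x) powr p / p + (\<bar>d\<bar> / t) powr q / q"
    using assms q by (intro Youngs_inequality) auto
  also have "\<dots> \<le> (t * x) powr p / 1 + (\<bar>d\<bar> / t) powr q / 1"
    using p q by (intro add_mono divide_left_mono) auto
  also have "\<dots> = t powr p * x powr p + \<bar>d\<bar> powr q / t powr q"
    using assms by (simp add: powr_mult powr_divide)
  finally show ?thesis by (simp add: q_def)
qed

text \<open>Truncating \<open>h\<close> at height \<open>n\<close> reduces the claim to bounded test
  functions. The remainder is paired by \<open>young_scaled\<close>: the weight \<open>c\<close>
  makes the part with \<open>P\<close> small, and for this \<open>c\<close> a large \<open>n\<close>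
  makes the tail of \<open>h\<close> small.\<close>

lemma integral_conv_Lq:
  fixes s :: "nat \<Rightarrow> 'a \<Rightarrow> real" and t h :: "'a \<Rightarrow> real" and p :: real
  defines "q \<equiv> p / (p - 1)"
  assumes p: "1 < p"
    and s: "\<And>i. s i \<in> borel_measurable N" "\<And>i x. 0 \<le> s i x" "\<And>i. integrable N (\<lambda>x. s i x powr p)" "\<And>i. (LINT x|N. s i x powr p) \<le> P"
    and t: "t \<in> borel_measurable N" "\<And>x. 0 \<le> t x" "integrable N (\<lambda>x. t x powr p)" "(LINT x|N. t x powr p) \<le> P"
    and conv: "\<And>g B. g \<in> borel_measurable N \<Longrightarrow> (\<And>x. \<bar>g x\<bar> \<le> B) \<Longrightarrow>
      (\<lambda>i. LINT x|N. s i x * g x) \<longlonglongrightarrow> (LINT x|N. t x * g x)"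
    and h: "h \<in> borel_measurable N" "integrable N (\<lambda>x. \<bar>h x\<bar> powr q)"
  shows "(\<lambda>i. LINT x|N. s i x * h x) \<longlonglongrightarrow> (LINT x|N. t x * h x)"
proof (rule LIMSEQ_I)
  fix e :: real assume e: "0 < e"
  have "0 \<le> (LINT x|N. t x powr p)" by (intro Bochner_Integration.integral_nonneg) simp
  then have P: "0 \<le> P" by (rule order_trans[OF _ t(4)])
  note [measurable] = h(1)
  define c where "c = (e / (8 * (P + 1))) powr (1 / p)"
  have c: "0 < c" "c powr p = e / (8 * (P + 1))" using e P p by (auto simp: c_def powr_powr)
  have cP: "c powr p * P \<le> e / 8" unfolding c(2) using e P by (simp add: field_simps)
  let ?d = "\<lambda>n x. h x * indicator {x. real n < \<bar>h x\<bar>} x"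
  have dm: "?d n \<in> borel_measurable N" for n by measurable
  have "(\<lambda>n. LINT x|N. \<bar>?d n x\<bar> powr q) \<longlonglongrightarrow> (LINT x|N. 0)"
  proof (rule integral_dominated_convergence[where w="\<lambda>x. \<bar>h x\<bar> powr q"])
    show "AE x in N. (\<lambda>n. \<bar>?d n x\<bar> powr q) \<longlonglongrightarrow> 0"
    proof (intro AE_I2 tendsto_eventually)
      fix x
      obtain n0 where "\<bar>h x\<bar> \<le> real n0" using real_arch_simple by blast
      then have "\<bar>?d n x\<bar> powr q = 0" if "n0 \<le> n" for n using that by (auto simp: indicator_def)
      then show "eventually (\<lambda>n. \<bar>?d n x\<bar> powr q = 0) sequentially" by (auto simp: eventually_sequentially)
    qed
    show "AE x in N. norm (\<bar>?d n x\<bar> powr q) \<le> \<bar>h x\<bar> powr q" for n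
      by (intro AE_I2) (auto simp: indicator_def)
  qed (use h in auto)
  then have "(\<lambda>n. (LINT x|N. \<bar>?d n x\<bar> powr q) / c powr q) \<longlonglongrightarrow> 0 / c powr q"
    using c by (intro tendsto_divide tendsto_const) auto
  then have "eventually (\<lambda>n. (LINT x|N. \<bar>?d n x\<bar> powr q) / c powr q < e / 8) sequentially"
    using e by (intro order_tendstoD) auto
  then obtain n where n: "(LINT x|N. \<bar>?d n x\<bar> powr q) / c powr q < e / 8"
    by (auto simp: eventually_sequentially)
  let ?g = "\<lambda>x. h x * indicator {x. \<bar>h x\<bar> \<le> real n} x"
  have gm: "?g \<in> borel_measurable N" by measurable
  have gB: "\<bar>?g x\<bar> \<le> real n" for x by (auto simp: indicator_def)
  have qd: "integrable N (\<lambda>x. \<bar>?d n x\<bar> powr q)"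
    by (rule Bochner_Integration.integrable_bound[OF h(2)]) (use dm in \<open>auto simp: indicator_def\<close>)
  have approx: "\<bar>(LINT x|N. u x * h x) - (LINT x|N. u x * ?g x)\<bar> < e / 4"
    if u: "u \<in> borel_measurable N" "\<And>x. 0 \<le> u x" "integrable N (\<lambda>x. u x powr p)" "(LINT x|N. u x powr p) \<le> P" for u
  proof -
    note [measurable] = u(1)
    have iu: "integrable N (\<lambda>x. u x * k x)" if k: "k \<in> borel_measurable N" "integrable N (\<lambda>x. \<bar>k x\<bar> powr q)" for k
    proof -
      note [measurable] = k(1)
      show ?thesis
      proof (rule Bochner_Integration.integrable_bound)
        show "integrable N (\<lambda>x. 1 powr p * u x powr p + \<bar>k x\<bar> powr q / 1 powr q)" using u k by simp
        show "AE x in N. norm (u x * k x) \<le> norm (1 powr p * u x powr p + \<bar>k x\<bar> powr q / 1 powr q)"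
        proof (rule AE_I2)
          fix x
          have "norm (u x * k x) = u x * \<bar>k x\<bar>" using u(2)[of x] by (simp add: abs_mult)
          also have "\<dots> \<le> 1 powr p * u x powr p + \<bar>k x\<bar> powr q / 1 powr q"
            unfolding q_def by (rule young_scaled[OF p u(2)]) simp
          finally show "norm (u x * k x) \<le> norm (1 powr p * u x powr p + \<bar>k x\<bar> powr q / 1 powr q)" by simp
        qed
      qed measurable
    qed
    have qg: "integrable N (\<lambda>x. \<bar>?g x\<bar> powr q)"
      by (rule Bochner_Integration.integrable_bound[OF h(2)]) (use gm in \<open>auto simp: indicator_def\<close>)
    have "(LINT x|N. u x * h x) - (LINT x|N. u x * ?g x) = (LINT x|N. u x * h x - u x * ?g x)"
      by (rule Bochner_Integration.integral_diff[OF iu[OF h] iu[OF gm qg], symmetric])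
    also have "\<dots> = (LINT x|N. u x * ?d n x)"
      by (intro Bochner_Integration.integral_cong) (auto simp: indicator_def)
    finally have "\<bar>(LINT x|N. u x * h x) - (LINT x|N. u x * ?g x)\<bar> \<le> (LINT x|N. \<bar>u x * ?d n x\<bar>)" by simp
    also have "\<dots> \<le> (LINT x|N. c powr p * u x powr p + \<bar>?d n x\<bar> powr q / c powr q)"
    proof (rule integral_mono)
      show "integrable N (\<lambda>x. \<bar>u x * ?d n x\<bar>)" using iu[OF dm qd] by simp
      show "integrable N (\<lambda>x. c powr p * u x powr p + \<bar>?d n x\<bar> powr q / c powr q)" using u qd by simp
      fix x
      have "\<bar>u x * ?d n x\<bar> = u x * \<bar>?d n x\<bar>" using u(2)[of x] by (simp add: abs_mult)
      then show "\<bar>u x * ?d n x\<bar> \<le> c powr p * u x powr p + \<bar>?d n x\<bar> powr q / c powr q"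
        unfolding q_def using young_scaled[OF p u(2) c(1), of x "?d n x"] by simp
    qed
    also have "\<dots> = c powr p * (LINT x|N. u x powr p) + (LINT x|N. \<bar>?d n x\<bar> powr q) / c powr q"
      using u qd by (subst Bochner_Integration.integral_add) auto
    also have "\<dots> < e / 8 + e / 8"
    proof (rule add_le_less_mono)
      show "c powr p * (LINT x|N. u x powr p) \<le> e / 8"
        by (rule order_trans[OF mult_left_mono[OF u(4)] cP]) simp
    qed (rule n)
    finally show ?thesis by simp
  qed
  from LIMSEQ_D[OF conv[OF gm gB], of "e / 4"] e obtain n0 where
    n0: "\<And>i. n0 \<le> i \<Longrightarrow> \<bar>(LINT x|N. s i x * ?g x) - (LINT x|N. t x * ?g x)\<bar> < e / 4"
    by auto
  have "norm ((LINT x|N. s i x * h x) - (LINT x|N. t x * h x)) < e" if "n0 \<le> i" for i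
    using n0[OF that] approx[OF s, of i] approx[OF t] e unfolding real_norm_def by linarith
  then show "\<exists>no. \<forall>i\<ge>no. norm ((LINT x|N. s i x * h x) - (LINT x|N. t x * h x)) < e" by blast
qed

text \<open>\<open>k\<close> is the conditional expectation of \<open>h\<close> given the
  cylindrical coordinates, obtained as a Radon-Nikodym derivative; test functions on the whole space
  are thereby replaced by functions on the half-plane. The bound by \<open>H\<close> comes from
  applying the same construction to \<open>H - h\<close>: the two derivatives add up to
  \<open>H\<close> almost everywhere.\<close>

lemma cyl_average:
  fixes e :: "'a::euclidean_space" and h :: "'a \<Rightarrow> real"
  assumes e: "norm e = 1" and [measurable]: "h \<in> borel_measurable borel" and h: "\<And>x. 0 \<le> h x" "\<And>x. h x \<le> H"
  obtains k :: "real \<times> real \<Rightarrow> real" where "k \<in> borel_measurable borel" "\<And>p. 0 \<le> k p" "\<And>p. k p \<le> H"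
    "\<And>s. s \<in> borel_measurable borel \<Longrightarrow>
      (\<integral>\<^sup>+x. s (cyl e x) * ennreal (h x) \<partial>lborel) = (\<integral>\<^sup>+p. s p * ennreal (k p) \<partial>cylm e)"
proof -
  interpret sf: sigma_finite_measure "cylm e" by (rule sigma_finite_cylm[OF e])
  have H: "0 \<le> H" using h(1)[of 0] h(2)[of 0] by simp
  define \<eta> where "\<eta> k = distr (density lborel (\<lambda>x. ennreal (k x))) borel (cyl e)" for k :: "'a \<Rightarrow> real"
  have \<eta>: "density (cylm e) (RN_deriv (cylm e) (\<eta> k)) = \<eta> k" "sets (\<eta> k) = sets borel"
    if [measurable]: "k \<in> borel_measurable borel" for k
  proof -
    show "sets (\<eta> k) = sets borel" by (simp add: \<eta>_def)
    have "absolutely_continuous (cylm e) (\<eta> k)"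
    proof (unfold absolutely_continuous_def, rule subsetI)
      fix S assume S: "S \<in> null_sets (cylm e)"
      then have Sb: "S \<in> sets borel" by auto
      then have [measurable]: "cyl e -` S \<in> sets borel" using measurable_sets[OF cyl_measurable Sb] by simp
      have "emeasure lborel (cyl e -` S) = 0" using S emeasure_cylm[OF Sb, of e] by (simp add: null_sets_def)
      then have "cyl e -` S \<in> null_sets lborel" by (simp add: null_sets_def)
      then have "AE x in lborel. x \<notin> cyl e -` S" by (rule AE_not_in)
      then have "emeasure (\<eta> k) S = 0"
        unfolding \<eta>_def using Sb
        by (subst emeasure_distr) (auto simp: emeasure_density nn_integral_0_iff_AE elim!: eventually_mono)
      then show "S \<in> null_sets (\<eta> k)" using Sb by (simp add: null_sets_def \<eta>_def)
    qed
    then show "density (cylm e) (RN_deriv (cylm e) (\<eta> k)) = \<eta> k"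
      by (intro sf.density_RN_deriv) (simp_all add: \<eta>_def)
  qed
  have nn\<eta>: "(\<integral>\<^sup>+p. s p \<partial>\<eta> k) = (\<integral>\<^sup>+x. s (cyl e x) * ennreal (k x) \<partial>lborel)"
    if [measurable]: "k \<in> borel_measurable borel" "s \<in> borel_measurable borel" for k s
    unfolding \<eta>_def by (subst nn_integral_distr) (auto simp: nn_integral_density mult.commute)
  let ?h' = "\<lambda>x. H - h x"
  have [measurable]: "?h' \<in> borel_measurable borel" by measurable
  let ?R = "RN_deriv (cylm e) (\<eta> h)" and ?R' = "RN_deriv (cylm e) (\<eta> ?h')"
  have [measurable]: "?R \<in> borel_measurable borel" "?R' \<in> borel_measurable borel"
    using borel_measurable_RN_deriv[of "cylm e"] by (simp_all cong: measurable_cong_sets)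
  have R: "(\<integral>\<^sup>+p. s p * ?R p \<partial>cylm e) = (\<integral>\<^sup>+x. s (cyl e x) * ennreal (h x) \<partial>lborel)"
    "(\<integral>\<^sup>+p. s p * ?R' p \<partial>cylm e) = (\<integral>\<^sup>+x. s (cyl e x) * ennreal (H - h x) \<partial>lborel)"
    if [measurable]: "s \<in> borel_measurable borel" for s
  proof -
    have "(\<integral>\<^sup>+p. s p * ?R p \<partial>cylm e) = (\<integral>\<^sup>+p. s p \<partial>density (cylm e) ?R)"
      by (subst nn_integral_density) (auto simp: mult.commute)
    then show "(\<integral>\<^sup>+p. s p * ?R p \<partial>cylm e) = (\<integral>\<^sup>+x. s (cyl e x) * ennreal (h x) \<partial>lborel)"
      by (simp add: \<eta> nn\<eta>)
    have "(\<integral>\<^sup>+p. s p * ?R' p \<partial>cylm e) = (\<integral>\<^sup>+p. s p \<partial>density (cylm e) ?R')"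
      by (subst nn_integral_density) (auto simp: mult.commute)
    then show "(\<integral>\<^sup>+p. s p * ?R' p \<partial>cylm e) = (\<integral>\<^sup>+x. s (cyl e x) * ennreal (H - h x) \<partial>lborel)"
      by (simp add: \<eta> nn\<eta>)
  qed
  have "density (cylm e) (\<lambda>p. ?R p + ?R' p) = density (cylm e) (\<lambda>p. ennreal H)"
  proof (rule measure_eqI)
    fix S assume "S \<in> sets (density (cylm e) (\<lambda>p. ?R p + ?R' p))"
    then have S: "S \<in> sets borel" by simp
    then have [measurable]: "(indicator S :: _ \<Rightarrow> ennreal) \<in> borel_measurable borel" by simp
    have "emeasure (density (cylm e) (\<lambda>p. ?R p + ?R' p)) S = (\<integral>\<^sup>+p. indicator S p * ?R p + indicator S p * ?R' p \<partial>cylm e)"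
      using S by (subst emeasure_density) (auto simp: distrib_left mult.commute)
    also have "\<dots> = (\<integral>\<^sup>+p. indicator S p * ?R p \<partial>cylm e) + (\<integral>\<^sup>+p. indicator S p * ?R' p \<partial>cylm e)"
      by (rule nn_integral_add) measurable
    also have "\<dots> = (\<integral>\<^sup>+x. indicator S (cyl e x) * ennreal (h x) \<partial>lborel) + (\<integral>\<^sup>+x. indicator S (cyl e x) * ennreal (H - h x) \<partial>lborel)"
      by (simp add: R)
    also have "\<dots> = (\<integral>\<^sup>+x. indicator S (cyl e x) * ennreal (h x) + indicator S (cyl e x) * ennreal (H - h x) \<partial>lborel)"
      by (rule nn_integral_add[symmetric]) measurable
    also have "\<dots> = (\<integral>\<^sup>+x. ennreal H * indicator S (cyl e x) \<partial>lborel)"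
    proof (intro nn_integral_cong)
      fix x
      have "ennreal (h x) + ennreal (H - h x) = ennreal H" using h by (subst ennreal_plus[symmetric]) auto
      then show "indicator S (cyl e x) * ennreal (h x) + indicator S (cyl e x) * ennreal (H - h x) = ennreal H * indicator S (cyl e x)"
        by (metis distrib_left mult.commute)
    qed
    also have "\<dots> = (\<integral>\<^sup>+p. ennreal H * indicator S p \<partial>cylm e)"
      by (subst nn_integral_cylm) auto
    also have "\<dots> = emeasure (density (cylm e) (\<lambda>p. ennreal H)) S"
      using S by (subst emeasure_density) auto
    finally show "emeasure (density (cylm e) (\<lambda>p. ?R p + ?R' p)) S = emeasure (density (cylm e) (\<lambda>p. ennreal H)) S" .
  qed simp
  then have "AE p in cylm e. ?R p + ?R' p = ennreal H"
    by (subst (asm) sf.density_unique_iff) auto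
  then have ae: "AE p in cylm e. ?R p = ennreal (min (enn2real (?R p)) H)"
  proof eventually_elim
    case (elim p)
    then have "?R p \<le> ennreal H" by (metis add_increasing2 order_refl zero_le)
    then obtain r where "?R p = ennreal r" "0 \<le> r" "r \<le> H" using H
      by (cases "?R p") (auto simp: top_unique)
    then show ?case by simp
  qed
  show ?thesis
  \<comment> \<open>Clipping changes the derivative only on a null set and makes the bound hold at
    every point.\<close>
  proof (rule that[of "\<lambda>p. min (enn2real (?R p)) H"])
    show "(\<lambda>p. min (enn2real (?R p)) H) \<in> borel_measurable borel" by measurable
    fix s :: "real \<times> real \<Rightarrow> ennreal" assume s: "s \<in> borel_measurable borel"
    have "(\<integral>\<^sup>+p. s p * ?R p \<partial>cylm e) = (\<integral>\<^sup>+p. s p * ennreal (min (enn2real (?R p)) H) \<partial>cylm e)"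
      using ae by (intro nn_integral_cong_AE) (auto elim!: eventually_mono)
    then show "(\<integral>\<^sup>+x. s (cyl e x) * ennreal (h x) \<partial>lborel) = (\<integral>\<^sup>+p. s p * ennreal (min (enn2real (?R p)) H) \<partial>cylm e)"
      using R(1)[OF s] by simp
  qed (use H in auto)
qed

section \<open>Upper semicontinuity of the potential energy\<close>

text \<open>The kernel is split into a singular part, a bounded part \<open>k\<close> of bounded
  support and a far part; the first and the last are small uniformly in \<open>i\<close>. For
  \<open>k\<close> the potentials converge pointwise, hence in square mean on balls, so a weakly
  convergent density meets a strongly convergent potential. Tightness controls what lies outside a
  ball.\<close>

lemma kint_riesz_limsup:
  fixes f :: "nat \<Rightarrow> 'a::euclidean_space \<Rightarrow> real" and g :: "'a \<Rightarrow> real"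
  assumes l: "0 < l" "l < DIM('a)"
    and f: "\<And>i x. 0 \<le> f i x" "\<And>i. integrable lborel (f i)" "\<And>i. (LINT x|lborel. f i x) \<le> M"
      "\<And>i. integrable lborel (\<lambda>x. (f i x)\<^sup>2)" "\<And>i. (LINT x|lborel. (f i x)\<^sup>2) \<le> N"
    and g: "\<And>x. 0 \<le> g x" "integrable lborel g" "(LINT x|lborel. g x) \<le> M"
    and tight: "\<And>\<epsilon>. 0 < \<epsilon> \<Longrightarrow> \<exists>R. \<forall>i. (LINT x|lborel. f i x * indicator {x. R \<le> norm x} x) \<le> \<epsilon>"
    and weak: "\<And>h B R. h \<in> borel_measurable borel \<Longrightarrow> (\<And>x. 0 \<le> h x) \<Longrightarrow> (\<And>x. h x \<le> B) \<Longrightarrow> (\<And>x. R \<le> norm x \<Longrightarrow> h x = 0) \<Longrightarrow>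
      (\<lambda>i. LINT x|lborel. f i x * h x) \<longlonglongrightarrow> (LINT x|lborel. g x * h x)"
    and \<epsilon>: "0 < \<epsilon>"
  shows "\<forall>\<^sub>F i in sequentially. kint (riesz l) (\<lambda>x. ennreal (f i x)) (\<lambda>x. ennreal (f i x))
    \<le> kint (riesz l) (\<lambda>x. ennreal (g x)) (\<lambda>x. ennreal (g x)) + ennreal \<epsilon>"
proof -
  have [measurable]: "f i \<in> borel_measurable borel" for i using f(2)[of i] by auto
  have [measurable]: "g \<in> borel_measurable borel" using g(2) by auto
  have "0 \<le> (LINT x|lborel. g x)" by (intro Bochner_Integration.integral_nonneg g)
  then have M: "0 \<le> M" by (rule order_trans[OF _ g(3)])
  have "0 \<le> (LINT x|lborel. (f 0 x)\<^sup>2)" by (intro Bochner_Integration.integral_nonneg) simp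
  then have N: "0 \<le> N" by (rule order_trans[OF _ f(5)])
  define \<kappa> where "\<kappa> = \<epsilon> / (8 * (N + 1))"
  have \<kappa>: "0 < \<kappa>" "\<kappa> * (2 * N) \<le> \<epsilon> / 4" using \<epsilon> N by (auto simp: \<kappa>_def field_simps)
  obtain a where a: "0 < a" "a \<le> 1" "(\<integral>\<^sup>+x. riesz_near l a (x::'a) \<partial>lborel) \<le> ennreal \<kappa>"
    by (rule riesz_near_small[OF l \<kappa>(1)])
  define D where "D = max 1 (4 * (M * M) / \<epsilon>)"
  have D: "1 \<le> D" "M * M / D \<le> \<epsilon> / 4"
  proof -
    show "1 \<le> D" by (simp add: D_def)
    have "4 * (M * M) / \<epsilon> \<le> D" by (simp add: D_def)
    then show "M * M / D \<le> \<epsilon> / 4" using \<epsilon> \<open>1 \<le> D\<close> by (simp add: field_simps)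
  qed
  \<comment> \<open>A sharp cut-off is admissible because weak convergence is tested with bounded
    Borel functions.\<close>
  define k where "k x = (if a \<le> norm x \<and> norm x < D then 1 / norm x ^ l else 0)" for x :: 'a
  define H where "H = 1 / a ^ l"
  have km [measurable]: "k \<in> borel_measurable borel" unfolding k_def [abs_def] by measurable
  have H: "0 \<le> H" using a by (simp add: H_def)
  have k: "0 \<le> k x" "k x \<le> H" for x
  proof -
    show "0 \<le> k x" by (simp add: k_def)
    show "k x \<le> H"
    proof (cases "a \<le> norm x")
      case True
      then have n: "0 < norm x ^ l" using a by (intro zero_less_power) linarith
      have "1 / norm x ^ l \<le> 1 / a ^ l"
        by (intro divide_left_mono power_mono mult_pos_pos n) (use True a in auto)
      then show ?thesis using H by (simp add: k_def H_def)
    qed (use H in \<open>simp add: k_def\<close>)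
  qed
  have k0: "k x = 0" if "D \<le> norm x" for x using that by (simp add: k_def)
  define U where "U w x = (LINT y|lborel. w y * k (x - y))" for w and x :: 'a
  have U: "0 \<le> U w x" "U w x \<le> H * M" "U w \<in> borel_measurable borel" "integrable lborel (\<lambda>x. w x * U w x)"
    "kint (\<lambda>x. ennreal (k x)) (\<lambda>x. ennreal (w x)) (\<lambda>x. ennreal (w x)) = ennreal (LINT x|lborel. w x * U w x)"
    if w: "\<And>x. 0 \<le> w x" "integrable lborel w" "(LINT x|lborel. w x) \<le> M" for w x
  proof -
    have [measurable]: "w \<in> borel_measurable borel" using w(2) by auto
    have int: "integrable lborel (\<lambda>y. w y * k (x - y))" for x
    proof (rule Bochner_Integration.integrable_bound)
      show "integrable lborel (\<lambda>y. H * w y)" using w by simp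
      show "AE y in lborel. norm (w y * k (x - y)) \<le> norm (H * w y)"
        using w(1) k H by (intro AE_I2) (simp add: mult.commute[of H] mult_left_mono)
    qed measurable
    show U0: "0 \<le> U w x" for x unfolding U_def using w k by (intro Bochner_Integration.integral_nonneg) simp
    show UH: "U w x \<le> H * M" for x
    proof -
      have "U w x \<le> (LINT y|lborel. w y * H)" unfolding U_def
        using int w k by (intro integral_mono) (auto intro: mult_left_mono)
      also have "\<dots> = (LINT y|lborel. w y) * H" by simp
      also have "\<dots> \<le> M * H" using w(3) H by (rule mult_right_mono)
      finally show ?thesis by (simp add: mult.commute)
    qed
    show Um [measurable]: "U w \<in> borel_measurable borel"
      unfolding U_def [abs_def] by measurable
    show iU: "integrable lborel (\<lambda>x. w x * U w x)"
    proof (rule Bochner_Integration.integrable_bound)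
      show "integrable lborel (\<lambda>y. H * M * w y)" using w by simp
      show "AE y in lborel. norm (w y * U w y) \<le> norm (H * M * w y)"
        using w(1) U0 UH H M by (intro AE_I2) (simp add: mult.commute[of "H * M"] mult_left_mono)
    qed measurable
    have "kint (\<lambda>x. ennreal (k x)) (\<lambda>x. ennreal (w x)) (\<lambda>x. ennreal (w x))
      = (\<integral>\<^sup>+x. ennreal (w x * U w x) \<partial>lborel)"
      unfolding kint_def
    proof (intro nn_integral_cong)
      fix x
      have "(\<integral>\<^sup>+y. ennreal (w x) * ennreal (w y) * ennreal (k (x - y)) \<partial>lborel)
        = (\<integral>\<^sup>+y. ennreal (w x) * ennreal (w y * k (x - y)) \<partial>lborel)"
        using w k by (intro nn_integral_cong) (simp add: ennreal_mult mult.assoc)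
      also have "\<dots> = ennreal (w x) * (\<integral>\<^sup>+y. ennreal (w y * k (x - y)) \<partial>lborel)"
        by (rule nn_integral_cmult) measurable
      also have "(\<integral>\<^sup>+y. ennreal (w y * k (x - y)) \<partial>lborel) = ennreal (U w x)"
        unfolding U_def using int w k by (intro nn_integral_eq_integral) auto
      also have "ennreal (w x) * ennreal (U w x) = ennreal (w x * U w x)"
        using w U0 by (simp add: ennreal_mult)
      finally show "(\<integral>\<^sup>+y. ennreal (w x) * ennreal (w y) * ennreal (k (x - y)) \<partial>lborel) = ennreal (w x * U w x)" .
    qed
    also have "\<dots> = ennreal (LINT x|lborel. w x * U w x)"
      using iU w U0 by (intro nn_integral_eq_integral) auto
    finally show "kint (\<lambda>x. ennreal (k x)) (\<lambda>x. ennreal (w x)) (\<lambda>x. ennreal (w x)) = ennreal (LINT x|lborel. w x * U w x)" .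
  qed
  note Uf = U[OF f(1,2,3)] and Ug = U[OF g]
  have [measurable]: "U g \<in> borel_measurable borel" "U (f i) \<in> borel_measurable borel" for i
    by (rule Ug(3), rule Uf(3))
  have HM: "0 \<le> H * M" using H M by simp
  have "0 < \<epsilon> / (16 * (H * M + 1))" using \<epsilon> HM by simp
  from tight[OF this] obtain R where R: "\<And>i. (LINT x|lborel. f i x * indicator {x. R \<le> norm x} x) \<le> \<epsilon> / (16 * (H * M + 1))"
    by blast
  let ?B = "{x::'a. norm x < R}"
  have Bset: "?B \<in> sets lborel" by measurable
  have "?B = ball 0 R" by auto
  then have Bfin: "emeasure lborel ?B < \<infinity>"
    using emeasure_lborel_ball_finite[of "0::'a" R] by simp
  have Bint: "integrable lborel (\<lambda>x. indicator ?B x * (C::real))" for C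
    using integrable_real_indicator[OF Bset Bfin] by simp
  define \<tau> where "\<tau> = \<epsilon> / (16 * (N + 1))"
  have \<tau>: "0 < \<tau>" "\<tau> * N \<le> \<epsilon> / 16" using \<epsilon> N by (auto simp: \<tau>_def field_simps)
  have conv: "(\<lambda>i. U (f i) x) \<longlonglongrightarrow> U g x" for x
    unfolding U_def
  proof (rule weak[where B=H and R="norm x + D"])
    show "(\<lambda>y. k (x - y)) \<in> borel_measurable borel" by measurable
    show "0 \<le> k (x - y)" "k (x - y) \<le> H" for y by (rule k)+
    fix y :: 'a assume "norm x + D \<le> norm y"
    then have "D \<le> norm (x - y)" using norm_triangle_ineq2[of y x] by (simp add: norm_minus_commute)
    then show "k (x - y) = 0" by (rule k0)
  qed
  \<comment> \<open>The kernel has turned weak into pointwise convergence, and \<open>H * M\<close>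
    bounds the difference of two nonnegative potentials.\<close>
  have conv2: "(\<lambda>i. LINT x|lborel. indicator ?B x * (U (f i) x - U g x)\<^sup>2) \<longlonglongrightarrow> (LINT x|(lborel::'a measure). 0)"
  proof (rule integral_dominated_convergence[where w="\<lambda>x. indicator ?B x * (H * M)\<^sup>2"])
    show "integrable lborel (\<lambda>x. indicator ?B x * (H * M)\<^sup>2)" by (rule Bint)
    show "AE x in lborel. (\<lambda>i. indicator ?B x * (U (f i) x - U g x)\<^sup>2) \<longlonglongrightarrow> 0"
    proof (rule AE_I2)
      fix x
      have "(\<lambda>i. indicator ?B x * (U (f i) x - U g x)\<^sup>2) \<longlonglongrightarrow> indicator ?B x * (U g x - U g x)\<^sup>2"
        by (intro tendsto_intros conv)
      then show "(\<lambda>i. indicator ?B x * (U (f i) x - U g x)\<^sup>2) \<longlonglongrightarrow> 0" by simp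
    qed
    show "AE x in lborel. norm (indicator ?B x * (U (f i) x - U g x)\<^sup>2) \<le> indicator ?B x * (H * M)\<^sup>2" for i
    proof (rule AE_I2)
      fix x
      have "\<bar>U (f i) x - U g x\<bar> \<le> H * M"
        using Uf(1)[of i x] Uf(2)[of i x] Ug(1)[of x] Ug(2)[of x] by (simp add: abs_le_iff)
      then have "(U (f i) x - U g x)\<^sup>2 \<le> (H * M)\<^sup>2" by (metis abs_ge_zero power2_abs power_mono)
      then show "norm (indicator ?B x * (U (f i) x - U g x)\<^sup>2) \<le> indicator ?B x * (H * M)\<^sup>2"
        by (simp add: indicator_def)
    qed
  qed measurable
  have ev1: "\<forall>\<^sub>F i in sequentially. (LINT x|lborel. indicator ?B x * (U (f i) x - U g x)\<^sup>2) < \<tau> * \<epsilon> / 16"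
    using conv2 \<tau> \<epsilon> by (intro order_tendstoD) auto
  have "(\<lambda>i. LINT x|lborel. f i x * (U g x * indicator ?B x)) \<longlonglongrightarrow> (LINT x|lborel. g x * (U g x * indicator ?B x))"
    using Ug(1,2) HM by (intro weak[where B="H * M" and R=R]) (auto simp: indicator_def)
  then have "\<forall>\<^sub>F i in sequentially. (LINT x|lborel. f i x * (U g x * indicator ?B x)) < (LINT x|lborel. g x * (U g x * indicator ?B x)) + \<epsilon> / 16"
    using \<epsilon> by (intro order_tendstoD) auto
  with ev1 show ?thesis
  proof eventually_elim
    case (elim i)
    note [measurable] = \<open>f i \<in> borel_measurable borel\<close>
    have itail: "integrable lborel (\<lambda>x. f i x * indicator {x. R \<le> norm x} x)"
      by (rule integrable_real_mult_indicator[OF _ f(2)]) measurable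
    have isq: "integrable lborel (\<lambda>x. indicator ?B x * (U (f i) x - U g x)\<^sup>2)"
    proof (rule Bochner_Integration.integrable_bound[OF Bint[of "(H * M)\<^sup>2"]])
      show "AE x in lborel. norm (indicator ?B x * (U (f i) x - U g x)\<^sup>2) \<le> norm (indicator ?B x * (H * M)\<^sup>2)"
      proof (rule AE_I2)
        fix x
        have "\<bar>U (f i) x - U g x\<bar> \<le> H * M"
          using Uf(1)[of i x] Uf(2)[of i x] Ug(1)[of x] Ug(2)[of x] by (simp add: abs_le_iff)
        then have "(U (f i) x - U g x)\<^sup>2 \<le> (H * M)\<^sup>2" by (metis abs_ge_zero power2_abs power_mono)
        then show "norm (indicator ?B x * (U (f i) x - U g x)\<^sup>2) \<le> norm (indicator ?B x * (H * M)\<^sup>2)"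
          by (simp add: indicator_def)
      qed
    qed measurable
    have bnd: "integrable lborel (\<lambda>x. w x * (U g x * indicator ?B x))" if w: "integrable lborel w" for w
    proof -
      have [measurable]: "w \<in> borel_measurable borel" using w by auto
      show ?thesis
      proof (rule Bochner_Integration.integrable_bound[OF integrable_mult_right[OF w, of "H * M"]])
        show "AE x in lborel. norm (w x * (U g x * indicator ?B x)) \<le> norm (H * M * w x)"
        proof (rule AE_I2)
          fix x
          have "\<bar>U g x * indicator ?B x\<bar> \<le> H * M" using Ug(1,2) HM by (simp add: indicator_def)
          then have "\<bar>w x\<bar> * \<bar>U g x * indicator ?B x\<bar> \<le> \<bar>w x\<bar> * (H * M)" by (rule mult_left_mono) simp
          also have "\<dots> = \<bar>H * M * w x\<bar>"
            using abs_mult[of "H * M" "w x"] abs_of_nonneg[OF HM] by (simp only: mult.commute)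
          finally show "norm (w x * (U g x * indicator ?B x)) \<le> norm (H * M * w x)"
            by (simp only: real_norm_def abs_mult)
        qed
      qed measurable
    qed
    \<comment> \<open>The integrand is compared with three contributions: the limit potential on the
      ball, the mass outside it times the bound \<open>H * M\<close>, and the difference of the
      potentials, separated from the density by the weight \<open>\<tau>\<close>.\<close>
    have "(LINT x|lborel. f i x * U (f i) x) \<le> (LINT x|lborel. f i x * (U g x * indicator ?B x)
       + (H * M) * (f i x * indicator {x. R \<le> norm x} x) + (\<tau> * (f i x)\<^sup>2 + (indicator ?B x * (U (f i) x - U g x)\<^sup>2) / \<tau>))"
    proof (rule integral_mono[OF Uf(4)])
      show "integrable lborel (\<lambda>x. f i x * (U g x * indicator ?B x)
       + (H * M) * (f i x * indicator {x. R \<le> norm x} x) + (\<tau> * (f i x)\<^sup>2 + (indicator ?B x * (U (f i) x - U g x)\<^sup>2) / \<tau>))"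
        by (intro Bochner_Integration.integrable_add integrable_mult_right integrable_divide bnd itail isq f)
      fix x
      show "f i x * U (f i) x \<le> f i x * (U g x * indicator ?B x)
       + (H * M) * (f i x * indicator {x. R \<le> norm x} x) + (\<tau> * (f i x)\<^sup>2 + (indicator ?B x * (U (f i) x - U g x)\<^sup>2) / \<tau>)"
      proof (cases "norm x < R")
        case True
        define d where "d = U (f i) x - U g x"
        have "0 \<le> (\<tau> * f i x - d / 2)\<^sup>2" by simp
        then have "\<tau> * (f i x * d) \<le> \<tau> * \<tau> * (f i x)\<^sup>2 + d\<^sup>2 / 4"
          by (simp add: power2_eq_square algebra_simps)
        also have "\<dots> \<le> \<tau> * \<tau> * (f i x)\<^sup>2 + d\<^sup>2" by simp
        finally have "f i x * d \<le> \<tau> * (f i x)\<^sup>2 + d\<^sup>2 / \<tau>" using \<tau>(1) by (simp add: field_simps power2_eq_square)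
        moreover have "f i x * U (f i) x = f i x * U g x + f i x * d" by (simp add: d_def algebra_simps)
        ultimately show ?thesis using True by (simp add: d_def)
      next
        case False
        have "f i x * U (f i) x \<le> f i x * (H * M)" using Uf(2) f(1) by (intro mult_left_mono) auto
        moreover have "0 \<le> \<tau> * (f i x)\<^sup>2" using \<tau>(1) by simp
        ultimately show ?thesis using False by (simp add: mult.commute)
      qed
    qed
    also have "\<dots> = (LINT x|lborel. f i x * (U g x * indicator ?B x)) + (H * M) * (LINT x|lborel. f i x * indicator {x. R \<le> norm x} x)
       + (\<tau> * (LINT x|lborel. (f i x)\<^sup>2) + (LINT x|lborel. indicator ?B x * (U (f i) x - U g x)\<^sup>2) / \<tau>)"
      by (simp add: Bochner_Integration.integral_add bnd[OF f(2)] itail isq f Bochner_Integration.integrable_add)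
    also have "\<dots> \<le> ((LINT x|lborel. g x * (U g x * indicator ?B x)) + \<epsilon> / 16) + \<epsilon> / 16 + (\<epsilon> / 16 + \<epsilon> / 16)"
    proof (intro add_mono)
      have "(H * M) * (LINT x|lborel. f i x * indicator {x. R \<le> norm x} x) \<le> (H * M) * (\<epsilon> / (16 * (H * M + 1)))"
        by (intro mult_left_mono R HM)
      also have "\<dots> \<le> (H * M + 1) * (\<epsilon> / (16 * (H * M + 1)))" using \<epsilon> HM by (intro mult_right_mono) auto
      also have "\<dots> = \<epsilon> / 16" using HM by (simp add: field_simps)
      finally show "(H * M) * (LINT x|lborel. f i x * indicator {x. R \<le> norm x} x) \<le> \<epsilon> / 16" .
      show "\<tau> * (LINT x|lborel. (f i x)\<^sup>2) \<le> \<epsilon> / 16"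
        by (rule order_trans[OF mult_left_mono[OF f(5)] \<tau>(2)]) (use \<tau>(1) in simp)
      show "(LINT x|lborel. indicator ?B x * (U (f i) x - U g x)\<^sup>2) / \<tau> \<le> \<epsilon> / 16"
        using elim(1) \<tau>(1) by (simp add: field_simps)
    qed (use elim(2) in simp)
    also have "(LINT x|lborel. g x * (U g x * indicator ?B x)) \<le> (LINT x|lborel. g x * U g x)"
      using g Ug by (intro integral_mono bnd) (auto simp: indicator_def)
    finally have real_le: "(LINT x|lborel. f i x * U (f i) x) \<le> (LINT x|lborel. g x * U g x) + \<epsilon> / 4" by simp
    let ?f = "\<lambda>x. ennreal (f i x)" and ?g = "\<lambda>x. ennreal (g x)"
    have nnf: "(\<integral>\<^sup>+x. ?f x \<partial>lborel) \<le> ennreal M"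
      using f(1,2) f(3)[of i] by (simp add: nn_integral_eq_integral ennreal_leI)
    have nnf2: "(\<integral>\<^sup>+x. (?f x)\<^sup>2 \<partial>lborel) \<le> ennreal N"
      using f(1,4) f(5)[of i] by (simp add: ennreal_power nn_integral_eq_integral ennreal_leI)
    have split: "riesz l x \<le> riesz_near l a x + ennreal (k x) + ennreal (1 / D)" for x :: 'a
    proof -
      consider "norm x < a" | "a \<le> norm x" "norm x < D" | "D \<le> norm x" by linarith
      then show ?thesis
      proof cases
        case 1 then show ?thesis by (simp add: riesz_near_def add.assoc)
      next
        case 2 then show ?thesis by (simp add: riesz_near_def riesz_def k_def add_increasing2)
      next
        case 3
        have "D \<le> norm x ^ l"
          using 3 D(1) l(1) power_increasing[of 1 l "norm x"] by simp
        then have "1 / norm x ^ l \<le> 1 / D" using D(1) by (intro divide_left_mono) auto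
        then show ?thesis by (simp add: riesz_def add_increasing ennreal_leI)
      qed
    qed
    have "kint (riesz l) ?f ?f \<le> kint (\<lambda>x. riesz_near l a x + ennreal (k x) + ennreal (1 / D)) ?f ?f"
      by (intro kint_mono mult_left_mono split) auto
    also have "\<dots> = kint (riesz_near l a) ?f ?f + kint (\<lambda>x. ennreal (k x)) ?f ?f + kint (\<lambda>x. ennreal (1 / D)) ?f ?f"
      by (simp add: kint_add_kernel)
    also have "\<dots> \<le> ennreal (\<epsilon> / 4) + (kint (riesz l) ?g ?g + ennreal (\<epsilon> / 4)) + ennreal (\<epsilon> / 4)"
    proof (intro add_mono)
      have "kint (riesz_near l a) ?f ?f \<le> (\<integral>\<^sup>+x. riesz_near l a (x::'a) \<partial>lborel) *
        (ennreal 1 * (\<integral>\<^sup>+x. (?f x)\<^sup>2 \<partial>lborel) + ennreal (1/1) * (\<integral>\<^sup>+x. (?f x)\<^sup>2 \<partial>lborel))"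
        by (rule kint_young) auto
      also have "\<dots> \<le> ennreal \<kappa> * (ennreal 1 * ennreal N + ennreal (1/1) * ennreal N)"
        by (intro mult_mono add_mono a nnf2) auto
      also have "\<dots> = ennreal (\<kappa> * (2 * N))"
        using \<kappa> N by (simp add: ennreal_mult'[symmetric] ennreal_plus[symmetric] del: ennreal_plus)
      also have "\<dots> \<le> ennreal (\<epsilon> / 4)" by (rule ennreal_leI[OF \<kappa>(2)])
      finally show "kint (riesz_near l a) ?f ?f \<le> ennreal (\<epsilon> / 4)" .
      have "kint (\<lambda>x. ennreal (k x)) ?f ?f \<le> ennreal ((LINT x|lborel. g x * U g x) + \<epsilon> / 4)"
        unfolding Uf(5) by (rule ennreal_leI[OF real_le])
      also have "\<dots> = kint (\<lambda>x. ennreal (k x)) ?g ?g + ennreal (\<epsilon> / 4)"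
        unfolding Ug(5) using \<epsilon> g Ug(1) by (intro ennreal_plus Bochner_Integration.integral_nonneg) auto
      also have "kint (\<lambda>x. ennreal (k x)) ?g ?g \<le> kint (riesz l) ?g ?g"
        by (intro kint_mono mult_left_mono) (auto simp: k_def riesz_def)
      finally show "kint (\<lambda>x. ennreal (k x)) ?f ?f \<le> kint (riesz l) ?g ?g + ennreal (\<epsilon> / 4)"
        by (simp add: add_right_mono)
      have "kint (\<lambda>x. ennreal (1 / D)) ?f ?f = ennreal (1 / D) * ((\<integral>\<^sup>+x. ?f x \<partial>lborel) * (\<integral>\<^sup>+x. ?f x \<partial>lborel))"
        by (rule kint_const) measurable
      also have "\<dots> \<le> ennreal (1 / D) * (ennreal M * ennreal M)"
        by (intro mult_left_mono mult_mono nnf) auto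
      also have "\<dots> = ennreal (M * M / D)" using M D by (simp add: ennreal_mult'[symmetric])
      also have "\<dots> \<le> ennreal (\<epsilon> / 4)" by (rule ennreal_leI[OF D(2)])
      finally show "kint (\<lambda>x. ennreal (1 / D)) ?f ?f \<le> ennreal (\<epsilon> / 4)" .
    qed
    also have "\<dots> = kint (riesz l) ?g ?g + (ennreal (\<epsilon> / 4) + ennreal (\<epsilon> / 4) + ennreal (\<epsilon> / 4))"
      by (simp add: ac_simps)
    also have "ennreal (\<epsilon> / 4) + ennreal (\<epsilon> / 4) + ennreal (\<epsilon> / 4) \<le> ennreal \<epsilon>"
      using \<epsilon> by (simp add: ennreal_plus[symmetric] ennreal_leI del: ennreal_plus)
    finally show ?case by (simp add: add_left_mono)
  qed
qed

context star
begin

text \<open>Test functions are bounded, depend on (r,z) only and vanish at large heights. This is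
  the common part of the limits produced by compactness and of arbitrary weak limits in
  \<open>Lp_space\<close>; together with \<open>tight\<close> and the bounds on mass and pressure it
  suffices for semicontinuity.\<close>

definition wconv :: "(nat \<Rightarrow> real \<times> real \<Rightarrow> real) \<Rightarrow> (real \<times> real \<Rightarrow> real) \<Rightarrow> bool" where
  "wconv s t \<longleftrightarrow> (\<forall>g B R. g \<in> borel_measurable borel \<longrightarrow> (\<forall>p. 0 \<le> g p \<and> g p \<le> B) \<longrightarrow>
     (\<forall>p. R < \<bar>snd p\<bar> \<longrightarrow> g p = 0) \<longrightarrow>
     (\<lambda>i. LINT p|cylm e3. s i p * g p) \<longlonglongrightarrow> (LINT p|cylm e3. t p * g p))"

section \<open>Semicontinuity and compactness for reduced densities\<close>

lemma wconvD:
  assumes "wconv s t" "g \<in> borel_measurable borel" "\<And>p. 0 \<le> g p" "\<And>p. g p \<le> B" "\<And>p. R < \<bar>snd p\<bar> \<Longrightarrow> g p = 0"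
  shows "(\<lambda>i. LINT p|cylm e3. s i p * g p) \<longlonglongrightarrow> (LINT p|cylm e3. t p * g p)"
  using assms unfolding wconv_def by blast

definition tight :: "(nat \<Rightarrow> real \<times> real \<Rightarrow> real) \<Rightarrow> bool" where
  "tight s \<longleftrightarrow> (\<forall>\<epsilon>>0. \<exists>R. \<forall>i. ms (s i) - \<epsilon> \<le> ms (cut (slab 0 R) (s i)))"

text \<open>Supplies the hypotheses of \<open>kint_riesz_limsup\<close> from the half-plane: inside
  the cylinder a height at most \<open>R\<close> bounds the norm by \<open>Rc + R\<close>, and a
  test function on the space is averaged to one on the half-plane.\<close>

lemma kint_limsup_St:
  fixes e :: "'a::euclidean_space"
  assumes e: "norm e = 1" and l: "0 < l" "l < DIM('a)" and c: "0 \<le> c"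
    and m: "\<And>u. u \<in> St \<Longrightarrow> (\<integral>\<^sup>+x. dens e u x \<partial>lborel) \<le> ennreal (c * ms u)"
    and q: "\<And>u. u \<in> St \<Longrightarrow> (\<integral>\<^sup>+x. (dens e u x)\<^sup>2 \<partial>lborel) \<le> ennreal (c * n2 u)"
    and s: "\<And>i. s i \<in> St" "\<And>i. ms (s i) \<le> M" "\<And>i. n2 (s i) \<le> N" and t: "t \<in> St" "ms t \<le> M"
    and tight: "tight s"
    and weak: "\<And>k B R. k \<in> borel_measurable borel \<Longrightarrow> (\<And>p. 0 \<le> k p) \<Longrightarrow> (\<And>p. k p \<le> B) \<Longrightarrow>
      (\<And>p. R < \<bar>snd p\<bar> \<Longrightarrow> k p = 0) \<Longrightarrow>
      (\<lambda>i. LINT p|cylm e. s i p * k p) \<longlonglongrightarrow> (LINT p|cylm e. t p * k p)"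
    and \<epsilon>: "0 < \<epsilon>"
  shows "\<forall>\<^sub>F i in sequentially. kint (riesz l) (dens e (s i)) (dens e (s i)) \<le> kint (riesz l) (dens e t) (dens e t) + ennreal \<epsilon>"
proof -
  let ?d = "\<lambda>u x. u (cyl e x) :: real"
  have um [measurable]: "?d u \<in> borel_measurable borel" if "u \<in> St" for u
    using StD(1)[OF that] by (rule measurable_compose[OF cyl_measurable])
  have d: "integrable lborel (?d u)" "(LINT x|lborel. ?d u x) \<le> c * ms u"
    "integrable lborel (\<lambda>x. (?d u x)\<^sup>2)" "(LINT x|lborel. (?d u x)\<^sup>2) \<le> c * n2 u" if u: "u \<in> St" for u
  proof -
    note [measurable] = um[OF u]
    have nn: "0 \<le> ?d u x" for x by (rule StD(2)[OF u])
    have cm: "0 \<le> c * ms u" "0 \<le> c * n2 u" using c ms_nonneg[OF u] n2_nonneg[of u] by auto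
    have 1: "(\<integral>\<^sup>+x. ennreal (?d u x) \<partial>lborel) \<le> ennreal (c * ms u)" using m[OF u] by (simp add: dens_def)
    have 2: "(\<integral>\<^sup>+x. ennreal ((?d u x)\<^sup>2) \<partial>lborel) \<le> ennreal (c * n2 u)"
      using q[OF u] nn by (simp add: dens_def ennreal_power)
    show "integrable lborel (?d u)" using nn 1 by (auto simp: integrable_iff_bounded intro: le_less_trans)
    show "integrable lborel (\<lambda>x. (?d u x)\<^sup>2)" using 2 by (auto simp: integrable_iff_bounded intro: le_less_trans)
    show "(LINT x|lborel. ?d u x) \<le> c * ms u"
      using nn 1 cm by (subst integral_eq_nn_integral) (auto intro: enn2real_leI)
    show "(LINT x|lborel. (?d u x)\<^sup>2) \<le> c * n2 u"
      using 2 cm by (subst integral_eq_nn_integral) (auto intro: enn2real_leI)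
  qed
  show ?thesis
    unfolding dens_def
  proof (rule kint_riesz_limsup[OF l, where M="c * M" and N="c * N"])
    show "0 \<le> ?d (s i) x" "0 \<le> ?d t x" for i x using StD(2) s t by auto
    show "integrable lborel (?d (s i))" "integrable lborel (\<lambda>x. (?d (s i) x)\<^sup>2)" "integrable lborel (?d t)" for i
      using d s t by auto
    show "(LINT x|lborel. ?d (s i) x) \<le> c * M" for i
      by (rule order_trans[OF d(2)[OF s(1)] mult_left_mono[OF s(2) c]])
    show "(LINT x|lborel. (?d (s i) x)\<^sup>2) \<le> c * N" for i
      by (rule order_trans[OF d(4)[OF s(1)] mult_left_mono[OF s(3) c]])
    show "(LINT x|lborel. ?d t x) \<le> c * M"
      by (rule order_trans[OF d(2)[OF t(1)] mult_left_mono[OF t(2) c]])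
    show "0 < \<epsilon>" by (rule \<epsilon>)
    show "\<exists>R. \<forall>i. (LINT x|lborel. ?d (s i) x * indicator {x. R \<le> norm x} x) \<le> \<epsilon>'" if "0 < \<epsilon>'" for \<epsilon>'
    proof -
      have "0 < \<epsilon>' / (c + 1)" using that c by simp
      then obtain R where R: "\<And>i. ms (s i) - \<epsilon>' / (c + 1) \<le> ms (cut (slab 0 R) (s i))"
        using tight unfolding tight_def by blast
      have "(LINT x|lborel. ?d (s i) x * indicator {x. Rc + R \<le> norm x} x) \<le> \<epsilon>'" for i
      proof -
        let ?r = "cut (- slab 0 R) (s i)"
        have X: "slab 0 R \<in> sets borel" by measurable
        have rSt: "?r \<in> St" by (intro St_cut s borel_comp X)
        have "(LINT x|lborel. ?d (s i) x * indicator {x. Rc + R \<le> norm x} x) \<le> (LINT x|lborel. ?d ?r x)"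
        proof (rule integral_mono)
          show "integrable lborel (\<lambda>x. ?d (s i) x * indicator {x. Rc + R \<le> norm x} x)"
            by (rule integrable_real_mult_indicator[OF _ d(1)[OF s(1)]]) measurable
          show "integrable lborel (?d ?r)" by (rule d(1)[OF rSt])
          fix x
          show "?d (s i) x * indicator {x. Rc + R \<le> norm x} x \<le> ?d ?r x"
          proof (cases "?d (s i) x = 0 \<or> norm x < Rc + R")
            case True
            then show ?thesis using StD(2)[OF rSt, of "cyl e x"] by (auto simp: indicator_def)
          next
            case False
            then have "fst (cyl e x) < Rc" using StD(3)[OF s(1), of "cyl e x" i] by (meson not_less)
            then have "R < \<bar>x \<bullet> e\<bar>" using False norm_le_cyl(1)[OF e, of x] by simp
            then show ?thesis using False by (simp add: cut_def)
          qed
        qed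
        also have "\<dots> \<le> c * ms ?r" by (rule d(2)[OF rSt])
        also have "\<dots> \<le> c * (\<epsilon>' / (c + 1))"
          using R[of i] ms_cut_split[OF s(1) X, of i] c by (intro mult_left_mono) auto
        also have "\<dots> \<le> \<epsilon>'" using that c by (simp add: field_simps)
        finally show ?thesis .
      qed
      then show ?thesis by blast
    qed
    fix h :: "'a \<Rightarrow> real" and B R
    assume h: "h \<in> borel_measurable borel" "\<And>x. 0 \<le> h x" "\<And>x. h x \<le> B" "\<And>x. R \<le> norm x \<Longrightarrow> h x = 0"
    note [measurable] = h(1)
    from cyl_average[OF e h(1-3)] obtain k where k: "k \<in> borel_measurable borel" "\<And>p. 0 \<le> k p" "\<And>p. k p \<le> B"
      "\<And>s. s \<in> borel_measurable borel \<Longrightarrow>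
      (\<integral>\<^sup>+x. s (cyl e x) * ennreal (h x) \<partial>lborel) = (\<integral>\<^sup>+p. s p * ennreal (k p) \<partial>cylm e)" by metis
    note [measurable] = k(1)
    have B0: "0 \<le> B" using h(2)[of 0] h(3)[of 0] by simp
    \<comment> \<open>The average vanishes beyond height \<open>R\<close> only almost everywhere;
      \<open>k'\<close> does so everywhere.\<close>
    define k' where "k' p = (if \<bar>snd p\<bar> \<le> R then k p else 0)" for p
    have "{p \<in> space (borel :: (real \<times> real) measure). \<bar>snd p\<bar> \<le> R} \<in> sets borel" by measurable
    then have [measurable]: "k' \<in> borel_measurable borel" unfolding k'_def [abs_def] by (intro measurable_If) auto
    have eq: "(LINT x|lborel. ?d u x * h x) = (LINT p|cylm e. u p * k' p)" if u: "u \<in> St" for u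
    proof -
      note [measurable] = StD(1)[OF u] um[OF u]
      let ?u = "\<lambda>p. ennreal (u p) * indicator (UNIV \<times> {-R..R}) p"
      have um': "?u \<in> borel_measurable borel" by measurable
      have "(\<integral>\<^sup>+x. ennreal (?d u x * h x) \<partial>lborel) = (\<integral>\<^sup>+x. ?u (cyl e x) * ennreal (h x) \<partial>lborel)"
      proof (intro nn_integral_cong)
        fix x
        show "ennreal (?d u x * h x) = ?u (cyl e x) * ennreal (h x)"
        proof (cases "\<bar>x \<bullet> e\<bar> \<le> R")
          case True
          then have "x \<bullet> e \<in> {-R..R}" by (simp add: abs_le_iff)
          then show ?thesis using h(2) StD(2)[OF u] by (simp add: ennreal_mult mem_Times_iff indicator_def)
        next
          case False
          then have "R \<le> norm x" using Cauchy_Schwarz_ineq2[of x e] e by simp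
          then show ?thesis using h(4) by simp
        qed
      qed
      also have "\<dots> = (\<integral>\<^sup>+p. ?u p * ennreal (k p) \<partial>cylm e)" by (rule k(4)[OF um'])
      also have "\<dots> = (\<integral>\<^sup>+p. ennreal (u p * k' p) \<partial>cylm e)"
        using k(2) StD(2)[OF u]
        by (intro nn_integral_cong) (auto simp: k'_def ennreal_mult indicator_def mem_Times_iff abs_le_iff)
      finally have nn: "(\<integral>\<^sup>+x. ennreal (?d u x * h x) \<partial>lborel) = \<dots>" .
      have "(LINT x|lborel. ?d u x * h x) = enn2real (\<integral>\<^sup>+x. ennreal (?d u x * h x) \<partial>lborel)"
        using h(2) StD(2)[OF u] by (intro integral_eq_nn_integral) auto
      also have "\<dots> = (LINT p|cylm e. u p * k' p)"
        unfolding nn using k(2) StD(2)[OF u] by (intro integral_eq_nn_integral[symmetric]) (auto simp: k'_def)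
      finally show ?thesis .
    qed
    show "(\<lambda>i. LINT x|lborel. ?d (s i) x * h x) \<longlonglongrightarrow> (LINT x|lborel. ?d t x * h x)"
      unfolding eq[OF s(1)] eq[OF t(1)]
      by (rule weak[where B=B and R=R]) (use k B0 in \<open>auto simp: k'_def\<close>)
  qed
qed

lemma BB_limsup:
  assumes s: "\<And>i. s i \<in> St" "\<And>i. ms (s i) \<le> M" "\<And>i. n2 (s i) \<le> N" and t: "t \<in> St" "ms t \<le> M"
    and tight: "tight s" and weak: "wconv s t" and \<epsilon>: "0 < \<epsilon>"
  shows "\<forall>\<^sub>F i in sequentially. BB (s i) (s i) \<le> BB t t + \<epsilon>"
proof -
  \<comment> \<open>The weights \<open>1/2\<close> and \<open>w\<close> of the two forms add up to
    at most \<open>1 + w\<close>.\<close>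
  define \<epsilon>' where "\<epsilon>' = \<epsilon> / (1 + w)"
  have "0 < \<epsilon>'" "(1 + w) * \<epsilon>' = \<epsilon>" using \<epsilon> w by (auto simp: \<epsilon>'_def)
  then have \<epsilon>': "0 < \<epsilon>'" "1/2 * \<epsilon>' + w * \<epsilon>' \<le> \<epsilon>" by (auto simp: distrib_right)
  have "\<forall>\<^sub>F i in sequentially. kint (riesz 1) (dens e3 (s i)) (dens e3 (s i)) \<le> kint (riesz 1) (dens e3 t) (dens e3 t) + ennreal \<epsilon>'"
  proof (rule kint_limsup_St[where c=1, OF norm_e3 _ _ _ _ _ s t tight _ \<epsilon>'(1)])
    show "(\<lambda>i. LINT p|cylm e3. s i p * k p) \<longlonglongrightarrow> (LINT p|cylm e3. t p * k p)"
      if "k \<in> borel_measurable borel" "\<And>p. 0 \<le> k p" "\<And>p. k p \<le> B" "\<And>p. R < \<bar>snd p\<bar> \<Longrightarrow> k p = 0" for k B R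
      by (rule wconvD[OF weak that])
  qed (auto simp: nn_dens3)
  moreover have "\<forall>\<^sub>F i in sequentially. kint (riesz 3) (dens e5 (s i)) (dens e5 (s i)) \<le> kint (riesz 3) (dens e5 t) (dens e5 t) + ennreal \<epsilon>'"
  proof (rule kint_limsup_St[where c=C5, OF norm_e5 _ _ _ _ _ s t tight _ \<epsilon>'(1)])
    fix k :: "real \<times> real \<Rightarrow> real" and B R
    assume k: "k \<in> borel_measurable borel" "\<And>p. 0 \<le> k p" "\<And>p. k p \<le> B" "\<And>p. R < \<bar>snd p\<bar> \<Longrightarrow> k p = 0"
    note [measurable] = k(1)
    \<comment> \<open>A test function for the lift becomes one for \<open>cylm e3\<close> after
      multiplication by the density of the lifted measure. Restricting the radius to the cylinder
      keeps the product bounded; beyond it the densities vanish, and negative radii carry no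
      mass.\<close>
    define k' where "k' p = (if 0 \<le> fst p \<and> fst p < Rc then k p * (c5 * fst p ^ 2) else 0)" for p
    have "{p \<in> space (borel :: (real \<times> real) measure). 0 \<le> fst p \<and> fst p < Rc} \<in> sets borel" by measurable
    then have k'm [measurable]: "k' \<in> borel_measurable borel" unfolding k'_def [abs_def] by (intro measurable_If) auto
    have B0: "0 \<le> B" using k(2)[of "(0,0)"] k(3)[of "(0,0)"] by simp
    have k'b: "0 \<le> k' p \<and> k' p \<le> B * C5" for p
    proof (cases "0 \<le> fst p \<and> fst p < Rc")
      case True
      then have "c5 * fst p ^ 2 \<le> C5" unfolding C5_def using c5 by (intro mult_left_mono power_mono) auto
      then have "k p * (c5 * fst p ^ 2) \<le> B * C5" using k B0 c5 by (intro mult_mono) auto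
      then show ?thesis using True k c5 by (simp add: k'_def)
    qed (use B0 C5_pos in \<open>auto simp: k'_def\<close>)
    have eq: "(LINT p|cylm e5. u p * k p) = (LINT p|cylm e3. u p * k' p)" if u: "u \<in> St" for u
    proof -
      note [measurable] = StD(1)[OF u]
      have "(LINT p|cylm e5. u p * k p) = enn2real (\<integral>\<^sup>+p. ennreal (u p * k p) \<partial>cylm e5)"
        using k StD(2)[OF u] by (intro integral_eq_nn_integral) auto
      also have "(\<integral>\<^sup>+p. ennreal (u p * k p) \<partial>cylm e5) = (\<integral>\<^sup>+p. ennreal (u p * k p) * ennreal (c5 * fst p ^ 2) \<partial>cylm e3)"
        by (rule nn_integral_lift) measurable
      also have "\<dots> = (\<integral>\<^sup>+p. ennreal (u p * k' p) \<partial>cylm e3)"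
      proof (rule nn_integral_cong_AE)
        show "AE p in cylm e3. ennreal (u p * k p) * ennreal (c5 * fst p ^ 2) = ennreal (u p * k' p)"
          using AE_cylm_fst
        proof eventually_elim
          case (elim p)
          show ?case
          proof (cases "Rc \<le> fst p")
            case False
            then show ?thesis using elim k StD(2)[OF u] c5
              by (simp add: k'_def ennreal_mult''[symmetric] mult.assoc)
          qed (simp add: StD(3)[OF u])
        qed
      qed
      also have "enn2real \<dots> = (LINT p|cylm e3. u p * k' p)"
        using k'b StD(2)[OF u] by (intro integral_eq_nn_integral[symmetric]) auto
      finally show ?thesis .
    qed
    have "(\<lambda>i. LINT p|cylm e3. s i p * k' p) \<longlonglongrightarrow> (LINT p|cylm e3. t p * k' p)"
      by (rule wconvD[OF weak k'm, where B="B * C5" and R=R]) (use k'b k(4) in \<open>auto simp: k'_def\<close>)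
    then show "(\<lambda>i. LINT p|cylm e5. s i p * k p) \<longlonglongrightarrow> (LINT p|cylm e5. t p * k p)"
      unfolding eq[OF s(1)] eq[OF t(1)] .
  qed (use C5_pos in \<open>auto simp: nn_dens5\<close>)
  ultimately show ?thesis
  proof eventually_elim
    case (elim i)
    have "BBe (s i) (s i) \<le> ennreal (1/2) * (kint (riesz 1) (dens e3 t) (dens e3 t) + ennreal \<epsilon>')
      + ennreal w * (kint (riesz 3) (dens e5 t) (dens e5 t) + ennreal \<epsilon>')"
      unfolding BBe_def by (intro add_mono mult_left_mono elim) auto
    also have "\<dots> = BBe t t + (ennreal (1/2) * ennreal \<epsilon>' + ennreal w * ennreal \<epsilon>')"
      unfolding BBe_def distrib_left by (simp only: ac_simps)
    also have "ennreal (1/2) * ennreal \<epsilon>' + ennreal w * ennreal \<epsilon>' = ennreal (1/2 * \<epsilon>' + w * \<epsilon>')"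
      using \<epsilon>' w by (simp only: ennreal_mult'[symmetric] ennreal_plus[symmetric] zero_le_mult_iff
          zero_le_divide_iff zero_le_one zero_le_numeral less_imp_le mult_nonneg_nonneg simp_thms)
    also have "BBe t t + \<dots> \<le> BBe t t + ennreal \<epsilon>"
      by (intro add_left_mono ennreal_leI \<epsilon>'(2))
    also have "\<dots> = ennreal (BB t t + \<epsilon>)"
      using \<epsilon> BB_nonneg[of t t] by (simp add: BBe_eq[OF t(1) t(1)])
    finally show ?case using \<epsilon> BB_nonneg[of t t] unfolding BB_def[of "s i"] by (intro enn2real_leI) auto
  qed
qed

lemma cylm_box_finite: "emeasure (cylm e3) ({..<Rc} \<times> {-b..b}) < \<infinity>"
  by (rule cylm_bounded_finite[OF norm_e3])

text \<open>Test with \<open>tn n powr (\<gamma> - 1)\<close> for truncations of \<open>t\<close>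
  and apply Young's inequality: the integral of \<open>tn n powr \<gamma>\<close> is at most
  \<open>P / \<gamma>\<close> plus \<open>1 - 1 / \<gamma>\<close> times itself, and absorbing the
  last term gives the bound \<open>P\<close>. Monotone convergence removes the truncation. Finite
  pressure of \<open>t\<close> is a conclusion because a freshly constructed limit is not yet known
  to lie in \<open>St\<close>.\<close>

lemma pw_lsc:
  assumes t: "t \<in> borel_measurable borel" "\<And>p. 0 \<le> t p" "\<And>p. Rc \<le> fst p \<Longrightarrow> t p = 0" "integrable (cylm e3) t"
    and s: "\<And>i. s i \<in> St" and weak: "wconv s t" and P: "\<forall>\<^sub>F i in sequentially. pw (s i) \<le> P"
  shows "integrable (cylm e3) (\<lambda>p. t p powr \<gamma>)" "pw t \<le> P"
proof -
  note [measurable] = t(1)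
  define tn where "tn n p = (if \<bar>snd p\<bar> \<le> real n then min (t p) (real n) else 0)" for n :: nat and p
  have "{p \<in> space (borel :: (real \<times> real) measure). \<bar>snd p\<bar> \<le> real n} \<in> sets borel" for n by measurable
  then have tnm [measurable]: "tn n \<in> borel_measurable borel" for n unfolding tn_def [abs_def] by (intro measurable_If) auto
  have tn: "0 \<le> tn n p" "tn n p \<le> t p" "tn n p \<le> real n" "real n < \<bar>snd p\<bar> \<Longrightarrow> tn n p = 0" "Rc \<le> fst p \<Longrightarrow> tn n p = 0" for n p
    using t(2)[of p] t(3)[of p] by (auto simp: tn_def)
  have bint: "integrable (cylm e3) (\<lambda>p. tn n p powr \<gamma>)" for n
  proof (rule Bochner_Integration.integrable_bound)
    show "integrable (cylm e3) (\<lambda>p. indicator ({..<Rc} \<times> {- real n..real n}) p * real n powr \<gamma>)"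
      using cylm_box_finite[of "real n"] by (intro integrable_mult_left integrable_real_indicator) auto
    show "AE p in cylm e3. norm (tn n p powr \<gamma>) \<le> norm (indicator ({..<Rc} \<times> {- real n..real n}) p * real n powr \<gamma>)"
    proof (rule AE_I2)
      fix p
      show "norm (tn n p powr \<gamma>) \<le> norm (indicator ({..<Rc} \<times> {- real n..real n}) p * real n powr \<gamma>)"
      proof (cases "p \<in> {..<Rc} \<times> {- real n..real n}")
        case True
        then show ?thesis using tn(1,3)[of n p] \<gamma> by (auto intro!: powr_mono2)
      next
        case False
        then have "Rc \<le> fst p \<or> real n < \<bar>snd p\<bar>" by (cases p) (auto simp: not_le; linarith)
        then show ?thesis using tn(4,5)[where n=n and p=p] by auto
      qed
    qed
  qed measurable
  have key: "(LINT p|cylm e3. tn n p powr \<gamma>) \<le> P" for n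
  proof -
    let ?g = "\<lambda>p. tn n p powr (\<gamma> - 1)"
    let ?I = "LINT p|cylm e3. tn n p powr \<gamma>"
    have gb: "?g p \<le> real n powr (\<gamma> - 1)" for p using tn(1,3)[of n p] \<gamma> by (intro powr_mono2) auto
    have gm: "?g \<in> borel_measurable borel" by measurable
    have conv: "(\<lambda>i. LINT p|cylm e3. s i p * ?g p) \<longlonglongrightarrow> (LINT p|cylm e3. t p * ?g p)"
      by (rule wconvD[OF weak gm _ gb, where R="real n"]) (use tn(4)[where n=n] in auto)
    have q: "tn n p powr \<gamma> = tn n p * ?g p" for p
      using tn(1)[of n p] powr_mult_base[of "tn n p" "\<gamma> - 1"] by (cases "tn n p = 0") auto
    have "?I \<le> (LINT p|cylm e3. t p * ?g p)"
    proof (rule integral_mono[OF bint])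
      show "integrable (cylm e3) (\<lambda>p. t p * ?g p)"
      proof (rule Bochner_Integration.integrable_bound)
        show "integrable (cylm e3) (\<lambda>p. real n powr (\<gamma> - 1) * t p)" using t by simp
        show "AE p in cylm e3. norm (t p * ?g p) \<le> norm (real n powr (\<gamma> - 1) * t p)"
          using gb t(2) by (intro AE_I2) (simp add: mult.commute[of "real n powr (\<gamma> - 1)"] mult_left_mono)
      qed measurable
      show "tn n p powr \<gamma> \<le> t p * ?g p" for p
        unfolding q using tn(2)[of n p] by (intro mult_right_mono) auto
    qed
    also have "\<dots> \<le> P / \<gamma> + (1 - 1 / \<gamma>) * ?I"
    proof (rule tendsto_upperbound[OF conv _ sequentially_bot])
      show "\<forall>\<^sub>F i in sequentially. (LINT p|cylm e3. s i p * ?g p) \<le> P / \<gamma> + (1 - 1 / \<gamma>) * ?I"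
        using P
      proof eventually_elim
        case (elim i)
        note [measurable] = StD(1)[OF s[of i]]
        have Y: "s i p * ?g p \<le> s i p powr \<gamma> / \<gamma> + (1 - 1 / \<gamma>) * tn n p powr \<gamma>" for p
        proof -
          define q where "q = \<gamma> / (\<gamma> - 1)"
          have q: "1 < q" "1 / \<gamma> + 1 / q = 1" using \<gamma> by (auto simp: q_def field_simps)
          have "s i p * ?g p \<le> s i p powr \<gamma> / \<gamma> + ?g p powr q / q"
            using \<gamma> q StD(2)[OF s] by (intro Youngs_inequality) auto
          also have "?g p powr q = tn n p powr \<gamma>" using \<gamma> by (simp add: powr_powr q_def)
          also have "tn n p powr \<gamma> / q = (1 - 1 / \<gamma>) * tn n p powr \<gamma>"
          proof -
            have "1 / q = 1 - 1 / \<gamma>" using q(2) by simp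
            then show ?thesis by (metis mult.commute times_divide_eq_right mult.right_neutral)
          qed
          finally show ?thesis .
        qed
        have i2: "integrable (cylm e3) (\<lambda>p. s i p powr \<gamma> / \<gamma> + (1 - 1 / \<gamma>) * tn n p powr \<gamma>)"
          by (intro Bochner_Integration.integrable_add integrable_divide integrable_mult_right StD(5)[OF s] bint)
        have "(LINT p|cylm e3. s i p * ?g p) \<le> (LINT p|cylm e3. s i p powr \<gamma> / \<gamma> + (1 - 1 / \<gamma>) * tn n p powr \<gamma>)"
        proof (rule integral_mono[OF _ i2 Y])
          show "integrable (cylm e3) (\<lambda>p. s i p * ?g p)"
            using Y StD(2)[OF s[of i]]
            by (intro Bochner_Integration.integrable_bound[OF i2]) (auto intro!: AE_I2 order_trans[OF Y abs_ge_self])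
        qed
        also have "\<dots> = pw (s i) / \<gamma> + (1 - 1 / \<gamma>) * ?I"
          using StD(5)[OF s] bint by (subst Bochner_Integration.integral_add) (auto simp: pw_def)
        also have "\<dots> \<le> P / \<gamma> + (1 - 1 / \<gamma>) * ?I" using elim \<gamma> by (simp add: divide_right_mono)
        finally show ?case .
      qed
    qed
    finally have "?I / \<gamma> \<le> P / \<gamma>" by (simp add: algebra_simps)
    then show ?thesis using \<gamma> by (simp add: divide_le_cancel)
  qed
  have "(\<lambda>n. \<integral>\<^sup>+p. ennreal (tn n p powr \<gamma>) \<partial>cylm e3) \<longlonglongrightarrow> (\<integral>\<^sup>+p. ennreal (t p powr \<gamma>) \<partial>cylm e3)"
  proof (rule nn_integral_LIMSEQ)
    show "incseq (\<lambda>n p. ennreal (tn n p powr \<gamma>))"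
    proof (intro incseq_SucI le_funI ennreal_leI powr_mono2)
      show "0 \<le> \<gamma>" using \<gamma> by simp
      show "0 \<le> tn n p" "tn n p \<le> tn (Suc n) p" for n p using t(2)[of p] by (auto simp: tn_def)
    qed
    show "(\<lambda>n. ennreal (tn n p powr \<gamma>)) \<longlonglongrightarrow> ennreal (t p powr \<gamma>)" for p
    proof (rule tendsto_eventually)
      obtain N where "max \<bar>snd p\<bar> (t p) \<le> real N" using real_arch_simple by blast
      then have "tn n p = t p" if "N \<le> n" for n using that by (auto simp: tn_def)
      then show "\<forall>\<^sub>F n in sequentially. ennreal (tn n p powr \<gamma>) = ennreal (t p powr \<gamma>)"
        by (intro eventually_sequentiallyI[of N]) simp
    qed
  qed measurable
  moreover have "(\<integral>\<^sup>+p. ennreal (tn n p powr \<gamma>) \<partial>cylm e3) \<le> ennreal P" for n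
    using key[of n] bint[of n] by (subst nn_integral_eq_integral) (auto intro: ennreal_leI)
  ultimately have le: "(\<integral>\<^sup>+p. ennreal (t p powr \<gamma>) \<partial>cylm e3) \<le> ennreal P"
    by (meson LIMSEQ_le_const2)
  show int: "integrable (cylm e3) (\<lambda>p. t p powr \<gamma>)"
    using le by (auto simp: integrable_iff_bounded intro: le_less_trans)
  have "0 \<le> (LINT p|cylm e3. tn 0 p powr \<gamma>)" by (intro Bochner_Integration.integral_nonneg) simp
  then have "0 \<le> P" using key[of 0] by linarith
  then show "pw t \<le> P"
    using le int unfolding pw_def by (subst integral_eq_nn_integral) (auto intro: enn2real_leI)
qed

text \<open>Upper semicontinuity of the interaction turns convergence of the energies into an
  eventual bound on the pressure terms, to which \<open>pw_lsc\<close> applies.\<close>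

theorem F_lsc:
  assumes s: "\<And>i. s i \<in> St" "\<And>i. ms (s i) \<le> M" "\<And>i. pw (s i) \<le> P" and t: "t \<in> St" "ms t \<le> M"
    and tight: "tight s" and weak: "wconv s t" and lim: "(\<lambda>i. F (s i)) \<longlonglongrightarrow> h"
  shows "F t \<le> h"
proof (rule field_le_epsilon)
  fix \<epsilon> :: real assume "0 < \<epsilon>"
  then have \<epsilon>: "0 < \<epsilon> / 2" by simp
  have n2: "n2 (s i) \<le> M + P" for i by (rule n2_le_mass[OF s])
  have "\<forall>\<^sub>F i in sequentially. F (s i) < h + \<epsilon> / 2" using lim \<epsilon> by (intro order_tendstoD) auto
  with BB_limsup[OF s(1,2) n2 t tight weak \<epsilon>]
  have "\<forall>\<^sub>F i in sequentially. pw (s i) \<le> (\<gamma> - 1) * (h + \<epsilon> + BB t t)"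
  proof eventually_elim
    case (elim i)
    then have "pw (s i) / (\<gamma> - 1) \<le> h + \<epsilon> + BB t t" unfolding F_def by linarith
    then show ?case using \<gamma> by (simp add: pos_divide_le_eq mult.commute)
  qed
  from pw_lsc(2)[OF StD(1-4)[OF t(1)] s(1) weak this]
  have "pw t / (\<gamma> - 1) \<le> h + \<epsilon> + BB t t" using \<gamma> by (simp add: pos_divide_le_eq mult.commute)
  then show "F t \<le> h + \<epsilon>" unfolding F_def by linarith
qed

text \<open>The limits of the set integrals define a set function. Uniform integrability and
  tightness make it continuous at the empty set, hence a measure; it is absolutely continuous with
  respect to \<open>cylm e3\<close>, and its density is the limit. Tightness extends convergence
  from bounded sets to all Borel sets, so that the whole mass \<open>M\<close> survives.\<close>

theorem St_compact:
  assumes s: "\<And>i::nat. s i \<in> St" "\<And>i. ms (s i) = M" "\<And>i. pw (s i) \<le> P" and tight: "tight s"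
  obtains \<phi> :: "nat \<Rightarrow> nat" and t where "strict_mono \<phi>" "t \<in> St" "ms t = M"
    "\<And>S. S \<in> sets borel \<Longrightarrow>
      (\<lambda>i. LINT p|cylm e3. s (\<phi> i) p * indicator S p) \<longlonglongrightarrow> (LINT p|cylm e3. t p * indicator S p)"
proof -
  interpret sf: sigma_finite_measure "cylm e3" by (rule sigma_finite_cylm[OF norm_e3])
  have sm [measurable]: "s i \<in> borel_measurable borel" for i by (rule StD(1)[OF s(1)])
  have M: "0 \<le> M" using ms_nonneg[OF s(1)[of 0]] s(2) by simp
  have P: "0 \<le> P" using pw_nonneg[of "s 0"] s(3)[of 0] by linarith
  have n2: "n2 (s i) \<le> M + P" for i by (rule n2_le_mass[OF s(1)]) (use s in auto)
  have distr: "integrable lborel (\<lambda>x. u (cyl e3 x)) = integrable (cylm e3) u"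
    "(LINT x|lborel. u (cyl e3 x)) = (LINT p|cylm e3. u p)" if "u \<in> borel_measurable borel" for u :: "real \<times> real \<Rightarrow> real"
    using that unfolding cylm_def by (auto simp: integrable_distr_eq integral_distr)
  obtain \<phi> :: "nat \<Rightarrow> nat" where \<phi>: "strict_mono \<phi>"
    "\<And>E. E \<in> sets borel \<Longrightarrow> bounded E \<Longrightarrow> convergent (\<lambda>i. LINT x|lborel. s (\<phi> i) (cyl e3 x) * indicator E x)"
  proof (rule L2_bounded_subseq_set_convergent[of "\<lambda>i x. s i (cyl e3 x)" "M + P" M])
    show "integrable lborel (\<lambda>x. s i (cyl e3 x))" for i using StD(4)[OF s(1)] by (simp add: distr)
    show "integrable lborel (\<lambda>x. (s i (cyl e3 x))\<^sup>2)" for i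
      using n2_integrable[OF s(1)] distr(1)[of "\<lambda>p. (s i p)\<^sup>2"] by simp
    show "0 \<le> s i (cyl e3 x)" for i x by (rule StD(2)[OF s(1)])
    show "(LINT x|lborel. (s i (cyl e3 x))\<^sup>2) \<le> M + P" for i
      using n2[of i] distr(2)[of "\<lambda>p. (s i p)\<^sup>2"] by (simp add: n2_def)
    show "(LINT x|lborel. s i (cyl e3 x)) \<le> M" for i
      using s(2)[of i] by (simp add: distr ms_def)
  qed blast
  define a where "a S i = (LINT p|cylm e3. s (\<phi> i) p * indicator S p)" for S i
  have ai: "integrable (cylm e3) (\<lambda>p. s (\<phi> i) p * indicator S p)" if "S \<in> sets borel" for S i
    using that by (intro integrable_real_mult_indicator StD(4)[OF s(1)]) simp
  have a0: "0 \<le> a S i" for S i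
    unfolding a_def using StD(2)[OF s(1)] by (intro Bochner_Integration.integral_nonneg) simp
  have a_mono: "a S i \<le> a T i" if "S \<in> sets borel" "T \<in> sets borel" "S \<subseteq> T" for S T i
    unfolding a_def using that StD(2)[OF s(1)] by (intro integral_mono ai) (auto simp: indicator_def)
  have aU: "a UNIV i = M" for i unfolding a_def using s(2)[of "\<phi> i"] by (simp add: ms_def)
  have a_add: "a (S \<union> T) i = a S i + a T i" if "S \<in> sets borel" "T \<in> sets borel" "S \<inter> T = {}" for S T i
  proof -
    have "a (S \<union> T) i = (LINT p|cylm e3. s (\<phi> i) p * indicator S p + s (\<phi> i) p * indicator T p)"
      unfolding a_def using that(3) by (intro Bochner_Integration.integral_cong) (auto simp: indicator_def)
    then show ?thesis unfolding a_def using that by (simp add: ai)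
  qed
  let ?box = "\<lambda>R. {..<Rc} \<times> {-R..R} :: (real \<times> real) set"
  have box: "?box R \<in> sets borel" for R by measurable
  \<comment> \<open>Tightness and the vanishing beyond \<open>Rc\<close> confine all but
    \<open>\<epsilon>\<close> of the mass to one box, for all \<open>i\<close> and \<open>S\<close>
    at once.\<close>
  have tail: "\<exists>R. \<forall>S\<in>sets borel. \<forall>i. a S i \<le> a (S \<inter> ?box R) i + \<epsilon>" if \<epsilon>: "0 < \<epsilon>" for \<epsilon>
  proof -
    obtain R where R: "\<And>i. ms (s i) - \<epsilon> \<le> ms (cut (slab 0 R) (s i))" using tight \<epsilon> unfolding tight_def by blast
    have X: "slab 0 R \<in> sets borel" by measurable
    have "a S i \<le> a (S \<inter> ?box R) i + \<epsilon>" if S: "S \<in> sets borel" for S i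
    proof -
      let ?r = "cut (- slab 0 R) (s (\<phi> i))"
      have r: "?r \<in> St" by (intro St_cut s borel_comp X)
      have SR: "S \<inter> ?box R \<in> sets borel" using S box by (rule sets.Int)
      have "a S i \<le> (LINT p|cylm e3. s (\<phi> i) p * indicator (S \<inter> ?box R) p + ?r p)"
        unfolding a_def
      proof (intro integral_mono Bochner_Integration.integrable_add ai S SR StD(4)[OF r])
        fix p
        show "s (\<phi> i) p * indicator S p \<le> s (\<phi> i) p * indicator (S \<inter> ?box R) p + ?r p"
        proof (cases "Rc \<le> fst p")
          case False
          then show ?thesis using StD(2)[OF s(1), of "\<phi> i" p]
            by (cases p) (auto simp: indicator_def cut_def abs_le_iff)
        qed (simp add: StD(3)[OF s(1)] cut_def)
      qed
      also have "\<dots> = a (S \<inter> ?box R) i + ms ?r"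
        unfolding a_def ms_def by (rule Bochner_Integration.integral_add[OF ai[OF SR] StD(4)[OF r]])
      also have "ms ?r \<le> \<epsilon>" using R[of "\<phi> i"] ms_cut_split[OF s(1) X, of "\<phi> i"] by linarith
      finally show ?thesis by simp
    qed
    then show ?thesis by blast
  qed
  have conv: "convergent (a S)" if S: "S \<in> sets borel" for S
  proof -
    have "Cauchy (a S)"
    proof (rule metric_CauchyI)
      fix e :: real assume e: "0 < e"
      then obtain R where R: "\<And>i. a S i \<le> a (S \<inter> ?box R) i + e / 4"
        using tail[of "e / 4"] S by auto
      have SR: "S \<inter> ?box R \<in> sets borel" using S box by (rule sets.Int)
      have R2: "a (S \<inter> ?box R) i \<le> a S i" for i by (rule a_mono[OF SR S]) auto
      have "convergent (\<lambda>i. LINT x|lborel. s (\<phi> i) (cyl e3 x) * indicator (cyl e3 -` (S \<inter> ?box R)) x)"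
      proof (rule \<phi>(2))
        show "cyl e3 -` (S \<inter> ?box R) \<in> sets borel" using measurable_sets[OF cyl_measurable SR] by simp
        show "bounded (cyl e3 -` (S \<inter> ?box R))"
        proof (rule boundedI[of _ "Rc + \<bar>R\<bar>"])
          fix x assume "x \<in> cyl e3 -` (S \<inter> ?box R)"
          then have "fst (cyl e3 x) < Rc" "\<bar>snd (cyl e3 x)\<bar> \<le> R" by (auto simp: mem_Times_iff)
          then show "norm x \<le> Rc + \<bar>R\<bar>" using norm_le_cyl(1)[OF norm_e3, of x] by linarith
        qed
      qed
      moreover have "(LINT x|lborel. s (\<phi> i) (cyl e3 x) * indicator (cyl e3 -` (S \<inter> ?box R)) x) = a (S \<inter> ?box R) i" for i
      proof -
        have "(\<lambda>p. s (\<phi> i) p * indicator (S \<inter> ?box R) p) \<in> borel_measurable borel"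
          using SR by measurable
        moreover have "indicator (cyl e3 -` (S \<inter> ?box R)) x = (indicator (S \<inter> ?box R) (cyl e3 x) :: real)" for x
          by (simp add: indicator_def)
        ultimately show ?thesis using distr(2) by (simp only: a_def)
      qed
      ultimately have "Cauchy (a (S \<inter> ?box R))" by (simp add: Cauchy_convergent_iff)
      then obtain N where N: "\<And>m n. N \<le> m \<Longrightarrow> N \<le> n \<Longrightarrow> dist (a (S \<inter> ?box R) m) (a (S \<inter> ?box R) n) < e / 2"
        using e unfolding Cauchy_def by (metis half_gt_zero)
      have "dist (a S m) (a S n) < e" if "N \<le> m" "N \<le> n" for m n
        using N[OF that] R[of m] R[of n] R2[of m] R2[of n] e unfolding dist_real_def by linarith
      then show "\<exists>N. \<forall>m\<ge>N. \<forall>n\<ge>N. dist (a S m) (a S n) < e" by blast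
    qed
    then show ?thesis by (simp add: Cauchy_convergent_iff)
  qed
  define L where "L S = lim (a S)" for S
  have L: "a S \<longlonglongrightarrow> L S" if "S \<in> sets borel" for S
    using conv[OF that] unfolding L_def by (simp add: convergent_LIMSEQ_iff)
  have L0: "0 \<le> L S" if "S \<in> sets borel" for S
    using a0 by (intro LIMSEQ_le_const[OF L[OF that]]) auto
  have LU: "L UNIV = M"
  proof -
    have "(\<lambda>i. M) \<longlonglongrightarrow> L UNIV" using L[of UNIV] by (simp add: aU [abs_def])
    then show ?thesis by (simp add: LIMSEQ_const_iff)
  qed
  have L_add: "L (S \<union> T) = L S + L T" if "S \<in> sets borel" "T \<in> sets borel" "S \<inter> T = {}" for S T
  proof (rule LIMSEQ_unique[OF L])
    show "S \<union> T \<in> sets borel" using that by auto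
    have "a (S \<union> T) = (\<lambda>i. a S i + a T i)" by (intro ext a_add that)
    then show "a (S \<union> T) \<longlonglongrightarrow> L S + L T"
      using tendsto_add[OF L[OF that(1)] L[OF that(2)]] by simp
  qed
  \<comment> \<open>Uniform absolute continuity: by the bound on square integrals, small measure
    inside the box forces small mass there.\<close>
  have L_small: "\<exists>\<delta>>0. \<exists>R. \<forall>S\<in>sets borel. emeasure (cylm e3) (S \<inter> ?box R) \<le> ennreal \<delta> \<longrightarrow> L S \<le> \<epsilon>" if \<epsilon>: "0 < \<epsilon>" for \<epsilon>
  proof -
    obtain R where R: "\<And>S i. S \<in> sets borel \<Longrightarrow> a S i \<le> a (S \<inter> ?box R) i + \<epsilon> / 2"
      using tail[of "\<epsilon> / 2"] \<epsilon> by auto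
    define \<tau> where "\<tau> = \<epsilon> / (4 * (M + P + 1))"
    have \<tau>: "0 < \<tau>" "\<tau> * (M + P) \<le> \<epsilon> / 4" using \<epsilon> M P by (auto simp: \<tau>_def field_simps)
    have "L S \<le> \<epsilon>" if S: "S \<in> sets borel" and small: "emeasure (cylm e3) (S \<inter> ?box R) \<le> ennreal (\<tau> * \<epsilon> / 4)" for S
    proof -
      have SR: "S \<inter> ?box R \<in> sets borel" using S box by (rule sets.Int)
      have "a S i \<le> \<epsilon>" for i
      proof -
        have "a (S \<inter> ?box R) i \<le> \<tau> * (M + P) + (\<tau> * \<epsilon> / 4) / \<tau>"
          unfolding a_def
          by (rule set_integral_le_L2[OF StD(4)[OF s(1)] n2_integrable[OF s(1)] StD(2)[OF s(1)] _ _ small])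
            (use SR n2[of "\<phi> i"] \<tau> \<epsilon> in \<open>auto simp: n2_def\<close>)
        also have "\<dots> \<le> \<epsilon> / 4 + \<epsilon> / 4" using \<tau> by simp
        finally show ?thesis using R[OF S, of i] by linarith
      qed
      then show ?thesis by (intro LIMSEQ_le_const2[OF L[OF S]]) auto
    qed
    moreover have "0 < \<tau> * \<epsilon> / 4" using \<tau> \<epsilon> by simp
    ultimately show ?thesis by blast
  qed
  have cont: "(\<lambda>n. ennreal (L (A n))) \<longlonglongrightarrow> 0"
    if A: "range A \<subseteq> sets borel" "decseq A" "(\<Inter>i. A i) = {}" for A :: "nat \<Rightarrow> (real \<times> real) set"
  proof -
    have Ab: "A n \<in> sets borel" for n using A by auto
    have "(\<lambda>n. L (A n)) \<longlonglongrightarrow> 0"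
    proof (rule LIMSEQ_I)
      fix r :: real assume r: "0 < r"
      then obtain \<delta> R where \<delta>: "0 < \<delta>" "\<And>S. S \<in> sets borel \<Longrightarrow> emeasure (cylm e3) (S \<inter> ?box R) \<le> ennreal \<delta> \<Longrightarrow> L S \<le> r / 2"
        using L_small[of "r / 2"] by auto
      have "(\<lambda>n. emeasure (cylm e3) (A n \<inter> ?box R)) \<longlonglongrightarrow> emeasure (cylm e3) (\<Inter>n. A n \<inter> ?box R)"
      proof (rule Lim_emeasure_decseq)
        show "range (\<lambda>n. A n \<inter> ?box R) \<subseteq> sets (cylm e3)" using Ab box by auto
        show "decseq (\<lambda>n. A n \<inter> ?box R)" using A(2) unfolding decseq_def by blast
        show "emeasure (cylm e3) (A n \<inter> ?box R) \<noteq> \<infinity>" for n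
        proof -
          have "emeasure (cylm e3) (A n \<inter> ?box R) \<le> emeasure (cylm e3) (?box R)"
            using box by (intro emeasure_mono) auto
          then show ?thesis using cylm_box_finite[of R] by auto
        qed
      qed
      moreover have "(\<Inter>n. A n \<inter> ?box R) = {}" using A(3) by auto
      ultimately have "(\<lambda>n. emeasure (cylm e3) (A n \<inter> ?box R)) \<longlonglongrightarrow> 0" by simp
      then have "\<forall>\<^sub>F n in sequentially. emeasure (cylm e3) (A n \<inter> ?box R) < ennreal \<delta>"
        using \<delta>(1) by (intro order_tendstoD) auto
      then obtain N where N: "\<And>n. N \<le> n \<Longrightarrow> emeasure (cylm e3) (A n \<inter> ?box R) < ennreal \<delta>"
        by (auto simp: eventually_sequentially)
      have "norm (L (A n) - 0) < r" if "N \<le> n" for n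
        using \<delta>(2)[OF Ab less_imp_le[OF N[OF that]]] L0[OF Ab, of n] r by simp
      then show "\<exists>no. \<forall>n\<ge>no. norm (L (A n) - 0) < r" by blast
    qed
    then show ?thesis by (auto dest: tendsto_ennrealI)
  qed
  define \<nu> where "\<nu> = measure_of UNIV (sets borel) (\<lambda>S :: (real \<times> real) set. ennreal (L S))"
  have L_empty: "L {} = 0" using L_add[of "{}" "{}"] by simp
  have ca: "countably_additive (sets (borel :: (real \<times> real) measure)) (\<lambda>S. ennreal (L S))"
  proof (rule sets.empty_continuous_imp_countably_additive)
    show "positive (sets borel) (\<lambda>S. ennreal (L S))" by (simp add: positive_def L_empty)
    show "additive (sets borel) (\<lambda>S. ennreal (L S))"
      unfolding additive_def using L_add L0 by (auto simp: ennreal_plus)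
    show "\<forall>A\<in>sets borel. ennreal (L A) \<noteq> \<infinity>" by simp
  qed (rule cont)
  have \<nu>: "emeasure \<nu> S = ennreal (L S)" if "S \<in> sets borel" for S
    unfolding \<nu>_def
  proof (rule emeasure_measure_of_sigma)
    show "sigma_algebra UNIV (sets (borel :: (real \<times> real) measure))"
      using sets.sigma_algebra_axioms[of "borel :: (real \<times> real) measure"] by simp
    show "positive (sets borel) (\<lambda>S. ennreal (L S))" by (simp add: positive_def L_empty)
  qed (rule ca, rule that)
  have sets\<nu>: "sets \<nu> = sets borel"
    unfolding \<nu>_def using sets.sigma_sets_eq[of "borel :: (real \<times> real) measure"]
    by (subst sets_measure_of) auto
  have ac: "absolutely_continuous (cylm e3) \<nu>"
  proof (unfold absolutely_continuous_def, rule subsetI)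
    fix S assume "S \<in> null_sets (cylm e3)"
    then have S: "S \<in> sets borel" "AE p in cylm e3. p \<notin> S" by (auto intro: AE_not_in)
    have "a S i = 0" for i
    proof -
      have "a S i = (LINT p|cylm e3. 0)"
        unfolding a_def using S(2) ai[OF S(1)]
        by (intro integral_cong_AE) (auto elim!: eventually_mono simp: indicator_def)
      then show ?thesis by simp
    qed
    then have "a S = (\<lambda>i. 0)" by (intro ext)
    then have "L S = 0" using L[OF S(1)] by (simp add: LIMSEQ_const_iff)
    then show "S \<in> null_sets \<nu>" using S(1) by (simp add: null_sets_def sets\<nu> \<nu>)
  qed
  define r where "r = RN_deriv (cylm e3) \<nu>"
  have [measurable]: "r \<in> borel_measurable borel"
    using borel_measurable_RN_deriv[of "cylm e3" \<nu>] unfolding r_def by (simp cong: measurable_cong_sets)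
  have dens: "density (cylm e3) r = \<nu>" unfolding r_def by (rule sf.density_RN_deriv[OF ac]) (simp add: sets\<nu>)
  have rS: "(\<integral>\<^sup>+p. r p * indicator S p \<partial>cylm e3) = ennreal (L S)" if "S \<in> sets borel" for S
  proof -
    have "emeasure (density (cylm e3) r) S = (\<integral>\<^sup>+p. r p * indicator S p \<partial>cylm e3)"
      using that by (intro emeasure_density) auto
    then show ?thesis by (simp add: dens \<nu>[OF that])
  qed
  have "(\<integral>\<^sup>+p. r p \<partial>cylm e3) \<noteq> \<infinity>" using rS[of UNIV] by simp
  then have fin: "AE p in cylm e3. r p \<noteq> \<infinity>" by (intro nn_integral_PInf_AE) auto
  let ?out = "{Rc..} \<times> (UNIV :: real set)"
  have out: "?out \<in> sets borel" by measurable
  have "L ?out = 0"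
  proof -
    have "a ?out i = 0" for i
    proof -
      have "a ?out i = (LINT p|cylm e3. 0)"
        unfolding a_def using StD(3)[OF s(1)]
        by (intro Bochner_Integration.integral_cong) (auto simp: indicator_def mem_Times_iff)
      then show ?thesis by simp
    qed
    then have "a ?out = (\<lambda>i. 0)" by (intro ext)
    then show ?thesis using L[OF out] by (simp add: LIMSEQ_const_iff)
  qed
  then have "(\<integral>\<^sup>+p. r p * indicator ?out p \<partial>cylm e3) = 0" using rS[OF out] by simp
  then have r0: "AE p in cylm e3. r p * indicator ?out p = 0"
    by (subst (asm) nn_integral_0_iff_AE) auto
  \<comment> \<open>The derivative vanishes beyond \<open>Rc\<close> almost everywhere, as the
    limiting masses do; the case distinction makes this hold at every point, as \<open>St\<close>
    requires.\<close>
  define t where "t p = (if fst p < Rc then enn2real (r p) else 0)" for p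
  have "{p \<in> space (borel :: (real \<times> real) measure). fst p < Rc} \<in> sets borel" by measurable
  then have tm [measurable]: "t \<in> borel_measurable borel" unfolding t_def [abs_def] by (intro measurable_If) auto
  have t0: "0 \<le> t p" "Rc \<le> fst p \<Longrightarrow> t p = 0" for p by (auto simp: t_def)
  have tr: "AE p in cylm e3. ennreal (t p) = r p"
    using fin r0
  proof eventually_elim
    case (elim p)
    show ?case
    proof (cases "fst p < Rc")
      case True
      then show ?thesis using elim(1) by (simp add: t_def ennreal_enn2real_if)
    next
      case False
      then show ?thesis using elim(2) by (simp add: t_def indicator_def mem_Times_iff)
    qed
  qed
  have nnt: "(\<integral>\<^sup>+p. ennreal (t p * indicator S p) \<partial>cylm e3) = ennreal (L S)" if S: "S \<in> sets borel" for S
  proof -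
    have "(\<integral>\<^sup>+p. ennreal (t p * indicator S p) \<partial>cylm e3) = (\<integral>\<^sup>+p. r p * indicator S p \<partial>cylm e3)"
      using tr by (intro nn_integral_cong_AE) (auto elim!: eventually_mono simp: indicator_def)
    then show ?thesis by (simp add: rS[OF S])
  qed
  have tL: "(LINT p|cylm e3. t p * indicator S p) = L S" if S: "S \<in> sets borel" for S
  proof -
    have "(\<lambda>p. t p * indicator S p) \<in> borel_measurable (cylm e3)" using S by measurable
    then show ?thesis using t0 L0[OF S] by (subst integral_eq_nn_integral) (auto simp: nnt[OF S])
  qed
  have ti: "integrable (cylm e3) t"
    using nnt[of UNIV] t0 by (auto simp: integrable_iff_bounded)
  have tms: "ms t = M" using tL[of UNIV] LU by (simp add: ms_def)
  have conv': "(\<lambda>i. LINT p|cylm e3. s (\<phi> i) p * indicator S p) \<longlonglongrightarrow> (LINT p|cylm e3. t p * indicator S p)"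
    if "S \<in> sets borel" for S using L[OF that] by (simp add: tL[OF that] a_def [abs_def])
  have wc: "wconv (\<lambda>i. s (\<phi> i)) t"
    unfolding wconv_def
  proof (intro allI impI)
    fix g :: "real \<times> real \<Rightarrow> real" and B R :: real
    assume g: "g \<in> borel_measurable borel" "\<forall>p. 0 \<le> g p \<and> g p \<le> B"
    show "(\<lambda>i. LINT p|cylm e3. s (\<phi> i) p * g p) \<longlonglongrightarrow> (LINT p|cylm e3. t p * g p)"
    proof (rule integral_conv_bounded[where M=M and B=B])
      show "integrable (cylm e3) (s (\<phi> i))" "0 \<le> s (\<phi> i) x" "(LINT x|cylm e3. s (\<phi> i) x) \<le> M" for i x
        using StD[OF s(1)] s(2)[of "\<phi> i"] by (auto simp: ms_def)
      show "integrable (cylm e3) t" "0 \<le> t x" "(LINT x|cylm e3. t x) \<le> M" for x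
        using ti t0 tms by (auto simp: ms_def)
      show "g \<in> borel_measurable (cylm e3)" using g by simp
      show "\<bar>g x\<bar> \<le> B" for x using g(2)[rule_format, of x] by linarith
    qed (simp add: conv')
  qed
  have "integrable (cylm e3) (\<lambda>p. t p powr \<gamma>)"
    by (rule pw_lsc(1)[OF tm t0(1) t0(2) ti _ wc, of P]) (use s in auto)
  then have "t \<in> St" using tm t0 ti unfolding St_def by blast
  then show ?thesis using that \<phi>(1) tms conv' by blast
qed

end

section \<open>Axisymmetric densities and reduced densities\<close>

lemma UNIV_5: "(UNIV :: 5 set) = {1, 2, 3, 4, 5}"
proof -
  have "card {1, 2, 3, 4, 5 :: 5} = 5" by simp
  then show ?thesis by (intro card_subset_eq[symmetric]) auto
qed

lemma sum_5: "sum f (UNIV :: 5 set) = f 1 + f 2 + f 3 + f 4 + f 5"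
  unfolding UNIV_5 by (simp add: add.assoc)

lemma cyl_e3: "cyl e3 x = (cyl_r x, x $ 3)"
  unfolding cyl_def inner_axis by (simp add: cyl_r_def norm_vec_def L2_set_def sum_3 axis_def)

lemma cyl_e5: "cyl e5 y = (sqrt ((y $ 1)\<^sup>2 + (y $ 2)\<^sup>2 + (y $ 4)\<^sup>2 + (y $ 5)\<^sup>2), y $ 3)"
  unfolding cyl_def inner_axis norm_vec_def L2_set_def sum_5 by (simp add: axis_def)

lemma cyl_e5_vector: "cyl e5 (vector [x $ 1, x $ 2, x $ 3, 0, 0]) = cyl e3 x"
  by (simp add: cyl_e3 cyl_e5 cyl_r_def vector_def)

lemma cyl_e3_vector: "0 \<le> r \<Longrightarrow> cyl e3 (vector [r, 0, z]) = (r, z)"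
  by (simp add: cyl_e3 cyl_r_def)

lemma cyl_e5_plane: "0 \<le> fst p \<Longrightarrow> cyl e5 (fst p *\<^sub>R axis 1 1 + snd p *\<^sub>R axis 3 1) = p"
  unfolding cyl_e5 by (simp add: axis_def prod_eq_iff)

lemma lift5_cyl: "lift5 \<rho> y = \<rho> (vector [fst (cyl e5 y), 0, snd (cyl e5 y)])"
  by (simp add: lift5_def profile_def cyl_e5)

lemma axisymmetric_cyl:
  assumes "axisymmetric \<rho>"
  shows "\<rho> x = \<rho> (vector [fst (cyl e3 x), 0, snd (cyl e3 x)])"
proof -
  obtain f where f: "\<And>x. \<rho> x = f (fst (cyl e3 x)) (snd (cyl e3 x))"
    using assms unfolding axisymmetric_def cyl_e3 by auto
  show ?thesis unfolding f[of x] f[of "vector _"] by (simp only: cyl_e3_vector fst_cyl_nonneg fst_conv snd_conv)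
qed

text \<open>The image of a Borel set under \<open>cyl e\<close> need not be Borel, but compact sets have compact
  images, and a Lebesgue measurable set is a countable union of compact sets up to a null set.\<close>

lemma cylm_inner_borel:
  fixes e :: "'a::euclidean_space"
  assumes "cyl e -` S \<in> sets lebesgue"
  obtains B where "B \<in> sets borel" "B \<subseteq> S" "cyl e -` S - cyl e -` B \<in> null_sets lebesgue"
proof -
  obtain C T where C: "fsigma C" "T \<in> null_sets lebesgue" "C \<union> T = cyl e -` S"
    using lebesgue_set_almost_fsigma[OF assms] by metis
  obtain K :: "nat \<Rightarrow> 'a set" where K: "range K \<subseteq> Collect compact" "C = \<Union>(range K)"
    using C(1) unfolding fsigma_Union_compact by auto
  have cc: "continuous_on X (cyl e)" for X
    unfolding cyl_def [abs_def] by (intro continuous_intros)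
  define B where "B = (\<Union>n. cyl e ` K n)"
  have "cyl e ` K n \<in> sets borel" for n
    using K(1) by (intro borel_compact compact_continuous_image cc) auto
  then have B: "B \<in> sets borel" unfolding B_def by auto
  have "K n \<subseteq> cyl e -` S" for n using C(3) K(2) by blast
  then have "B \<subseteq> S" unfolding B_def by blast
  moreover have sub: "cyl e -` S - cyl e -` B \<subseteq> T" unfolding B_def using C(3) K(2) by auto
  moreover have "cyl e -` B \<in> sets lborel" using measurable_sets[OF cyl_measurable B] by simp
  then have "cyl e -` S - cyl e -` B \<in> sets lebesgue" using assms by (intro sets.Diff) auto
  then have "cyl e -` S - cyl e -` B \<in> null_sets lebesgue" using C(2) sub by (rule_tac null_sets_subset) auto
  ultimately show ?thesis using that B by blast
qed

text \<open>Exhaust \<open>S\<close> and its complement by Borel sets from inside. What is left over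
  is a Borel set with null preimage, so \<open>S\<close> differs from a Borel set by part of a null
  set.\<close>

lemma cylm_completion_sets:
  fixes e :: "'a::euclidean_space"
  assumes S: "cyl e -` S \<in> sets lebesgue"
  shows "S \<in> sets (completion (cylm e))"
proof -
  obtain B where B: "B \<in> sets borel" "B \<subseteq> S" "cyl e -` S - cyl e -` B \<in> null_sets lebesgue"
    by (rule cylm_inner_borel[OF S])
  have "cyl e -` (- S) = space lebesgue - cyl e -` S" by auto
  also have "\<dots> \<in> sets lebesgue" using S by (rule sets.compl_sets)
  finally have S': "cyl e -` (- S) \<in> sets lebesgue" .
  obtain B' where B': "B' \<in> sets borel" "B' \<subseteq> - S" "cyl e -` (- S) - cyl e -` B' \<in> null_sets lebesgue"
    by (rule cylm_inner_borel[OF S'])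
  let ?N = "- (B \<union> B')"
  have N: "?N \<in> sets borel" using B(1) B'(1) by auto
  have "cyl e -` ?N \<in> sets lborel" using measurable_sets[OF cyl_measurable N] by simp
  moreover have "cyl e -` ?N = (cyl e -` S - cyl e -` B) \<union> (cyl e -` (- S) - cyl e -` B')"
    using B(2) B'(2) by auto
  then have "cyl e -` ?N \<in> null_sets lebesgue" using null_sets.Un[OF B(3) B'(3)] by simp
  ultimately have "cyl e -` ?N \<in> null_sets lborel" by (simp add: null_sets_completion_iff)
  then have "?N \<in> null_sets (cylm e)"
    using N by (intro null_setsI) (auto simp: emeasure_cylm)
  then show ?thesis
    using B B' by (intro sets_completionI[of S B "S - B" ?N]) auto
qed

text \<open>Preimages under \<open>f\<close> lie in the completion of \<open>cylm e\<close>, and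
  functions measurable for a completion agree almost everywhere with Borel ones. This supplies the
  Borel profile of a density that is only Lebesgue measurable.\<close>

lemma cylm_borel_representative:
  fixes e :: "'a::euclidean_space" and f :: "real \<times> real \<Rightarrow> real"
  assumes "(\<lambda>x. f (cyl e x)) \<in> borel_measurable lebesgue"
  obtains g where "g \<in> borel_measurable borel" "AE p in cylm e. f p = g p"
proof -
  have "f \<in> borel_measurable (completion (cylm e))"
  proof (rule measurableI)
    fix A :: "real set" assume "A \<in> sets borel"
    then have "(\<lambda>x. f (cyl e x)) -` A \<inter> space lebesgue \<in> sets lebesgue" by (rule measurable_sets[OF assms])
    then have "cyl e -` (f -` A) \<in> sets lebesgue" by (simp add: vimage_def)
    then show "f -` A \<inter> space (completion (cylm e)) \<in> sets (completion (cylm e))"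
      using cylm_completion_sets by auto
  qed simp
  from completion_ex_borel_measurable_real[OF this] show ?thesis
    using that unfolding measurable_cong_sets[OF sets_cylm refl] by blast
qed

lemma AE_cylmD: "AE p in cylm e. P p \<Longrightarrow> AE x in lebesgue. P (cyl e x)"
  unfolding cylm_def by (intro AE_completion AE_distrD[OF _, of "cyl e" lborel borel]) auto

lemma integral_lebesgue_cylm:
  fixes s :: "real \<times> real \<Rightarrow> real"
  assumes [measurable]: "s \<in> borel_measurable borel"
  shows "integrable lebesgue (\<lambda>x. s (cyl e x)) \<longleftrightarrow> integrable (cylm e) s"
    "(LINT x|lebesgue. s (cyl e x)) = (LINT p|cylm e. s p)"
proof -
  have m: "(\<lambda>x. s (cyl e x)) \<in> borel_measurable lborel"
    using measurable_compose[OF cyl_measurable assms] by simp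
  show "integrable lebesgue (\<lambda>x. s (cyl e x)) \<longleftrightarrow> integrable (cylm e) s"
    using m unfolding cylm_def by (subst integrable_completion, simp, subst integrable_distr_eq) auto
  show "(LINT x|lebesgue. s (cyl e x)) = (LINT p|cylm e. s p)"
    using m unfolding cylm_def by (subst integral_completion, simp, subst integral_distr) auto
qed

context star
begin

text \<open>\<open>lift5\<close> reads \<open>\<rho>\<close> on a half-plane, which is a null set of
  \<open>real^3\<close>. For an arbitrary \<open>\<rho>\<close> agreement of the lifts is therefore
  not a consequence of agreement in \<open>real^3\<close>, and it is recorded separately.\<close>

definition repr :: "(real^3 \<Rightarrow> real) \<Rightarrow> (real \<times> real \<Rightarrow> real) \<Rightarrow> bool" where
  "repr \<rho> s \<longleftrightarrow> s \<in> St \<and> (AE x in lebesgue. \<rho> x = s (cyl e3 x)) \<and> (AE y in lebesgue. lift5 \<rho> y = s (cyl e5 y))"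

section \<open>The energy in reduced form\<close>

lemma AE_cylm_lift: "AE p in cylm e3. P p \<Longrightarrow> AE p in cylm e5. P p"
  unfolding lift_measure by (subst AE_density) auto

lemma cyl_measurable_lebesgue: "s \<in> borel_measurable borel \<Longrightarrow> (\<lambda>x. s (cyl e x)) \<in> borel_measurable lebesgue"
  for s :: "real \<times> real \<Rightarrow> real"
  using measurable_compose[OF cyl_measurable, of s borel] by (intro measurable_completion) simp

lemma reprD:
  assumes "repr \<rho> s"
  shows "s \<in> St" "AE x in lebesgue. \<rho> x = s (cyl e3 x)" "AE y in lebesgue. lift5 \<rho> y = s (cyl e5 y)"
    "\<rho> \<in> borel_measurable lebesgue" "lift5 \<rho> \<in> borel_measurable lebesgue"
proof -
  show 1: "s \<in> St" and 2: "AE x in lebesgue. \<rho> x = s (cyl e3 x)" and 3: "AE y in lebesgue. lift5 \<rho> y = s (cyl e5 y)"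
    using assms unfolding repr_def by blast+
  show "\<rho> \<in> borel_measurable lebesgue"
    by (rule borel_measurable_AE[OF cyl_measurable_lebesgue[OF StD(1)[OF 1]]]) (use 2 in \<open>auto elim: eventually_mono\<close>)
  show "lift5 \<rho> \<in> borel_measurable lebesgue"
    by (rule borel_measurable_AE[OF cyl_measurable_lebesgue[OF StD(1)[OF 1]]]) (use 3 in \<open>auto elim: eventually_mono\<close>)
qed

lemma repr_integral:
  assumes r: "repr \<rho> s"
  shows "(LINT x|lebesgue. \<rho> x) = ms s" "(LINT x|lebesgue. \<rho> x powr \<gamma>) = pw s"
proof -
  note [measurable] = reprD(4)[OF r] StD(1)[OF reprD(1)[OF r]]
  note [measurable] = cyl_measurable_lebesgue[OF StD(1)[OF reprD(1)[OF r]]]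
  have "(LINT x|lebesgue. \<rho> x) = (LINT x|lebesgue. s (cyl e3 x))"
    using reprD(2)[OF r] by (intro integral_cong_AE) auto
  then show "(LINT x|lebesgue. \<rho> x) = ms s" by (simp add: integral_lebesgue_cylm ms_def)
  have "(LINT x|lebesgue. \<rho> x powr \<gamma>) = (LINT x|lebesgue. s (cyl e3 x) powr \<gamma>)"
    using reprD(2)[OF r] by (intro integral_cong_AE) (auto elim: eventually_mono)
  also have "\<dots> = pw s" unfolding pw_def by (rule integral_lebesgue_cylm(2)[of "\<lambda>p. s p powr \<gamma>"]) measurable
  finally show "(LINT x|lebesgue. \<rho> x powr \<gamma>) = pw s" .
qed

lemma repr_cyl:
  assumes "s \<in> St"
  shows "repr (\<lambda>x. s (cyl e3 x)) s"
proof -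
  have "lift5 (\<lambda>x. s (cyl e3 x)) y = s (cyl e5 y)" for y
    unfolding lift5_cyl by (simp add: cyl_e3_vector del: snd_cyl)
  then show ?thesis using assms by (simp add: repr_def)
qed

lemma W_star_cyl:
  assumes s: "s \<in> St"
  shows "(\<lambda>x. s (cyl e3 x)) \<in> W_star \<gamma> (ms s) Rc"
proof -
  note [measurable] = StD(1)[OF s]
  have "axisymmetric (\<lambda>x. s (cyl e3 x))"
    unfolding axisymmetric_def by (rule exI[of _ "\<lambda>r z. s (r, z)"]) (simp add: cyl_e3)
  moreover have "integrable lebesgue (\<lambda>x. s (cyl e3 x))" using StD(4)[OF s] by (simp add: integral_lebesgue_cylm)
  moreover have "integrable lebesgue (\<lambda>x. s (cyl e3 x) powr \<gamma>)"
    using StD(5)[OF s] integral_lebesgue_cylm(1)[of "\<lambda>p. s p powr \<gamma>" e3] by simp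
  ultimately show ?thesis
    using cyl_measurable_lebesgue[OF StD(1)[OF s]] StD(2,3)[OF s] repr_integral(1)[OF repr_cyl[OF s]]
    unfolding W_star_def W_class_def Lp_space_def by (auto simp: cyl_e3)
qed

text \<open>Axial symmetry makes \<open>\<rho>\<close> a function of the cylindrical coordinates,
  and null sets of \<open>cylm e3\<close> are null for \<open>cylm e5\<close>, so one Borel
  correction on the half-plane serves both spaces.\<close>

lemma W_star_repr:
  assumes \<rho>: "\<rho> \<in> W_star \<gamma> M Rc"
  obtains s where "repr \<rho> s" "ms s = M"
proof -
  have ax: "axisymmetric \<rho>" and nn: "AE x in lebesgue. 0 \<le> \<rho> x" and int: "integrable lebesgue \<rho>"
    and m: "\<rho> \<in> borel_measurable lebesgue" and pow: "integrable lebesgue (\<lambda>x. \<bar>\<rho> x\<bar> powr \<gamma>)"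
    and M: "(LINT x|lebesgue. \<rho> x) = M" and z: "\<And>x. Rc \<le> cyl_r x \<Longrightarrow> \<rho> x = 0"
    using \<rho> unfolding W_star_def W_class_def Lp_space_def by auto
  define f where "f p = \<rho> (vector [fst p, 0, snd p])" for p :: "real \<times> real"
  have f: "\<rho> x = f (cyl e3 x)" for x using axisymmetric_cyl[OF ax] by (simp add: f_def)
  have "(\<lambda>x. f (cyl e3 x)) \<in> borel_measurable lebesgue" using m f by (simp add: f[symmetric])
  then obtain g where g [measurable]: "g \<in> borel_measurable borel" and fg: "AE p in cylm e3. f p = g p"
    by (rule cylm_borel_representative)
  \<comment> \<open>Nonnegativity and vanishing beyond \<open>Rc\<close> become pointwise
    properties, while \<open>g\<close> changes only on a null set.\<close>
  define s where "s p = (if fst p < Rc then max 0 (g p) else 0)" for p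
  have "{p \<in> space (borel :: (real \<times> real) measure). fst p < Rc} \<in> sets borel" by measurable
  then have sm [measurable]: "s \<in> borel_measurable borel" unfolding s_def [abs_def] by (intro measurable_If) auto
  have "{p \<in> space (borel :: (real \<times> real) measure). fst p < Rc \<longrightarrow> 0 \<le> g p} \<in> sets borel" by measurable
  then have pred: "Measurable.pred borel (\<lambda>p. fst p < Rc \<longrightarrow> 0 \<le> g p)" by (simp add: pred_def)
  have "AE x in lebesgue. fst (cyl e3 x) < Rc \<longrightarrow> 0 \<le> g (cyl e3 x)"
    using nn AE_cylmD[OF fg] by eventually_elim (simp add: f)
  then have "AE p in cylm e3. fst p < Rc \<longrightarrow> 0 \<le> g p"
    by (simp add: AE_completion_iff AE_cylm_iff[OF pred])
  moreover have "AE p in cylm e3. 0 \<le> fst p" by (rule AE_cylm_fst)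
  ultimately have fs: "AE p in cylm e3. f p = s p"
    using fg
  proof eventually_elim
    case (elim p)
    show ?case
    proof (cases "fst p < Rc")
      case True
      then show ?thesis using elim by (simp add: s_def)
    next
      case False
      then have "\<rho> (vector [fst p, 0, snd p]) = 0"
        using elim(2) by (intro z) (auto simp: cyl_r_def)
      then show ?thesis using False by (simp add: s_def f_def)
    qed
  qed
  have r3: "AE x in lebesgue. \<rho> x = s (cyl e3 x)" using AE_cylmD[OF fs] by (simp add: f)
  have r5: "AE y in lebesgue. lift5 \<rho> y = s (cyl e5 y)"
    using AE_cylmD[OF AE_cylm_lift[OF fs]] by (simp add: lift5_cyl f_def del: snd_cyl)
  have s0: "0 \<le> s p" "Rc \<le> fst p \<Longrightarrow> s p = 0" for p by (auto simp: s_def)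
  note [measurable] = cyl_measurable_lebesgue[OF sm]
  have "integrable lebesgue (\<lambda>x. s (cyl e3 x))"
    using int by (rule integrable_cong_AE_imp) (use r3 in \<open>auto elim: eventually_mono\<close>)
  then have "integrable (cylm e3) s" by (simp add: integral_lebesgue_cylm)
  moreover have "integrable lebesgue (\<lambda>x. s (cyl e3 x) powr \<gamma>)"
    using pow by (rule integrable_cong_AE_imp) (use r3 in \<open>auto simp: abs_of_nonneg[OF s0(1)] elim: eventually_mono\<close>)
  then have "integrable (cylm e3) (\<lambda>p. s p powr \<gamma>)"
    using integral_lebesgue_cylm(1)[of "\<lambda>p. s p powr \<gamma>" e3] by simp
  ultimately have "s \<in> St" using sm s0 unfolding St_def by blast
  then have "repr \<rho> s" using r3 r5 by (simp add: repr_def)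
  then show ?thesis using that repr_integral(1) M by metis
qed

lemma kint_riesz3_finite:
  assumes "s \<in> St"
  shows "kint (riesz 3) (dens e5 s) (dens e5 s) < top" "kint (riesz 1) (dens e3 s) (dens e3 s) < top"
proof -
  \<comment> \<open>With weight 1 finiteness of the sum yields finiteness of both summands; the
    weight at hand may be 0 and would then hide the five-dimensional one.\<close>
  interpret s1: star \<gamma> 1 Rc c5 using \<gamma> Rc c5 lift_measure by unfold_locales auto
  show "kint (riesz 3) (dens e5 s) (dens e5 s) < top" "kint (riesz 1) (dens e3 s) (dens e3 s) < top"
    using s1.BBe_finite[OF assms assms] unfolding s1.BBe_def by (auto simp: ennreal_mult_less_top)
qed

lemma integral_enn2real:
  assumes [measurable]: "u \<in> borel_measurable N" and "(\<integral>\<^sup>+x. u x \<partial>N) < top"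
  shows "integrable N (\<lambda>x. enn2real (u x))" "(LINT x|N. enn2real (u x)) = enn2real (\<integral>\<^sup>+x. u x \<partial>N)"
proof -
  have "AE x in N. u x \<noteq> \<infinity>" using assms by (intro nn_integral_PInf_AE) auto
  then have "AE x in N. ennreal (enn2real (u x)) = u x" by eventually_elim (simp add: top.not_eq_extremum)
  then have *: "(\<integral>\<^sup>+x. ennreal (enn2real (u x)) \<partial>N) = (\<integral>\<^sup>+x. u x \<partial>N)" by (rule nn_integral_cong_AE)
  show "integrable N (\<lambda>x. enn2real (u x))" using assms(2) by (auto simp: integrable_iff_bounded *)
  show "(LINT x|N. enn2real (u x)) = enn2real (\<integral>\<^sup>+x. u x \<partial>N)"
    by (subst integral_eq_nn_integral) (auto simp: *)
qed

text \<open>Holds at every x, including points where the potential is infinite: the Bochner integral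
  and \<open>enn2real\<close> are both 0 there.\<close>

lemma riesz_integral:
  fixes \<sigma> :: "'a::euclidean_space \<Rightarrow> real"
  assumes [measurable]: "\<sigma> \<in> borel_measurable lebesgue" and s: "s \<in> St" and r: "AE y in lebesgue. \<sigma> y = s (cyl e y)"
  shows "(LINT y|lebesgue. \<sigma> y / norm (x - y) ^ l) = enn2real (\<integral>\<^sup>+y. dens e s y * riesz l (x - y) \<partial>lborel)"
proof -
  note [measurable] = cyl_measurable_lebesgue[OF StD(1)[OF s]]
  have [measurable]: "(\<lambda>y. norm (x - y) ^ l) \<in> borel_measurable lebesgue"
    by (intro measurable_completion) simp
  have "(LINT y|lebesgue. \<sigma> y / norm (x - y) ^ l) = (LINT y|lebesgue. s (cyl e y) / norm (x - y) ^ l)"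
    using r by (intro integral_cong_AE) (auto elim: eventually_mono)
  also have "\<dots> = enn2real (\<integral>\<^sup>+y. ennreal (s (cyl e y) / norm (x - y) ^ l) \<partial>lebesgue)"
    using StD(2)[OF s] by (intro integral_eq_nn_integral) auto
  also have "(\<integral>\<^sup>+y. ennreal (s (cyl e y) / norm (x - y) ^ l) \<partial>lebesgue) = (\<integral>\<^sup>+y. dens e s y * riesz l (x - y) \<partial>lborel)"
    using StD(2)[OF s] unfolding nn_integral_completion dens_def riesz_def
    by (intro nn_integral_cong) (simp flip: ennreal_mult add: divide_inverse)
  finally show ?thesis .
qed

text \<open>The negative signs of \<open>G5\<close> and of the source cancel, and the second factor
  \<open>\<beta>\<close> in the energy makes the magnetic term attractive for either sign of
  \<open>\<beta>\<close>: its coefficient is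
  \<open>2 * pi * \<beta>\<^sup>2 / (15 * \<omega>)\<close> with \<omega> the volume of the unit
  ball of \<open>real^5\<close>. Passing to the five-dimensional integral absorbs the factor r^2 and
  produces \<open>c5\<close>, which is why \<open>w\<close> is divided by it.\<close>

lemma repr_energy:
  assumes r: "repr \<rho> s" and weq: "w = 2 * pi * \<beta>\<^sup>2 / (15 * measure lebesgue (ball (0 :: real^5) 1) * c5)"
  shows "energy \<gamma> \<beta> \<rho> = F s"
proof -
  let ?\<omega> = "measure lebesgue (ball (0 :: real^5) 1)"
  have s: "s \<in> St" by (rule reprD(1)[OF r])
  note sm [measurable] = StD(1)[OF s]
  have sc [measurable]: "(\<lambda>x. s (cyl e x)) \<in> borel_measurable borel" for e :: "'a::euclidean_space"
    by (rule measurable_compose[OF cyl_measurable sm])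
  define P1 where "P1 x = (\<integral>\<^sup>+y. dens e3 s y * riesz 1 (x - y) \<partial>lborel)" for x
  define P3 where "P3 x = (\<integral>\<^sup>+y. dens e5 s y * riesz 3 (x - y) \<partial>lborel)" for x
  \<comment> \<open>Reads the potential on one half-plane of \<open>real^5\<close>; by
    \<open>riesz_potential_cyl\<close> this determines it everywhere.\<close>
  define q where "q p = P3 (fst p *\<^sub>R axis 1 1 + snd p *\<^sub>R axis 3 1)" for p :: "real \<times> real"
  have P1m [measurable]: "P1 \<in> borel_measurable borel" unfolding P1_def [abs_def] by measurable
  have P3m [measurable]: "P3 \<in> borel_measurable borel" unfolding P3_def [abs_def] by measurable
  have qm [measurable]: "q \<in> borel_measurable borel"
    unfolding q_def [abs_def]
    by (rule measurable_compose[OF _ P3m]) (intro borel_measurable_continuous_onI continuous_intros)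
  have P3q: "P3 x = q (cyl e5 x)" for x
  proof -
    have *: "cyl e5 x = cyl e5 (fst (cyl e5 x) *\<^sub>R axis 1 1 + snd (cyl e5 x) *\<^sub>R axis 3 1)"
      by (rule cyl_e5_plane[symmetric]) simp
    show ?thesis unfolding q_def P3_def dens_def
      by (rule riesz_potential_cyl[OF * norm_e5]) measurable
  qed
  have grav: "grav_pot \<rho> x = enn2real (P1 x)" for x
    using riesz_integral[OF reprD(4)[OF r] s reprD(2)[OF r], of x 1] by (simp add: grav_pot_def P1_def)
  have mag: "mag_pot \<beta> \<rho> x = (fst (cyl e3 x))\<^sup>2 * (4 * pi * \<beta> / (15 * ?\<omega>) * enn2real (q (cyl e3 x)))" for x
  proof -
    let ?v = "vector [x $ 1, x $ 2, x $ 3, 0, 0] :: real^5"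
    have "chi_e \<beta> \<rho> ?v = (LINT y|lebesgue. 4 * pi * \<beta> / (15 * ?\<omega>) * (lift5 \<rho> y / norm (?v - y) ^ 3))"
      unfolding chi_e_def G5_def by (intro Bochner_Integration.integral_cong) (simp_all add: field_simps)
    also have "\<dots> = 4 * pi * \<beta> / (15 * ?\<omega>) * enn2real (P3 ?v)"
      unfolding integral_mult_right_zero riesz_integral[OF reprD(5)[OF r] s reprD(3)[OF r]] P3_def ..
    finally show ?thesis by (simp add: mag_pot_def P3q cyl_e5_vector cyl_e3)
  qed
  define K1 where "K1 = kint (riesz 1) (dens e3 s) (dens e3 s)"
  define K3 where "K3 = kint (riesz 3) (dens e5 s) (dens e5 s)"
  have fin: "K1 < top" "K3 < top" using kint_riesz3_finite[OF s] by (auto simp: K1_def K3_def)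
  let ?u1 = "\<lambda>x. dens e3 s x * P1 x"
  let ?v3 = "\<lambda>p. ennreal (s p) * ennreal ((fst p)\<^sup>2) * q p"
  let ?u3 = "\<lambda>x. ?v3 (cyl e3 x)"
  have K1: "(\<integral>\<^sup>+x. ?u1 x \<partial>lborel) = K1"
    unfolding K1_def kint_def P1_def
    by (intro nn_integral_cong) (simp add: nn_integral_cmult[symmetric] mult.assoc)
  have v3m: "?v3 \<in> borel_measurable borel" by measurable
  have K3': "K3 = ennreal c5 * (\<integral>\<^sup>+x. ?u3 x \<partial>lborel)"
  proof -
    have "K3 = (\<integral>\<^sup>+x. dens e5 s x * P3 x \<partial>lborel)"
      unfolding K3_def kint_def P3_def
      by (intro nn_integral_cong) (simp add: nn_integral_cmult[symmetric] mult.assoc)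
    also have "\<dots> = (\<integral>\<^sup>+x. ennreal (s (cyl e5 x)) * q (cyl e5 x) \<partial>lborel)"
      by (simp add: P3q dens_def)
    also have "\<dots> = (\<integral>\<^sup>+p. ennreal (s p) * q p \<partial>cylm e5)"
      by (rule nn_integral_cylm[symmetric]) measurable
    also have "\<dots> = (\<integral>\<^sup>+p. ennreal (s p) * q p * ennreal (c5 * fst p ^ 2) \<partial>cylm e3)"
      by (rule nn_integral_lift) measurable
    also have "\<dots> = (\<integral>\<^sup>+p. ennreal c5 * ?v3 p \<partial>cylm e3)"
      using c5 by (intro nn_integral_cong) (simp add: ennreal_mult mult_ac)
    also have "\<dots> = ennreal c5 * (\<integral>\<^sup>+p. ?v3 p \<partial>cylm e3)"
      by (rule nn_integral_cmult) measurable
    also have "(\<integral>\<^sup>+p. ?v3 p \<partial>cylm e3) = (\<integral>\<^sup>+x. ?u3 x \<partial>lborel)"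
      by (rule nn_integral_cylm[OF v3m])
    finally show ?thesis .
  qed
  have fin3: "(\<integral>\<^sup>+x. ?u3 x \<partial>lborel) < top"
    using fin(2) c5 unfolding K3' by (auto simp: ennreal_mult_less_top)
  have u1m: "?u1 \<in> borel_measurable lborel" by measurable
  have u3m: "?u3 \<in> borel_measurable lborel" using measurable_compose[OF cyl_measurable v3m] by simp
  note i1 = integral_enn2real[OF u1m, unfolded K1, OF fin(1)]
  note i3 = integral_enn2real[OF u3m fin3]
  let ?k = "2 * pi * \<beta>\<^sup>2 / (15 * ?\<omega>)"
  let ?f = "\<lambda>x. s (cyl e3 x) powr \<gamma> / (\<gamma> - 1) - 1/2 * enn2real (?u1 x) - ?k * enn2real (?u3 x)"
  have fm: "?f \<in> borel_measurable lborel" using u1m u3m by measurable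
  have i0: "integrable lborel (\<lambda>x. s (cyl e3 x) powr \<gamma>)" "(LINT x|lborel. s (cyl e3 x) powr \<gamma>) = pw s"
  proof -
    have m: "(\<lambda>p. s p powr \<gamma>) \<in> borel_measurable borel" by measurable
    have m': "(\<lambda>x. s (cyl e3 x) powr \<gamma>) \<in> borel_measurable lborel" by measurable
    show "integrable lborel (\<lambda>x. s (cyl e3 x) powr \<gamma>)" "(LINT x|lborel. s (cyl e3 x) powr \<gamma>) = pw s"
      using integral_lebesgue_cylm[OF m, of e3] StD(5)[OF s] integrable_completion[OF m'] integral_completion[OF m']
      by (auto simp: pw_def)
  qed
  have eq: "A_fun \<gamma> (\<rho> x) - 1/2 * \<rho> x * grav_pot \<rho> x - 1/2 * \<beta> * \<rho> x * mag_pot \<beta> \<rho> x = ?f x"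
    if "\<rho> x = s (cyl e3 x)" for x
  proof -
    have "enn2real (?u1 x) = s (cyl e3 x) * enn2real (P1 x)"
      using StD(2)[OF s] by (simp add: dens_def enn2real_mult)
    moreover have "enn2real (?u3 x) = s (cyl e3 x) * (fst (cyl e3 x))\<^sup>2 * enn2real (q (cyl e3 x))"
      using StD(2)[OF s] by (simp add: enn2real_mult)
    ultimately show ?thesis
      unfolding that grav mag A_fun_def pressure_def by (simp add: power2_eq_square)
  qed
  have "energy \<gamma> \<beta> \<rho> = (LINT x|lebesgue. ?f x)"
    unfolding energy_def
  proof (rule integral_cong_AE)
    show ae: "AE x in lebesgue. A_fun \<gamma> (\<rho> x) - 1/2 * \<rho> x * grav_pot \<rho> x - 1/2 * \<beta> * \<rho> x * mag_pot \<beta> \<rho> x = ?f x"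
      using reprD(2)[OF r] by (rule eventually_mono) (rule eq)
    show fl: "?f \<in> borel_measurable lebesgue" by (rule measurable_completion[OF fm])
    show "(\<lambda>x. A_fun \<gamma> (\<rho> x) - 1/2 * \<rho> x * grav_pot \<rho> x - 1/2 * \<beta> * \<rho> x * mag_pot \<beta> \<rho> x) \<in> borel_measurable lebesgue"
      by (rule borel_measurable_AE[OF fl]) (rule eventually_mono[OF ae], rule sym)
  qed
  also have "\<dots> = (LINT x|lborel. ?f x)" by (rule integral_completion[OF fm])
  also have "\<dots> = pw s / (\<gamma> - 1) - 1/2 * enn2real K1 - ?k * enn2real (\<integral>\<^sup>+x. ?u3 x \<partial>lborel)"
    using i0 i1 i3
    by (subst Bochner_Integration.integral_diff, simp, simp)+ simp
  also have "\<dots> = F s"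
  proof -
    have "enn2real (ennreal a * K1 + ennreal w * K3) = a * enn2real K1 + w * enn2real K3" if "0 \<le> a" for a
      using fin w that by (subst enn2real_plus) (auto simp: ennreal_mult_less_top enn2real_mult)
    from this[of "1/2"] have "enn2real (BBe s s) = 1/2 * enn2real K1 + w * enn2real K3"
      unfolding BBe_def K1_def[symmetric] K3_def[symmetric] by linarith
    moreover have "enn2real K3 = c5 * enn2real (\<integral>\<^sup>+x. ?u3 x \<partial>lborel)"
      unfolding K3' using c5 by (simp add: enn2real_mult)
    moreover have "w * (c5 * X) = ?k * X" for X unfolding weq using c5 by simp
    ultimately show ?thesis unfolding F_def BB_def by simp
  qed
  finally show ?thesis .
qed

end

section \<open>Vertical shifts and convergence in the original variables\<close>

lemma AE_lebesgue_translate: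
  fixes c :: "'a::euclidean_space"
  assumes "AE x in lebesgue. P x"
  shows "AE x in lebesgue. P (x + c)"
proof -
  have "AE x in distr lborel borel ((+) c). P x"
    using assms unfolding lborel_distr_plus AE_completion_iff .
  then have "AE x in lborel. P (c + x)" by (rule AE_distrD[rotated]) simp
  then show ?thesis by (simp add: AE_completion_iff add.commute)
qed

context star
begin

lemma shift_repr:
  assumes "repr \<rho> s"
  shows "AE x in lebesgue. \<rho> (x + a *\<^sub>R e3) = shift a s (cyl e3 x)"
  using AE_lebesgue_translate[OF reprD(2)[OF assms], of "a *\<^sub>R e3"]
  by (simp add: cyl_shift shift_def del: snd_cyl)

lemma Lp_space_AE_cyl:
  assumes u: "u \<in> St" and ae: "AE x in lebesgue. \<sigma> x = u (cyl e3 x)"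
  shows "\<sigma> \<in> Lp_space \<gamma>"
proof -
  note [measurable] = StD(1)[OF u] cyl_measurable_lebesgue[OF StD(1)[OF u]]
  have [measurable]: "\<sigma> \<in> borel_measurable lebesgue"
    by (rule borel_measurable_AE[OF cyl_measurable_lebesgue[OF StD(1)[OF u]]]) (use ae in \<open>auto elim: eventually_mono\<close>)
  have "integrable lebesgue (\<lambda>x. u (cyl e3 x) powr \<gamma>)"
    using StD(5)[OF u] integral_lebesgue_cylm(1)[of "\<lambda>p. u p powr \<gamma>" e3] by simp
  then have "integrable lebesgue (\<lambda>x. \<bar>\<sigma> x\<bar> powr \<gamma>)"
    by (rule integrable_cong_AE_imp) (use ae in \<open>auto simp: abs_of_nonneg[OF StD(2)[OF u]] elim: eventually_mono\<close>)
  then show ?thesis by (simp add: Lp_space_def)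
qed

lemma integral_AE_cyl:
  assumes u: "u \<in> St" and ae: "AE x in lebesgue. \<sigma> x = u (cyl e3 x)" and h [measurable]: "h \<in> borel_measurable lebesgue"
  shows "(LINT x|lebesgue. \<sigma> x * h x) = (LINT x|lebesgue. u (cyl e3 x) * h x)"
proof -
  note [measurable] = cyl_measurable_lebesgue[OF StD(1)[OF u]]
  have [measurable]: "\<sigma> \<in> borel_measurable lebesgue"
    using Lp_space_AE_cyl[OF u ae] by (simp add: Lp_space_def)
  show ?thesis using ae by (intro integral_cong_AE) (auto elim: eventually_mono)
qed

text \<open>Balls about points of the axis and slabs are comparable inside the cylinder. The two
  bounds translate between the mass condition of \<open>shifted_limit\<close> and the slabs of
  \<open>tight\<close>, one in each direction.\<close>

lemma ball_mass:
  assumes r: "repr \<rho> s"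
  shows "(LINT x : ball (a *\<^sub>R e3) R|lebesgue. \<rho> x) \<le> ms (cut (slab a R) s)"
    and "0 \<le> R \<Longrightarrow> ms (cut (slab a R) s) \<le> (LINT x : ball (a *\<^sub>R e3) (Rc + R + 1)|lebesgue. \<rho> x)"
proof -
  have s: "s \<in> St" by (rule reprD(1)[OF r])
  have si: "integrable lebesgue (\<lambda>x. s (cyl e3 x))"
    using StD(4)[OF s] by (simp add: integral_lebesgue_cylm(1)[OF StD(1)[OF s]])
  have c: "cut (slab a R) s \<in> St" by (rule St_cut[OF s]) simp
  have ci: "integrable lebesgue (\<lambda>x. cut (slab a R) s (cyl e3 x))"
    "ms (cut (slab a R) s) = (LINT x|lebesgue. cut (slab a R) s (cyl e3 x))"
    using StD(4)[OF c] integral_lebesgue_cylm[OF StD(1)[OF c], of e3] by (auto simp: ms_def)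
  have b: "ball x r \<in> sets lebesgue" for x :: "real^3" and r by simp
  have bi: "integrable lebesgue (\<lambda>x. s (cyl e3 x) * indicator (ball (a *\<^sub>R e3) r) x)" for r
    using integrable_mult_indicator[OF b[of "a *\<^sub>R e3" r] si] by (simp add: mult.commute)
  have int: "(LINT x : ball (a *\<^sub>R e3) r|lebesgue. \<rho> x) = (LINT x|lebesgue. s (cyl e3 x) * indicator (ball (a *\<^sub>R e3) r) x)" for r
  proof -
    let ?B = "ball (a *\<^sub>R e3) r"
    have eq: "(\<lambda>x. indicator ?B x *\<^sub>R \<rho> x) = (\<lambda>x. \<rho> x * indicator ?B x)" by (rule ext) simp
    have "indicator ?B \<in> borel_measurable lebesgue" using b by (rule borel_measurable_indicator)
    then show ?thesis unfolding set_lebesgue_integral_def eq by (rule integral_AE_cyl[OF s reprD(2)[OF r]])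
  qed
  have d: "(dist (a *\<^sub>R e3) x)\<^sup>2 = (fst (cyl e3 x))\<^sup>2 + (snd (cyl e3 x) - a)\<^sup>2" for x :: "real^3"
    using norm_cyl[OF norm_e3, of "x + (- a) *\<^sub>R e3"] cyl_shift[OF norm_e3, of x "- a"]
    by (simp add: dist_norm norm_minus_commute del: snd_cyl)
  show "(LINT x : ball (a *\<^sub>R e3) R|lebesgue. \<rho> x) \<le> ms (cut (slab a R) s)"
    unfolding int ci(2)
  proof (intro integral_mono bi ci(1))
    fix x :: "real^3"
    have "\<bar>snd (cyl e3 x) - a\<bar> \<le> dist (a *\<^sub>R e3) x"
      by (rule power2_le_imp_le) (simp_all add: d del: snd_cyl)
    then show "s (cyl e3 x) * indicator (ball (a *\<^sub>R e3) R) x \<le> cut (slab a R) s (cyl e3 x)"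
      using StD(2)[OF s] by (simp add: cut_def indicator_def del: snd_cyl)
  qed
  assume R: "0 \<le> R"
  show "ms (cut (slab a R) s) \<le> (LINT x : ball (a *\<^sub>R e3) (Rc + R + 1)|lebesgue. \<rho> x)"
    unfolding int ci(2)
  proof (intro integral_mono bi ci(1))
    fix x :: "real^3"
    show "cut (slab a R) s (cyl e3 x) \<le> s (cyl e3 x) * indicator (ball (a *\<^sub>R e3) (Rc + R + 1)) x"
    proof (cases "snd (cyl e3 x) \<in> slab a R \<and> fst (cyl e3 x) < Rc")
      case True
      have "(dist (a *\<^sub>R e3) x)\<^sup>2 \<le> (fst (cyl e3 x) + \<bar>snd (cyl e3 x) - a\<bar>)\<^sup>2"
        unfolding d power2_sum power2_abs by simp
      then have "dist (a *\<^sub>R e3) x \<le> fst (cyl e3 x) + \<bar>snd (cyl e3 x) - a\<bar>"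
        by (rule power2_le_imp_le) simp
      then have "x \<in> ball (a *\<^sub>R e3) (Rc + R + 1)" using True by (simp del: snd_cyl)
      then show ?thesis using StD(2)[OF s] by (simp add: cut_def del: snd_cyl mem_ball)
    next
      case False
      then have "cut (slab a R) s (cyl e3 x) = 0"
        using StD(3)[OF s, of "cyl e3 x"] by (auto simp: cut_def not_less simp del: snd_cyl)
      then show ?thesis using StD(2)[OF s] by simp
    qed
  qed
qed

lemma cut_slab_shift: "cut (slab 0 R) (shift a s) = shift a (cut (slab a R) s)"
  by (rule ext) (simp add: cut_def shift_def)

lemma ms_cut_shift: "s \<in> St \<Longrightarrow> ms (cut (slab 0 R) (shift a s)) = ms (cut (slab a R) s)"
  unfolding cut_slab_shift by (intro ms_shift St_cut) auto

text \<open>Nonnegative bounded Borel test functions are averaged to the half-plane, signed ones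
  become nonnegative by adding a constant, and unbounded ones are reached by
  \<open>integral_conv_Lq\<close>. A Lebesgue measurable \<open>h\<close> is exchanged for a Borel
  one.\<close>

lemma Lp_weak_limit:
  assumes u: "\<And>i::nat. u i \<in> St" "\<And>i. ms (u i) = M" "\<And>i. pw (u i) \<le> P" and t: "t \<in> St" "ms t = M"
    and conv: "\<And>S. S \<in> sets borel \<Longrightarrow>
      (\<lambda>i. LINT p|cylm e3. u i p * indicator S p) \<longlonglongrightarrow> (LINT p|cylm e3. t p * indicator S p)"
    and h: "h \<in> Lp_space (\<gamma> / (\<gamma> - 1))"
  shows "(\<lambda>i. LINT x|lebesgue. u i (cyl e3 x) * h x) \<longlonglongrightarrow> (LINT x|lebesgue. t (cyl e3 x) * h x)"
proof -
  have M: "0 \<le> M" using ms_nonneg[OF t(1)] t(2) by simp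
  have sm: "(\<lambda>x. s (cyl e3 x)) \<in> borel_measurable lborel" if "s \<in> St" for s
    using measurable_compose[OF cyl_measurable StD(1)[OF that]] by simp
  have si: "integrable lborel (\<lambda>x. s (cyl e3 x))" "(LINT x|lborel. s (cyl e3 x)) = ms s" if "s \<in> St" for s
    using integral_lebesgue_cylm[OF StD(1)[OF that], of e3] StD(4)[OF that]
      integrable_completion[OF sm[OF that]] integral_completion[OF sm[OF that]] by (auto simp: ms_def)
  have sp: "integrable lborel (\<lambda>x. s (cyl e3 x) powr \<gamma>)" "(LINT x|lborel. s (cyl e3 x) powr \<gamma>) = pw s" if "s \<in> St" for s
  proof -
    note [measurable] = StD(1)[OF that] sm[OF that]
    have m: "(\<lambda>p. s p powr \<gamma>) \<in> borel_measurable borel" by measurable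
    have m': "(\<lambda>x. s (cyl e3 x) powr \<gamma>) \<in> borel_measurable lborel" by measurable
    show "integrable lborel (\<lambda>x. s (cyl e3 x) powr \<gamma>)" "(LINT x|lborel. s (cyl e3 x) powr \<gamma>) = pw s"
      using integral_lebesgue_cylm[OF m, of e3] StD(5)[OF that] integrable_completion[OF m'] integral_completion[OF m']
      by (auto simp: pw_def)
  qed
  have gi: "integrable lborel (\<lambda>x. s (cyl e3 x) * g x)"
    if "s \<in> St" "g \<in> borel_measurable lborel" "\<And>x. \<bar>g x\<bar> \<le> B" for s g B
  proof (rule Bochner_Integration.integrable_bound)
    show "integrable lborel (\<lambda>x. B * s (cyl e3 x))" using si(1)[OF that(1)] by simp
    show "(\<lambda>x. s (cyl e3 x) * g x) \<in> borel_measurable lborel" using sm[OF that(1)] that(2) by measurable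
    show "AE x in lborel. norm (s (cyl e3 x) * g x) \<le> norm (B * s (cyl e3 x))"
    proof (rule AE_I2)
      fix x
      have "\<bar>g x\<bar> \<le> \<bar>B\<bar>" using that(3)[of x] by linarith
      then show "norm (s (cyl e3 x) * g x) \<le> norm (B * s (cyl e3 x))"
        by (simp add: abs_mult mult.commute mult_right_mono)
    qed
  qed
  have pos: "(\<lambda>i. LINT x|lborel. u i (cyl e3 x) * g x) \<longlonglongrightarrow> (LINT x|lborel. t (cyl e3 x) * g x)"
    if g: "g \<in> borel_measurable borel" "\<And>x. 0 \<le> g x" "\<And>x. g x \<le> H" for g H
  proof (rule cyl_average[OF norm_e3 g])
    fix k :: "real \<times> real \<Rightarrow> real"
    assume k: "k \<in> borel_measurable borel" "\<And>p. 0 \<le> k p" "\<And>p. k p \<le> H"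
      "\<And>s. s \<in> borel_measurable borel \<Longrightarrow>
        (\<integral>\<^sup>+x. s (cyl e3 x) * ennreal (g x) \<partial>lborel) = (\<integral>\<^sup>+p. s p * ennreal (k p) \<partial>cylm e3)"
    have eq: "(LINT x|lborel. s (cyl e3 x) * g x) = (LINT p|cylm e3. s p * k p)" if s: "s \<in> St" for s
    proof -
      note [measurable] = StD(1)[OF s] sm[OF s] g(1) k(1)
      have "(LINT x|lborel. s (cyl e3 x) * g x) = enn2real (\<integral>\<^sup>+x. ennreal (s (cyl e3 x) * g x) \<partial>lborel)"
        using StD(2)[OF s] g(2) by (intro integral_eq_nn_integral) auto
      also have "(\<integral>\<^sup>+x. ennreal (s (cyl e3 x) * g x) \<partial>lborel) = (\<integral>\<^sup>+x. ennreal (s (cyl e3 x)) * ennreal (g x) \<partial>lborel)"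
        using StD(2)[OF s] g(2) by (simp add: ennreal_mult)
      also have "\<dots> = (\<integral>\<^sup>+p. ennreal (s p) * ennreal (k p) \<partial>cylm e3)"
        by (rule k(4)) measurable
      also have "\<dots> = (\<integral>\<^sup>+p. ennreal (s p * k p) \<partial>cylm e3)"
        using StD(2)[OF s] k(2) by (simp add: ennreal_mult)
      also have "enn2real \<dots> = (LINT p|cylm e3. s p * k p)"
        using StD(2)[OF s] k(2) by (intro integral_eq_nn_integral[symmetric]) auto
      finally show ?thesis .
    qed
    have "(\<lambda>i. LINT p|cylm e3. u i p * k p) \<longlonglongrightarrow> (LINT p|cylm e3. t p * k p)"
    proof (rule integral_conv_bounded[where M=M and B=H])
      show "integrable (cylm e3) (u i)" "0 \<le> u i x" "(LINT x|cylm e3. u i x) \<le> M" for i x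
        using StD[OF u(1)] u(2)[of i] by (auto simp: ms_def)
      show "integrable (cylm e3) t" "0 \<le> t x" "(LINT x|cylm e3. t x) \<le> M" for x
        using StD[OF t(1)] t(2) by (auto simp: ms_def)
      show "k \<in> borel_measurable (cylm e3)" using k(1) by simp
      show "\<bar>k x\<bar> \<le> H" for x using k(2,3)[of x] by linarith
    qed (simp add: conv)
    then show "(\<lambda>i. LINT x|lborel. u i (cyl e3 x) * g x) \<longlonglongrightarrow> (LINT x|lborel. t (cyl e3 x) * g x)" by (simp only: eq[OF u(1)] eq[OF t(1)])
  qed
  have bdd: "(\<lambda>i. LINT x|lborel. u i (cyl e3 x) * g x) \<longlonglongrightarrow> (LINT x|lborel. t (cyl e3 x) * g x)"
    if g: "g \<in> borel_measurable lborel" "\<And>x. \<bar>g x\<bar> \<le> B" for g B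
  proof -
    \<comment> \<open>All densities have the same mass \<open>M\<close>, so adding \<open>B\<close>
      to the test function changes every integral by the same amount \<open>B * M\<close>.\<close>
    have gB: "(LINT x|lborel. s (cyl e3 x) * (g x + B)) - B * M = (LINT x|lborel. s (cyl e3 x) * g x)"
      if "s \<in> St" "ms s = M" for s
    proof -
      have "(LINT x|lborel. s (cyl e3 x) * (g x + B)) = (LINT x|lborel. s (cyl e3 x) * g x + B * s (cyl e3 x))"
        by (intro Bochner_Integration.integral_cong) (simp_all add: algebra_simps)
      also have "\<dots> = (LINT x|lborel. s (cyl e3 x) * g x) + B * M"
        using gi[OF that(1) g] si[OF that(1)] that(2) by simp
      finally show ?thesis by simp
    qed
    have g': "(\<lambda>x. g x + B) \<in> borel_measurable borel" using g(1) by simp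
    have n: "0 \<le> g x + B" "g x + B \<le> 2 * B" for x using g(2)[of x] by linarith+
    show ?thesis
      using tendsto_diff[OF pos[OF g' n] tendsto_const[of "B * M"]]
      unfolding gB[OF u(1,2)] gB[OF t] .
  qed
  have hm: "h \<in> borel_measurable lebesgue" and hq: "integrable lebesgue (\<lambda>x. \<bar>h x\<bar> powr (\<gamma> / (\<gamma> - 1)))"
    using h by (auto simp: Lp_space_def)
  obtain h' where h' [measurable]: "h' \<in> borel_measurable lborel" and hh: "AE x in lborel. h x = h' x"
    using completion_ex_borel_measurable_real[OF hm] by blast
  have hh': "AE x in lebesgue. h x = h' x" using hh by (rule AE_completion)
  have hl [measurable]: "h' \<in> borel_measurable lebesgue" by (rule measurable_completion[OF h'])
  have "integrable lebesgue (\<lambda>x. \<bar>h' x\<bar> powr (\<gamma> / (\<gamma> - 1)))"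
    using hq by (rule integrable_cong_AE_imp) (use hh' in \<open>auto elim: eventually_mono\<close>)
  then have hq': "integrable lborel (\<lambda>x. \<bar>h' x\<bar> powr (\<gamma> / (\<gamma> - 1)))"
    by (subst (asm) integrable_completion) auto
  have eq: "(LINT x|lebesgue. s (cyl e3 x) * h x) = (LINT x|lborel. s (cyl e3 x) * h' x)" if "s \<in> St" for s
  proof -
    note [measurable] = cyl_measurable_lebesgue[OF StD(1)[OF that]] hm sm[OF that]
    have "(LINT x|lebesgue. s (cyl e3 x) * h x) = (LINT x|lebesgue. s (cyl e3 x) * h' x)"
      using hh' by (intro integral_cong_AE) (auto elim: eventually_mono)
    also have "\<dots> = (LINT x|lborel. s (cyl e3 x) * h' x)"
      by (rule integral_completion) measurable
    finally show ?thesis .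
  qed
  have \<gamma>1: "1 < \<gamma>" using \<gamma> by simp
  have "(\<lambda>i. LINT x|lborel. u i (cyl e3 x) * h' x) \<longlonglongrightarrow> (LINT x|lborel. t (cyl e3 x) * h' x)"
  proof (rule integral_conv_Lq[OF \<gamma>1, where P="max P (pw t)"])
    show "(LINT x|lborel. u i (cyl e3 x) powr \<gamma>) \<le> max P (pw t)" for i
      using u(3)[of i] by (simp add: sp(2)[OF u(1)])
    show "(LINT x|lborel. t (cyl e3 x) powr \<gamma>) \<le> max P (pw t)" by (simp add: sp(2)[OF t(1)])
  qed (use StD(2)[OF u(1)] StD(2)[OF t(1)] sm[OF u(1)] sm[OF t(1)] sp(1)[OF u(1)] sp(1)[OF t(1)] bdd h' hq' in blast)+
  then show ?thesis by (simp only: eq[OF u(1)] eq[OF t(1)])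
qed

text \<open>A test function of \<open>wconv\<close> yields an element of the dual space once it is
  restricted to a box of finite measure.\<close>

lemma weak_conv_Lp_wconv:
  assumes weak: "weak_conv_Lp \<gamma> \<sigma> \<tau>" and u: "\<And>i. u i \<in> St" and t: "t \<in> St"
    and ae: "\<And>i. AE x in lebesgue. \<sigma> i x = u i (cyl e3 x)" "AE x in lebesgue. \<tau> x = t (cyl e3 x)"
  shows "wconv u t"
  unfolding wconv_def
proof (intro allI impI)
  fix g :: "real \<times> real \<Rightarrow> real" and B R :: real
  assume g [measurable]: "g \<in> borel_measurable borel" and gB: "\<forall>p. 0 \<le> g p \<and> g p \<le> B"
    and gR: "\<forall>p. R < \<bar>snd p\<bar> \<longrightarrow> g p = 0"
  let ?X = "{..<Rc} \<times> {- R..R}"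
  let ?q = "\<gamma> / (\<gamma> - 1)"
  have X [measurable]: "?X \<in> sets borel" by (intro borel_Times) auto
  \<comment> \<open>The densities vanish beyond \<open>Rc\<close>, so they do not see this cut;
    \<open>g\<close> alone need not be integrable over all radii.\<close>
  define k where "k p = g p * indicator ?X p" for p
  have km [measurable]: "k \<in> borel_measurable borel" unfolding k_def [abs_def] by measurable
  have "integrable (cylm e3) (\<lambda>p. \<bar>k p\<bar> powr ?q)"
  proof (rule Bochner_Integration.integrable_bound)
    show "integrable (cylm e3) (\<lambda>p. B powr ?q * indicator ?X p)"
      using cylm_bounded_finite[OF norm_e3, of Rc R] by (intro integrable_mult_right integrable_real_indicator) auto
    show "AE p in cylm e3. norm (\<bar>k p\<bar> powr ?q) \<le> norm (B powr ?q * indicator ?X p)"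
    proof (rule AE_I2)
      fix p
      have "g p powr ?q \<le> B powr ?q" using gB[rule_format, of p] \<gamma> by (intro powr_mono2) auto
      then show "norm (\<bar>k p\<bar> powr ?q) \<le> norm (B powr ?q * indicator ?X p)"
        using gB[rule_format, of p] unfolding k_def by (cases "p \<in> ?X") (simp_all del: mem_Sigma_iff)
    qed
  qed measurable
  then have "integrable lebesgue (\<lambda>x. \<bar>k (cyl e3 x)\<bar> powr ?q)"
    using integral_lebesgue_cylm(1)[of "\<lambda>p. \<bar>k p\<bar> powr ?q" e3] by simp
  then have kL: "(\<lambda>x. k (cyl e3 x)) \<in> Lp_space ?q"
    using cyl_measurable_lebesgue[OF km] by (simp add: Lp_space_def)
  have lim: "(\<lambda>i. LINT x|lebesgue. \<sigma> i x * k (cyl e3 x)) \<longlonglongrightarrow> (LINT x|lebesgue. \<tau> x * k (cyl e3 x))"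
    using weak kL unfolding weak_conv_Lp_def by (elim conjE) (erule bspec)
  have eq: "(LINT x|lebesgue. \<kappa> x * k (cyl e3 x)) = (LINT p|cylm e3. s p * g p)"
    if s: "s \<in> St" and sa: "AE x in lebesgue. \<kappa> x = s (cyl e3 x)" for s \<kappa>
  proof -
    have m: "(\<lambda>p. s p * k p) \<in> borel_measurable borel" using StD(1)[OF s] by measurable
    have "(LINT x|lebesgue. \<kappa> x * k (cyl e3 x)) = (LINT x|lebesgue. s (cyl e3 x) * k (cyl e3 x))"
      by (rule integral_AE_cyl[OF s sa cyl_measurable_lebesgue[OF km]])
    also have "\<dots> = (LINT p|cylm e3. s p * k p)" by (rule integral_lebesgue_cylm(2)[OF m])
    also have "\<dots> = (LINT p|cylm e3. s p * g p)"
    proof (intro Bochner_Integration.integral_cong refl)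
      fix p
      show "s p * k p = s p * g p"
      proof (cases "p \<in> ?X")
        case False
        then have "Rc \<le> fst p \<or> R < \<bar>snd p\<bar>" by (auto simp: mem_Times_iff)
        then show ?thesis using StD(3)[OF s, of p] gR[rule_format, of p] by (auto simp: k_def)
      qed (simp add: k_def)
    qed
    finally show ?thesis .
  qed
  show "(\<lambda>i. LINT p|cylm e3. u i p * g p) \<longlonglongrightarrow> (LINT p|cylm e3. t p * g p)"
    using lim unfolding eq[OF u ae(1)] eq[OF t ae(2)] .
qed

lemma energy_bounded_pw_bounded:
  assumes s: "\<And>i::nat. s i \<in> St" "\<And>i. ms (s i) = M" and lim: "(\<lambda>i. F (s i)) \<longlonglongrightarrow> h"
  obtains P where "\<And>i. pw (s i) \<le> P"
proof -
  have M: "0 \<le> M" using ms_nonneg[OF s(1)] s(2) by metis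
  obtain C where C: "\<And>u. u \<in> St \<Longrightarrow> ms u \<le> M \<Longrightarrow> pw u / (2 * (\<gamma> - 1)) - C \<le> F u"
    using coercive[OF M] by metis
  have "Bseq (\<lambda>i. F (s i))" using lim by (intro convergent_imp_Bseq) (auto simp: convergent_def)
  then obtain K where K: "\<And>i. norm (F (s i)) \<le> K" unfolding Bseq_def by auto
  have "pw (s i) \<le> (K + C) * (2 * (\<gamma> - 1))" for i
  proof -
    have "pw (s i) / (2 * (\<gamma> - 1)) \<le> K + C" using C[OF s(1)[of i]] s(2)[of i] K[of i] by simp
    then show ?thesis using \<gamma> by (subst (asm) pos_divide_le_eq) auto
  qed
  then show ?thesis by (rule that)
qed

end

theorem theorem3p3:
  fixes M \<beta> \<gamma> R_M Rc :: real
  assumes "M > 0" and "\<gamma> > 2"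
    and "star_radius \<gamma> M R_M" and "Rc \<ge> R_M"
  shows "((INF \<rho>\<in>W_star \<gamma> M Rc. ereal (energy \<gamma> \<beta> \<rho>)) < 0 \<and>
          (\<exists>C1>0. \<exists>C2>0. \<forall>\<rho>\<in>W_star \<gamma> M Rc.
             energy \<gamma> \<beta> \<rho> \<ge> C1 * (LINT x|lebesgue. \<rho> x powr \<gamma>) - C2))
       \<and> (\<forall>\<rho>. minimizing_seq (energy \<gamma> \<beta>) (W_star \<gamma> M Rc) \<rho> \<longrightarrow>
            (\<exists>a \<phi>. \<exists>\<tau>\<in>W_star \<gamma> M Rc. strict_mono (\<phi> :: nat \<Rightarrow> nat) \<and>
               shifted_limit \<gamma> M (\<rho> \<circ> \<phi>) a \<tau>))
       \<and> (\<forall>\<rho> a \<phi>. \<forall>\<tau>\<in>W_star \<gamma> M Rc.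
            minimizing_seq (energy \<gamma> \<beta>) (W_star \<gamma> M Rc) \<rho> \<and>
            strict_mono (\<phi> :: nat \<Rightarrow> nat) \<and> shifted_limit \<gamma> M (\<rho> \<circ> \<phi>) a \<tau> \<longrightarrow>
            is_arg_min (energy \<gamma> \<beta>) (\<lambda>\<sigma>. \<sigma> \<in> W_star \<gamma> M Rc) \<tau>)"
proof -
  have e: "e3 \<in> Basis" "e5 \<in> Basis" by (simp_all add: axis_in_Basis_iff)
  obtain c5 where c5: "c5 > 0" and "cylm e5 = density (cylm e3) (\<lambda>p. ennreal (c5 * fst p ^ (DIM(real^5) - DIM(real^3))))"
    by (rule cylm_dim_change[OF e]) auto
  then have lift: "cylm e5 = density (cylm e3) (\<lambda>p. ennreal (c5 * fst p ^ 2))" by simp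
  let ?\<omega> = "measure lebesgue (ball (0 :: real^5) 1)"
  \<comment> \<open>The value required by \<open>repr_energy\<close>: the magnetic coefficient
    divided by the factor \<open>c5\<close> of the lift.\<close>
  define w where weq: "w = 2 * pi * \<beta>\<^sup>2 / (15 * ?\<omega> * c5)"
  have "0 \<le> w" using c5 unfolding weq by (intro divide_nonneg_nonneg mult_nonneg_nonneg) auto
  moreover have "0 < Rc" using assms(3,4) unfolding star_radius_def by linarith
  ultimately interpret star \<gamma> w Rc c5
    using assms(2) c5 lift by unfold_locales auto
  let ?W = "W_star \<gamma> M Rc"
  let ?E = "energy \<gamma> \<beta>"
  note en = repr_energy[OF _ weq]
  have M: "0 \<le> M" using assms(1) by simp
  obtain C where C: "0 < C" "\<And>s. s \<in> St \<Longrightarrow> ms s \<le> M \<Longrightarrow> pw s / (2 * (\<gamma> - 1)) - C \<le> F s"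
    by (rule coercive[OF M]) blast
  obtain b where b: "b \<in> St" "ms b = M" "F b < 0" by (rule negative_block[OF assms(1)])
  have W: "(\<lambda>x. s (cyl e3 x)) \<in> ?W" "?E (\<lambda>x. s (cyl e3 x)) = F s" if "s \<in> St" "ms s = M" for s
    using W_star_cyl[OF that(1)] en[OF repr_cyl[OF that(1)]] that(2) by auto
  have coer: "?E \<rho> \<ge> 1 / (2 * (\<gamma> - 1)) * (LINT x|lebesgue. \<rho> x powr \<gamma>) - C" if \<rho>: "\<rho> \<in> ?W" for \<rho>
  proof -
    obtain s where s: "repr \<rho> s" "ms s = M" by (rule W_star_repr[OF \<rho>])
    show ?thesis using C(2)[OF reprD(1)[OF s(1)]] s(2) en[OF s(1)] repr_integral(2)[OF s(1)] by simp
  qed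
  have pwnn: "0 \<le> (LINT x|lebesgue. \<rho> x powr \<gamma>)" for \<rho> :: "real^3 \<Rightarrow> real"
    by (rule Bochner_Integration.integral_nonneg) simp
  have lower: "- C \<le> ?E \<rho>" if "\<rho> \<in> ?W" for \<rho>
  proof -
    have "0 \<le> 1 / (2 * (\<gamma> - 1)) * (LINT x|lebesgue. \<rho> x powr \<gamma>)"
      using pwnn[of \<rho>] assms(2) by (intro mult_nonneg_nonneg) auto
    then show ?thesis using coer[OF that] by linarith
  qed
  let ?I = "INF \<rho>\<in>?W. ereal (?E \<rho>)"
  have up: "?I \<le> ereal (F b)" using INF_lower[OF W(1)[OF b(1,2)], of "\<lambda>\<rho>. ereal (?E \<rho>)"] W(2)[OF b(1,2)] by simp
  have "ereal (- C) \<le> ?I" by (rule INF_greatest) (use lower in simp)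
  \<comment> \<open>Coercivity and the negative block make the infimum a real number, as the
    tightness argument requires for its target \<open>h\<close>.\<close>
  with up obtain h where h: "?I = ereal h" by (cases ?I) auto
  have hF: "h \<le> F u" if "u \<in> St" "ms u = M" for u
    using INF_lower[OF W(1)[OF that], of "\<lambda>\<rho>. ereal (?E \<rho>)"] W(2)[OF that] unfolding h by simp
  have seq: "\<exists>s. (\<forall>i. repr (\<rho> i) (s i) \<and> ms (s i) = M) \<and> (\<lambda>i. F (s i)) \<longlonglongrightarrow> h"
    if "minimizing_seq ?E ?W \<rho>" for \<rho>
  proof -
    have \<rho>: "\<And>i. \<rho> i \<in> ?W" and lim: "(\<lambda>i. ereal (?E (\<rho> i))) \<longlonglongrightarrow> ereal h"
      using that unfolding minimizing_seq_def h by blast+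
    have "\<exists>s. repr (\<rho> i) s \<and> ms s = M" for i using W_star_repr[OF \<rho>] by metis
    then obtain s where s: "\<And>i. repr (\<rho> i) (s i)" "\<And>i. ms (s i) = M" by metis
    have "(\<lambda>i. F (s i)) \<longlonglongrightarrow> h" using lim by (simp add: en[OF s(1)])
    with s show ?thesis by blast
  qed
  show ?thesis
  proof (intro conjI allI ballI impI)
    show "?I < 0" using up b(3) by (simp add: order_le_less_trans)
    show "\<exists>C1>0. \<exists>C2>0. \<forall>\<rho>\<in>?W. ?E \<rho> \<ge> C1 * (LINT x|lebesgue. \<rho> x powr \<gamma>) - C2"
      using coer C(1) assms(2) by (intro exI[of _ "1 / (2 * (\<gamma> - 1))"] exI[of _ C] conjI ballI) auto
  next
    fix \<rho> assume "minimizing_seq ?E ?W \<rho>"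
    then obtain s where s: "\<And>i. repr (\<rho> i) (s i)" "\<And>i. ms (s i) = M" and lim: "(\<lambda>i. F (s i)) \<longlonglongrightarrow> h"
      using seq by blast
    note sSt = reprD(1)[OF s(1)]
    obtain P where P: "\<And>i. pw (s i) \<le> P" using energy_bounded_pw_bounded[OF sSt s(2) lim] by blast
    have "\<exists>(\<phi> :: nat \<Rightarrow> nat) (a :: nat \<Rightarrow> real). strict_mono \<phi> \<and>
      (\<forall>\<epsilon>>0. \<exists>R. \<forall>i. M - \<epsilon> \<le> ms (cut (slab (a i) R) (s (\<phi> i))))"
    proof (rule minimizing_tight[OF hF assms(1) sSt s(2) lim], goal_cases)
      case (3 \<phi> a)
      then show ?case by (intro exI[of _ \<phi>] exI[of _ a] conjI allI impI)
    qed
    then obtain \<phi> :: "nat \<Rightarrow> nat" and a :: "nat \<Rightarrow> real" where \<phi>: "strict_mono \<phi>"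
      and tight: "\<And>\<epsilon>. 0 < \<epsilon> \<Longrightarrow> \<exists>R. \<forall>i. M - \<epsilon> \<le> ms (cut (slab (a i) R) (s (\<phi> i)))"
      by blast
    \<comment> \<open>Recentred, so that the slabs carrying almost all mass stand at height
      0.\<close>
    define u where "u i = shift (a i) (s (\<phi> i))" for i
    have u: "u i \<in> St" "ms (u i) = M" "pw (u i) \<le> P" for i
      unfolding u_def using St_shift[OF sSt] ms_shift[OF sSt] pw_shift[OF sSt] s(2) P by auto
    have ut: "tight u"
      unfolding tight_def u(2) unfolding u_def ms_cut_shift[OF sSt] using tight by blast
    obtain \<psi> :: "nat \<Rightarrow> nat" and t where \<psi>: "strict_mono \<psi>" and t: "t \<in> St" "ms t = M"
      and conv: "\<And>S. S \<in> sets borel \<Longrightarrow>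
        (\<lambda>i. LINT p|cylm e3. u (\<psi> i) p * indicator S p) \<longlonglongrightarrow> (LINT p|cylm e3. t p * indicator S p)"
      by (rule St_compact[OF u ut]) blast
    let ?\<tau> = "\<lambda>x. t (cyl e3 x)"
    have ae: "AE x in lebesgue. \<rho> (\<phi> (\<psi> i)) (x + a (\<psi> i) *\<^sub>R e3) = u (\<psi> i) (cyl e3 x)" for i
      unfolding u_def by (rule shift_repr[OF s(1)])
    have "shifted_limit \<gamma> M (\<rho> \<circ> (\<phi> \<circ> \<psi>)) (a \<circ> \<psi>) ?\<tau>"
      unfolding shifted_limit_def
    proof (intro conjI allI impI)
      fix \<epsilon> :: real assume "0 < \<epsilon>"
      then obtain R where R: "\<And>i. M - \<epsilon> \<le> ms (cut (slab (a i) R) (s (\<phi> i)))" using tight by blast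
      \<comment> \<open>The radius obtained from tightness may be negative, which the maximum
        repairs; the other summands turn a slab into a ball that contains its part of the
        cylinder.\<close>
      let ?R = "Rc + max R 0 + 1"
      have "M - \<epsilon> \<le> (LINT x : ball ((a \<circ> \<psi>) i *\<^sub>R e3) ?R|lebesgue. (\<rho> \<circ> (\<phi> \<circ> \<psi>)) i x)" for i
      proof -
        have "M - \<epsilon> \<le> ms (cut (slab (a (\<psi> i)) R) (s (\<phi> (\<psi> i))))" by (rule R)
        also have "\<dots> \<le> ms (cut (slab (a (\<psi> i)) (max R 0)) (s (\<phi> (\<psi> i))))"
          by (intro ms_cut_mono sSt) auto
        also have "\<dots> \<le> (LINT x : ball (a (\<psi> i) *\<^sub>R e3) ?R|lebesgue. \<rho> (\<phi> (\<psi> i)) x)"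
          by (rule ball_mass(2)[OF s(1)]) simp
        finally show ?thesis by simp
      qed
      moreover have "0 < ?R" using Rc by simp
      ultimately show "\<exists>R>0. \<forall>i. M - \<epsilon> \<le> (LINT x : ball ((a \<circ> \<psi>) i *\<^sub>R e3) R|lebesgue. (\<rho> \<circ> (\<phi> \<circ> \<psi>)) i x)"
        by blast
    next
      show "weak_conv_Lp \<gamma> (\<lambda>i x. (\<rho> \<circ> (\<phi> \<circ> \<psi>)) i (x + (a \<circ> \<psi>) i *\<^sub>R e3)) ?\<tau>"
        unfolding weak_conv_Lp_def comp_def
      proof (intro conjI allI ballI)
        show "(\<lambda>x. \<rho> (\<phi> (\<psi> i)) (x + a (\<psi> i) *\<^sub>R e3)) \<in> Lp_space \<gamma>" for i by (rule Lp_space_AE_cyl[OF u(1) ae])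
        show "?\<tau> \<in> Lp_space \<gamma>" by (rule Lp_space_AE_cyl[OF t(1)]) simp
        fix h :: "real^3 \<Rightarrow> real" assume h: "h \<in> Lp_space (\<gamma> / (\<gamma> - 1))"
        then have hm: "h \<in> borel_measurable lebesgue" by (simp add: Lp_space_def)
        show "(\<lambda>i. LINT x|lebesgue. \<rho> (\<phi> (\<psi> i)) (x + a (\<psi> i) *\<^sub>R e3) * h x) \<longlonglongrightarrow> (LINT x|lebesgue. ?\<tau> x * h x)"
          unfolding integral_AE_cyl[OF u(1) ae hm]
          by (rule Lp_weak_limit[OF u t conv h])
      qed
    qed
    then show "\<exists>a \<phi>. \<exists>\<tau>\<in>?W. strict_mono (\<phi> :: nat \<Rightarrow> nat) \<and> shifted_limit \<gamma> M (\<rho> \<circ> \<phi>) a \<tau>"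
      using W(1)[OF t] strict_mono_o[OF \<phi> \<psi>] by blast
  next
    \<comment> \<open>Here the shifts, the subsequence and the limit are arbitrary and not those
      constructed before. Only \<open>shifted_limit\<close> is available: its ball condition gives
      \<open>tight\<close>, its weak convergence gives \<open>wconv\<close>, and lower
      semicontinuity does the rest.\<close>
    fix \<rho> a and \<phi> :: "nat \<Rightarrow> nat" and \<tau>
    assume \<tau>: "\<tau> \<in> ?W"
      and A: "minimizing_seq ?E ?W \<rho> \<and> strict_mono \<phi> \<and> shifted_limit \<gamma> M (\<rho> \<circ> \<phi>) a \<tau>"
    obtain s where s: "\<And>i. repr (\<rho> i) (s i)" "\<And>i. ms (s i) = M" and lim: "(\<lambda>i. F (s i)) \<longlonglongrightarrow> h"
      using seq A by blast
    note sSt = reprD(1)[OF s(1)]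
    obtain P where P: "\<And>i. pw (s i) \<le> P" using energy_bounded_pw_bounded[OF sSt s(2) lim] by blast
    obtain t where t: "repr \<tau> t" "ms t = M" by (rule W_star_repr[OF \<tau>])
    define u where "u i = shift (a i) (s (\<phi> i))" for i
    have u: "u i \<in> St" "ms (u i) = M" "pw (u i) \<le> P" "F (u i) = F (s (\<phi> i))" for i
      unfolding u_def using St_shift[OF sSt] ms_shift[OF sSt] pw_shift[OF sSt] F_shift[OF sSt] s(2) P by auto
    have "tight u"
      unfolding tight_def u(2)
    proof (intro allI impI)
      fix \<epsilon> :: real assume "0 < \<epsilon>"
      then obtain R where R: "\<And>i. M - \<epsilon> \<le> (LINT x : ball (a i *\<^sub>R e3) R|lebesgue. \<rho> (\<phi> i) x)"
        using A unfolding shifted_limit_def comp_def by blast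
      have "M - \<epsilon> \<le> ms (cut (slab 0 R) (u i))" for i
        unfolding u_def ms_cut_shift[OF sSt] using R[of i] ball_mass(1)[OF s(1)] by (rule order_trans)
      then show "\<exists>R. \<forall>i. M - \<epsilon> \<le> ms (cut (slab 0 R) (u i))" by blast
    qed
    moreover have "wconv u t"
    proof (rule weak_conv_Lp_wconv[OF _ u(1) reprD(1)[OF t(1)] _ reprD(2)[OF t(1)]])
      show "weak_conv_Lp \<gamma> (\<lambda>i x. \<rho> (\<phi> i) (x + a i *\<^sub>R e3)) \<tau>"
        using A unfolding shifted_limit_def comp_def by blast
      show "AE x in lebesgue. \<rho> (\<phi> i) (x + a i *\<^sub>R e3) = u i (cyl e3 x)" for i
        unfolding u_def by (rule shift_repr[OF s(1)])
    qed
    moreover have "(\<lambda>i. F (u i)) \<longlonglongrightarrow> h"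
      using LIMSEQ_subseq_LIMSEQ[OF lim, of \<phi>] A unfolding u(4) comp_def by blast
    ultimately have "F t \<le> h"
      using u(2) t(2) by (intro F_lsc[of u M P t h] u(1,3) reprD(1)[OF t(1)]) auto
    then have "?E \<tau> \<le> h" using en[OF t(1)] by simp
    moreover have "h \<le> ?E \<sigma>" if "\<sigma> \<in> ?W" for \<sigma>
      using INF_lower[OF that, of "\<lambda>\<rho>. ereal (?E \<rho>)"] unfolding h by simp
    ultimately show "is_arg_min ?E (\<lambda>\<sigma>. \<sigma> \<in> ?W) \<tau>"
      using \<tau> unfolding is_arg_min_def by (meson not_less order_trans)
  qed
qed

end
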